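(* Every $n$-vertex 1-bend RAC graph has at most $5.5n-11$ edges.
   Context: A 1-bend right-angle-crossing drawing (RAC$_1$ drawing) of a graph is a polyline drawing in which every edge has at most one bend and every crossing between edges forms $90^\circ$ angles. A graph is a 1-bend RAC graph if it admits such a drawing.
   Formalization: The bound is stated for graphs with n ≥ 3 vertices; for n ≤ 2 it fails as written (a single edge on two vertices has 1 edge while 5.5·2 − 11 = 0). *)

theory Defs
  imports "HOL-Analysis.Analysis"
begin

definition simple_graph :: "'a set \<Rightarrow> 'a set set \<Rightarrow> bool" where
  "simple_graph V E \<longleftrightarrow> finite V \<and>
     E \<subseteq> {{u, v} | u v. u \<in> V \<and> v \<in> V \<and> u \<noteq> v}"

text \<open>A polyline drawing with at most one bend per edge: vertex u is placed at p u,
  edge e = {u,v} is drawn as the polyline p u -- b e -- p v (the bend b e may lie on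
  the straight segment, giving a bend-free edge). The drawing is RAC if every two
  edge segments of distinct edges meeting in a point that is not a common end vertex
  are perpendicular.\<close>
definition rac1_drawing ::
  "'a set \<Rightarrow> 'a set set \<Rightarrow> ('a \<Rightarrow> real^2) \<Rightarrow> ('a set \<Rightarrow> real^2) \<Rightarrow> bool" where
  "rac1_drawing V E p b \<longleftrightarrow>
     inj_on p V \<and>
     (\<forall>e\<in>E. \<forall>u\<in>e. \<forall>v\<in>e. u \<noteq> v \<longrightarrow>
         closed_segment (p u) (b e) \<inter> closed_segment (b e) (p v) = {b e}) \<and>
     (\<forall>e\<in>E. \<forall>w\<in>V - e. \<forall>u\<in>e. p w \<notin> closed_segment (p u) (b e)) \<and>
     (\<forall>e\<in>E. \<forall>f\<in>E. e \<noteq> f \<longrightarrow> (\<forall>u\<in>e. \<forall>v\<in>f. \<forall>x.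
         x \<in> closed_segment (p u) (b e) \<inter> closed_segment (p v) (b f) \<longrightarrow>
         x \<notin> p ` (e \<inter> f) \<longrightarrow> (p u - b e) \<bullet> (p v - b f) = 0))"

definition rac1_graph :: "'a set \<Rightarrow> 'a set set \<Rightarrow> bool" where
  "rac1_graph V E \<longleftrightarrow> (\<exists>p b. rac1_drawing V E p b)"

end

(* Proof idea. Call a face with k sides (arcs between vertices and crossings) that meets at most one
   vertex needy if k <= 3; it lacks 4 - k in Euler's formula. Every needy face can claim 4 - k of the bent
   crossed edges on its boundary so that no bend is claimed twice: at a right angle of a crossing a triangle
   or digon with straight or reflex sides does not close up, so a bounded needy face has a convex bend, which
   it claims. Exceptional are faces at a vertex u whose side lies on another edge at u; there, in a drawing
   with the fewest crossings, the sides at u are bent. The unbounded face is treated by looking at the convex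
   hull of the drawing. The other faces with k <= 3 have an uncrossed edge on their boundary.

   Let E0 be the uncrossed edges. Delete the crossed edges inside those faces of E0 that have at most 5 sides
   and a frontier in one component of E0. Charging the remaining drawing bounds the number of crossed edges by
   4n - 8 minus a surplus that outweighs the deleted edges, and Euler's formula for E0, where long faces have
   at least 6 sides, bounds the uncrossed edges by 3/2 (n - 2) up to that surplus. *)

theory Submission
  imports Defs
begin

section \<open>Euler's inequality in the plane\<close>

text \<open>The number \<open>4 - k\<close> comes from Euler's formula: with V vertices, E edges and
  x crossings all faces together have 2E + 4x sides, so the sum of \<open>4 - k\<close> over the
  faces is at least 2E + 8 - 4V. It is paid by sides on uncrossed edges and by claimed bends, two
  units per uncrossed and one per crossed edge, which gives 4n - 8. The remaining problem is that a
  plane graph may have up to 3(n - 2) edges. A small face of E0 with k sides, once emptied, receives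
  k and needs only \<open>4 - k\<close>, a surplus of 2k - 4, while a simple graph has at most 2k -
  5 further edges on its vertices as long as k <= 5. For k = 6 this fails, which fixes the
  threshold. Each small face leaves a gain of at least 1, of which the bound for the uncrossed edges
  consumes 3/4. An obstacle throughout is that drawings may be disconnected: faces are components of
  the complement, their boundary may consist of several walks, and faces of E0 that touch several
  components have to be bounded by the number of components.\<close>

lemma arc_closes_loop:
  fixes g :: "real \<Rightarrow> complex"
  assumes "arc g" "path_image g \<inter> S \<subseteq> {pathstart g, pathfinish g}"
    and "path_component S (pathstart g) (pathfinish g)"
  obtains In Out where "In \<inter> Out = {}" "open In" "open Out" "connected In" "connected Out"
    "path_image g \<inter> (In \<union> Out) = {}" "- (S \<union> path_image g) \<subseteq> In \<union> Out"
    "path_image g \<subseteq> closure In" "path_image g \<subseteq> closure Out"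
proof -
  have ne: "pathstart g \<noteq> pathfinish g" using arc_distinct_ends[OF assms(1)] by simp
  obtain p where p: "path p" "path_image p \<subseteq> S" "pathstart p = pathstart g" "pathfinish p = pathfinish g"
    using assms(3) by (auto simp: path_component_def)
  then have "path (reversepath p)" "pathstart (reversepath p) = pathfinish g" "pathfinish (reversepath p) = pathstart g"
    by auto
  \<comment> \<open>The path inside \<open>S\<close> is thinned to an arc, so that together with
    \<open>g\<close> it forms a simple loop.\<close>
  then obtain q where q: "arc q" "path_image q \<subseteq> path_image (reversepath p)" "pathstart q = pathfinish g"
      "pathfinish q = pathstart g"
    using path_contains_arc[of "reversepath p" "pathfinish g" "pathstart g"] ne by metis
  then have qS: "path_image q \<subseteq> S" using p by auto
  define c where "c = g +++ q"
  have "simple_path c" unfolding c_def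
  proof (rule simple_path_join_loop[OF assms(1) q(1)])
    show "path_image g \<inter> path_image q \<subseteq> {pathstart g, pathstart q}"
      unfolding q(3) using assms(2) qS by fast
  qed (simp_all only: q)
  moreover have "pathfinish c = pathstart c" using q by (simp add: c_def)
  ultimately obtain In Out where J: "open In" "connected In" "open Out" "connected Out" "In \<inter> Out = {}"
      "In \<union> Out = - path_image c" "frontier In = path_image c" "frontier Out = path_image c"
    by (rule Jordan_curve)
  have im: "path_image c = path_image g \<union> path_image q"
    unfolding c_def using q by (simp add: path_image_join)
  show thesis
  proof (rule that[of In Out])
    show "- (S \<union> path_image g) \<subseteq> In \<union> Out" using J(6) im qS by auto
    show "path_image g \<subseteq> closure In" "path_image g \<subseteq> closure Out"
      using J(7,8) im by (auto simp: frontier_def)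
    show "path_image g \<inter> (In \<union> Out) = {}" using J(6) im by auto
  qed (use J in auto)
qed

section \<open>Counting faces by sample points and components by paths\<close>

definition separated_points :: "complex set \<Rightarrow> complex set \<Rightarrow> bool" where
  "separated_points S R \<longleftrightarrow> finite R \<and> R \<subseteq> - S \<and>
     (\<forall>x\<in>R. \<forall>y\<in>R. x \<noteq> y \<longrightarrow> \<not> connected_component (- S) x y)"

definition npc :: "complex set \<Rightarrow> nat" where
  "npc S = card (path_component_set S ` S)"

lemma connected_component_antimono:
  "connected_component (- T) x y \<Longrightarrow> S \<subseteq> T \<Longrightarrow> connected_component (- S) x y"
  by (meson Compl_subset_Compl_iff connected_component_of_subset)

text \<open>A closed set without interior cannot swallow an open component, so every sample point
  finds a substitute in its own component. Separation persists because the complement only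
  shrinks.\<close>

lemma separated_points_move:
  assumes S: "closed S" and R: "separated_points S R" and g: "closed T" "interior T = {}"
  obtains R' where "separated_points (S \<union> T) R'" "card R' = card R"
    "\<forall>y\<in>R'. \<exists>x\<in>R. connected_component (- S) x y"
proof -
  have ex: "\<exists>y. connected_component (- S) x y \<and> y \<notin> T" if "x \<in> R" for x
  proof -
    have x: "x \<in> - S" using R that by (auto simp: separated_points_def)
    have o: "open (connected_component_set (- S) x)" using S by (simp add: open_connected_component open_Compl)
    have "x \<in> connected_component_set (- S) x" using x by (simp add: connected_component_refl)
    then have "\<not> connected_component_set (- S) x \<subseteq> T"
      using interior_maximal[OF _ o, of T] g(2) by blast
    then show ?thesis by auto
  qed
  then obtain h where h: "\<And>x. x \<in> R \<Longrightarrow> connected_component (- S) x (h x)" "\<And>x. x \<in> R \<Longrightarrow> h x \<notin> T"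
    by metis
  have inj: "x = y" if "x \<in> R" "y \<in> R" "connected_component (- S) (h x) (h y)" for x y
  proof -
    have "connected_component (- S) x (h y)" by (rule connected_component_trans[OF h(1)[OF that(1)] that(3)])
    then have "connected_component (- S) x y"
      by (rule connected_component_trans[OF _ connected_component_sym[OF h(1)[OF that(2)]]])
    then show ?thesis using R that unfolding separated_points_def by blast
  qed
  have nS: "h x \<notin> S" if "x \<in> R" for x using h(1)[OF that] connected_component_in by auto
  show thesis
  proof (rule that[of "h ` R"])
    show "separated_points (S \<union> T) (h ` R)"
      unfolding separated_points_def
    proof (intro conjI ballI impI)
      show "finite (h ` R)" using R by (simp add: separated_points_def)
      show "h ` R \<subseteq> - (S \<union> T)" using nS h by auto
      fix x y assume "x \<in> h ` R" "y \<in> h ` R" "x \<noteq> y"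
      then show "\<not> connected_component (- (S \<union> T)) x y"
        using inj connected_component_antimono[of "S \<union> T" x y S] by auto
    qed
    have "inj_on h R" 
    proof (rule inj_onI)
      fix x y assume "x \<in> R" "y \<in> R" "h x = h y"
      then show "x = y" using inj[of x y] nS[of x] by (simp add: connected_component_refl)
    qed
    then show "card (h ` R) = card R" by (rule card_image)
    show "\<forall>y\<in>h ` R. \<exists>x\<in>R. connected_component (- S) x y" using h(1) by auto
  qed
qed

text \<open>The new arc closes a loop through \<open>S\<close>. Two points on its two sides, close
  to its middle, share a face of \<open>S\<close> but are separated by the loop. They replace the at
  most one old sample point of that face.\<close>

lemma separated_points_add_loop:
  fixes g :: "real \<Rightarrow> complex"
  assumes S: "closed S" and R: "separated_points S R"
    and g: "arc g" "path_image g \<inter> S = {pathstart g, pathfinish g}" "interior (path_image g) = {}"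
    and pc: "path_component S (pathstart g) (pathfinish g)"
  obtains R' where "separated_points (S \<union> path_image g) R'" "Suc (card R) \<le> card R'"
proof -
  have g2: "path_image g \<inter> S \<subseteq> {pathstart g, pathfinish g}" using g(2) by simp
  obtain In Out where J: "In \<inter> Out = {}" "open In" "open Out" "connected In" "connected Out"
    "path_image g \<inter> (In \<union> Out) = {}" "- (S \<union> path_image g) \<subseteq> In \<union> Out"
    "path_image g \<subseteq> closure In" "path_image g \<subseteq> closure Out"
    by (rule arc_closes_loop[OF g(1) g2 pc])
  let ?T = "path_image g"
  have clT: "closed ?T" using g(1) by (simp add: closed_arc_image)
  define z where "z = g (1/2)"
  have zT: "z \<in> ?T" by (auto simp: z_def path_image_def)
  have inj: "inj_on g {0..1}" using g(1) by (simp add: arc_def)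
  have "z \<noteq> pathstart g" "z \<noteq> pathfinish g"
    using inj_onD[OF inj, of "1/2" 0] inj_onD[OF inj, of "1/2" 1] by (auto simp: z_def pathstart_def pathfinish_def)
  then have zS: "z \<notin> S" using g(2) zT by auto
  obtain r where r: "r > 0" "ball z r \<subseteq> - S" using S zS unfolding closed_def open_contains_ball by blast
  obtain p where p: "p \<in> In" "dist p z < r" using subsetD[OF J(8) zT] r(1) unfolding closure_approachable by blast
  obtain q where q: "q \<in> Out" "dist q z < r" using subsetD[OF J(9) zT] r(1) unfolding closure_approachable by blast
  have pq: "p \<in> ball z r" "q \<in> ball z r" using p q by (auto simp: dist_commute)
  have nin: "p \<notin> ?T" "q \<notin> ?T" "p \<notin> S" "q \<notin> S" using p q J(6) pq r by auto
  have ccpq: "connected_component (- S) p q"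
    unfolding connected_component_def using pq r(2) connected_ball by blast
  have sep: "\<not> connected_component (- (S \<union> ?T)) p q"
  proof
    assume "connected_component (- (S \<union> ?T)) p q"
    then obtain C where C: "connected C" "C \<subseteq> - (S \<union> ?T)" "p \<in> C" "q \<in> C" by (auto simp: connected_component_def)
    then have "C \<subseteq> In \<union> Out" using J(7) by auto
    then have "In \<inter> C = {} \<or> Out \<inter> C = {}" using connectedD[OF C(1) J(2,3)] J(1) by auto
    then show False using p q C by auto
  qed
  define R0 where "R0 = {x \<in> R. \<not> connected_component (- S) x p}"
  have fR: "finite R" using R by (simp add: separated_points_def)
  have R0: "separated_points S R0" using R by (auto simp: separated_points_def R0_def)
  have "card R \<le> Suc (card R0)"
  proof (cases "\<exists>x\<in>R. connected_component (- S) x p")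
    case True
    then obtain x where x: "x \<in> R" "connected_component (- S) x p" by auto
    have "y = x" if "y \<in> R" "connected_component (- S) y p" for y
    proof -
      have "connected_component (- S) y x"
        by (rule connected_component_trans[OF that(2) connected_component_sym[OF x(2)]])
      then show ?thesis using R that x unfolding separated_points_def by blast
    qed
    then have "R \<subseteq> insert x R0" by (auto simp: R0_def)
    then show ?thesis
      by (metis R0 card_insert_if card_mono finite_insert le_SucI separated_points_def)
  next
    case False
    then have "R0 = R" by (auto simp: R0_def)
    then show ?thesis by simp
  qed
  obtain R1 where R1: "separated_points (S \<union> ?T) R1" "card R1 = card R0"
    "\<forall>y\<in>R1. \<exists>x\<in>R0. connected_component (- S) x y"
    by (rule separated_points_move[OF S R0 clT g(3)])
  have Rf: "finite R1" "R1 \<subseteq> - (S \<union> ?T)" using R1(1) by (auto simp: separated_points_def)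
  have np: "\<not> connected_component (- S) y p" if yR: "y \<in> R1" for y
    proof -
    obtain x where "x \<in> R0" "connected_component (- S) x y" using bspec[OF R1(3) yR] by auto
    then show ?thesis unfolding R0_def using connected_component_trans[of "- S" x y p] by auto
  qed
  have nq: "\<not> connected_component (- S) y q" if "y \<in> R1" for y
    using np[OF that] connected_component_trans[OF _ connected_component_sym[OF ccpq], of y] by auto
  have pqn: "p \<notin> R1" "q \<notin> R1" using np[of p] nq[of q] nin by (auto simp: connected_component_refl)
  have "p \<noteq> q" using J(1) p q by auto
  then have card: "card (R1 \<union> {p,q}) = Suc (Suc (card R1))" using pqn Rf by auto
  have anti: "\<not> connected_component (- (S \<union> ?T)) x y" if "\<not> connected_component (- S) x y" for x y
    using that connected_component_antimono[of "S \<union> ?T" x y S] by auto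
  show thesis
  proof (rule that[of "R1 \<union> {p,q}"])
    show "Suc (card R) \<le> card (R1 \<union> {p,q})" using card R1(2) \<open>card R \<le> Suc (card R0)\<close> by simp
    have 1: "\<not> connected_component (- (S \<union> ?T)) x y" if "x \<in> R1" "y \<in> R1" "x \<noteq> y" for x y
      using R1(1) that by (auto simp: separated_points_def)
    have 2: "\<not> connected_component (- (S \<union> ?T)) x p" "\<not> connected_component (- (S \<union> ?T)) x q"
      if "x \<in> R1" for x using anti np nq that by auto
    show "separated_points (S \<union> ?T) (R1 \<union> {p,q})"
      unfolding separated_points_def
    proof (intro conjI ballI impI)
      fix x y assume "x \<in> R1 \<union> {p,q}" "y \<in> R1 \<union> {p,q}" "x \<noteq> y"
      then show "\<not> connected_component (- (S \<union> ?T)) x y"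
        using 1[of x y] 2[of x] 2[of y] sep connected_component_sym[of "- (S \<union> ?T)" x y]
          connected_component_sym[of "- (S \<union> ?T)" p q] connected_component_sym[of "- (S \<union> ?T)" q p] by blast
    qed (use Rf nin in auto)
  qed
qed

lemma path_component_antimono:
  "path_component S x y \<Longrightarrow> S \<subseteq> T \<Longrightarrow> path_component T x y"
  by (meson path_component_of_subset)

lemma path_component_set_eq_iff:
  assumes "x \<in> S" "y \<in> S"
  shows "path_component_set S x = path_component_set S y \<longleftrightarrow> path_component S x y"
proof
  assume "path_component_set S x = path_component_set S y"
  have x: "y \<in> path_component_set S y" using assms(2) by (simp add: path_component_refl)
  then show "path_component S x y" using \<open>path_component_set S x = path_component_set S y\<close> by auto
next
  assume "path_component S x y"
  then show "path_component_set S x = path_component_set S y" using path_component_eq[of y S x] by simp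
qed

text \<open>Since \<open>T\<close> is attached to \<open>S\<close> at \<open>a\<close>, every
  component of the union contains one of \<open>S\<close>. The map from old to new components is
  therefore onto, and it identifies those of \<open>a\<close> and \<open>b\<close>, which costs one
  if they differ.\<close>

lemma npc_add_arc:
  assumes fin: "finite (path_component_set S ` S)" and T: "path_connected T" and a: "a \<in> T" "a \<in> S" and b: "b \<in> T" "b \<in> S"
  shows "finite (path_component_set (S \<union> T) ` (S \<union> T))" (is ?A)
    and "npc (S \<union> T) \<le> npc S" (is ?B)
    and "\<not> path_component S a b \<Longrightarrow> Suc (npc (S \<union> T)) \<le> npc S" (is "_ \<Longrightarrow> ?C")
proof -
  let ?P = "path_component_set S" and ?Q = "path_component_set (S \<union> T)"
  have Ta: "path_component (S \<union> T) a t" if "t \<in> T" for t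
    using T a that by (meson path_connected_component path_component_antimono Un_upper2)
  have im: "?Q ` (S \<union> T) = ?Q ` S"
  proof
    show "?Q ` (S \<union> T) \<subseteq> ?Q ` S"
    proof
      fix C assume "C \<in> ?Q ` (S \<union> T)"
      then obtain x where x: "x \<in> S \<union> T" "C = ?Q x" by auto
      show "C \<in> ?Q ` S"
      proof (cases "x \<in> S")
        case False
        then have "C = ?Q a" using x path_component_eq[of x "S \<union> T" a] Ta[of x] by auto
        then show ?thesis using a by auto
      qed (use x in auto)
    qed
  qed auto
  define F where "F C = ?Q (SOME x. x \<in> S \<and> C = ?P x)" for C
  have F: "F (?P x) = ?Q x" if "x \<in> S" for x
  proof -
    have "(SOME y. y \<in> S \<and> ?P x = ?P y) \<in> S \<and> ?P x = ?P (SOME y. y \<in> S \<and> ?P x = ?P y)"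
      by (rule someI[of _ x]) (use that in simp)
    then obtain y where y: "y = (SOME y. y \<in> S \<and> ?P x = ?P y)" "y \<in> S" "?P x = ?P y" by blast
    have "path_component S x y" using y(2,3) that path_component_set_eq_iff by blast
    then have "path_component (S \<union> T) x y" by (rule path_component_antimono) auto
    then show ?thesis unfolding F_def y(1)[symmetric] using path_component_eq[of y "S \<union> T" x] by simp
  qed
  have FI: "?Q ` (S \<union> T) = F ` (?P ` S)" unfolding im by (auto simp: F image_image)
  show ?A unfolding FI using fin by simp
  show ?B unfolding npc_def FI using card_image_le[OF fin] by auto
  show ?C if nab: "\<not> path_component S a b"
  proof -
    have ne: "?P a \<noteq> ?P b" using nab a b path_component_set_eq_iff by blast
    have eq: "F (?P a) = F (?P b)" using a b Ta F path_component_set_eq_iff[of a "S \<union> T" b] by auto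
    have "?Q ` (S \<union> T) = F ` (?P ` S - {?P a})"
    proof -
      have "?P b \<in> ?P ` S - {?P a}" using ne imageI[OF b(2), of ?P] by (metis DiffI singletonD)
      then have "F (?P a) \<in> F ` (?P ` S - {?P a})" unfolding eq by (rule imageI)
      then have "F C \<in> F ` (?P ` S - {?P a})" if "C \<in> ?P ` S" for C
        using that by (cases "C = ?P a") (metis, metis DiffI imageI singletonD)
      then have "F ` (?P ` S) \<subseteq> F ` (?P ` S - {?P a})" by (rule image_subsetI)
      moreover have "F ` (?P ` S - {?P a}) \<subseteq> F ` (?P ` S)" by (rule image_mono) (rule Diff_subset)
      ultimately show ?thesis unfolding FI by (rule equalityI)
    qed
    then have "npc (S \<union> T) \<le> card (?P ` S - {?P a})" unfolding npc_def using fin by (simp add: card_image_le)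
    also have "\<dots> < card (?P ` S)" using fin a by (intro card_Diff1_less) auto
    finally show ?thesis by (simp add: npc_def)
  qed
qed

lemma path_component_finite:
  fixes S :: "complex set" assumes "finite S" "path_component S x y" shows "x = y"
proof -
  obtain g where "path g" "path_image g \<subseteq> S" "pathstart g = x" "pathfinish g = y"
    using assms(2) by (auto simp: path_component_def)
  then show ?thesis
    using assms(1) by (metis connected_finite_iff_sing connected_path_image finite_subset path_image_nonempty
        pathfinish_in_path_image pathstart_in_path_image singletonD)
qed

text \<open>The inequality \<open>F + V \<ge> E + C + 1\<close>: an edge inside a component of the drawing closes a loop and creates
  a face by the Jordan curve theorem, any other edge merges two components.\<close>

theorem euler_inequality:
  fixes N :: "complex set" and I :: "(complex \<times> complex) set"
  assumes "finite N" "N \<noteq> {}" "finite I"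
    and "\<And>a b. (a,b) \<in> I \<Longrightarrow> a \<noteq> b \<and> a \<in> N \<and> b \<in> N \<and> open_segment a b \<inter> N = {}"
    and "\<And>d d'. d \<in> I \<Longrightarrow> d' \<in> I \<Longrightarrow> d \<noteq> d' \<Longrightarrow>
      open_segment (fst d) (snd d) \<inter> open_segment (fst d') (snd d') = {}"
  shows "\<exists>R. separated_points (N \<union> (\<Union>d\<in>I. closed_segment (fst d) (snd d))) R \<and>
     finite (path_component_set (N \<union> (\<Union>d\<in>I. closed_segment (fst d) (snd d))) ` (N \<union> (\<Union>d\<in>I. closed_segment (fst d) (snd d)))) \<and>
     card I + npc (N \<union> (\<Union>d\<in>I. closed_segment (fst d) (snd d))) + 1 \<le> card R + card N"
  using assms(3-5)
proof (induction I rule: finite_induct)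
  case empty
  have fc: "path_component_set N x = {x}" if "x \<in> N" for x
    using path_component_finite[OF assms(1)] that by (auto simp: path_component_refl)
  then have "path_component_set N ` N = (\<lambda>x. {x}) ` N" by (rule image_cong[OF refl])
  then have n: "npc N = card N" "finite (path_component_set N ` N)"
    unfolding npc_def using assms(1) by (simp_all add: card_image)
  obtain x where "x \<notin> N" using assms(1) infinite_UNIV_char_0 ex_new_if_finite by metis
  then have "separated_points N {x}" by (auto simp: separated_points_def)
  then show ?case using n by (intro exI[of _ "{x}"]) auto
next
  case (insert d I)
  obtain a b where d: "d = (a,b)" by (cases d)
  let ?S = "N \<union> (\<Union>d\<in>I. closed_segment (fst d) (snd d))"
  let ?T = "closed_segment a b"
  have ab: "a \<noteq> b" "a \<in> N" "b \<in> N" "open_segment a b \<inter> N = {}" using insert.prems(1)[of a b] d by auto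
  have un: "N \<union> (\<Union>d\<in>insert d I. closed_segment (fst d) (snd d)) = ?S \<union> ?T" using d by auto
  obtain R where R: "separated_points ?S R" "finite (path_component_set ?S ` ?S)" "card I + npc ?S + 1 \<le> card R + card N"
  proof -
    have "\<And>a b. (a, b) \<in> I \<Longrightarrow> a \<noteq> b \<and> a \<in> N \<and> b \<in> N \<and> open_segment a b \<inter> N = {}"
      using insert.prems(1) by blast
    moreover have "\<And>d d'. d \<in> I \<Longrightarrow> d' \<in> I \<Longrightarrow> d \<noteq> d' \<Longrightarrow>
      open_segment (fst d) (snd d) \<inter> open_segment (fst d') (snd d') = {}" using insert.prems(2) by blast
    ultimately show ?thesis using insert.IH that by blast
  qed
  have cl: "closed ?S" using assms(1) insert.hyps(1) by (intro closed_Un finite_imp_closed closed_UN) simp_all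
  have int: "?T \<inter> ?S = {a,b}"
  proof -
    have "open_segment a b \<inter> closed_segment (fst e) (snd e) = {}" if "e \<in> I" for e
    proof -
      have "open_segment a b \<inter> open_segment (fst e) (snd e) = {}"
        using insert.prems(2)[of d e] that insert.hyps d by auto
      moreover have "fst e \<in> N" "snd e \<in> N" using insert.prems(1)[of "fst e" "snd e"] that by (metis insertI2 prod.collapse)+
      ultimately show ?thesis using ab(4) by (auto simp: closed_segment_eq_open)
    qed
    then show ?thesis using ab by (auto simp: closed_segment_eq_open)
  qed
  have pT: "path_connected ?T" by simp
  have g: "arc (linepath a b)" "path_image (linepath a b) \<inter> ?S = {pathstart (linepath a b), pathfinish (linepath a b)}"
      "interior (path_image (linepath a b)) = {}"
    using ab(1) int by (auto simp: interior_closed_segment_ge2)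
  have aS: "a \<in> ?S" "b \<in> ?S" using ab by auto
  note m = npc_add_arc[OF R(2) pT ends_in_segment(1) aS(1) ends_in_segment(2) aS(2)]
  show ?case
  proof (cases "path_component ?S a b")
    case True
    then obtain R' where "separated_points (?S \<union> ?T) R'" "Suc (card R) \<le> card R'"
      using separated_points_add_loop[OF cl R(1) g] True by auto
    then show ?thesis unfolding un using m(1,2) R(3) insert.hyps by (intro exI[of _ R']) auto
  next
    case False
    have "interior ?T = {}" using g(3) by simp
    then obtain R' where "separated_points (?S \<union> ?T) R'" "card R' = card R"
      using separated_points_move[OF cl R(1) closed_segment] by metis
    then show ?thesis unfolding un using m(1) m(3)[OF False] R(3) insert.hyps by (intro exI[of _ R']) auto
  qed
qed


text \<open>Through each bad face an arc can be drawn that joins two components of \<open>S\<close>.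
  Added one after the other, these arcs merge two components each time, because by Janiszewski's
  theorem none of them closes a loop. At the end at least one component is left, so there are fewer
  bad faces than components.\<close>

theorem bad_faces:
  fixes S :: "complex set"
  assumes S: "compact S" "S \<noteq> {}" and fin: "finite (path_component_set S ` S)"
    and cl: "\<And>x. x \<in> S \<Longrightarrow> closed (path_component_set S x)"
    and B: "finite B" "B \<subseteq> components (- S)"
    and bad: "\<And>f. f \<in> B \<Longrightarrow> \<exists>a\<in>frontier f. \<exists>b\<in>frontier f. \<not> path_component S a b"
  shows "card B + 1 \<le> npc S"
proof -
  have clS: "closed S" using S(1) by (rule compact_imp_closed)
  \<comment> \<open>\<open>T\<close> is \<open>S\<close> together with the arcs drawn so far; it
    avoids all faces that have not been treated.\<close>
  have "\<exists>T. closed T \<and> S \<subseteq> T \<and> (\<forall>f \<in> components (- S) - B. T \<inter> f = {}) \<and> finite (path_component_set T ` T) \<and>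
       npc T + card B \<le> npc S"
    using B bad
  proof (induction B rule: finite_induct)
    case empty
    then show ?case using clS fin in_components_subset by (intro exI[of _ S]) fastforce
  next
    case (insert f B)
    obtain T where T: "closed T" "S \<subseteq> T" "\<And>f'. f' \<in> components (- S) - B \<Longrightarrow> T \<inter> f' = {}"
      "finite (path_component_set T ` T)" "npc T + card B \<le> npc S"
      using insert.IH insert.prems by (metis insertI2 insert_subset)
    have f: "f \<in> components (- S)" using insert.prems by auto
    obtain a b where ab: "a \<in> frontier f" "b \<in> frontier f" "\<not> path_component S a b" using insert.prems by blast
    have fo: "open f" by (rule open_components[OF open_Compl[OF clS] f])
    have fc: "connected f" using f in_components_connected by auto
    have fS: "f \<inter> S = {}" using in_components_subset[OF f] by auto
    have frS: "frontier f \<subseteq> S" using frontier_of_components_closed_complement[OF clS f] by simp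
    define K where "K = path_component_set S a"
    have KS: "K \<subseteq> S" unfolding K_def using path_component_mem(2) by force
    have Kcl: "closed K" unfolding K_def using cl ab frS by auto
    \<comment> \<open>The rest is closed as a union of finitely many closed components.\<close>
    have SK: "S - K = \<Union> {C \<in> path_component_set S ` S. C \<noteq> K}" (is "_ = ?U")
    proof
      show "S - K \<subseteq> ?U"
      proof
        fix x assume x: "x \<in> S - K"
        have "x \<in> path_component_set S x" using x by (simp add: path_component_refl)
        then show "x \<in> ?U" using x by auto
      qed
      show "?U \<subseteq> S - K"
      proof
        fix x assume "x \<in> ?U"
        then obtain y where y: "y \<in> S" "x \<in> path_component_set S y" "path_component_set S y \<noteq> K" by auto
        have "x \<notin> K"
        proof
          assume "x \<in> K"
          then have "path_component S a y" unfolding K_def using y path_component_trans path_component_sym by (metis mem_Collect_eq)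
          then show False using y(3) path_component_eq unfolding K_def by (metis mem_Collect_eq)
        qed
        then show "x \<in> S - K" using y path_component_mem(2) by auto
      qed
    qed
    have SKcl: "closed (S - K)"
      unfolding SK by (rule closed_Union) (use fin cl in auto)
    have aK: "a \<in> K" "b \<notin> K" using ab frS by (auto simp: K_def path_component_refl)
    have opU: "openin (top_of_set (frontier f)) (frontier f \<inter> - (S - K))"
      by (rule openin_open_Int[OF open_Compl[OF SKcl]])
    have opV: "openin (top_of_set (frontier f)) (frontier f \<inter> - K)"
      by (rule openin_open_Int[OF open_Compl[OF Kcl]])
    \<comment> \<open>The two relatively open parts of the frontier are its points in
      \<open>K\<close> and those outside \<open>K\<close>; the arc runs through \<open>f\<close>
      from one part to the other.\<close>
    obtain g where g: "arc g" "pathstart g \<in> frontier f \<inter> - (S - K)" "pathfinish g \<in> frontier f \<inter> - K" "g ` {0<..<1} \<subseteq> f"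
      by (rule dense_accessible_frontier_point_pairs[OF fo fc opU opV]) (use aK ab in auto)
    let ?a = "pathstart g" and ?b = "pathfinish g" and ?T = "path_image g"
    have gab: "?a \<in> K" "?b \<in> S - K" "?a \<in> S" "?b \<in> S" using g frS by auto
    have gim: "?T \<subseteq> insert ?a (insert ?b f)"
    proof
      fix x assume "x \<in> ?T"
      then obtain t where t: "x = g t" "0 \<le> t" "t \<le> 1" by (auto simp: path_image_def)
      then consider "t = 0" | "t = 1" | "0 < t" "t < 1" by fastforce
      then show "x \<in> insert ?a (insert ?b f)"
        using subsetD[OF g(4), of "g t"] t(1) by cases (auto simp: pathstart_def pathfinish_def)
    qed
    have Tcl: "closed ?T" "compact ?T" using g(1) by (simp_all add: closed_arc_image compact_arc_image)
    have Tf: "T \<inter> f = {}" using T(3) f insert.hyps by auto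
    \<comment> \<open>A loop through the arc would separate two points of \<open>f\<close> next to
      its middle. But the arc meets \<open>K\<close> and \<open>S - K\<close> in one point each, so
      neither union separates them; the two unions meet in the connected arc, so all of it together
      does not separate them either. The connecting set then lies in \<open>f\<close>, which
      \<open>T\<close> avoids.\<close>
    have np: "\<not> path_component T ?a ?b"
    proof
      assume pc: "path_component T ?a ?b"
      have gT: "?T \<inter> T \<subseteq> {?a, ?b}" using gim Tf by auto
      obtain In Out where J: "In \<inter> Out = {}" "open In" "open Out" "connected In" "connected Out"
        "?T \<inter> (In \<union> Out) = {}" "- (T \<union> ?T) \<subseteq> In \<union> Out" "?T \<subseteq> closure In" "?T \<subseteq> closure Out"
        by (rule arc_closes_loop[OF g(1) gT pc])
      define z where "z = g (1/2)"
      have zT: "z \<in> ?T" by (auto simp: z_def path_image_def)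
      have zf: "z \<in> f" unfolding z_def using g(4) by auto
      obtain r where r: "r > 0" "ball z r \<subseteq> f" using fo zf open_contains_ball by blast
      obtain p where p: "p \<in> In" "dist p z < r" using subsetD[OF J(8) zT] r(1) unfolding closure_approachable by blast
      obtain q where q: "q \<in> Out" "dist q z < r" using subsetD[OF J(9) zT] r(1) unfolding closure_approachable by blast
      have pq: "p \<in> f" "q \<in> f" using p q r by (auto simp: dist_commute subset_iff)
      have nin: "p \<notin> ?T" "q \<notin> ?T" using p q J(6) by auto
      have ccf: "connected_component (- S) p q"
        unfolding connected_component_def using fc fS pq by blast
      have ccg: "connected_component (- ?T) p q"
        unfolding connected_component_def using connected_arc_complement[OF g(1)] nin by auto
      have c1: "connected_component (- (?T \<union> K)) p q"
      proof (rule Janiszewski[OF Tcl(2) Kcl _ ccg])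
        have "?T \<inter> K = {?a}" using gim gab KS fS by auto
        then show "connected (?T \<inter> K)" by simp
        show "connected_component (- K) p q" by (rule connected_component_antimono[OF ccf KS])
      qed
      have c2: "connected_component (- (?T \<union> (S - K))) p q"
      proof (rule Janiszewski[OF Tcl(2) SKcl _ ccg])
        have "?T \<inter> (S - K) = {?b}" using gim gab KS fS by auto
        then show "connected (?T \<inter> (S - K))" by simp
        show "connected_component (- (S - K)) p q" by (rule connected_component_antimono[OF ccf]) auto
      qed
      have "compact K" using compact_Int_closed[OF S(1) Kcl] KS by (simp add: inf.absorb2)
      then have cK: "compact (?T \<union> K)" using Tcl by auto
      have c3: "connected_component (- ((?T \<union> K) \<union> (?T \<union> (S - K)))) p q"
      proof (rule Janiszewski[OF cK _ _ c1 c2])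
        show "closed (?T \<union> (S - K))" using SKcl Tcl by auto
        have "(?T \<union> K) \<inter> (?T \<union> (S - K)) = ?T" by auto
        then show "connected ((?T \<union> K) \<inter> (?T \<union> (S - K)))" using connected_arc_image[OF g(1)] by simp
      qed
      then obtain C where C: "connected C" "C \<subseteq> - ((?T \<union> K) \<union> (?T \<union> (S - K)))" "p \<in> C" "q \<in> C"
        by (auto simp: connected_component_def)
      have CS: "C \<subseteq> - S" using C(2) by auto
      have "C \<subseteq> f" by (rule components_maximal[OF f C(1) CS]) (use C pq in auto)
      then have "C \<subseteq> - (T \<union> ?T)" using C(2) Tf by auto
      then have "C \<subseteq> In \<union> Out" using J(7) by auto
      then have "In \<inter> C = {} \<or> Out \<inter> C = {}" using connectedD[OF C(1) J(2,3)] J(1) by auto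
      then show False using p q C by auto
    qed
    have pT: "path_connected ?T" using g(1) by (simp add: arc_imp_path path_connected_path_image)
    have aT: "?a \<in> T" "?b \<in> T" using gab T(2) by auto
    note m = npc_add_arc[OF T(4) pT pathstart_in_path_image aT(1) pathfinish_in_path_image aT(2)]
    show ?case
    proof (intro exI[of _ "T \<union> ?T"] conjI ballI)
      show "closed (T \<union> ?T)" using T Tcl by auto
      show "S \<subseteq> T \<union> ?T" using T by auto
      show "finite (path_component_set (T \<union> ?T) ` (T \<union> ?T))" by (rule m(1))
      show "npc (T \<union> ?T) + card (insert f B) \<le> npc S" using m(3)[OF np] T(5) insert.hyps by auto
      fix f' assume f': "f' \<in> components (- S) - insert f B"
      have "f \<inter> f' = {}" using components_nonoverlap[OF f, of f'] f' by auto
      moreover have "S \<inter> f' = {}" using in_components_subset[of f' "- S"] f' by auto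
      ultimately show "(T \<union> ?T) \<inter> f' = {}" using T(3)[of f'] f' gim gab by blast
    qed
  qed
  then obtain T where T: "S \<subseteq> T" "finite (path_component_set T ` T)" "npc T + card B \<le> npc S" by auto
  have "npc T > 0" unfolding npc_def using T(1,2) S(2) by (simp add: card_gt_0_iff) blast
  then show ?thesis using T(3) by simp
qed

section \<open>Faces of plane straight-line drawings\<close>

text \<open>The triangle over the base from 0 to 1 with slope \<open>\<eta>\<close> at both ends.
  The face beside an edge is recognised by such triangles because they can be made narrow at the
  ends, where other edges start.\<close>

definition tri :: "real \<Rightarrow> complex set" where
  "tri \<eta> = {z. 0 < Im z \<and> Im z < \<eta> * Re z \<and> Im z < \<eta> * (1 - Re z)}"

lemma convex_tri: "convex (tri \<eta>)"
proof -
  have "tri \<eta> = {z. 0 < Im z} \<inter> {z. inner (Complex (-\<eta>) 1) z < 0} \<inter> {z. inner (Complex \<eta> 1) z < \<eta>}"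
    by (auto simp: tri_def inner_complex_def algebra_simps)
  then show ?thesis
    using convex_halfspace_Im_gt[of 0] by (auto intro!: convex_Int convex_halfspace_lt)
qed

lemma tri_Re:
  assumes "0 < \<eta>" "z \<in> tri \<eta>" shows "0 < Re z \<and> Re z < 1"
proof -
  have "0 < \<eta> * Re z" "0 < \<eta> * (1 - Re z)" using assms(2) by (auto simp: tri_def)
  then show ?thesis using assms(1) by (simp add: zero_less_mult_iff)
qed

lemma tri_mono: "\<eta> \<le> \<eta>' \<Longrightarrow> 0 < \<eta> \<Longrightarrow> tri \<eta> \<subseteq> tri \<eta>'"
proof
  fix z assume e: "\<eta> \<le> \<eta>'" "0 < \<eta>" and z: "z \<in> tri \<eta>"
  have "0 < Re z" "0 < 1 - Re z" using tri_Re[OF e(2) z] by auto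
  then have "\<eta> * Re z \<le> \<eta>' * Re z" "\<eta> * (1 - Re z) \<le> \<eta>' * (1 - Re z)" using e by (simp_all add: mult_right_mono)
  then show "z \<in> tri \<eta>'" using z by (auto simp: tri_def)
qed

text \<open>A segment that starts at 0 or 1 is avoided by a slope not above its own; any other
  segment has positive distance from the base.\<close>

lemma tri_segment:
  assumes o: "open_segment 0 1 \<inter> closed_segment c d = {}"
    and e: "0 \<in> closed_segment c d \<Longrightarrow> 0 = c \<or> 0 = d" "1 \<in> closed_segment c d \<Longrightarrow> 1 = c \<or> 1 = d"
  shows "\<exists>\<eta>>0. tri \<eta> \<inter> closed_segment c d = {}"
proof -
  have at0: "\<exists>\<eta>>0. tri \<eta> \<inter> closed_segment 0 d = {}" for d
  proof -
    define \<eta> where "\<eta> = (if 0 < Im d \<and> 0 < Re d then Im d / Re d else 1)"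
    have p: "\<eta> > 0" by (simp add: \<eta>_def)
    have "False" if zt: "z \<in> tri \<eta>" and zs: "z \<in> closed_segment 0 d" for z
    proof -
      obtain u where u: "z = of_real u * d" "0 \<le> u" "u \<le> 1" using zs by (auto simp: closed_segment_def scaleR_conv_of_real)
      have z: "0 < Re z" "0 < Im z" "Im z < \<eta> * Re z" using zt tri_Re[OF p zt] by (auto simp: tri_def)
      then have "0 < u * Re d" "0 < u * Im d" using u by auto
      then have "0 < Re d" "0 < Im d" "0 < u" using u(2) by (auto simp: zero_less_mult_iff)
      then show False using z(3) u(1) by (auto simp: \<eta>_def)
    qed
    then show ?thesis using p by auto
  qed
  have at1: "\<exists>\<eta>>0. tri \<eta> \<inter> closed_segment 1 d = {}" for d
  proof -
    define \<eta> where "\<eta> = (if 0 < Im d \<and> 0 < 1 - Re d then Im d / (1 - Re d) else 1)"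
    have p: "\<eta> > 0" by (simp add: \<eta>_def)
    have "False" if zt: "z \<in> tri \<eta>" and zs: "z \<in> closed_segment 1 d" for z
    proof -
      obtain u where u: "z = (1 - of_real u) + of_real u * d" "0 \<le> u" "u \<le> 1"
        using zs by (auto simp: closed_segment_def scaleR_conv_of_real)
      have z: "0 < 1 - Re z" "0 < Im z" "Im z < \<eta> * (1 - Re z)" using zt tri_Re[OF p zt] by (auto simp: tri_def)
      have eq: "1 - Re z = u * (1 - Re d)" "Im z = u * Im d"
        using arg_cong[OF u(1), of Re] arg_cong[OF u(1), of Im] by (simp_all add: algebra_simps)
      then have "0 < u * (1 - Re d)" "0 < u * Im d" using z by auto
      then have "0 < 1 - Re d" "0 < Im d" "0 < u" using u(2) by (auto simp: zero_less_mult_iff)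
      then show False using z(3) eq by (auto simp: \<eta>_def)
    qed
    then show ?thesis using p by auto
  qed
  consider "c = 0" | "d = 0" | "c = 1" | "d = 1" | "0 \<notin> closed_segment c d" "1 \<notin> closed_segment c d" using e by metis
  then show ?thesis
  proof cases
    case 5
    then have "closed_segment 0 1 \<inter> closed_segment c d = {}" using o by (auto simp: closed_segment_eq_open[of "0::complex" 1])
    then obtain e where e: "e > 0" "\<And>x y. x \<in> closed_segment 0 1 \<Longrightarrow> y \<in> closed_segment c d \<Longrightarrow> e \<le> dist x y"
      using separate_compact_closed[of "closed_segment 0 1" "closed_segment c d"] by auto
    have "tri e \<inter> closed_segment c d = {}"
    proof (rule ccontr)
      assume "tri e \<inter> closed_segment c d \<noteq> {}"
      then obtain z where z: "z \<in> tri e" "z \<in> closed_segment c d" by auto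
      have re: "0 < Re z" "Re z < 1" using tri_Re[OF e(1) z(1)] by auto
      then have "of_real (Re z) \<in> closed_segment 0 (1::complex)"
        by (auto simp: closed_segment_def scaleR_conv_of_real intro!: exI[of _ "Re z"])
      then have "e \<le> dist (of_real (Re z)) z" using e z by blast
      also have "\<dots> = Im z" using z by (auto simp: dist_norm cmod_def tri_def)
      also have "\<dots> < e * Re z" using z by (auto simp: tri_def)
      also have "\<dots> \<le> e" using e re by (simp add: mult_left_le)
      finally show False by simp
    qed
    then show ?thesis using e by auto
  next
    case 2 then show ?thesis using at0[of c] by (simp add: closed_segment_commute)
  next
    case 4 then show ?thesis using at1[of c] by (simp add: closed_segment_commute)
  qed (use at0 at1 in auto)
qed

text \<open>The two polar forms connect sectors at a node with the triangle of an edge that leaves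
  the node (first form) or enters it (second form).\<close>

lemma tri_polar:
  assumes "0 < x" "x \<le> 1/2" "0 < sin y" "0 < cos y" "sin y < \<eta> * cos y" "0 < \<eta>"
  shows "of_real x * exp (\<i> * of_real y) \<in> tri \<eta>" "1 - of_real x * exp (\<i> * of_real (- y)) \<in> tri \<eta>"
proof -
  have "x * sin y < x * (\<eta> * cos y)" using assms by simp
  then have A: "x * sin y < \<eta> * (x * cos y)" by (simp add: mult_ac)
  have "x * cos y \<le> 1/2 * 1" using assms by (intro mult_mono) auto
  then have B: "x * cos y \<le> 1/2" by simp
  have "\<eta> * (x * cos y) \<le> \<eta> * (1/2)" "\<eta> * (1/2) \<le> \<eta> * (1 - x * cos y)"
    using assms(6) B by (intro mult_left_mono; simp)+
  then have C: "x * sin y < \<eta> * (1 - x * cos y)" using A by linarith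
  show "of_real x * exp (\<i> * of_real y) \<in> tri \<eta>" "1 - of_real x * exp (\<i> * of_real (- y)) \<in> tri \<eta>"
    unfolding cis_conv_exp[symmetric] tri_def using A C assms by simp_all
qed

text \<open>The thin triangle with base \<open>[a,b]\<close> on the left of the direction from \<open>a\<close> to \<open>b\<close>.\<close>

definition thin :: "complex \<Rightarrow> complex \<Rightarrow> real \<Rightarrow> complex set" where
  "thin a b \<eta> = (\<lambda>z. a + z * (b - a)) ` tri \<eta>"

lemma connected_thin: "connected (thin a b \<eta>)"
  unfolding thin_def by (intro connected_continuous_image convex_connected convex_tri continuous_intros)

lemma thin_mono: "\<eta> \<le> \<eta>' \<Longrightarrow> 0 < \<eta> \<Longrightarrow> thin a b \<eta> \<subseteq> thin a b \<eta>'"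
  unfolding thin_def by (intro image_mono tri_mono)

lemma tri_nonempty: "0 < \<eta> \<Longrightarrow> Complex (1/2) (\<eta>/4) \<in> tri \<eta>"
  by (auto simp: tri_def)

lemma open_segment_affine:
  fixes a b :: complex assumes "a \<noteq> b"
  shows "a + z * (b - a) \<in> open_segment a b \<longleftrightarrow> z \<in> open_segment 0 1"
proof -
  have "open_segment a b = (\<lambda>z. a + z * (b - a)) ` open_segment 0 1"
    using assms by (auto simp: open_segment_image_interval scaleR_conv_of_real algebra_simps image_image)
  moreover have "inj (\<lambda>z. a + z * (b - a))" using assms by (auto intro!: injI)
  ultimately show ?thesis
    using inj_image_mem_iff[of "\<lambda>z. a + z * (b - a)" z "open_segment 0 1"] by auto
qed

lemma closed_segment_affine:
  fixes a b c d z :: complex assumes "a \<noteq> b"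
  shows "a + z * (b - a) \<in> closed_segment c d \<longleftrightarrow> z \<in> closed_segment ((c - a)/(b - a)) ((d - a)/(b - a))"
proof -
  define x y D where "x = (c - a) / (b - a)" and "y = (d - a) / (b - a)" and "D = b - a"
  have D: "D \<noteq> 0" using assms by (simp add: D_def)
  have cd: "c = a + x * D" "d = a + y * D" using D by (simp_all add: x_def y_def D_def)
  have "(1 - u) * c + u * d = a + ((1 - u) * x + u * y) * D" for u unfolding cd by (simp add: algebra_simps)
  then have "a + z * D = (1 - u) * c + u * d \<longleftrightarrow> z = (1 - u) * x + u * y" for u using D by simp
  then have "a + z * D \<in> closed_segment c d \<longleftrightarrow> z \<in> closed_segment x y"
    by (simp add: closed_segment_def scaleR_conv_of_real)
  then show ?thesis by (simp add: x_def y_def D_def)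
qed

lemma exp_2pi: "exp (\<i> * of_real (2 * pi)) = 1"
  using cis_conv_exp[of "2 * pi"] cis_2pi by simp

text \<open>The clockwise angle from \<open>z\<close> to \<open>c\<close>, with values in \<open>(0, 2\<pi>]\<close>, so that turning back counts as a full turn.\<close>

definition ang :: "complex \<Rightarrow> complex \<Rightarrow> real" where
  "ang z c = (let t = Arg2pi (z / c) in if t = 0 then 2 * pi else t)"

lemma ang_bounds: "0 < ang z c \<and> ang z c \<le> 2 * pi"
  using Arg2pi_ge_0[of "z/c"] Arg2pi_lt_2pi[of "z/c"] by (auto simp: ang_def Let_def)

lemma ang_polar: "z \<noteq> 0 \<Longrightarrow> c \<noteq> 0 \<Longrightarrow> z = of_real (cmod z / cmod c) * (c * exp (\<i> * of_real (ang z c)))"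
proof -
  assume z: "z \<noteq> 0" "c \<noteq> 0"
  have "z / c = of_real (cmod (z/c)) * exp (\<i> * of_real (Arg2pi (z/c)))" by (rule Arg2pi_eq)
  also have "exp (\<i> * of_real (Arg2pi (z/c))) = exp (\<i> * of_real (ang z c))"
    using exp_2pi by (auto simp: ang_def Let_def)
  finally have "z / c = of_real (cmod z / cmod c) * exp (\<i> * of_real (ang z c))" by (simp add: norm_divide)
  then show ?thesis using z by (simp add: divide_eq_eq mult_ac)
qed

lemma ang_unique:
  assumes "z = of_real k * (c * exp (\<i> * of_real t))" "0 < k" "c \<noteq> 0" "0 < t" "t \<le> 2 * pi"
  shows "ang z c = t"
proof (cases "t = 2 * pi")
  case True
  then have "z / c = of_real k" using assms by (simp only: exp_2pi) simp
  then have "Arg2pi (z / c) = 0" using assms(2) by (simp add: Arg2pi_eq_0)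
  then show ?thesis using True by (simp add: ang_def)
next
  case False
  have "of_real k * exp (\<i> * of_real t) = z / c" using assms(1,3) by simp
  then have "Arg2pi (z / c) = t" by (rule Arg2pi_unique) (use assms False in simp_all)
  then show ?thesis using assms by (simp add: ang_def)
qed


lemma half_lt: "0 < q \<Longrightarrow> x \<le> q / 2 \<Longrightarrow> x < q" for q x :: real
  by linarith

text \<open>Every edge is represented by two darts, one for each of its sides. The graph may be
  disconnected and may have isolated nodes.\<close>

locale plane_graph =
  fixes N :: "complex set" and A :: "(complex \<times> complex) set"
  assumes finN: "finite N"
    and A_sym: "(a,b) \<in> A \<Longrightarrow> (b,a) \<in> A"
    and A_N: "(a,b) \<in> A \<Longrightarrow> a \<in> N"
    and A_ne: "(a,b) \<in> A \<Longrightarrow> a \<noteq> b"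
    and A_open: "(a,b) \<in> A \<Longrightarrow> open_segment a b \<inter> N = {}"
    and A_disj: "(a,b) \<in> A \<Longrightarrow> (c,d) \<in> A \<Longrightarrow> open_segment a b \<inter> open_segment c d \<noteq> {} \<Longrightarrow>
      (c,d) = (a,b) \<or> (c,d) = (b,a)"
begin

definition S :: "complex set" where
  "S = N \<union> (\<Union>d\<in>A. closed_segment (fst d) (snd d))"

definition nbr :: "complex \<Rightarrow> complex set" where
  "nbr w = {c. (w,c) \<in> A}"

lemma A_N2: "(a,b) \<in> A \<Longrightarrow> b \<in> N" using A_sym A_N by blast

lemma finA: "finite A"
proof (rule finite_subset)
  show "A \<subseteq> N \<times> N" using A_N A_N2 by auto
qed (simp add: finN)

lemma finite_nbr: "finite (nbr w)"
  by (rule finite_subset[of _ N]) (use A_N2 finN in \<open>auto simp: nbr_def\<close>)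

lemma closed_S: "closed S" unfolding S_def
  by (intro closed_Un finite_imp_closed closed_UN finN finA) auto

lemma compact_S: "compact S" unfolding S_def
  by (intro compact_Un compact_UN finite_imp_compact[OF finN] finA) auto

lemma N_S: "w \<in> N \<Longrightarrow> w \<in> S" by (simp add: S_def)

lemma seg_S: "(a,b) \<in> A \<Longrightarrow> z \<in> closed_segment a b \<Longrightarrow> z \<in> S" by (force simp: S_def)

lemma S_cases:
  assumes "z \<in> S"
  obtains "z \<in> N" | a b where "(a,b) \<in> A" "z \<in> open_segment a b"
  using assms A_N A_N2 unfolding S_def by (auto simp: closed_segment_eq_open)

lemma thin_free:
  assumes ab: "(a,b) \<in> A"
  shows "\<exists>\<eta>>0. thin a b \<eta> \<inter> S = {}"
proof -
  have ne: "a \<noteq> b" by (rule A_ne[OF ab])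
  have D: "b - a \<noteq> 0" using ne by simp
  \<comment> \<open>Nodes enter as degenerate segments, so that isolated nodes are avoided in the
    same way as edges.\<close>
  let ?K = "(\<lambda>n. (n,n)) ` N \<union> {d\<in>A. d \<noteq> (a,b) \<and> d \<noteq> (b,a)}"
  let ?f = "\<lambda>z. a + z * (b - a)"
  have SK: "S \<subseteq> closed_segment a b \<union> (\<Union>d\<in>?K. closed_segment (fst d) (snd d))"
  proof
    fix z assume "z \<in> S"
    then show "z \<in> closed_segment a b \<union> (\<Union>d\<in>?K. closed_segment (fst d) (snd d))"
    proof (cases rule: S_cases)
      case (2 p q)
      show ?thesis
      proof (cases "(p,q) = (a,b) \<or> (p,q) = (b,a)")
        case True
        then have "z \<in> open_segment a b" using 2(2) by (auto simp: open_segment_commute)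
        then show ?thesis by (simp add: open_closed_segment)
      next
        case False
        then have "(p,q) \<in> ?K" using 2 by auto
        moreover have "z \<in> closed_segment (fst (p,q)) (snd (p,q))" using 2 by (simp add: open_closed_segment)
        ultimately show ?thesis by blast
      qed
    qed auto
  qed
  have "\<forall>d\<in>?K. \<exists>\<eta>>0. thin a b \<eta> \<inter> closed_segment (fst d) (snd d) = {}"
  proof
    fix d assume d: "d \<in> ?K"
    obtain p q where pq: "d = (p,q)" by (cases d)
    have pqN: "p \<in> N" "q \<in> N" using d pq A_N A_N2 by auto
    have aff: "?f z \<in> closed_segment p q \<longleftrightarrow> z \<in> closed_segment ((p-a)/(b-a)) ((q-a)/(b-a))" for z
      by (rule closed_segment_affine[OF ne])
    have pqo: "open_segment p q \<inter> N = {}" using d pq A_open by auto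
    have disj: "open_segment a b \<inter> closed_segment p q = {}"
    proof (cases "d \<in> A \<and> d \<noteq> (a,b) \<and> d \<noteq> (b,a)")
      case True
      then have "open_segment a b \<inter> open_segment p q = {}" using A_disj[OF ab, of p q] pq by auto
      then show ?thesis using A_open[OF ab] pqN by (auto simp: closed_segment_eq_open)
    next
      case False
      then have "p = q" using d pq by auto
      then show ?thesis using A_open[OF ab] pqN by auto
    qed
    have ep: "z = p \<or> z = q" if "z \<in> closed_segment p q" "z \<in> N" for z
      using that pqo by (auto simp: closed_segment_eq_open)
    have "\<exists>\<eta>>0. tri \<eta> \<inter> closed_segment ((p-a)/(b-a)) ((q-a)/(b-a)) = {}"
    proof (rule tri_segment)
      show "open_segment 0 1 \<inter> closed_segment ((p-a)/(b-a)) ((q-a)/(b-a)) = {}"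
      proof -
        have False if "z \<in> open_segment 0 1" "z \<in> closed_segment ((p-a)/(b-a)) ((q-a)/(b-a))" for z
          using that disj open_segment_affine[OF ne, of z] aff[of z] by auto
        then show ?thesis by auto
      qed
      show "0 = (p-a)/(b-a) \<or> 0 = (q-a)/(b-a)" if "0 \<in> closed_segment ((p-a)/(b-a)) ((q-a)/(b-a))"
        using ep[of a] aff[of 0] that A_N[OF ab] by auto
      show "1 = (p-a)/(b-a) \<or> 1 = (q-a)/(b-a)" if "1 \<in> closed_segment ((p-a)/(b-a)) ((q-a)/(b-a))"
        using ep[of b] aff[of 1] that A_N2[OF ab] D by auto
    qed
    then obtain \<eta> where "\<eta> > 0" "tri \<eta> \<inter> closed_segment ((p-a)/(b-a)) ((q-a)/(b-a)) = {}" by auto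
    then show "\<exists>\<eta>>0. thin a b \<eta> \<inter> closed_segment (fst d) (snd d) = {}"
      using aff pq unfolding thin_def by (intro exI[of _ \<eta>]) auto
  qed
  from bchoice[OF this] obtain h where h0: "\<forall>d\<in>?K. h d > 0 \<and> thin a b (h d) \<inter> closed_segment (fst d) (snd d) = {}"
    by (elim exE)
  note h = bspec[OF h0]
  define \<eta> where "\<eta> = Min (insert 1 (h ` ?K))"
  have fin: "finite ?K" using finN finA by simp
  have \<eta>: "\<eta> > 0" unfolding \<eta>_def using h fin by (subst Min_gr_iff) auto
  have "thin a b \<eta> \<inter> closed_segment (fst d) (snd d) = {}" if "d \<in> ?K" for d
  proof -
    have "\<eta> \<le> h d" unfolding \<eta>_def using fin that by (intro Min_le) auto
    then show ?thesis using h[OF that] thin_mono[OF _ \<eta>, of "h d" a b] by blast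
  qed
  moreover have "thin a b \<eta> \<inter> closed_segment a b = {}"
  proof -
    have "?f z \<notin> closed_segment a b" if "z \<in> tri \<eta>" for z
    proof -
      have "z \<notin> closed_segment 0 1" using that by (auto simp: tri_def closed_segment_def scaleR_conv_of_real)
      then show ?thesis using closed_segment_affine[OF ne, of z a b] D by simp
    qed
    then show ?thesis by (auto simp: thin_def)
  qed
  ultimately have "thin a b \<eta> \<inter> S = {}" using SK by blast
  then show ?thesis using \<eta> by blast
qed

text \<open>The face on the left of a dart.\<close>

definition lf :: "complex \<times> complex \<Rightarrow> complex set" where
  "lf d = (SOME f. f \<in> components (- S) \<and> (\<exists>\<eta>>0. thin (fst d) (snd d) \<eta> \<subseteq> f))"

lemma thin_nonempty: "0 < \<eta> \<Longrightarrow> thin a b \<eta> \<noteq> {}" unfolding thin_def using tri_nonempty by blast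

lemma lf_props:
  assumes "d \<in> A" shows "lf d \<in> components (- S)" "\<exists>\<eta>>0. thin (fst d) (snd d) \<eta> \<subseteq> lf d"
proof -
  obtain \<eta> where \<eta>: "\<eta> > 0" "thin (fst d) (snd d) \<eta> \<inter> S = {}" using thin_free[of "fst d" "snd d"] assms by auto
  then have "thin (fst d) (snd d) \<eta> \<subseteq> - S" by auto
  moreover have "- S \<noteq> {}" using \<eta> thin_nonempty[of \<eta> "fst d" "snd d"] by blast
  ultimately obtain f where "f \<in> components (- S)" "thin (fst d) (snd d) \<eta> \<subseteq> f"
    using exists_component_superset connected_thin by metis
  then have "\<exists>f. f \<in> components (- S) \<and> (\<exists>\<eta>>0. thin (fst d) (snd d) \<eta> \<subseteq> f)" using \<eta>(1) by auto
  from someI_ex[OF this] show "lf d \<in> components (- S)" "\<exists>\<eta>>0. thin (fst d) (snd d) \<eta> \<subseteq> lf d"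
    unfolding lf_def by auto
qed

lemma lf_eqI:
  assumes "d \<in> A" "f \<in> components (- S)" "\<And>\<eta>. 0 < \<eta> \<Longrightarrow> thin (fst d) (snd d) \<eta> \<inter> f \<noteq> {}"
  shows "lf d = f"
proof -
  obtain \<eta> where \<eta>: "\<eta> > 0" "thin (fst d) (snd d) \<eta> \<subseteq> lf d" using lf_props(2)[OF assms(1)] by auto
  then have "lf d \<inter> f \<noteq> {}" using assms(3)[OF \<eta>(1)] by auto
  then show ?thesis using components_nonoverlap[OF lf_props(1)[OF assms(1)] assms(2)] by blast
qed

lemma nbr_unique:
  assumes "(w,c) \<in> A" "(w,c') \<in> A" "c' - w = of_real s * (c - w)" "0 < s"
  shows "c = c'"
proof (rule ccontr)
  assume ne: "c \<noteq> c'"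
  then have "s \<noteq> 1" using assms(3) by auto
  then consider "s < 1" | "1 < s" by linarith
  then show False
  proof cases
    case 1
    have "c' = (1 - s) *\<^sub>R w + s *\<^sub>R c" using assms(3) by (simp add: scaleR_conv_of_real algebra_simps)
    then have "c' \<in> open_segment w c" unfolding in_segment using 1 assms(4) A_ne[OF assms(1)] by blast
    then show False using A_open[OF assms(1)] A_N2[OF assms(2)] by blast
  next
    case 2
    have "c - w = of_real (inverse s) * (c' - w)" using assms(3,4) by (simp add: field_simps)
    then have "c = (1 - inverse s) *\<^sub>R w + inverse s *\<^sub>R c'" by (simp add: scaleR_conv_of_real algebra_simps)
    moreover have "0 < inverse s" "inverse s < 1" using 2 by (simp_all add: field_simps)
    ultimately have "c \<in> open_segment w c'" unfolding in_segment using A_ne[OF assms(2)] by blast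
    then show False using A_open[OF assms(2)] A_N2[OF assms(1)] by blast
  qed
qed

text \<open>The nodes and edges that miss \<open>w\<close> form a closed set, so a small disc around
  \<open>w\<close> sees only the edges at \<open>w\<close>.\<close>

lemma star:
  assumes w: "w \<in> N"
  shows "\<exists>r>0. (\<forall>c\<in>nbr w. r \<le> dist w c) \<and>
    (\<forall>z\<in>S. dist z w < r \<longrightarrow> z = w \<or> (\<exists>c\<in>nbr w. \<exists>s>0. z - w = of_real s * (c - w)))"
proof -
  define S' where "S' = (N - {w}) \<union> (\<Union>d\<in>{d\<in>A. w \<notin> closed_segment (fst d) (snd d)}. closed_segment (fst d) (snd d))"
  have "closed S'" unfolding S'_def
    by (intro closed_Un finite_imp_closed closed_UN) (use finN finA in auto)
  moreover have "w \<notin> S'" by (auto simp: S'_def)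
  ultimately obtain r where r: "r > 0" "ball w r \<subseteq> - S'"
    using open_contains_ball[of "- S'"] by auto
  have 1: "r \<le> dist w c" if "c \<in> nbr w" for c
  proof -
    have "c \<in> S'" using that A_N2[of w c] A_ne[of w c] by (auto simp: nbr_def S'_def)
    then show ?thesis using r by (metis ComplD linorder_not_le mem_ball subsetD)
  qed
  have 2: "\<exists>c\<in>nbr w. \<exists>s>0. z - w = of_real s * (c - w)" if z: "z \<in> S" "dist z w < r" "z \<noteq> w" for z
  proof -
    have zS: "z \<notin> S'" using r z(2) by (auto simp: dist_commute)
    then have zN: "z \<notin> N" using z(3) by (auto simp: S'_def)
    obtain a b where ab: "(a,b) \<in> A" "z \<in> open_segment a b" using z(1) zN by (cases rule: S_cases) auto
    have "w \<in> closed_segment a b" using zS ab by (force simp: S'_def closed_segment_eq_open)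
    then have "w = a \<or> w = b" using A_open[OF ab(1)] w by (auto simp: closed_segment_eq_open)
    then obtain c where c: "(w,c) \<in> A" "z \<in> open_segment w c" using ab A_sym open_segment_commute by metis
    then obtain s where "0 < s" "z = (1 - s) *\<^sub>R w + s *\<^sub>R c" by (auto simp: in_segment)
    then have "z - w = of_real s * (c - w)" by (simp add: scaleR_conv_of_real algebra_simps)
    then show ?thesis using c \<open>0 < s\<close> by (auto simp: nbr_def)
  qed
  show ?thesis using r(1) 1 2 by blast
qed

text \<open>The first neighbour of \<open>w\<close> met when turning clockwise from the direction \<open>z\<close>.\<close>

definition cwn :: "complex \<Rightarrow> complex \<Rightarrow> complex" where
  "cwn w z = (SOME c. c \<in> nbr w \<and> (\<forall>c'\<in>nbr w. ang z (c - w) \<le> ang z (c' - w)))"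

lemma cwn_props:
  assumes "nbr w \<noteq> {}"
  shows "cwn w z \<in> nbr w" "c' \<in> nbr w \<Longrightarrow> ang z (cwn w z - w) \<le> ang z (c' - w)"
proof -
  have "\<exists>c. c \<in> nbr w \<and> (\<forall>c'\<in>nbr w. ang z (c - w) \<le> ang z (c' - w))"
    using ex_min_if_finite[OF finite_imageI[OF finite_nbr[of w], of "\<lambda>c. ang z (c - w)"]] assms
    by (auto simp: not_less)
  from someI_ex[OF this] show "cwn w z \<in> nbr w" "c' \<in> nbr w \<Longrightarrow> ang z (cwn w z - w) \<le> ang z (c' - w)"
    unfolding cwn_def by blast+
qed

definition free :: "complex \<Rightarrow> complex \<Rightarrow> bool" where
  "free w z \<longleftrightarrow> z \<noteq> 0 \<and> \<not> (\<exists>c\<in>nbr w. \<exists>s>0. z = of_real s * (c - w))"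

text \<open>A neighbour ray strictly inside the sector would be met before \<open>c\<close> when
  turning clockwise from \<open>z\<close>.\<close>

lemma sector_free:
  assumes n: "nbr w \<noteq> {}" and z: "z \<noteq> 0" and c: "c = cwn w z" and t: "0 < t" "t < ang z (c - w)" and k: "0 < k"
  shows "free w (of_real k * ((c - w) * exp (\<i> * of_real t)))"
proof -
  have cn: "c \<in> nbr w" using cwn_props(1)[OF n] c by simp
  have cw: "c - w \<noteq> 0" using cn A_ne by (auto simp: nbr_def)
  have "False" if "c' \<in> nbr w" "s > 0" "of_real k * ((c - w) * exp (\<i> * of_real t)) = of_real s * (c' - w)" for c' s
  proof -
    define \<theta> where "\<theta> = ang z (c - w)"
    define \<mu> where "\<mu> = cmod z / cmod (c - w)"
    have \<mu>: "0 < \<mu>" using z cw by (simp add: \<mu>_def)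
    have zz: "z = of_real \<mu> * ((c - w) * exp (\<i> * of_real \<theta>))"
      unfolding \<mu>_def \<theta>_def by (rule ang_polar[OF z cw])
    have cw': "c' - w \<noteq> 0" using that(1) A_ne by (auto simp: nbr_def)
    have e: "exp (\<i> * of_real \<theta>) = exp (\<i> * of_real t) * exp (\<i> * of_real (\<theta> - t))"
      by (simp add: exp_add[symmetric] algebra_simps)
    have cc: "(c - w) * exp (\<i> * of_real t) = of_real (s / k) * (c' - w)"
      using that(3) k by (simp add: field_simps)
    have "z = of_real \<mu> * (((c - w) * exp (\<i> * of_real t)) * exp (\<i> * of_real (\<theta> - t)))"
      unfolding zz e by (simp only: mult.assoc)
    also have "\<dots> = of_real (\<mu> * (s / k)) * ((c' - w) * exp (\<i> * of_real (\<theta> - t)))"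
      unfolding cc by (simp only: of_real_mult mult.assoc)
    finally have "ang z (c' - w) = \<theta> - t"
      by (rule ang_unique) (use \<mu> that(2) k cw' t ang_bounds[of z "c - w"] in \<open>auto simp: \<theta>_def\<close>)
    then show False using cwn_props(2)[OF n that(1), of z] c t by (simp add: \<theta>_def)
  qed
  then show ?thesis unfolding free_def using k cw by auto
qed

lemma free_scale: "free w z \<Longrightarrow> 0 < k \<Longrightarrow> free w (of_real k * z)"
proof -
  assume f: "free w z" and k: "0 < k"
  have "False" if "c \<in> nbr w" "s > 0" "of_real k * z = of_real s * (c - w)" for c s
  proof -
    have "z = of_real (s / k) * (c - w)" using that k by (simp add: field_simps)
    moreover have "s / k > 0" using that k by simp
    ultimately show False using f that(1) unfolding free_def by blast
  qed
  then show ?thesis using f k unfolding free_def by auto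
qed

text \<open>A sector to the left of the ray towards \<open>c\<close> that contains no other ray is
  connected, avoids the drawing near \<open>w\<close> and meets every thin triangle of
  \<open>(w,c)\<close>; so it belongs to the face of this dart. The set \<open>J\<close> of angles
  is general because it is half open when the sector ends at a point of the plane and open when it
  ends at an incoming edge.\<close>

lemma sector_face:
  assumes w: "w \<in> N"
  shows "\<exists>r>0. (\<forall>c\<in>nbr w. r \<le> dist w c) \<and> (\<forall>c J \<theta> \<rho> t. c \<in> nbr w \<longrightarrow> convex J \<longrightarrow> J \<subseteq> {0<..} \<longrightarrow> 0 < \<theta> \<longrightarrow> {0<..<\<theta>} \<subseteq> J \<longrightarrow>
    (\<forall>t\<in>J. free w ((c - w) * exp (\<i> * of_real t))) \<longrightarrow> 0 < \<rho> \<longrightarrow> \<rho> * cmod (c - w) < r \<longrightarrow> t \<in> J \<longrightarrow>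
    w + of_real \<rho> * ((c - w) * exp (\<i> * of_real t)) \<in> lf (w,c))"
proof -
  obtain r where r: "r > 0" "\<forall>c\<in>nbr w. r \<le> dist w c"
    "\<And>z. z \<in> S \<Longrightarrow> dist z w < r \<Longrightarrow> z = w \<or> (\<exists>c\<in>nbr w. \<exists>s>0. z - w = of_real s * (c - w))"
    using star[OF w] by blast
  show ?thesis
  proof (intro exI[of _ r] conjI allI impI r(1,2))
    fix c J \<theta> \<rho> t
    assume c: "c \<in> nbr w" and J: "convex J" "J \<subseteq> {0<..}" "0 < (\<theta>::real)" "{0<..<\<theta>} \<subseteq> J"
      and fr: "\<forall>t\<in>J. free w ((c - w) * exp (\<i> * of_real t))"
      and \<rho>: "0 < \<rho>" "\<rho> * cmod (c - w) < r" and t: "t \<in> J"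
    have wc: "(w,c) \<in> A" using c by (simp add: nbr_def)
    have ne: "c - w \<noteq> 0" using A_ne[OF wc] by simp
    define h where "h = (\<lambda>p. w + of_real (fst p) * ((c - w) * exp (\<i> * of_real (snd p))))"
    define P where "P = {0<..<r / cmod (c - w)} \<times> J"
    have "connected (h ` P)" unfolding h_def P_def
      by (intro connected_continuous_image convex_connected convex_Times J continuous_intros) auto
    moreover have "h ` P \<subseteq> - S"
    proof -
      have "h (x,y) \<notin> S" if "(x,y) \<in> P" for x y
      proof
        assume S: "h (x,y) \<in> S"
        have xy: "0 < x" "x < r / cmod (c - w)" "y \<in> J" using that by (auto simp: P_def)
        have d: "h (x,y) - w = of_real x * ((c - w) * exp (\<i> * of_real y))" by (simp add: h_def)
        then have "dist (h (x,y)) w = x * cmod (c - w)" using xy by (simp add: dist_norm norm_mult)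
        also have "\<dots> < r" using xy ne by (simp add: field_simps)
        finally have "h (x,y) = w \<or> (\<exists>c\<in>nbr w. \<exists>s>0. h (x,y) - w = of_real s * (c - w))" by (rule r(3)[OF S])
        moreover have "free w (h (x,y) - w)" unfolding d using fr xy by (intro free_scale) auto
        ultimately show False unfolding free_def by auto
      qed
      then show ?thesis by auto
    qed
    moreover have "- S \<noteq> {}" using lf_props(1)[OF wc] in_components_subset in_components_nonempty by fastforce
    ultimately obtain f where f: "f \<in> components (- S)" "h ` P \<subseteq> f"
      using exists_component_superset by metis
    have "lf (w,c) = f"
    proof (rule lf_eqI[OF wc f(1)])
      fix \<eta> :: real assume \<eta>: "0 < \<eta>"
      define y where "y = min (\<theta>/2) (arctan \<eta> / 2)"
      define x where "x = min (1/2) (r / cmod (c - w) / 2)"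
      have yp: "0 < y" "y < \<theta>" "y < arctan \<eta>" using J(3) \<eta> by (auto simp: y_def min_def zero_less_arctan_iff)
      have y2: "y < pi/2" using yp arctan_ubound[of \<eta>] by linarith
      have cs: "0 < sin y" "0 < cos y" using yp y2 by (auto intro: sin_gt_zero cos_gt_zero)
      have "tan y < tan (arctan \<eta>)" using yp arctan_ubound[of \<eta>] by (intro tan_monotone) auto
      then have "tan y < \<eta>" by (simp add: tan_arctan)
      then have "sin y / cos y < \<eta>" by (simp only: tan_def)
      then have tn: "sin y < \<eta> * cos y" using cs by (simp only: pos_divide_less_eq)
      have rp: "0 < r / cmod (c - w)" using r(1) ne by simp
      have "x \<le> r / cmod (c - w) / 2" "x \<le> 1/2" by (simp_all add: x_def)
    moreover have xpos: "0 < x" using rp by (simp add: x_def)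
    ultimately have xp: "0 < x" "x \<le> 1/2" "x < r / cmod (c - w)" using rp xpos half_lt[of "r / cmod (c - w)"] by (auto simp del: divide_divide_eq_left)
      have pt: "h (x,y) = w + (of_real x * exp (\<i> * of_real y)) * (c - w)" by (simp add: h_def mult_ac)
      have "of_real x * exp (\<i> * of_real y) \<in> tri \<eta>" by (rule tri_polar(1)[OF xp(1,2) cs tn \<eta>])
      then have "h (x,y) \<in> thin w c \<eta>" unfolding pt thin_def by blast
      moreover have "(x,y) \<in> P" using xp yp J(4) by (auto simp: P_def)
      ultimately show "thin (fst (w,c)) (snd (w,c)) \<eta> \<inter> f \<noteq> {}" using f(2) by auto
    qed
    moreover have "(\<rho>,t) \<in> P" using \<rho> t ne by (auto simp: P_def field_simps)
    then have "h (\<rho>,t) \<in> f" using f(2) by auto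
    ultimately show "w + of_real \<rho> * ((c - w) * exp (\<i> * of_real t)) \<in> lf (w,c)" by (simp add: h_def)
  qed
qed

text \<open>Turning clockwise from the point until the first ray sweeps a free sector, which lies to
  the left of that ray.\<close>

lemma free_face:
  assumes w: "w \<in> N" and n: "nbr w \<noteq> {}"
  shows "\<exists>r>0. \<forall>y. dist y w < r \<longrightarrow> y \<notin> S \<longrightarrow> y \<in> lf (w, cwn w (y - w))"
proof -
  obtain r where r: "r > 0" "\<And>c. c \<in> nbr w \<Longrightarrow> r \<le> dist w c"
    "\<And>c J \<theta> \<rho> t. c \<in> nbr w \<Longrightarrow> convex J \<Longrightarrow> J \<subseteq> {0<..} \<Longrightarrow> 0 < \<theta> \<Longrightarrow> {0<..<\<theta>} \<subseteq> J \<Longrightarrow>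
    (\<forall>t\<in>J. free w ((c - w) * exp (\<i> * of_real t))) \<Longrightarrow> 0 < \<rho> \<Longrightarrow> \<rho> * cmod (c - w) < r \<Longrightarrow> t \<in> J \<Longrightarrow>
    w + of_real \<rho> * ((c - w) * exp (\<i> * of_real t)) \<in> lf (w,c)"
    using sector_face[OF w] by metis
  have "y \<in> lf (w, cwn w (y - w))" if y: "dist y w < r" "y \<notin> S" for y
  proof -
    define z c where "z = y - w" and "c = cwn w z"
    have cn: "c \<in> nbr w" using cwn_props(1)[OF n] by (simp add: c_def)
    have wc: "(w,c) \<in> A" using cn by (simp add: nbr_def)
    have cw: "c - w \<noteq> 0" using A_ne[OF wc] by simp
    have z0: "z \<noteq> 0" using y(2) N_S[OF w] by (auto simp: z_def)
    have fz: "free w z"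
    proof -
      have False if c': "c' \<in> nbr w" "s > 0" "z = of_real s * (c' - w)" for c' s
      proof -
        have A: "(w,c') \<in> A" using c' by (simp add: nbr_def)
        have "cmod z < dist w c'" using y(1) r(2)[OF c'(1)] by (simp add: z_def dist_norm)
        then have "s * cmod (c' - w) < 1 * cmod (c' - w)" using c' by (simp add: norm_mult dist_norm norm_minus_commute)
        then have "s < 1" using mult_less_cancel_right_disj A_ne[OF A] by (metis norm_not_less_zero)
        moreover have "y = (1 - s) *\<^sub>R w + s *\<^sub>R c'" using c'(3) by (simp add: z_def scaleR_conv_of_real algebra_simps)
        ultimately have "y \<in> closed_segment w c'" using c'(2) unfolding in_segment by (intro exI[of _ s]) auto
        then show False using seg_S[OF A] y(2) by simp
      qed
      then show ?thesis using z0 unfolding free_def by blast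
    qed
    define \<theta> where "\<theta> = ang z (c - w)"
    define \<mu> where "\<mu> = cmod z / cmod (c - w)"
    have \<theta>: "0 < \<theta>" using ang_bounds by (simp add: \<theta>_def)
    have \<mu>: "0 < \<mu>" using z0 cw by (simp add: \<mu>_def)
    have zz: "z = of_real \<mu> * ((c - w) * exp (\<i> * of_real \<theta>))"
      unfolding \<mu>_def \<theta>_def by (rule ang_polar[OF z0 cw])
    have fr: "\<forall>t\<in>{0<..\<theta>}. free w ((c - w) * exp (\<i> * of_real t))"
    proof
      fix t assume t: "t \<in> {0<..\<theta>}"
      show "free w ((c - w) * exp (\<i> * of_real t))"
      proof (cases "t = \<theta>")
        case True
        have "free w (of_real (inverse \<mu>) * z)" using free_scale[OF fz, of "inverse \<mu>"] \<mu> by simp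
        moreover have "of_real (inverse \<mu>) * z = (c - w) * exp (\<i> * of_real \<theta>)" unfolding zz using \<mu> by simp
        ultimately show ?thesis using True by simp
      next
        case False
        then show ?thesis using sector_free[OF n z0 c_def, of t 1] t by (auto simp: \<theta>_def)
      qed
    qed
    have "w + of_real \<mu> * ((c - w) * exp (\<i> * of_real \<theta>)) \<in> lf (w,c)"
    proof (rule r(3)[OF cn _ _ \<theta> _ fr \<mu>])
      show "\<mu> * cmod (c - w) < r" using y(1) cw by (simp add: \<mu>_def z_def dist_norm)
    qed (use \<theta> in auto)
    then have "w + z \<in> lf (w,c)" using zz by simp
    then show ?thesis by (simp add: c_def z_def)
  qed
  then show ?thesis using r(1) by blast
qed

text \<open>The next dart along the boundary of the face on the left.\<close>

definition nx :: "complex \<times> complex \<Rightarrow> complex \<times> complex" where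
  "nx d = (snd d, cwn (snd d) (fst d - snd d))"

lemma nx_A: "d \<in> A \<Longrightarrow> nx d \<in> A"
proof -
  assume d: "d \<in> A"
  then have "fst d \<in> nbr (snd d)" using A_sym[of "fst d" "snd d"] by (simp add: nbr_def)
  then have "cwn (snd d) (fst d - snd d) \<in> nbr (snd d)" using cwn_props(1) by blast
  then show "nx d \<in> A" by (simp add: nx_def nbr_def)
qed

lemma fst_nx [simp]: "fst (nx d) = snd d" by (simp add: nx_def)

text \<open>The free sector between the two edges at \<open>w\<close> meets the thin triangles of
  both darts, near the head of the first and near the tail of the second.\<close>

lemma lf_nx:
  assumes d: "d \<in> A" shows "lf (nx d) = lf d"
proof -
  obtain a w where aw: "d = (a,w)" by (cases d)
  have A: "(a,w) \<in> A" using d aw by simp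
  have w: "w \<in> N" using A_N2[OF A] .
  have an: "a \<in> nbr w" using A_sym[OF A] by (simp add: nbr_def)
  then have n: "nbr w \<noteq> {}" by auto
  define z c where "z = a - w" and "c = cwn w z"
  have cn: "c \<in> nbr w" using cwn_props(1)[OF n] by (simp add: c_def)
  have wc: "(w,c) \<in> A" using cn by (simp add: nbr_def)
  have cw: "c - w \<noteq> 0" using A_ne[OF wc] by simp
  have z0: "z \<noteq> 0" using A_ne[OF A] by (simp add: z_def)
  define \<theta> where "\<theta> = ang z (c - w)"
  define \<mu> where "\<mu> = cmod z / cmod (c - w)"
  have \<theta>: "0 < \<theta>" using ang_bounds by (simp add: \<theta>_def)
  have \<mu>: "0 < \<mu>" using z0 cw by (simp add: \<mu>_def)
  have zz: "z = of_real \<mu> * ((c - w) * exp (\<i> * of_real \<theta>))"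
    unfolding \<mu>_def \<theta>_def by (rule ang_polar[OF z0 cw])
  have fr: "\<forall>t\<in>{0<..<\<theta>}. free w ((c - w) * exp (\<i> * of_real t))"
    using sector_free[OF n z0 c_def, of _ 1] by (auto simp: \<theta>_def)
  obtain r where r: "r > 0"
    "\<And>c J \<theta> \<rho> t. c \<in> nbr w \<Longrightarrow> convex J \<Longrightarrow> J \<subseteq> {0<..} \<Longrightarrow> 0 < \<theta> \<Longrightarrow> {0<..<\<theta>} \<subseteq> J \<Longrightarrow>
    (\<forall>t\<in>J. free w ((c - w) * exp (\<i> * of_real t))) \<Longrightarrow> 0 < \<rho> \<Longrightarrow> \<rho> * cmod (c - w) < r \<Longrightarrow> t \<in> J \<Longrightarrow>
    w + of_real \<rho> * ((c - w) * exp (\<i> * of_real t)) \<in> lf (w,c)"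
    using sector_face[OF w] by metis
  have "lf d = lf (w,c)"
  proof (rule lf_eqI[OF d lf_props(1)[OF wc]])
    fix \<eta> :: real assume \<eta>: "0 < \<eta>"
    define y where "y = min (\<theta>/2) (arctan \<eta> / 2)"
    define x where "x = min (1/2) (r / cmod z / 2)"
    have yp: "0 < y" "y < \<theta>" "y < arctan \<eta>" using \<theta> \<eta> by (auto simp: y_def min_def zero_less_arctan_iff)
    have y2: "y < pi/2" using yp arctan_ubound[of \<eta>] by linarith
    have cs: "0 < sin y" "0 < cos y" using yp y2 by (auto intro: sin_gt_zero cos_gt_zero)
    have "tan y < tan (arctan \<eta>)" using yp arctan_ubound[of \<eta>] by (intro tan_monotone) auto
    then have "tan y < \<eta>" by (simp add: tan_arctan)
      then have "sin y / cos y < \<eta>" by (simp only: tan_def)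
      then have tn: "sin y < \<eta> * cos y" using cs by (simp only: pos_divide_less_eq)
    have rp: "0 < r / cmod z" using r(1) z0 by simp
    have "x \<le> r / cmod z / 2" "x \<le> 1/2" by (simp_all add: x_def)
    moreover have xpos: "0 < x" using rp by (simp add: x_def)
    ultimately have xp: "0 < x" "x \<le> 1/2" "x < r / cmod z" using rp xpos half_lt[of "r / cmod z"] by (auto simp del: divide_divide_eq_left)
    define \<zeta> where "\<zeta> = 1 - of_real x * exp (\<i> * of_real (- y))"
    have "\<zeta> \<in> tri \<eta>" unfolding \<zeta>_def by (rule tri_polar(2)[OF xp(1,2) cs tn \<eta>])
    then have "a + \<zeta> * (w - a) \<in> thin a w \<eta>" by (auto simp: thin_def)
    moreover have "a + \<zeta> * (w - a) = w + of_real (x * \<mu>) * ((c - w) * exp (\<i> * of_real (\<theta> - y)))"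
    proof -
      have "a + \<zeta> * (w - a) = w + of_real x * exp (\<i> * of_real (- y)) * z" by (simp add: \<zeta>_def z_def algebra_simps)
      also have "\<dots> = w + of_real (x * \<mu>) * ((c - w) * (exp (\<i> * of_real \<theta>) * exp (\<i> * of_real (- y))))"
        by (subst zz) (simp add: mult_ac)
      also have "exp (\<i> * of_real \<theta>) * exp (\<i> * of_real (- y)) = exp (\<i> * of_real (\<theta> - y))"
        by (simp add: exp_add[symmetric] algebra_simps)
      finally show ?thesis .
    qed
    moreover have "w + of_real (x * \<mu>) * ((c - w) * exp (\<i> * of_real (\<theta> - y))) \<in> lf (w,c)"
    proof (rule r(2)[OF cn _ _ \<theta> _ fr])
      have "x * cmod z < r" using xp z0 by (simp add: field_simps)
      then show "x * \<mu> * cmod (c - w) < r" using cw by (simp add: \<mu>_def)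
    qed (use \<theta> yp xp \<mu> in auto)
    ultimately show "thin (fst d) (snd d) \<eta> \<inter> lf (w,c) \<noteq> {}" using aw by auto
  qed
  then show ?thesis using aw by (simp add: nx_def c_def z_def)
qed

text \<open>Of two darts with the same successor, the one with the smaller angle would lie in the
  free sector swept from the other. Equal angles mean the same ray and hence the same
  neighbour.\<close>

lemma nx_inj:
  assumes d: "d \<in> A" "d' \<in> A" and e: "nx d = nx d'"
  shows "d = d'"
proof -
  have main: False if A: "(a,w) \<in> A" "(a',w) \<in> A" and c: "c = cwn w (a - w)" "c = cwn w (a' - w)"
      and lt: "ang (a - w) (c - w) < ang (a' - w) (c - w)" for a a' w c
  proof -
    have n: "nbr w \<noteq> {}" "a \<in> nbr w" using A A_sym by (auto simp: nbr_def)
    have "(w,c) \<in> A" using cwn_props(1)[OF n(1), of "a - w"] c by (simp add: nbr_def)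
    then have cw: "c - w \<noteq> 0" using A_ne by auto
    have z: "a - w \<noteq> 0" "a' - w \<noteq> 0" using A_ne A by auto
    define \<mu> where "\<mu> = cmod (a - w) / cmod (c - w)"
    have \<mu>: "0 < \<mu>" using z cw by (simp add: \<mu>_def)
    have "a - w = of_real \<mu> * ((c - w) * exp (\<i> * of_real (ang (a - w) (c - w))))"
      unfolding \<mu>_def by (rule ang_polar[OF z(1) cw])
    then have "free w (a - w)"
      using sector_free[OF n(1) z(2) c(2) _ lt \<mu>] ang_bounds by metis
    moreover have "a - w = of_real 1 * (a - w)" by simp
    ultimately show False unfolding free_def using n(2) zero_less_one by metis
  qed
  obtain a w where aw: "d = (a,w)" by (cases d)
  obtain a' where aw': "d' = (a',w)" using e aw by (cases d') (auto simp: nx_def)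
  define c where "c = cwn w (a - w)"
  have c': "c = cwn w (a' - w)" using e aw aw' by (simp add: nx_def c_def)
  have A: "(a,w) \<in> A" "(a',w) \<in> A" using d aw aw' by auto
  have "ang (a - w) (c - w) = ang (a' - w) (c - w)"
    using main[OF A c_def c'] main[OF A(2,1) c' c_def] by (meson linorder_neqE_linordered_idom)
  note eqa = this
  have n: "nbr w \<noteq> {}" "a \<in> nbr w" using A A_sym by (auto simp: nbr_def)
  have "(w,c) \<in> A" using cwn_props(1)[OF n(1), of "a - w"] c_def by (simp add: nbr_def)
  then have cw: "c - w \<noteq> 0" using A_ne by auto
  have z: "a - w \<noteq> 0" "a' - w \<noteq> 0" using A_ne A by auto
  define E where "E = (c - w) * exp (\<i> * of_real (ang (a - w) (c - w)))"
  have E: "a - w = of_real (cmod (a - w) / cmod (c - w)) * E" "a' - w = of_real (cmod (a' - w) / cmod (c - w)) * E"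
    using ang_polar[OF z(1) cw] ang_polar[OF z(2) cw] eqa by (simp_all only: E_def)
  have "a' - w = of_real (cmod (a' - w) / cmod (a - w)) * (a - w)"
  proof -
    have "of_real (cmod (a' - w) / cmod (a - w)) * (of_real (cmod (a - w) / cmod (c - w)) * E) =
      of_real (cmod (a' - w) / cmod (a - w) * (cmod (a - w) / cmod (c - w))) * E" by (simp only: of_real_mult mult.assoc)
    also have "cmod (a' - w) / cmod (a - w) * (cmod (a - w) / cmod (c - w)) = cmod (a' - w) / cmod (c - w)" using z by simp
    finally show ?thesis by (simp only: E(1)[symmetric] E(2)[symmetric])
  qed
  moreover have "0 < cmod (a' - w) / cmod (a - w)" using z by simp
  ultimately have "a = a'" using nbr_unique[of w a a'] A A_sym by blast
  then show ?thesis using aw aw' by simp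
qed

section \<open>Every face has a dart; Euler's inequality for faces\<close>

lemma open_frontier_complement:
  fixes f :: "complex set"
  assumes "open f" "f \<noteq> {}" "frontier f \<subseteq> K" "f \<inter> K = {}" "connected (- K)"
  shows "f = - K"
proof -
  have "openin (top_of_set (- K)) f" using assms by (auto intro!: open_subset)
  moreover have "f = - K \<inter> closure f"
    using assms(1,3,4) closure_subset[of f] by (auto simp: frontier_def interior_open)
  then have "closedin (top_of_set (- K)) f" by (metis closed_closure closedin_closed_Int)
  ultimately show ?thesis using assms(2,5) unfolding connected_clopen by blast
qed

lemma comp_open: "f \<in> components (- S) \<Longrightarrow> open f"
  by (rule open_components[OF open_Compl[OF closed_S]])

lemma comp_disj: "f \<in> components (- S) \<Longrightarrow> f \<inter> S = {}"
  using in_components_subset by fastforce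

lemma frontier_S: "f \<in> components (- S) \<Longrightarrow> frontier f \<subseteq> S"
  by (rule frontier_of_components_closed_complement[OF closed_S])

lemma comp_eqI: "f \<in> components (- S) \<Longrightarrow> f' \<in> components (- S) \<Longrightarrow> y \<in> f \<Longrightarrow> y \<in> f' \<Longrightarrow> f = f'"
  using components_nonoverlap by blast

lemma frontier_node:
  assumes f: "f \<in> components (- S)" and w: "w \<in> frontier f" "w \<in> N" "nbr w \<noteq> {}"
  shows "\<exists>c. (w,c) \<in> A \<and> lf (w,c) = f"
proof -
  obtain r where r: "r > 0" "\<And>y. dist y w < r \<Longrightarrow> y \<notin> S \<Longrightarrow> y \<in> lf (w, cwn w (y - w))"
    using free_face[OF w(2,3)] by blast
  have "w \<in> closure f" using w(1) by (simp add: frontier_def)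
  then obtain y where y: "y \<in> f" "dist y w < r" using r(1) unfolding closure_approachable by blast
  have "y \<notin> S" using y(1) comp_disj[OF f] by auto
  then have yl: "y \<in> lf (w, cwn w (y - w))" using r(2) y(2) by blast
  have A: "(w, cwn w (y - w)) \<in> A" using cwn_props(1)[OF w(3)] by (simp add: nbr_def)
  show ?thesis using A comp_eqI[OF lf_props(1)[OF A] f yl y(1)] by blast
qed

text \<open>The sign of the imaginary part tells on which side of the line from \<open>a\<close> to
  \<open>b\<close> the point \<open>y\<close> lies; near \<open>s\<close> no other edge
  interferes.\<close>

lemma half_disc:
  assumes ab: "(a,b) \<in> A" and s: "s \<in> open_segment a b"
  shows "\<exists>r>0. \<forall>y. dist y s < r \<longrightarrow> (0 < Im ((y - a) / (b - a)) \<longrightarrow> y \<in> lf (a,b)) \<and> (Im ((y - a) / (b - a)) = 0 \<longrightarrow> y \<in> S)"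
proof -
  define S' where "S' = N \<union> (\<Union>d\<in>{d\<in>A. s \<notin> closed_segment (fst d) (snd d)}. closed_segment (fst d) (snd d))"
  have "closed S'" unfolding S'_def
    by (intro closed_Un finite_imp_closed closed_UN) (use finN finA in auto)
  moreover have "s \<notin> S'" using A_open[OF ab] s by (auto simp: S'_def)
  ultimately obtain r where r: "r > 0" "ball s r \<subseteq> - S'" using open_contains_ball[of "- S'"] by auto
  have near: "z \<in> open_segment a b" if z: "z \<in> S" "dist z s < r" for z
  proof -
    have zS: "z \<notin> S'" using r z(2) by (auto simp: dist_commute)
    then have zN: "z \<notin> N" by (auto simp: S'_def)
    obtain p q where pq: "(p,q) \<in> A" "z \<in> open_segment p q" using z(1) zN by (cases rule: S_cases) auto
    have "s \<in> closed_segment p q" using zS pq by (force simp: S'_def closed_segment_eq_open)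
    moreover have "s \<notin> N" using A_open[OF ab] s by auto
    ultimately have "s \<in> open_segment p q" using A_N[OF pq(1)] A_N2[OF pq(1)] by (auto simp: closed_segment_eq_open)
    then have "(p,q) = (a,b) \<or> (p,q) = (b,a)" using A_disj[OF ab pq(1)] s by blast
    then show ?thesis using pq(2) open_segment_commute by blast
  qed
  have ne: "b - a \<noteq> 0" using A_ne[OF ab] by simp
  obtain \<sigma> where \<sigma>: "0 < \<sigma>" "\<sigma> < 1" "s = (1 - \<sigma>) *\<^sub>R a + \<sigma> *\<^sub>R b" using s by (auto simp: in_segment)
  have s': "s = a + of_real \<sigma> * (b - a)" using \<sigma>(3) by (simp add: scaleR_conv_of_real algebra_simps)
  define m where "m = min (r / cmod (b - a)) (min \<sigma> (1 - \<sigma>))"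
  have m: "0 < m" "m \<le> r / cmod (b - a)" "m \<le> \<sigma>" "m \<le> 1 - \<sigma>" using r(1) ne \<sigma> by (auto simp: m_def)
  define h where "h = (\<lambda>z. a + z * (b - a))"
  define P where "P = {z. 0 < Im z} \<inter> ball (of_real \<sigma>) m"
  have dst: "dist (h z) s = cmod (z - of_real \<sigma>) * cmod (b - a)" for z
  proof -
    have "h z - s = (z - of_real \<sigma>) * (b - a)" unfolding h_def s' by (simp add: algebra_simps)
    then show ?thesis by (simp add: dist_norm norm_mult)
  qed
  have "convex P" unfolding P_def by (intro convex_Int convex_halfspace_Im_gt convex_ball)
  then have con: "connected (h ` P)" unfolding h_def
    by (intro connected_continuous_image convex_connected continuous_intros)
  have sub: "h ` P \<subseteq> - S"
  proof -
    have "h z \<notin> S" if z: "z \<in> P" for z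
    proof
      assume "h z \<in> S"
      moreover have "cmod (z - of_real \<sigma>) < r / cmod (b - a)" using z m by (auto simp: P_def dist_norm norm_minus_commute)
      then have "dist (h z) s < r" unfolding dst using ne by (simp add: field_simps)
      ultimately have "h z \<in> open_segment a b" using near by blast
      then have "z \<in> open_segment 0 1" unfolding h_def using open_segment_affine[of a b z] ne by simp
      then show False using z by (auto simp: P_def in_segment scaleR_conv_of_real)
    qed
    then show ?thesis by auto
  qed
  have "- S \<noteq> {}" using in_components_subset[OF lf_props(1)[OF ab]] in_components_nonempty[OF lf_props(1)[OF ab]] by auto
  then obtain f where f: "f \<in> components (- S)" "h ` P \<subseteq> f" using exists_component_superset[OF sub _ con] by blast
  have lf: "lf (a,b) = f"
  proof (rule lf_eqI[OF ab f(1)])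
    fix \<eta> :: real assume \<eta>: "0 < \<eta>"
    define t where "t = min (m/2) (min (\<eta> * \<sigma> / 2) (\<eta> * (1 - \<sigma>) / 2))"
    have "0 < \<eta> * \<sigma>" "0 < \<eta> * (1 - \<sigma>)" using \<eta> \<sigma> by auto
    then have t: "0 < t" "t < m" "t < \<eta> * \<sigma>" "t < \<eta> * (1 - \<sigma>)" using m(1) unfolding t_def by linarith+
    then have "Complex \<sigma> t \<in> tri \<eta>" by (auto simp: tri_def)
    then have "h (Complex \<sigma> t) \<in> thin a b \<eta>" unfolding h_def thin_def by blast
    moreover have "Complex \<sigma> t \<in> P" using t by (auto simp: P_def dist_norm cmod_def)
    ultimately show "thin (fst (a,b)) (snd (a,b)) \<eta> \<inter> f \<noteq> {}" using f(2) by auto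
  qed
  show ?thesis
  proof (intro exI[of _ "m * cmod (b - a)"] conjI allI impI)
    show "0 < m * cmod (b - a)" using m ne by simp
    fix y assume y: "dist y s < m * cmod (b - a)"
    define z where "z = (y - a) / (b - a)"
    have yz: "y = h z" using ne by (simp add: h_def z_def)
    have zd: "cmod (z - of_real \<sigma>) < m" using y ne unfolding yz dst by simp
    show "y \<in> lf (a,b)" if "0 < Im ((y - a) / (b - a))"
    proof -
      have "z \<in> P" using that zd by (auto simp: P_def z_def dist_norm norm_minus_commute)
      then show ?thesis using f(2) lf yz by auto
    qed
    show "y \<in> S" if "Im ((y - a) / (b - a)) = 0"
    proof -
      have zr: "z = of_real (Re z)" using that by (simp add: z_def complex_eq_iff)
      have "\<bar>Re z - \<sigma>\<bar> < m" using zd abs_Re_le_cmod[of "z - of_real \<sigma>"] by simp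
      then have "0 \<le> Re z" "Re z \<le> 1" using m by linarith+
      moreover have "y = (1 - Re z) *\<^sub>R a + Re z *\<^sub>R b"
        unfolding yz h_def by (subst zr) (simp add: scaleR_conv_of_real algebra_simps)
      ultimately have "y \<in> closed_segment a b" unfolding in_segment by blast
      then show ?thesis by (rule seg_S[OF ab])
    qed
  qed
qed

lemma frontier_open:
  assumes f: "f \<in> components (- S)" and ab: "(a,b) \<in> A" and s: "s \<in> frontier f" "s \<in> open_segment a b"
  shows "lf (a,b) = f \<or> lf (b,a) = f"
proof -
  have ba: "(b,a) \<in> A" "s \<in> open_segment b a" using A_sym[OF ab] s by (auto simp: open_segment_commute)
  obtain r where r: "r > 0" "\<And>y. dist y s < r \<Longrightarrow> 0 < Im ((y - a) / (b - a)) \<Longrightarrow> y \<in> lf (a,b)"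
    "\<And>y. dist y s < r \<Longrightarrow> Im ((y - a) / (b - a)) = 0 \<Longrightarrow> y \<in> S" using half_disc[OF ab s(2)] by blast
  obtain r' where r': "r' > 0" "\<And>y. dist y s < r' \<Longrightarrow> 0 < Im ((y - b) / (a - b)) \<Longrightarrow> y \<in> lf (b,a)"
    using half_disc[OF ba] by blast
  have "s \<in> closure f" using s(1) by (simp add: frontier_def)
  then obtain y where y: "y \<in> f" "dist y s < min r r'" using r(1) r'(1) unfolding closure_approachable by (meson min_less_iff_conj)
  have yS: "y \<notin> S" using y(1) comp_disj[OF f] by auto
  have ne: "b - a \<noteq> 0" "a - b \<noteq> 0" using A_ne[OF ab] by auto
  have "(y - b) / (a - b) = 1 - (y - a) / (b - a)" using ne by (simp add: field_simps)
  then have im: "Im ((y - b) / (a - b)) = - Im ((y - a) / (b - a))" by simp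
  consider "0 < Im ((y - a) / (b - a))" | "0 < Im ((y - b) / (a - b))" | "Im ((y - a) / (b - a)) = 0"
    unfolding im by linarith
  then show ?thesis
  proof cases
    case 1
    then show ?thesis using comp_eqI[OF lf_props(1)[OF ab] f r(2) y(1)] y by auto
  next
    case 2
    then show ?thesis using comp_eqI[OF lf_props(1)[OF ba(1)] f r'(2) y(1)] y by auto
  next
    case 3
    then show ?thesis using r(3) y yS by auto
  qed
qed

text \<open>Otherwise the frontier consists of isolated nodes. Finitely many points do not separate
  the plane, so the face is all the rest and leaves no room for an edge.\<close>

lemma comp_has_dart:
  assumes f: "f \<in> components (- S)" and ne: "A \<noteq> {}"
  shows "\<exists>d\<in>A. lf d = f"
proof (rule ccontr)
  assume no: "\<not> (\<exists>d\<in>A. lf d = f)"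
  define K where "K = {w\<in>N. nbr w = {}}"
  have "frontier f \<subseteq> K"
  proof
    fix s assume s: "s \<in> frontier f"
    then have "s \<in> S" using frontier_S[OF f] by auto
    then show "s \<in> K"
    proof (cases rule: S_cases)
      case 1
      then show ?thesis using frontier_node[OF f s] no unfolding K_def by blast
    next
      case (2 a b)
      then show ?thesis using frontier_open[OF f 2(1) s 2(2)] A_sym[OF 2(1)] no by blast
    qed
  qed
  moreover have "connected (- K)"
  proof -
    have "countable K" using finN by (simp add: K_def countable_finite)
    then have "connected (UNIV - K)" by (intro connected_open_diff_countable) auto
    then show ?thesis by (simp add: Compl_eq_Diff_UNIV)
  qed
  moreover have "f \<inter> K = {}" using comp_disj[OF f] N_S by (auto simp: K_def)
  ultimately have "f = - K" using open_frontier_complement comp_open[OF f] in_components_nonempty[OF f] by metis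
  then have "S \<subseteq> K" using comp_disj[OF f] by auto
  moreover obtain a b where ab: "(a,b) \<in> A" using ne by auto
  ultimately have "a \<in> K" using seg_S[OF ab] by auto
  then show False using ab by (auto simp: K_def nbr_def)
qed

lemma comps_eq: "A \<noteq> {} \<Longrightarrow> components (- S) = lf ` A"
  using comp_has_dart lf_props(1) by blast

theorem euler_faces:
  assumes ne: "A \<noteq> {}"
  shows "finite (path_component_set S ` S)" "card A + 2 * npc S + 2 \<le> 2 * card (lf ` A) + 2 * card N"
proof -
  \<comment> \<open>One dart of each edge, selected by the lexicographic order of its ends.\<close>
  define I where "I = {d\<in>A. Re (fst d) < Re (snd d) \<or> Re (fst d) = Re (snd d) \<and> Im (fst d) < Im (snd d)}"
  have IA: "I \<subseteq> A" by (auto simp: I_def)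
  have finI: "finite I" using IA finA finite_subset by blast
  have AI: "A = I \<union> prod.swap ` I"
  proof
    show "A \<subseteq> I \<union> prod.swap ` I"
    proof
      fix d assume d: "d \<in> A"
      obtain a b where ab: "d = (a,b)" by (cases d)
      have "a \<noteq> b" "(b,a) \<in> A" using d ab A_ne A_sym by auto
      then have "(a,b) \<in> I \<or> (b,a) \<in> I" using d ab by (auto simp: I_def complex_eq_iff)
      then show "d \<in> I \<union> prod.swap ` I" using ab by force
    qed
  qed (use IA A_sym in auto)
  have "I \<inter> prod.swap ` I = {}" by (auto simp: I_def)
  then have cA: "card A = 2 * card I"
    using AI card_Un_disjoint[OF finI finite_imageI[OF finI, of prod.swap]] by (simp add: card_image)
  have SI: "S = N \<union> (\<Union>d\<in>I. closed_segment (fst d) (snd d))"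
    unfolding S_def by (subst AI) (auto simp: closed_segment_commute)
  have N: "N \<noteq> {}" using ne A_N by auto
  have p1: "a \<noteq> b \<and> a \<in> N \<and> b \<in> N \<and> open_segment a b \<inter> N = {}" if "(a,b) \<in> I" for a b
    using that IA A_ne A_N A_N2 A_open by blast
  have p2: "open_segment (fst d) (snd d) \<inter> open_segment (fst d') (snd d') = {}" if "d \<in> I" "d' \<in> I" "d \<noteq> d'" for d d'
  proof (rule ccontr)
    assume "\<not> ?thesis"
    then have "d' = d \<or> d' = (snd d, fst d)" using A_disj[of "fst d" "snd d" "fst d'" "snd d'"] that IA by auto
    then show False using that by (auto simp: I_def)
  qed
  obtain R where R: "separated_points S R" "finite (path_component_set S ` S)" "card I + npc S + 1 \<le> card R + card N"
    using euler_inequality[OF finN N finI p1 p2] unfolding SI[symmetric] by blast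
  have RS: "finite R" "R \<subseteq> - S" using R(1) by (auto simp: separated_points_def)
  have "inj_on (connected_component_set (- S)) R"
  proof (rule inj_onI)
    fix x y assume xy: "x \<in> R" "y \<in> R" "connected_component_set (- S) x = connected_component_set (- S) y"
    have "y \<in> connected_component_set (- S) y" using xy RS by (auto simp: connected_component_refl)
    then have "connected_component (- S) x y" using xy(3) by auto
    then show "x = y" using R(1) xy unfolding separated_points_def by blast
  qed
  moreover have "connected_component_set (- S) ` R \<subseteq> lf ` A"
    using RS comps_eq[OF ne] unfolding components_def by auto
  ultimately have "card R \<le> card (lf ` A)" using card_inj_on_le finA by blast
  then show "finite (path_component_set S ` S)" "card A + 2 * npc S + 2 \<le> 2 * card (lf ` A) + 2 * card N"
    using R cA by auto
qed

end

section \<open>Convex hulls of faces\<close>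

context plane_graph begin

text \<open>Turning back has the largest possible angle \<open>2 * pi\<close>, so it is chosen only
  when there is no other edge.\<close>

lemma nx_other:
  assumes aw: "(a,w) \<in> A" and c: "(w,c) \<in> A" "c \<noteq> a"
  shows "snd (nx (a,w)) \<noteq> a"
proof
  assume e: "snd (nx (a,w)) = a"
  have z: "a - w \<noteq> 0" using A_ne[OF aw] by simp
  have cw: "c - w \<noteq> 0" using A_ne[OF c(1)] by simp
  have "a - w = of_real 1 * ((a - w) * exp (\<i> * of_real (2 * pi)))" by (simp only: exp_2pi) simp
  then have "ang (a - w) (a - w) = 2 * pi" by (rule ang_unique) (use z in auto)
  moreover have n: "nbr w \<noteq> {}" "c \<in> nbr w" using c by (auto simp: nbr_def)
  ultimately have "2 * pi \<le> ang (a - w) (c - w)"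
    using cwn_props(2)[OF n, of "a - w"] e by (simp add: nx_def)
  then have g: "ang (a - w) (c - w) = 2 * pi" using ang_bounds[of "a - w" "c - w"] by linarith
  have "a - w = of_real (cmod (a - w) / cmod (c - w)) * (c - w)"
    using ang_polar[OF z cw] unfolding g exp_2pi by simp
  moreover have "0 < cmod (a - w) / cmod (c - w)" using z cw by simp
  ultimately show False using nbr_unique[OF c(1) A_sym[OF aw]] c(2) by blast
qed

text \<open>Clockwise from the incoming edge, the rays of a cross have the angles
  \<open>pi/2\<close>, \<open>pi\<close>, \<open>3*pi/2\<close> and \<open>2*pi\<close>; the
  smallest one belongs to the left turn.\<close>

lemma nx_cross:
  assumes aw: "(a,w) \<in> A" and c: "(w,c) \<in> A" "c - w = of_real s * (\<i> * (w - a))" "0 < s"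
    and all: "\<And>c'. c' \<in> nbr w \<Longrightarrow> \<exists>s>0. \<exists>u\<in>{1,-1,\<i>,-\<i>}. c' - w = of_real s * (u * (w - a))"
  shows "nx (a,w) = (w,c)"
proof -
  have z: "a - w \<noteq> 0" using A_ne[OF aw] by simp
  have cw: "c - w \<noteq> 0" using A_ne[OF c(1)] by simp
  define k where "k = cwn w (a - w)"
  have n: "nbr w \<noteq> {}" "c \<in> nbr w" using c by (auto simp: nbr_def)
  have kn: "k \<in> nbr w" unfolding k_def by (rule cwn_props(1)[OF n(1)])
  have e2: "exp (\<i> * of_real (pi/2)) = \<i>" using cis_conv_exp[of "pi/2"] by simp
  have ac: "ang (a - w) (c - w) = pi/2"
    by (rule ang_unique[of _ "inverse s"]) (use c cw in \<open>simp_all only: e2, simp_all add: field_simps\<close>)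
  have "ang (a - w) (k - w) \<le> pi/2" using cwn_props(2)[OF n, of "a - w"] ac by (simp add: k_def)
  moreover obtain s' u where su: "0 < s'" "u \<in> {1,-1,\<i>,-\<i>}" "k - w = of_real s' * (u * (w - a))" using all[OF kn] by blast
  have kw: "k - w \<noteq> 0" using kn A_ne by (auto simp: nbr_def)
  have e1: "exp (\<i> * of_real pi) = -1" using cis_conv_exp[of pi] by simp
  have e3: "exp (\<i> * of_real (3*pi/2)) = -\<i>"
  proof -
    have "cis (3*pi/2) = cis pi * cis (pi/2)" unfolding cis_mult by (rule arg_cong[of _ _ cis]) simp
    then have "exp (\<i> * of_real (3*pi/2)) = exp (\<i> * of_real pi) * exp (\<i> * of_real (pi/2))"
      by (simp only: cis_conv_exp)
    then show ?thesis by (simp only: e1 e2) simp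
  qed
  have "u = \<i>"
  proof (rule ccontr)
    assume "u \<noteq> \<i>"
    then consider "u = 1" | "u = -1" | "u = -\<i>" using su(2) by auto
    then have "pi/2 < ang (a - w) (k - w)"
    proof cases
      case 1
      have "ang (a - w) (k - w) = pi"
        by (rule ang_unique[of _ "inverse s'"]) (use su 1 kw in \<open>simp_all only: e1, simp_all add: field_simps\<close>)
      then show ?thesis by simp
    next
      case 2
      have "ang (a - w) (k - w) = 2 * pi"
        by (rule ang_unique[of _ "inverse s'"]) (use su 2 kw in \<open>simp_all only: exp_2pi, simp_all add: field_simps\<close>)
      then show ?thesis by simp
    next
      case 3
      have "ang (a - w) (k - w) = 3*pi/2"
        by (rule ang_unique[of _ "inverse s'"]) (use su 3 kw in \<open>simp_all only: e3, simp_all add: field_simps\<close>)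
      then show ?thesis by simp
    qed
    then show False using calculation by simp
  qed
  then have e: "k - w = of_real (s'/s) * (c - w)" using su(3) c by simp
  have "0 < s'/s" using su c by simp
  moreover have "(w,k) \<in> A" using kn by (simp add: nbr_def)
  ultimately have "c = k" using nbr_unique[OF c(1) _ e] by simp
  then show ?thesis by (simp add: nx_def k_def)
qed

section \<open>Hulls of bounded faces and of the whole drawing\<close>

definition P :: "complex set \<Rightarrow> complex set" where
  "P f = {fst d |d. d \<in> A \<and> lf d = f}"

lemma P_fst: "d \<in> A \<Longrightarrow> fst d \<in> P (lf d)" unfolding P_def by blast

lemma P_snd: "d \<in> A \<Longrightarrow> snd d \<in> P (lf d)"
  using P_fst[OF nx_A] lf_nx fst_nx by metis

lemma frontier_hull:
  assumes f: "f \<in> components (- S)" and iso: "\<And>w. w \<in> N \<Longrightarrow> nbr w \<noteq> {}"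
  shows "frontier f \<subseteq> convex hull (P f)"
proof
  fix s assume s: "s \<in> frontier f"
  then have "s \<in> S" using frontier_S[OF f] by auto
  then show "s \<in> convex hull (P f)"
  proof (cases rule: S_cases)
    case 1
    then obtain c where "(s,c) \<in> A" "lf (s,c) = f" using frontier_node[OF f s 1] iso by blast
    then show ?thesis using P_fst[of "(s,c)"] by (simp add: hull_inc)
  next
    case (2 a b)
    have "a \<in> P f" "b \<in> P f"
      using frontier_open[OF f 2(1) s 2(2)] P_fst P_snd 2(1) A_sym[OF 2(1)] by fastforce+
    then have "closed_segment a b \<subseteq> convex hull (P f)"
      by (intro closed_segment_subset convex_convex_hull hull_inc)
    then show ?thesis using 2(2) by (auto simp: open_closed_segment)
  qed
qed

text \<open>The extreme points of the hull of the closure lie on the frontier, and by the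
  Krein-Milman theorem they span this hull.\<close>

lemma bounded_face_hull:
  assumes f: "f \<in> components (- S)" and iso: "\<And>w. w \<in> N \<Longrightarrow> nbr w \<noteq> {}" and b: "bounded f"
  shows "f \<subseteq> convex hull (P f)"
proof -
  define K where "K = convex hull (closure f)"
  have cf: "compact (closure f)" using b by (simp add: compact_closure)
  then have K: "compact K" "convex K" unfolding K_def by (simp_all add: compact_convex_hull)
  have "{x. x extreme_point_of K} \<subseteq> frontier f"
  proof
    fix x assume x: "x \<in> {x. x extreme_point_of K}"
    then have xc: "x \<in> closure f" unfolding K_def using extreme_point_of_convex_hull by blast
    have "x \<notin> interior f"
    proof
      assume "x \<in> interior f"
      moreover have "f \<subseteq> K" unfolding K_def using closure_subset[of f] hull_subset[of "closure f" convex] by auto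
      ultimately have "x \<in> interior K" using interior_mono by blast
      then show False using x extreme_point_not_in_interior by blast
    qed
    then show "x \<in> frontier f" using xc by (simp add: frontier_def)
  qed
  moreover have "K = convex hull {x. x extreme_point_of K}" by (rule Krein_Milman_Minkowski[OF K])
  ultimately have "K \<subseteq> convex hull (frontier f)" using hull_mono by metis
  also have "\<dots> \<subseteq> convex hull (P f)" by (rule hull_minimal[OF frontier_hull[OF f iso]]) auto
  finally show ?thesis unfolding K_def using closure_subset[of f] hull_subset[of "closure f" convex] by auto
qed

text \<open>At a right turn the sector of the face is wider than \<open>pi\<close>, so it contains
  the direction opposite to the sum of the two edge vectors.\<close>

lemma right_turn_points:
  assumes aw: "(a,w) \<in> A" and nx: "nx (a,w) = (w,c)" and rt: "Im (cnj (w - a) * (c - w)) < 0"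
  shows "\<exists>r>0. \<forall>\<epsilon>. 0 < \<epsilon> \<longrightarrow> \<epsilon> < r \<longrightarrow> w - of_real \<epsilon> * ((a - w) + (c - w)) \<in> lf (a,w)"
proof -
  have w: "w \<in> N" using A_N2[OF aw] .
  have wc: "(w,c) \<in> A" using nx_A[OF aw] nx by simp
  have cn: "c \<in> nbr w" using wc by (simp add: nbr_def)
  have n: "nbr w \<noteq> {}" using cn by auto
  have cd: "c = cwn w (a - w)" using nx by (simp add: nx_def)
  have z0: "a - w \<noteq> 0" and cw: "c - w \<noteq> 0" using A_ne[OF aw] A_ne[OF wc] by auto
  define \<theta> where "\<theta> = ang (a - w) (c - w)"
  define \<mu> where "\<mu> = cmod (a - w) / cmod (c - w)"
  have \<theta>: "0 < \<theta>" "\<theta> \<le> 2 * pi" using ang_bounds by (auto simp: \<theta>_def)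
  have \<mu>: "0 < \<mu>" using z0 cw by (simp add: \<mu>_def)
  have zz: "a - w = of_real \<mu> * ((c - w) * exp (\<i> * of_real \<theta>))"
    unfolding \<mu>_def \<theta>_def by (rule ang_polar[OF z0 cw])
  have fr: "\<forall>t\<in>{0<..<\<theta>}. free w ((c - w) * exp (\<i> * of_real t))"
    using sector_free[OF n z0 cd, of _ 1] by (auto simp: \<theta>_def)
  have q: "(a - w) / (c - w) = of_real \<mu> * cis \<theta>" using zz cw by (simp add: cis_conv_exp)
  have sin: "sin \<theta> < 0"
  proof -
    have "cnj (w - a) * (c - w) = - (cnj ((a - w) / (c - w)) * of_real ((cmod (c - w))\<^sup>2))"
      using cw by (simp add: complex_norm_square field_simps del: of_real_power)
    also have "\<dots> = - (of_real (\<mu> * (cmod (c - w))\<^sup>2) * cnj (cis \<theta>))" unfolding q by simp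
    finally have eq: "Im (cnj (w - a) * (c - w)) = \<mu> * (cmod (c - w))\<^sup>2 * sin \<theta>" by simp
    have "0 < \<mu> * (cmod (c - w))\<^sup>2" using \<mu> cw by simp
    moreover have "\<mu> * (cmod (c - w))\<^sup>2 * sin \<theta> < 0" using rt by (simp only: eq)
    ultimately show ?thesis by (metis mult_less_0_iff order_less_asym)
  qed
  have \<theta>pi: "pi < \<theta>"
  proof (rule ccontr)
    assume "\<not> pi < \<theta>"
    then have "0 \<le> sin \<theta>" using \<theta> by (intro sin_ge_zero) auto
    then show False using sin by simp
  qed
  define v where "v = - ((a - w) + (c - w))"
  have vq: "v / (c - w) = - (1 + of_real \<mu> * cis \<theta>)" using q cw by (simp add: v_def field_simps)
  have imv: "0 < Im (v / (c - w))" unfolding vq using sin \<mu> by (simp add: mult_pos_neg)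
  then have v0: "v \<noteq> 0" by auto
  define t where "t = ang v (c - w)"
  define \<nu> where "\<nu> = cmod v / cmod (c - w)"
  have \<nu>: "0 < \<nu>" using v0 cw by (simp add: \<nu>_def)
  have vv: "v = of_real \<nu> * ((c - w) * exp (\<i> * of_real t))" unfolding \<nu>_def t_def by (rule ang_polar[OF v0 cw])
  then have "v / (c - w) = of_real \<nu> * cis t" using cw by (simp add: cis_conv_exp)
  then have "0 < \<nu> * sin t" using imv by simp
  then have st: "0 < sin t" using \<nu> by (simp add: zero_less_mult_iff)
  have t: "0 < t" "t < pi"
  proof -
    have tb: "0 < t" "t \<le> 2 * pi" using ang_bounds by (auto simp: t_def)
    show "0 < t" by (rule tb)
    show "t < pi"
    proof (rule ccontr)
      assume "\<not> t < pi"
      then have "sin t \<le> 0" using tb sin_le_zero[of t] sin_two_pi by (cases "t = 2 * pi") auto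
      then show False using st by simp
    qed
  qed
  obtain r where r: "r > 0"
    "\<And>c J \<theta> \<rho> t. c \<in> nbr w \<Longrightarrow> convex J \<Longrightarrow> J \<subseteq> {0<..} \<Longrightarrow> 0 < \<theta> \<Longrightarrow> {0<..<\<theta>} \<subseteq> J \<Longrightarrow>
    (\<forall>t\<in>J. free w ((c - w) * exp (\<i> * of_real t))) \<Longrightarrow> 0 < \<rho> \<Longrightarrow> \<rho> * cmod (c - w) < r \<Longrightarrow> t \<in> J \<Longrightarrow>
    w + of_real \<rho> * ((c - w) * exp (\<i> * of_real t)) \<in> lf (w,c)"
    using sector_face[OF w] by metis
  have lfe: "lf (w,c) = lf (a,w)" using lf_nx[OF aw] nx by simp
  show ?thesis
  proof (intro exI[of _ "r / cmod v"] conjI allI impI)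
    show "0 < r / cmod v" using r(1) v0 by simp
    fix \<epsilon> assume \<epsilon>: "0 < \<epsilon>" "\<epsilon> < r / cmod v"
    have "w + of_real (\<epsilon> * \<nu>) * ((c - w) * exp (\<i> * of_real t)) \<in> lf (w,c)"
    proof (rule r(2)[OF cn _ _ \<theta>(1) _ fr])
      have "\<epsilon> * cmod v < r" using \<epsilon> v0 by (simp add: field_simps)
      then show "\<epsilon> * \<nu> * cmod (c - w) < r" using cw by (simp add: \<nu>_def)
    qed (use \<epsilon> \<nu> \<theta> t \<theta>pi in auto)
    moreover have "of_real (\<epsilon> * \<nu>) * ((c - w) * exp (\<i> * of_real t)) = of_real \<epsilon> * v"
      by (simp only: of_real_mult mult.assoc vv[symmetric])
    ultimately have "w + of_real \<epsilon> * v \<in> lf (w,c)" by (simp only:)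
    then show "w - of_real \<epsilon> * ((a - w) + (c - w)) \<in> lf (a,w)"
      by (simp only: v_def mult_minus_right lfe diff_conv_add_uminus)
  qed
qed

text \<open>At a straight passage \<open>w\<close> lies between its two neighbours. At a right turn
  it lies between a point of the face behind it and the midpoint of the neighbours. All of these are
  in the hull, so \<open>w\<close> would not be extreme.\<close>

lemma extreme_left_turn:
  assumes iso: "\<And>w. w \<in> N \<Longrightarrow> nbr w \<noteq> {}" and aw: "(a,w) \<in> A" and nx: "nx (a,w) = (w,c)" "c \<noteq> a"
    and b: "bounded (lf (a,w))" and ext: "w extreme_point_of (convex hull (P (lf (a,w))))"
  shows "0 < Im (cnj (w - a) * (c - w))"
proof (rule ccontr)
  assume neg: "\<not> 0 < Im (cnj (w - a) * (c - w))"
  let ?H = "convex hull (P (lf (a,w)))"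
  have wc: "(w,c) \<in> A" using nx_A[OF aw] nx by simp
  have ne: "a \<noteq> w" "w \<noteq> c" using A_ne[OF aw] A_ne[OF wc] by auto
  have aH: "a \<in> ?H" using P_fst[OF aw] by (simp add: hull_inc)
  have cH: "c \<in> ?H" using P_snd[OF wc] lf_nx[OF aw] nx by (simp add: hull_inc)
  have noseg: "\<not> w \<in> open_segment x y" if "x \<in> ?H" "y \<in> ?H" for x y
    using ext that unfolding extreme_point_of_def by blast
  show False
  proof (cases "Im (cnj (w - a) * (c - w)) = 0")
    case True
    define k where "k = Re (cnj (w - a) * (c - w)) / (cmod (w - a))\<^sup>2"
    have "cnj (w - a) * (c - w) = of_real (k * (cmod (w - a))\<^sup>2)"
      using True ne by (simp add: k_def complex_eq_iff)
    then have "cnj (w - a) * (c - w) = cnj (w - a) * (of_real k * (w - a))"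
      by (simp add: complex_norm_square mult_ac del: of_real_power)
    then have ck: "c - w = of_real k * (w - a)" using ne by simp
    then have "k \<noteq> 0" using ne by auto
    show False
    proof (cases "0 < k")
      case True
      define m where "m = 1 / (1 + k)"
      have m: "0 < m" "m < 1" "m * (1 + k) = 1" using True by (auto simp: m_def)
      have "w = (1 - m) *\<^sub>R a + m *\<^sub>R c"
      proof -
        have "c = w + of_real k * (w - a)" using ck by (simp add: algebra_simps)
        then have "(1 - m) *\<^sub>R a + m *\<^sub>R c = a + of_real (m * (1 + k)) * (w - a)"
          by (subst \<open>c = _\<close>) (simp add: scaleR_conv_of_real algebra_simps)
        then show ?thesis using m(3) by simp
      qed
      then have "w \<in> open_segment a c" using m(1,2) nx(2) unfolding in_segment by auto
      then show False using noseg[OF aH cH] by simp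
    next
      case False
      then have "0 < - k" using \<open>k \<noteq> 0\<close> by simp
      moreover have "c - w = of_real (- k) * (a - w)" using ck by (simp add: algebra_simps)
      ultimately show False using nbr_unique[OF A_sym[OF aw] wc] nx(2) by blast
    qed
  next
    case False
    then have rt: "Im (cnj (w - a) * (c - w)) < 0" using neg by simp
    obtain r where r: "r > 0" "\<And>\<epsilon>. 0 < \<epsilon> \<Longrightarrow> \<epsilon> < r \<Longrightarrow> w - of_real \<epsilon> * ((a - w) + (c - w)) \<in> lf (a,w)"
      using right_turn_points[OF aw nx(1) rt] by blast
    define x where "x = w - of_real (r/2) * ((a - w) + (c - w))"
    have "x \<in> lf (a,w)" unfolding x_def by (rule r(2)) (use r(1) in simp_all)
    then have xH: "x \<in> ?H" using bounded_face_hull[OF lf_props(1)[OF aw] iso b] by blast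
    define y where "y = (1/2) *\<^sub>R a + (1/2) *\<^sub>R c"
    have yH: "y \<in> ?H" unfolding y_def using convexD[OF convex_convex_hull aH cH, of "1/2" "1/2"] by simp
    have yw: "y - w = of_real (1/2) * ((a - w) + (c - w))" by (simp add: y_def scaleR_conv_of_real algebra_simps)
    have xw: "x - w = of_real (- r) * (y - w)"
    proof -
      define Y where "Y = (a - w) + (c - w)"
      have "x = w - of_real (r/2) * Y" "y - w = of_real (1/2) * Y" using yw unfolding x_def Y_def by simp_all
      then show ?thesis by simp
    qed
    have "y \<noteq> w"
    proof
      assume "y = w"
      then have "c - w = w - a" using yw by (simp add: algebra_simps)
      moreover have "Im (cnj (w - a) * (w - a)) = 0" by (simp add: algebra_simps)
      ultimately show False using rt by (simp only: less_irrefl)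
    qed
    \<comment> \<open>As \<open>x - w\<close> is \<open>- r\<close> times \<open>y - w\<close>,
      these weights combine \<open>x\<close> and \<open>y\<close> to \<open>w\<close>.\<close>
    define m where "m = r / (1 + r)"
    have m: "0 < m" "m < 1" "(1 - m) * r = m" using r(1) by (auto simp: m_def field_simps)
    have "(1 - m) *\<^sub>R x + m *\<^sub>R y = w + of_real (m - (1 - m) * r) * (y - w)"
    proof -
      have xe: "x = w + of_real (- r) * (y - w)" using xw by (simp add: algebra_simps)
      show ?thesis by (subst xe) (simp add: scaleR_conv_of_real algebra_simps)
    qed
    then have "w = (1 - m) *\<^sub>R x + m *\<^sub>R y" using m(3) by simp
    moreover have "x \<noteq> y"
    proof
      assume "x = y"
      then have "y - w = of_real (- r) * (y - w)" using xw by simp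
      then have "of_real (1 + r) * (y - w) = 0" by (simp add: algebra_simps)
      then show False using r(1) \<open>y \<noteq> w\<close> by (simp del: of_real_add)
    qed
    ultimately have "w \<in> open_segment x y" using m(1,2) unfolding in_segment by blast
    then show False using noseg[OF xH yH] by simp
  qed
qed

lemma S_hull: "S \<subseteq> convex hull N"
proof -
  have "closed_segment a b \<subseteq> convex hull N" if "(a,b) \<in> A" for a b
    by (intro closed_segment_subset convex_convex_hull hull_inc A_N[OF that] A_N2[OF that])
  then have "closed_segment (fst d) (snd d) \<subseteq> convex hull N" if "d \<in> A" for d using that by simp
  then show ?thesis unfolding S_def by (intro Un_least UN_least hull_subset)
qed

text \<open>Prolonging an edge at an extreme point beyond that point leaves the hull of the nodes
  immediately. The outside of the hull is connected and belongs to the unbounded face.\<close>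

lemma outer_face_ext:
  assumes f: "f \<in> components (- S)" "\<not> bounded f" and w: "w extreme_point_of (convex hull N)" "nbr w \<noteq> {}"
  shows "\<exists>c. (w,c) \<in> A \<and> lf (w,c) = f"
proof -
  let ?H = "convex hull N"
  have cH: "compact ?H" using finN by (simp add: compact_convex_hull finite_imp_compact)
  have con: "connected (- ?H)" using connected_complement_bounded_convex[of ?H] cH compact_imp_bounded by auto
  have f0: "- ?H \<subseteq> f"
  proof (rule components_maximal[OF f(1) con])
    show "- ?H \<subseteq> - S" using S_hull by auto
    have "\<not> f \<subseteq> ?H" using f(2) cH bounded_subset compact_imp_bounded by blast
    then show "f \<inter> - ?H \<noteq> {}" by auto
  qed
  have wN: "w \<in> N" using w(1) extreme_point_of_convex_hull by blast
  obtain r where r: "r > 0" "\<And>y. dist y w < r \<Longrightarrow> y \<notin> S \<Longrightarrow> y \<in> lf (w, cwn w (y - w))"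
    using free_face[OF wN w(2)] by blast
  obtain c0 where c0: "c0 \<in> nbr w" using w(2) by auto
  then have c0': "c0 \<noteq> w" "c0 \<in> ?H" using A_ne A_N2 by (auto simp: nbr_def hull_inc)
  define e where "e = r / (2 * cmod (w - c0))"
  have e: "0 < e" using r(1) c0' by (simp add: e_def)
  define y where "y = w + of_real e * (w - c0)"
  have yH: "y \<notin> ?H"
  proof
    assume yH: "y \<in> ?H"
    define m where "m = 1 / (1 + e)"
    have m: "0 < m" "m < 1" "m * (1 + e) = 1" using e by (auto simp: m_def)
    have "(1 - m) *\<^sub>R c0 + m *\<^sub>R y = c0 + of_real (m * (1 + e)) * (w - c0)"
      by (simp add: y_def scaleR_conv_of_real algebra_simps)
    then have "w = (1 - m) *\<^sub>R c0 + m *\<^sub>R y" using m(3) by simp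
    moreover have "c0 \<noteq> y"
    proof
      assume "c0 = y"
      then have "of_real (1 + e) * (w - c0) = 0" by (simp add: y_def algebra_simps)
      then show False using e c0' by (simp del: of_real_add)
    qed
    ultimately have "w \<in> open_segment c0 y" using m unfolding in_segment by blast
    then show False using w(1) c0'(2) yH unfolding extreme_point_of_def by blast
  qed
  have "dist y w = e * cmod (w - c0)" using e by (simp add: y_def dist_norm norm_mult)
  also have "\<dots> < r" using r(1) c0' by (simp add: e_def)
  finally have "y \<in> lf (w, cwn w (y - w))" using r(2) yH S_hull by blast
  moreover have "y \<in> f" using f0 yH by auto
  moreover have A: "(w, cwn w (y - w)) \<in> A" using cwn_props(1)[OF w(2)] by (simp add: nbr_def)
  ultimately show ?thesis using comp_eqI[OF lf_props(1)[OF A] f(1)] A by blast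
qed

lemma outer_hull:
  assumes iso: "\<And>w. w \<in> N \<Longrightarrow> nbr w \<noteq> {}" and f: "f \<in> components (- S)" "\<not> bounded f"
  shows "N \<subseteq> convex hull {w \<in> P f. w extreme_point_of (convex hull N)}"
proof -
  have "{w. w extreme_point_of (convex hull N)} \<subseteq> {w \<in> P f. w extreme_point_of (convex hull N)}"
  proof
    fix w assume "w \<in> {w. w extreme_point_of (convex hull N)}"
    then have w: "w extreme_point_of (convex hull N)" by simp
    then have "w \<in> N" using extreme_point_of_convex_hull by blast
    then show "w \<in> {w \<in> P f. w extreme_point_of (convex hull N)}"
      using outer_face_ext[OF f w] iso w P_fst by fastforce
  qed
  moreover have "convex hull N = convex hull {w. w extreme_point_of (convex hull N)}"
    by (rule Krein_Milman_polytope[OF finN])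
  ultimately show ?thesis using hull_subset[of N convex] hull_mono by (metis (no_types, lifting) order_trans)
qed

text \<open>A path component is a union of finitely many nodes and whole edges.\<close>

lemma path_component_closed:
  assumes x: "x \<in> S" shows "closed (path_component_set S x)"
proof -
  let ?K = "path_component_set S x"
  have seg: "closed_segment a b \<subseteq> ?K" if "(a,b) \<in> A" "z \<in> closed_segment a b" "z \<in> ?K" for a b z
  proof
    fix y assume y: "y \<in> closed_segment a b"
    have "path_connected (closed_segment a b)" "closed_segment a b \<subseteq> S" using seg_S[OF that(1)] by auto
    then have "path_component S z y"
      using that(2) y unfolding path_connected_component by (metis path_component_antimono)
    moreover have "path_component S x z" using that(3) by simp
    ultimately have "path_component S x y" by (metis path_component_trans)
    then show "y \<in> ?K" by simp
  qed
  have "?K = (N \<inter> ?K) \<union> (\<Union>d\<in>{d\<in>A. fst d \<in> ?K}. closed_segment (fst d) (snd d))" (is "_ = ?R")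
  proof
    show "?K \<subseteq> ?R"
    proof
      fix z assume z: "z \<in> ?K"
      then have "z \<in> S" using path_component_mem(2) by auto
      then show "z \<in> ?R"
      proof (cases rule: S_cases)
        case (2 a b)
        then have zc: "z \<in> closed_segment a b" by (simp add: open_closed_segment)
        then have "a \<in> ?K" using seg[OF 2(1) zc z] by auto
        then show ?thesis using 2(1) zc by force
      qed (use z in auto)
    qed
    show "?R \<subseteq> ?K" using seg[OF _ ends_in_segment(1)] by fastforce
  qed
  moreover have "closed ?R"
    by (intro closed_Un finite_imp_closed closed_UN) (use finN finA in auto)
  ultimately show ?thesis by metis
qed

lemma bad_faces_bound:
  assumes "A \<noteq> {}" "B \<subseteq> components (- S)"
    and "\<And>f. f \<in> B \<Longrightarrow> \<exists>a\<in>frontier f. \<exists>b\<in>frontier f. \<not> path_component S a b"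
  shows "card B + 1 \<le> npc S"
proof -
  obtain a b where "(a,b) \<in> A" using assms(1) by auto
  then have "a \<in> S" using A_N N_S by simp
  then have S: "S \<noteq> {}" by auto
  have "B \<subseteq> lf ` A" using comps_eq[OF assms(1)] assms(2) by simp
  then have fin: "finite B" using finA by (simp add: finite_subset)
  show ?thesis
    by (rule bad_faces[OF compact_S S euler_faces(1)[OF assms(1)] path_component_closed fin assms(2,3)])
qed

end

section \<open>One-bend right-angle-crossing drawings\<close>

lemma open_segment_param:
  fixes P D :: complex assumes "D \<noteq> 0" "s < t"
  shows "z \<in> open_segment (P + of_real s * D) (P + of_real t * D) \<longleftrightarrow> (\<exists>r. s < r \<and> r < t \<and> z = P + of_real r * D)"
proof -
  have ne: "P + of_real s * D \<noteq> P + of_real t * D" using assms by simp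
  have eq: "(1 - u) *\<^sub>R (P + of_real s * D) + u *\<^sub>R (P + of_real t * D) = P + of_real (s + u * (t - s)) * D" for u
    by (simp add: scaleR_conv_of_real algebra_simps)
  show ?thesis
  proof
    assume "z \<in> open_segment (P + of_real s * D) (P + of_real t * D)"
    then obtain u where u: "0 < u" "u < 1" "z = P + of_real (s + u * (t - s)) * D" unfolding in_segment eq by auto
    have "0 < u * (t - s)" "u * (t - s) < 1 * (t - s)" using u assms by (auto intro: mult_strict_right_mono)
    then show "\<exists>r. s < r \<and> r < t \<and> z = P + of_real r * D" using u(3) by (intro exI[of _ "s + u * (t - s)"]) auto
  next
    assume "\<exists>r. s < r \<and> r < t \<and> z = P + of_real r * D"
    then obtain r where r: "s < r" "r < t" "z = P + of_real r * D" by auto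
    define u where "u = (r - s) / (t - s)"
    have u: "0 < u" "u < 1" "s + u * (t - s) = r" using r assms by (auto simp: u_def field_simps)
    show "z \<in> open_segment (P + of_real s * D) (P + of_real t * D)"
      unfolding in_segment eq using ne u r(3) by blast
  qed
qed

lemma closed_segment_param:
  fixes P Q :: complex
  shows "z \<in> closed_segment P Q \<longleftrightarrow> (\<exists>r. 0 \<le> r \<and> r \<le> 1 \<and> z = P + of_real r * (Q - P))"
  unfolding in_segment by (simp add: scaleR_conv_of_real algebra_simps)

lemma inner_zero_perp:
  fixes y z :: complex assumes "z \<noteq> 0" "z \<bullet> y = 0"
  shows "\<exists>t. y = of_real t * (\<i> * z)"
proof -
  have z2: "(Re z)\<^sup>2 + (Im z)\<^sup>2 \<noteq> 0" using assms(1) by (simp add: complex_eq_iff sum_power2_eq_zero_iff)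
  define t where "t = (Re z * Im y - Im z * Re y) / ((Re z)\<^sup>2 + (Im z)\<^sup>2)"
  have i: "Re z * Re y + Im z * Im y = 0" using assms(2) by (simp add: inner_complex_def)
  have "Re y * ((Re z)\<^sup>2 + (Im z)\<^sup>2) = - (Re z * Im y - Im z * Re y) * Im z"
    using i by (simp add: power2_eq_square algebra_simps) algebra
  moreover have "Im y * ((Re z)\<^sup>2 + (Im z)\<^sup>2) = (Re z * Im y - Im z * Re y) * Re z"
    using i by (simp add: power2_eq_square algebra_simps) algebra
  ultimately have "Re y = - (t * Im z)" "Im y = t * Re z" using z2 unfolding t_def by (simp_all add: field_simps)
  then show ?thesis by (intro exI[of _ t]) (simp add: complex_eq_iff)
qed

lemma (in plane_graph) nbr_unique_dir:
  assumes "(w,c) \<in> A" "(w,c') \<in> A" "c - w = of_real s * z" "c' - w = of_real s' * z" "0 < s" "0 < s'"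
  shows "c = c'"
proof (rule nbr_unique[OF assms(1,2)])
  show "c' - w = of_real (s' / s) * (c - w)" using assms by simp
qed (use assms in simp)

text \<open>The conditions \<open>bend_V\<close> and \<open>bend_free\<close> put the bends into
  general position. Every edge then has a bend of its own, even if it is straight, and consists of
  exactly two nondegenerate halves.\<close>

locale drawing =
  fixes V :: "'a set" and E :: "'a set set" and p :: "'a \<Rightarrow> complex" and b :: "'a set \<Rightarrow> complex"
  assumes finV: "finite V"
    and E_pair: "e \<in> E \<Longrightarrow> \<exists>u v. u \<in> V \<and> v \<in> V \<and> u \<noteq> v \<and> e = {u,v}"
    and p_inj: "inj_on p V"
    and bend_seg: "e \<in> E \<Longrightarrow> u \<in> e \<Longrightarrow> v \<in> e \<Longrightarrow> u \<noteq> v \<Longrightarrow>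
      closed_segment (p u) (b e) \<inter> closed_segment (b e) (p v) = {b e}"
    and far: "e \<in> E \<Longrightarrow> w \<in> V - e \<Longrightarrow> u \<in> e \<Longrightarrow> p w \<notin> closed_segment (p u) (b e)"
    and perp: "e \<in> E \<Longrightarrow> f \<in> E \<Longrightarrow> e \<noteq> f \<Longrightarrow> u \<in> e \<Longrightarrow> v \<in> f \<Longrightarrow> x \<in> closed_segment (p u) (b e) \<Longrightarrow>
      x \<in> closed_segment (p v) (b f) \<Longrightarrow> x \<notin> p ` V \<Longrightarrow> (p u - b e) \<bullet> (p v - b f) = 0"
    and bend_V: "e \<in> E \<Longrightarrow> b e \<notin> p ` V"
    and bend_free: "e \<in> E \<Longrightarrow> f \<in> E \<Longrightarrow> e \<noteq> f \<Longrightarrow> v \<in> f \<Longrightarrow> b e \<notin> closed_segment (p v) (b f)"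
begin

text \<open>An edge consists of two half edges, from its ends to its bend; the nodes are the vertices, bends and crossings.\<close>

definition hs :: "'a set \<Rightarrow> 'a \<Rightarrow> complex set" where
  "hs e u = closed_segment (p u) (b e)"

definition X :: "complex set" where
  "X = {x. x \<notin> p ` V \<and> (\<exists>e\<in>E. \<exists>f\<in>E. e \<noteq> f \<and> (\<exists>u\<in>e. x \<in> hs e u) \<and> (\<exists>v\<in>f. x \<in> hs f v))}"

definition N :: "complex set" where "N = p ` V \<union> b ` E \<union> X"

definition A :: "(complex \<times> complex) set" where
  "A = {(a,c). a \<noteq> c \<and> a \<in> N \<and> c \<in> N \<and> open_segment a c \<inter> N = {} \<and> (\<exists>e\<in>E. \<exists>u\<in>e. a \<in> hs e u \<and> c \<in> hs e u)}"

lemma E_V: "e \<in> E \<Longrightarrow> u \<in> e \<Longrightarrow> u \<in> V" using E_pair[of e] by auto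

lemma finE: "finite E"
proof (rule finite_subset)
  show "E \<subseteq> Pow V" using E_V by auto
qed (simp add: finV)

lemma E_other: assumes "e \<in> E" "u \<in> e" shows "\<exists>v. v \<noteq> u \<and> e = {u,v}"
proof -
  obtain x y where xy: "x \<noteq> y" "e = {x,y}" using E_pair[OF assms(1)] by auto
  show ?thesis
  proof (cases "u = x")
    case True then show ?thesis using xy by (intro exI[of _ y]) auto
  next
    case False then show ?thesis using xy assms(2) by (intro exI[of _ x]) auto
  qed
qed

lemma card_edge: "e \<in> E \<Longrightarrow> card e = 2" using E_pair[of e] by auto

lemma finite_edge: "e \<in> E \<Longrightarrow> finite e" using E_pair[of e] by auto

lemma pu_ne_b: "e \<in> E \<Longrightarrow> u \<in> e \<Longrightarrow> p u \<noteq> b e"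
  using bend_V[of e] imageI[OF E_V[of e u], of p] by auto

lemma p_hs [simp]: "p u \<in> hs e u" and b_hs [simp]: "b e \<in> hs e u" by (simp_all add: hs_def)

lemma hs_other: "e \<in> E \<Longrightarrow> u \<in> e \<Longrightarrow> v \<in> e \<Longrightarrow> z \<in> hs e u \<Longrightarrow> z \<in> hs e v \<Longrightarrow> z \<noteq> b e \<Longrightarrow> u = v"
  using bend_seg[of e u v] by (auto simp: hs_def closed_segment_commute)

lemma p_in_hs: "e \<in> E \<Longrightarrow> u \<in> e \<Longrightarrow> w \<in> V \<Longrightarrow> p w \<in> hs e u \<Longrightarrow> w = u"
proof (rule ccontr)
  assume a: "e \<in> E" "u \<in> e" "w \<in> V" "p w \<in> hs e u" "w \<noteq> u"
  show False
  proof (cases "w \<in> e")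
    case True
    have "p w \<noteq> b e" using bend_V[OF a(1)] a(3) by (metis imageI)
    then show False using hs_other[OF a(1) True a(2) p_hs a(4)] a(5) by simp
  next
    case False
    then show False using far[of e w u] a by (auto simp: hs_def)
  qed
qed

lemma b_in_hs: "e \<in> E \<Longrightarrow> f \<in> E \<Longrightarrow> u \<in> f \<Longrightarrow> b e \<in> hs f u \<Longrightarrow> e = f"
  using bend_free by (auto simp: hs_def)

lemma b_inj: "inj_on b E"
proof (rule inj_onI)
  fix e f assume ef: "e \<in> E" "f \<in> E" "b e = b f"
  obtain u v where "f = {u,v}" using E_pair[OF ef(2)] by auto
  then show "e = f" using b_in_hs[OF ef(1,2), of u] ef(3) by simp
qed

lemma hs_N: "e \<in> E \<Longrightarrow> u \<in> e \<Longrightarrow> f \<in> E \<Longrightarrow> v \<in> f \<Longrightarrow> z \<in> hs e u \<Longrightarrow> z \<in> hs f v \<Longrightarrow> z \<notin> N \<Longrightarrow> e = f \<and> u = v"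
proof -
  assume a: "e \<in> E" "u \<in> e" "f \<in> E" "v \<in> f" "z \<in> hs e u" "z \<in> hs f v" "z \<notin> N"
  have z: "z \<notin> p ` V" "z \<notin> X" "z \<notin> b ` E" using a(7) by (auto simp: N_def)
  have ef: "e = f"
  proof (rule ccontr)
    assume "e \<noteq> f"
    then have "z \<in> X" using a(1-6) z(1) unfolding X_def by auto
    then show False using z(2) by simp
  qed
  moreover have "z \<noteq> b e" using z(3) a(1) by auto
  ultimately show "e = f \<and> u = v" using hs_other[OF a(1,2), of v z] a by simp
qed

lemma X_disj: "X \<inter> p ` V = {}" "X \<inter> b ` E = {}" "p ` V \<inter> b ` E = {}"
proof -
  show "X \<inter> p ` V = {}" by (auto simp: X_def)
  show "p ` V \<inter> b ` E = {}" 
  proof (rule ccontr)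
    assume "p ` V \<inter> b ` E \<noteq> {}"
    then obtain z where z: "z \<in> p ` V" "z \<in> b ` E" by auto
    then obtain e where "e \<in> E" "z = b e" by auto
    then show False using bend_V[of e] z(1) by simp
  qed
  have False if eE: "e \<in> E" and bX: "b e \<in> X" for e
  proof -
    obtain g h u v where "g \<in> E" "h \<in> E" "g \<noteq> h" "u \<in> g" "b e \<in> hs g u" "v \<in> h" "b e \<in> hs h v"
      using bX unfolding X_def by blast
    then show False using b_in_hs[OF eE, of g u] b_in_hs[OF eE, of h v] by simp
  qed
  then show "X \<inter> b ` E = {}" by auto
qed

lemma hs_perp: "e \<in> E \<Longrightarrow> f \<in> E \<Longrightarrow> e \<noteq> f \<Longrightarrow> u \<in> e \<Longrightarrow> v \<in> f \<Longrightarrow> x \<in> hs e u \<Longrightarrow> x \<in> hs f v \<Longrightarrow> x \<notin> p ` V \<Longrightarrow>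
   \<exists>t. t \<noteq> 0 \<and> b f - p v = of_real t * (\<i> * (b e - p u))"
proof -
  assume a: "e \<in> E" "f \<in> E" "e \<noteq> f" "u \<in> e" "v \<in> f" "x \<in> hs e u" "x \<in> hs f v" "x \<notin> p ` V"
  have "(b e - p u) \<bullet> (b f - p v) = 0"
    using perp[OF a(1-5), of x] a by (simp add: hs_def inner_diff_left inner_diff_right)
  then obtain t where t: "b f - p v = of_real t * (\<i> * (b e - p u))"
    using inner_zero_perp[of "b e - p u" "b f - p v"] pu_ne_b[OF a(1,4)] by auto
  moreover have "t \<noteq> 0" using t pu_ne_b[OF a(2,5)] by auto
  ultimately show ?thesis by blast
qed

lemma X_edges:
  assumes "x \<in> X"
  obtains e u f v where "e \<in> E" "u \<in> e" "f \<in> E" "v \<in> f" "e \<noteq> f" "x \<in> hs e u" "x \<in> hs f v"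
    "x \<noteq> p u" "x \<noteq> b e" "x \<noteq> p v" "x \<noteq> b f"
    "\<And>g w. g \<in> E \<Longrightarrow> w \<in> g \<Longrightarrow> x \<in> hs g w \<Longrightarrow> g = e \<and> w = u \<or> g = f \<and> w = v"
proof -
  obtain e f u v where a: "e \<in> E" "f \<in> E" "e \<noteq> f" "u \<in> e" "x \<in> hs e u" "v \<in> f" "x \<in> hs f v" "x \<notin> p ` V"
    using assms unfolding X_def by blast
  have "x \<noteq> p w" if "w \<in> g" "g \<in> E" for w g using a(8) E_V[OF that(2,1)] by auto
  moreover have "x \<noteq> b g" if "g \<in> E" for g using X_disj(2) assms that by auto
  ultimately have n: "x \<noteq> p u" "x \<noteq> b e" "x \<noteq> p v" "x \<noteq> b f" using a by auto
  have "g = e \<and> w = u \<or> g = f \<and> w = v" if g: "g \<in> E" "w \<in> g" "x \<in> hs g w" for g w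
  proof -
    have "g = e \<or> g = f"
    proof (rule ccontr)
      assume no: "\<not> (g = e \<or> g = f)"
      obtain t where t: "t \<noteq> 0" "b f - p v = of_real t * (\<i> * (b e - p u))" using hs_perp[OF a(1,2,3,4,6,5,7,8)] by blast
      obtain t' where t': "t' \<noteq> 0" "b g - p w = of_real t' * (\<i> * (b e - p u))"
        using hs_perp[OF a(1) g(1) _ a(4) g(2) a(5) g(3) a(8)] no by blast
      obtain t'' where t'': "t'' \<noteq> 0" "b g - p w = of_real t'' * (\<i> * (b f - p v))"
        using hs_perp[OF a(2) g(1) _ a(6) g(2) a(7) g(3) a(8)] no by blast
      have "of_real t' * (\<i> * (b e - p u)) = of_real t'' * (\<i> * (of_real t * (\<i> * (b e - p u))))"
        by (metis t'(2) t''(2) t(2))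
      then have "(of_real t' * \<i> - of_real t'' * (\<i> * (of_real t * \<i>))) * (b e - p u) = 0"
        by (simp only: left_diff_distrib mult.assoc right_minus_eq)
      then have "of_real t' * \<i> = of_real t'' * (\<i> * (of_real t * \<i>))"
        using pu_ne_b[OF a(1,4)] by (metis mult_eq_0_iff right_minus_eq)
      then have "Im (of_real t' * \<i>) = Im (of_real t'' * (\<i> * (of_real t * \<i>)))" by (rule arg_cong)
      then show False using t'(1) by simp
    qed
    then show ?thesis using hs_other[of e w u x] hs_other[of f w v x] g a n by auto
  qed
  then show thesis by (rule that[OF a(1,4,2,6,3,5,7) n])
qed

text \<open>Two perpendicular segments have at most one common point.\<close>

lemma finX: "finite X"
proof -
  define Q where "Q e u f v = {x. x \<in> hs e u \<and> x \<in> hs f v \<and> x \<notin> p ` V}" for e u f v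
  have fQ: "finite (Q e u f v)" if a: "e \<in> E" "f \<in> E" "e \<noteq> f" "u \<in> e" "v \<in> f" for e u f v
  proof -
    have "x = y" if x: "x \<in> Q e u f v" and y: "y \<in> Q e u f v" for x y
    proof -
      obtain t where t: "t \<noteq> 0" "b f - p v = of_real t * (\<i> * (b e - p u))"
        using hs_perp[OF a, of x] x unfolding Q_def by blast
      obtain r1 r2 s1 s2 where r: "x = p u + of_real r1 * (b e - p u)" "y = p u + of_real r2 * (b e - p u)"
        "x = p v + of_real s1 * (b f - p v)" "y = p v + of_real s2 * (b f - p v)"
        using x y unfolding Q_def hs_def closed_segment_param by blast
      have "x - y = of_real (r1 - r2) * (b e - p u)" unfolding r(1) r(2) by (simp add: algebra_simps)
      moreover have "x - y = of_real (s1 - s2) * (b f - p v)" by (subst r(3), subst r(4)) (simp add: algebra_simps)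
      ultimately have "of_real (r1 - r2) * (b e - p u) = of_real (s1 - s2) * (of_real t * (\<i> * (b e - p u)))" by (metis t(2))
      then have "(of_real (r1 - r2) - of_real (s1 - s2) * (of_real t * \<i>)) * (b e - p u) = 0"
        by (simp only: left_diff_distrib mult.assoc right_minus_eq)
      then have "of_real (r1 - r2) = of_real (s1 - s2) * (of_real t * \<i>)" using pu_ne_b[OF a(1,4)] by simp
      then have "Re (of_real (r1 - r2)) = Re (of_real (s1 - s2) * (of_real t * \<i>))" by (rule arg_cong)
      then show "x = y" using r(1,2) by simp
    qed
    then have "Q e u f v \<subseteq> {SOME x. x \<in> Q e u f v}" using some_in_eq[of "Q e u f v"] by blast
    then show ?thesis using finite_subset by blast
  qed
  have "X \<subseteq> (\<Union>(e,f)\<in>{(e,f). e \<in> E \<and> f \<in> E \<and> e \<noteq> f}. \<Union>u\<in>e. \<Union>v\<in>f. Q e u f v)"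
    unfolding X_def Q_def by fastforce
  moreover have "finite (\<Union>(e,f)\<in>{(e,f). e \<in> E \<and> f \<in> E \<and> e \<noteq> f}. \<Union>u\<in>e. \<Union>v\<in>f. Q e u f v)"
  proof (rule finite_UN_I)
    show "finite {(e,f). e \<in> E \<and> f \<in> E \<and> e \<noteq> f}" by (rule finite_subset[of _ "E \<times> E"]) (auto simp: finE)
    fix ef assume "ef \<in> {(e,f). e \<in> E \<and> f \<in> E \<and> e \<noteq> f}"
    then show "finite (case ef of (e,f) \<Rightarrow> \<Union>u\<in>e. \<Union>v\<in>f. Q e u f v)"
      using fQ finite_edge by (auto split: prod.splits)
  qed
  ultimately show ?thesis using finite_subset by blast
qed

lemma finN: "finite N" by (simp add: N_def finV finE finX)

lemma A_I: "e \<in> E \<Longrightarrow> u \<in> e \<Longrightarrow> a \<in> hs e u \<Longrightarrow> c \<in> hs e u \<Longrightarrow> a \<noteq> c \<Longrightarrow> a \<in> N \<Longrightarrow> c \<in> N \<Longrightarrow> open_segment a c \<inter> N = {} \<Longrightarrow> (a,c) \<in> A"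
  unfolding A_def by blast

lemma A_D: "(a,c) \<in> A \<Longrightarrow> a \<noteq> c \<and> a \<in> N \<and> c \<in> N \<and> open_segment a c \<inter> N = {} \<and> (\<exists>e\<in>E. \<exists>u\<in>e. a \<in> hs e u \<and> c \<in> hs e u)"
  unfolding A_def by blast

lemma open_seg_hs: "a \<in> hs e u \<Longrightarrow> c \<in> hs e u \<Longrightarrow> z \<in> open_segment a c \<Longrightarrow> z \<in> hs e u"
  unfolding hs_def using closed_segment_subset[of a "closed_segment (p u) (b e)" c] open_closed_segment convex_closed_segment by blast

text \<open>An inner point of a dart is no node and so determines the half edge. Two darts with a
  common inner point are compared by parameters along this half edge: if their ends differed, a node
  would lie inside one of them.\<close>

sublocale plane_graph N A
proof
  show "finite N" by (rule finN)
  fix a c assume ac: "(a,c) \<in> A"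
  note D = A_D[OF ac]
  show "(c,a) \<in> A" using ac unfolding A_def by (auto simp: open_segment_commute)
  show "a \<in> N" "a \<noteq> c" "open_segment a c \<inter> N = {}" using D by auto
  fix a' c' assume ac': "(a',c') \<in> A" and ne: "open_segment a c \<inter> open_segment a' c' \<noteq> {}"
  note D' = A_D[OF ac']
  obtain e u where e: "e \<in> E" "u \<in> e" "a \<in> hs e u" "c \<in> hs e u" using D by blast
  obtain f v where f: "f \<in> E" "v \<in> f" "a' \<in> hs f v" "c' \<in> hs f v" using D' by blast
  obtain z where z: "z \<in> open_segment a c" "z \<in> open_segment a' c'" using ne by blast
  have "z \<in> hs e u" "z \<in> hs f v" using open_seg_hs e f z by blast+
  moreover have "z \<notin> N" using z(1) D by auto
  ultimately have ef: "e = f" "u = v" using hs_N e f by blast+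
  define Q where "Q = b e - p u"
  have Q: "Q \<noteq> 0" using pu_ne_b[OF e(1,2)] by (simp add: Q_def)
  define g where "g r = p u + of_real r * Q" for r
  have gi: "g r = g s \<longleftrightarrow> r = s" for r s using Q by (simp add: g_def)
  have os: "z \<in> open_segment (g s) (g t) \<longleftrightarrow> (\<exists>r. s < r \<and> r < t \<and> z = g r)" if "s < t" for s t z
    unfolding g_def by (rule open_segment_param[OF Q that])
  obtain s t s' t' where st: "a = g s" "c = g t" "a' = g s'" "c' = g t'"
    using e f unfolding ef hs_def closed_segment_param g_def Q_def by metis
  have main: "s = s' \<and> t = t'"
    if h: "s < t" "s' < t'" "open_segment (g s) (g t) \<inter> N = {}" "open_segment (g s') (g t') \<inter> N = {}"
      "z \<in> open_segment (g s) (g t)" "z \<in> open_segment (g s') (g t')" "g s \<in> N" "g t \<in> N" "g s' \<in> N" "g t' \<in> N" for s t s' t'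
  proof -
    obtain r where r: "s < r" "r < t" "z = g r" using os[OF h(1)] h(5) by blast
    obtain r' where r': "s' < r'" "r' < t'" "z = g r'" using os[OF h(2)] h(6) by blast
    have rr: "r' = r" using r r' gi by simp
    have "\<not> s < s'" using os[OF h(1), of "g s'"] h(3,9) r r' rr by force
    moreover have "\<not> s' < s" using os[OF h(2), of "g s"] h(4,7) r r' rr by force
    moreover have "\<not> t < t'" using os[OF h(2), of "g t"] h(4,8) r r' rr by force
    moreover have "\<not> t' < t" using os[OF h(1), of "g t'"] h(3,10) r r' rr by force
    ultimately show ?thesis by linarith
  qed
  have nst: "s \<noteq> t" "s' \<noteq> t'" using D D' st by auto
  have fo: "open_segment (g s) (g t) \<inter> N = {}" "open_segment (g t) (g s) \<inter> N = {}"
     "open_segment (g s') (g t') \<inter> N = {}" "open_segment (g t') (g s') \<inter> N = {}"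
     "z \<in> open_segment (g s) (g t)" "z \<in> open_segment (g t) (g s)" "z \<in> open_segment (g s') (g t')" "z \<in> open_segment (g t') (g s')"
     "g s \<in> N" "g t \<in> N" "g s' \<in> N" "g t' \<in> N"
    using D D' st z by (auto simp: open_segment_commute)
  consider "s < t" "s' < t'" | "s < t" "t' < s'" | "t < s" "s' < t'" | "t < s" "t' < s'" using nst by linarith
  then show "(a',c') = (a,c) \<or> (a',c') = (c,a)"
    using main[of s t s' t'] main[of s t t' s'] main[of t s s' t'] main[of t s t' s'] fo st by cases auto
qed

lemma A_owner_unique:
  assumes A: "(a,c) \<in> A" and e: "e \<in> E" "u \<in> e" "a \<in> hs e u" "c \<in> hs e u"
    and f: "f \<in> E" "v \<in> f" "a \<in> hs f v" "c \<in> hs f v"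
  shows "e = f \<and> u = v"
proof -
  have ne: "a \<noteq> c" using A_ne[OF A] .
  then have m: "midpoint a c \<in> open_segment a c" by simp
  then have "midpoint a c \<notin> N" using A_open[OF A] by blast
  then show ?thesis using hs_N[OF e(1,2) f(1,2)] open_seg_hs[OF e(3,4) m] open_seg_hs[OF f(3,4) m] by simp
qed

text \<open>The half edge that contains a dart.\<close>

definition own :: "complex \<times> complex \<Rightarrow> 'a set \<times> 'a" where
  "own d = (THE h. fst h \<in> E \<and> snd h \<in> fst h \<and> fst d \<in> hs (fst h) (snd h) \<and> snd d \<in> hs (fst h) (snd h))"

lemma ownI:
  assumes "(a,c) \<in> A" "e \<in> E" "u \<in> e" "a \<in> hs e u" "c \<in> hs e u"
  shows "own (a,c) = (e,u)"
  unfolding own_def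
proof (rule the_equality)
  show "fst (e,u) \<in> E \<and> snd (e,u) \<in> fst (e,u) \<and> fst (a,c) \<in> hs (fst (e,u)) (snd (e,u)) \<and> snd (a,c) \<in> hs (fst (e,u)) (snd (e,u))"
    using assms by simp
  fix h assume h: "fst h \<in> E \<and> snd h \<in> fst h \<and> fst (a,c) \<in> hs (fst h) (snd h) \<and> snd (a,c) \<in> hs (fst h) (snd h)"
  then have "fst h = e \<and> snd h = u"
    using A_owner_unique[OF assms(1), of "fst h" "snd h" e u] assms by simp
  then show "h = (e,u)" by (cases h) simp
qed

lemma own_cases:
  assumes "(a,c) \<in> A"
  obtains e u where "e \<in> E" "u \<in> e" "a \<in> hs e u" "c \<in> hs e u" "own (a,c) = (e,u)"
proof -
  obtain e u where e: "e \<in> E" "u \<in> e" "a \<in> hs e u" "c \<in> hs e u" using A_D[OF assms] by auto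
  show thesis by (rule that[OF e ownI[OF assms e]])
qed

lemma own_sym: assumes A: "(a,c) \<in> A" shows "own (c,a) = own (a,c)"
  by (rule own_cases[OF A]) (simp add: ownI[OF A_sym[OF A]])

text \<open>The neighbour is the first node on the way from \<open>w\<close> to the end
  \<open>q\<close> of the half edge.\<close>

lemma ray_nbr:
  assumes e: "e \<in> E" "u \<in> e" and w: "w \<in> N" "w \<in> hs e u" and q: "q \<in> {p u, b e}" "q \<noteq> w"
  shows "\<exists>c. (w,c) \<in> A \<and> c \<in> hs e u \<and> (\<exists>s>0. s \<le> 1 \<and> c - w = of_real s * (q - w))"
proof -
  define D where "D = q - w"
  have D: "D \<noteq> 0" using q by (simp add: D_def)
  define g where "g r = w + of_real r * D" for r
  have gi: "inj g" using D by (auto intro!: injI simp: g_def)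
  define M where "M = {r. 0 < r \<and> r \<le> 1 \<and> g r \<in> N}"
  have "finite (g -` N)" using finite_vimageI[OF finN gi] .
  then have fM: "finite M" by (rule finite_subset[rotated]) (auto simp: M_def)
  have qN: "q \<in> N" using q e E_V by (auto simp: N_def)
  then have "1 \<in> M" by (simp add: M_def g_def D_def)
  then have Mne: "M \<noteq> {}" by auto
  define r0 where "r0 = Min M"
  have r0: "r0 \<in> M" unfolding r0_def by (rule Min_in[OF fM Mne])
  then have r0': "0 < r0" "r0 \<le> 1" "g r0 \<in> N" by (auto simp: M_def)
  have qh: "q \<in> hs e u" using q by auto
  have sub: "closed_segment w q \<subseteq> hs e u"
    unfolding hs_def by (rule closed_segment_subset) (use w qh in \<open>auto simp: hs_def\<close>)
  have "g r0 \<in> closed_segment w q" unfolding closed_segment_param g_def D_def using r0' by (intro exI[of _ r0]) simp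
  then have ch: "g r0 \<in> hs e u" using sub by auto
  have ne: "w \<noteq> g r0" using r0' D by (simp add: g_def)
  have "open_segment w (g r0) \<inter> N = {}"
  proof -
    have False if z: "z \<in> open_segment w (g r0)" "z \<in> N" for z
    proof -
      obtain r where r: "0 < r" "r < r0" "z = g r"
        using open_segment_param[OF D r0'(1), of z w] z(1) by (auto simp: g_def)
      then have "r \<in> M" using z(2) r0' by (simp add: M_def)
      then have "r0 \<le> r" unfolding r0_def by (rule Min_le[OF fM])
      then show False using r by simp
    qed
    then show ?thesis by auto
  qed
  then have "(w, g r0) \<in> A" by (rule A_I[OF e w(2) ch ne w(1) r0'(3)])
  moreover have "g r0 - w = of_real r0 * (q - w)" by (simp add: g_def D_def)
  ultimately show ?thesis using ch r0' by blast
qed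

lemma nbr_ray:
  assumes A: "(w,c) \<in> A" and e: "e \<in> E" "u \<in> e" "w \<in> hs e u" "c \<in> hs e u"
  shows "\<exists>q\<in>{p u, b e}. q \<noteq> w \<and> (\<exists>s>0. c - w = of_real s * (q - w))"
proof -
  define Q where "Q = b e - p u"
  obtain r t where rt: "0 \<le> r" "r \<le> 1" "w = p u + of_real r * Q" "0 \<le> t" "t \<le> 1" "c = p u + of_real t * Q"
    using e(3,4) unfolding hs_def closed_segment_param Q_def by blast
  have ne: "r \<noteq> t" using A_ne[OF A] rt by auto
  have cw: "c - w = of_real (t - r) * Q" unfolding rt(3,6) by (simp add: algebra_simps)
  show ?thesis
  proof (cases "r < t")
    case True
    have bw: "b e - w = of_real (1 - r) * Q" unfolding rt(3) Q_def by (simp add: algebra_simps)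
    define s where "s = (t - r) / (1 - r)"
    have s: "s > 0" "s * (1 - r) = t - r" using True rt by (auto simp: s_def)
    have "c - w = of_real s * (b e - w)" unfolding cw bw s(2)[symmetric] by simp
    moreover have "b e \<noteq> w" using calculation A_ne[OF A] by auto
    ultimately show ?thesis using s(1) by blast
  next
    case False
    then have lt: "t < r" using ne by simp
    have pw: "p u - w = of_real (- r) * Q" unfolding rt(3) by (simp add: algebra_simps)
    define s where "s = (r - t) / r"
    have s: "s > 0" "s * (- r) = t - r" using lt rt by (auto simp: s_def)
    have "c - w = of_real s * (p u - w)" unfolding cw pw s(2)[symmetric] by simp
    moreover have "p u \<noteq> w" using calculation A_ne[OF A] by auto
    ultimately show ?thesis using s(1) by blast
  qed
qed

section \<open>Degrees of vertices, bends and crossings\<close>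

lemma p_V_N: "u \<in> V \<Longrightarrow> p u \<in> N" and b_N: "e \<in> E \<Longrightarrow> b e \<in> N" and X_N: "x \<in> X \<Longrightarrow> x \<in> N"
  by (auto simp: N_def)

lemma card_nbr_V:
  assumes u: "u \<in> V" shows "card (nbr (p u)) = card {e\<in>E. u \<in> e}"
proof (rule bij_betw_same_card)
  let ?h = "\<lambda>c. fst (own (p u, c))"
  have own: "\<exists>e s. own (p u, c) = (e,u) \<and> e \<in> E \<and> u \<in> e \<and> 0 < s \<and> c - p u = of_real s * (b e - p u)" if "c \<in> nbr (p u)" for c
  proof -
    have A: "(p u, c) \<in> A" using that by (simp add: nbr_def)
    obtain e v where e: "e \<in> E" "v \<in> e" "p u \<in> hs e v" "c \<in> hs e v" "own (p u,c) = (e,v)" by (rule own_cases[OF A])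
    have v: "v = u" using p_in_hs[OF e(1,2) u e(3)] by simp
    obtain q s where "q \<in> {p v, b e}" "q \<noteq> p u" "s > 0" "c - p u = of_real s * (q - p u)"
      using nbr_ray[OF A e(1-4)] by blast
    then show ?thesis using e v by auto
  qed
  show "bij_betw ?h (nbr (p u)) {e\<in>E. u \<in> e}"
  proof (rule bij_betw_imageI)
    show "inj_on ?h (nbr (p u))"
    proof (rule inj_onI)
      fix c c' assume c: "c \<in> nbr (p u)" "c' \<in> nbr (p u)" "?h c = ?h c'"
      obtain e s where e: "own (p u, c) = (e,u)" "0 < s" "c - p u = of_real s * (b e - p u)" using own[OF c(1)] by blast
      obtain s' where e': "0 < s'" "c' - p u = of_real s' * (b e - p u)" using own[OF c(2)] c(3) e(1) by auto
      show "c = c'" using nbr_unique_dir[OF _ _ e(3) e'(2) e(2) e'(1)] c by (simp add: nbr_def)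
    qed
    show "?h ` nbr (p u) = {e\<in>E. u \<in> e}"
    proof
      show "?h ` nbr (p u) \<subseteq> {e\<in>E. u \<in> e}" using own by fastforce
      show "{e\<in>E. u \<in> e} \<subseteq> ?h ` nbr (p u)"
      proof
        fix e assume "e \<in> {e\<in>E. u \<in> e}"
        then have e: "e \<in> E" "u \<in> e" by auto
        obtain c where c: "(p u,c) \<in> A" "c \<in> hs e u"
          using ray_nbr[OF e p_V_N[OF u] p_hs, of "b e"] pu_ne_b[OF e] by auto
        have "own (p u,c) = (e,u)" by (rule ownI[OF c(1) e p_hs c(2)])
        then show "e \<in> ?h ` nbr (p u)" using c(1) by (force simp: nbr_def)
      qed
    qed
  qed
qed

lemma b_nbr_own:
  assumes e: "e \<in> E" and A: "(b e, c) \<in> A"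
  shows "\<exists>u s. own (b e, c) = (e,u) \<and> u \<in> e \<and> c \<in> hs e u \<and> 0 < s \<and> c - b e = of_real s * (p u - b e)"
proof -
  obtain f v where f: "f \<in> E" "v \<in> f" "b e \<in> hs f v" "c \<in> hs f v" "own (b e,c) = (f,v)" by (rule own_cases[OF A])
  have v: "f = e" using b_in_hs[OF e f(1,2,3)] by simp
  obtain q s where "q \<in> {p v, b f}" "q \<noteq> b e" "s > 0" "c - b e = of_real s * (q - b e)"
    using nbr_ray[OF A f(1-4)] by blast
  then show ?thesis using f v by auto
qed

lemma b_nbr_ex:
  assumes e: "e \<in> E" "u \<in> e"
  shows "\<exists>c. (b e, c) \<in> A \<and> own (b e, c) = (e,u) \<and> c \<in> hs e u"
proof -
  obtain c where c: "(b e,c) \<in> A" "c \<in> hs e u"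
    using ray_nbr[OF e b_N[OF e(1)] b_hs, of "p u"] pu_ne_b[OF e] by auto
  then show ?thesis using ownI[OF c(1) e b_hs c(2)] by auto
qed

lemma b_nbr_unique:
  assumes e: "e \<in> E" and A: "(b e, c) \<in> A" "(b e, c') \<in> A" and o: "own (b e, c) = own (b e, c')"
  shows "c = c'"
proof -
  obtain u s where u: "own (b e, c) = (e,u)" "0 < s" "c - b e = of_real s * (p u - b e)" using b_nbr_own[OF e A(1)] by blast
  obtain s' where s': "0 < s'" "c' - b e = of_real s' * (p u - b e)" using b_nbr_own[OF e A(2)] o u(1) by auto
  show ?thesis by (rule nbr_unique_dir[OF A u(3) s'(2) u(2) s'(1)])
qed

lemma card_nbr_b:
  assumes e: "e \<in> E" shows "card (nbr (b e)) = 2"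
proof -
  have "bij_betw (\<lambda>c. snd (own (b e, c))) (nbr (b e)) e"
  proof (rule bij_betw_imageI)
    show "inj_on (\<lambda>c. snd (own (b e, c))) (nbr (b e))"
    proof (rule inj_onI)
      fix c c' assume c: "c \<in> nbr (b e)" "c' \<in> nbr (b e)" "snd (own (b e, c)) = snd (own (b e, c'))"
      then have A: "(b e,c) \<in> A" "(b e,c') \<in> A" by (auto simp: nbr_def)
      have "own (b e, c) = own (b e, c')" using b_nbr_own[OF e A(1)] b_nbr_own[OF e A(2)] c(3) by auto
      then show "c = c'" by (rule b_nbr_unique[OF e A])
    qed
    show "(\<lambda>c. snd (own (b e, c))) ` nbr (b e) = e"
    proof
      show "(\<lambda>c. snd (own (b e, c))) ` nbr (b e) \<subseteq> e" using b_nbr_own[OF e] by (force simp: nbr_def)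
      show "e \<subseteq> (\<lambda>c. snd (own (b e, c))) ` nbr (b e)"
      proof
        fix u assume "u \<in> e"
        then obtain c where "(b e, c) \<in> A" "own (b e, c) = (e,u)" using b_nbr_ex[OF e] by blast
        then show "u \<in> (\<lambda>c. snd (own (b e, c))) ` nbr (b e)" by (force simp: nbr_def)
      qed
    qed
  qed
  then show ?thesis using bij_betw_same_card card_edge[OF e] by metis
qed

text \<open>The vectors \<open>z\<close> and \<open>\<i> * z\<close> span the two axes of the cross;
  each axis carries one of the two half edges through the crossing.\<close>

lemma X_nbrs:
  assumes x: "x \<in> X"
  obtains e u f v z where "e \<in> E" "u \<in> e" "f \<in> E" "v \<in> f" "e \<noteq> f" "x \<in> hs e u" "x \<in> hs f v" "z \<noteq> 0"
    "\<And>c. (x,c) \<in> A \<Longrightarrow> (\<exists>s>0. \<exists>k\<in>{1,-1}. c - x = of_real s * (k * z) \<and> own (x,c) = (e,u)) \<or>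
        (\<exists>s>0. \<exists>k\<in>{\<i>,-\<i>}. c - x = of_real s * (k * z) \<and> own (x,c) = (f,v))"
    "\<And>k. k \<in> {1,-1,\<i>,-\<i>} \<Longrightarrow> \<exists>c s. (x,c) \<in> A \<and> 0 < s \<and> c - x = of_real s * (k * z)"
proof -
  obtain e u f v where ef: "e \<in> E" "u \<in> e" "f \<in> E" "v \<in> f" "e \<noteq> f" "x \<in> hs e u" "x \<in> hs f v"
    "x \<noteq> p u" "x \<noteq> b e" "x \<noteq> p v" "x \<noteq> b f"
    and un: "\<And>g w. g \<in> E \<Longrightarrow> w \<in> g \<Longrightarrow> x \<in> hs g w \<Longrightarrow> g = e \<and> w = u \<or> g = f \<and> w = v"
    by (rule X_edges[OF x]) blast
  have xV: "x \<notin> p ` V" using x X_disj(1) by auto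
  define z where "z = b e - p u"
  have z: "z \<noteq> 0" using pu_ne_b[OF ef(1,2)] by (simp add: z_def)
  obtain t where t: "t \<noteq> 0" "b f - p v = of_real t * (\<i> * z)"
    using hs_perp[OF ef(1,3,5,2,4,6,7) xV] unfolding z_def by blast
  have pos: "\<exists>r. 0 < r \<and> r < 1 \<and> x = p u + of_real r * (b e - p u)" if h: "x \<in> hs e u" "x \<noteq> p u" "x \<noteq> b e" for e u
  proof -
    obtain r where r: "0 \<le> r" "r \<le> 1" "x = p u + of_real r * (b e - p u)" using h(1) unfolding hs_def closed_segment_param by blast
    have "r \<noteq> 0" "r \<noteq> 1" using r h by auto
    then show ?thesis using r by (intro exI[of _ r]) auto
  qed
  obtain r where r: "0 < r" "r < 1" "x = p u + of_real r * (b e - p u)" using pos[OF ef(6,8,9)] by blast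
  obtain r' where r': "0 < r'" "r' < 1" "x = p v + of_real r' * (b f - p v)" using pos[OF ef(7,10,11)] by blast
  have d1: "b e - x = of_real (1 - r) * (1 * z)" "p u - x = of_real r * (-1 * z)"
    using r(3) unfolding z_def by (simp_all add: algebra_simps)
  have "b f - x = of_real (1 - r') * (b f - p v)" "p v - x = of_real (- r') * (b f - p v)"
    using r'(3) by (simp_all add: algebra_simps)
  then have d2: "b f - x = of_real ((1 - r') * t) * (\<i> * z)" "p v - x = of_real (- r' * t) * (\<i> * z)" unfolding t(2) by simp_all
  \<comment> \<open>The factor \<open>t\<close> may be negative. Its sign is moved into the
    direction, so that the scalars stay positive.\<close>
  define \<sigma> where "\<sigma> = (if 0 < t then 1 else -1::real)"
  have \<sigma>: "\<sigma> * \<sigma> = 1" "0 < t * \<sigma>" "\<sigma> = 1 \<or> \<sigma> = -1" using t(1) by (auto simp: \<sigma>_def)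
  have d3: "b f - x = of_real ((1 - r') * (t * \<sigma>)) * ((of_real \<sigma> * \<i>) * z)" "p v - x = of_real (r' * (t * \<sigma>)) * ((of_real (- \<sigma>) * \<i>) * z)"
  proof -
    have "(1 - r') * (t * \<sigma>) * \<sigma> = (1 - r') * t" "r' * (t * \<sigma>) * (- \<sigma>) = - r' * t" using \<sigma>(1) by (simp_all add: mult.assoc)
    then have "of_real ((1 - r') * (t * \<sigma>)) * of_real \<sigma> = (of_real ((1 - r') * t) :: complex)"
      "of_real (r' * (t * \<sigma>)) * of_real (- \<sigma>) = (of_real (- r' * t) :: complex)" by (metis of_real_mult)+
    then show "b f - x = of_real ((1 - r') * (t * \<sigma>)) * ((of_real \<sigma> * \<i>) * z)" "p v - x = of_real (r' * (t * \<sigma>)) * ((of_real (- \<sigma>) * \<i>) * z)"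
      unfolding d2 by (simp_all only: mult.assoc[symmetric])
  qed
  have p3: "0 < (1 - r') * (t * \<sigma>)" "0 < r' * (t * \<sigma>)" using r' \<sigma>(2) by simp_all
  have si: "of_real \<sigma> * \<i> \<in> {\<i>, -\<i>}" "of_real (- \<sigma>) * \<i> \<in> {\<i>, -\<i>}" using \<sigma>(3) by auto
  have P1: "(\<exists>s>0. \<exists>k\<in>{1,-1}. c - x = of_real s * (k * z) \<and> own (x,c) = (e,u)) \<or>
        (\<exists>s>0. \<exists>k\<in>{\<i>,-\<i>}. c - x = of_real s * (k * z) \<and> own (x,c) = (f,v))" if A: "(x,c) \<in> A" for c
  proof -
    obtain g w where g: "g \<in> E" "w \<in> g" "x \<in> hs g w" "c \<in> hs g w" "own (x,c) = (g,w)" by (rule own_cases[OF A])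
    obtain q s where q: "q \<in> {p w, b g}" "s > 0" "c - x = of_real s * (q - x)"
      using nbr_ray[OF A g(1-4)] by blast
    from un[OF g(1-3)] show ?thesis
    proof
      assume gw: "g = e \<and> w = u"
      then consider "q = b e" | "q = p u" using q(1) by auto
      then have "\<exists>s>0. \<exists>k\<in>{1,-1}. c - x = of_real s * (k * z)"
      proof cases
        case 1
        have "c - x = of_real (s * (1 - r)) * (1 * z)" unfolding q(3) 1 d1 by simp
        moreover have "0 < s * (1 - r)" using q(2) r by simp
        ultimately show ?thesis by blast
      next
        case 2
        have "c - x = of_real (s * r) * (-1 * z)" unfolding q(3) 2 d1 by simp
        moreover have "0 < s * r" using q(2) r by simp
        ultimately show ?thesis by blast
      qed
      then show ?thesis using gw g(5) by blast
    next
      assume gw: "g = f \<and> w = v"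
      then consider "q = b f" | "q = p v" using q(1) by auto
      then have "\<exists>s>0. \<exists>k\<in>{\<i>,-\<i>}. c - x = of_real s * (k * z)"
      proof cases
        case 1
        have "c - x = of_real (s * ((1 - r') * (t * \<sigma>))) * ((of_real \<sigma> * \<i>) * z)" unfolding q(3) 1 d3 by simp
        moreover have "0 < s * ((1 - r') * (t * \<sigma>))" using q(2) p3 by simp
        ultimately show ?thesis using si by blast
      next
        case 2
        have "c - x = of_real (s * (r' * (t * \<sigma>))) * ((of_real (- \<sigma>) * \<i>) * z)" unfolding q(3) 2 d3 by simp
        moreover have "0 < s * (r' * (t * \<sigma>))" using q(2) p3 by simp
        ultimately show ?thesis using si by blast
      qed
      then show ?thesis using gw g(5) by blast
    qed
  qed
  have P2: "\<exists>c s. (x,c) \<in> A \<and> 0 < s \<and> c - x = of_real s * (k * z)" if k: "k \<in> {1,-1,\<i>,-\<i>}" for k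
  proof -
    have gen: "\<exists>c s. (x,c) \<in> A \<and> 0 < s \<and> c - x = of_real s * (k * z)"
      if g: "g \<in> E" "w \<in> g" "x \<in> hs g w" "q \<in> {p w, b g}" "q \<noteq> x" "q - x = of_real m * (k * z)" "0 < m" for g w q m
    proof -
      obtain c s where c: "(x,c) \<in> A" "s > 0" "c - x = of_real s * (q - x)"
        using ray_nbr[OF g(1,2) X_N[OF x] g(3-5)] by blast
      then have "c - x = of_real (s * m) * (k * z)" using g(6) by simp
      moreover have "0 < s * m" using c g(7) by simp
      ultimately show ?thesis using c(1) by blast
    qed
    have "k = 1 \<or> k = -1 \<or> k = of_real \<sigma> * \<i> \<or> k = of_real (- \<sigma>) * \<i>" using k \<sigma>(3) by auto
    then show ?thesis
    proof (elim disjE)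
      assume k: "k = 1" show ?thesis by (rule gen[OF ef(1,2,6) _ ef(9)[symmetric] d1(1)[folded k]]) (use r in auto)
    next
      assume k: "k = -1" show ?thesis by (rule gen[OF ef(1,2,6) _ ef(8)[symmetric] d1(2)[folded k]]) (use r in auto)
    next
      assume k: "k = of_real \<sigma> * \<i>" show ?thesis by (rule gen[OF ef(3,4,7) _ ef(11)[symmetric] d3(1)[folded k] p3(1)]) auto
    next
      assume k: "k = of_real (- \<sigma>) * \<i>" show ?thesis by (rule gen[OF ef(3,4,7) _ ef(10)[symmetric] d3(2)[folded k] p3(2)]) auto
    qed
  qed
  show thesis by (rule that[OF ef(1-7) z P1 P2])
qed

lemma unit_dirs_inj:
  assumes "k \<in> {1,-1,\<i>,-\<i>}" "k' \<in> {1,-1,\<i>,-\<i>}" "of_real s * (k * z) = of_real s' * (k' * z)" "0 < s" "0 < s'" "z \<noteq> (0::complex)"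
  shows "k = k'"
proof -
  have "of_real s * k = of_real s' * k'" using assms(3,6) by simp
  then have "s * Re k = s' * Re k'" "s * Im k = s' * Im k'" by (auto simp: complex_eq_iff)
  then show ?thesis using assms(1,2,4,5) by (auto simp: complex_eq_iff)
qed

lemma card_nbr_X:
  assumes x: "x \<in> X" shows "card (nbr x) = 4"
proof -
  obtain e u f v z where z: "z \<noteq> 0"
    and P1: "\<And>c. (x,c) \<in> A \<Longrightarrow> (\<exists>s>0. \<exists>k\<in>{1,-1}. c - x = of_real s * (k * z) \<and> own (x,c) = (e,u)) \<or>
        (\<exists>s>0. \<exists>k\<in>{\<i>,-\<i>}. c - x = of_real s * (k * z) \<and> own (x,c) = (f,v))"
    and P2: "\<And>k. k \<in> {1,-1,\<i>,-\<i>} \<Longrightarrow> \<exists>c s. (x,c) \<in> A \<and> 0 < s \<and> c - x = of_real s * (k * z)"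
    by (rule X_nbrs[OF x]) blast
  let ?K = "{1,-1,\<i>,-\<i>}"
  have P1': "\<exists>s>0. \<exists>k\<in>?K. c - x = of_real s * (k * z)" if "(x,c) \<in> A" for c using P1[OF that] by blast
  from P2 obtain c s where cs: "\<And>k. k \<in> ?K \<Longrightarrow> (x, c k) \<in> A \<and> 0 < s k \<and> c k - x = of_real (s k) * (k * z)" by metis
  have "bij_betw c ?K (nbr x)"
  proof (rule bij_betw_imageI)
    show "inj_on c ?K"
    proof (rule inj_onI)
      fix k k' assume k: "k \<in> ?K" "k' \<in> ?K" "c k = c k'"
      then have "of_real (s k) * (k * z) = of_real (s k') * (k' * z)" using cs by metis
      then show "k = k'" using unit_dirs_inj[OF k(1,2)] cs k z by blast
    qed
    show "c ` ?K = nbr x"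
    proof
      show "c ` ?K \<subseteq> nbr x" using cs by (auto simp: nbr_def)
      show "nbr x \<subseteq> c ` ?K"
      proof
        fix d assume "d \<in> nbr x"
        then have d: "(x,d) \<in> A" by (simp add: nbr_def)
        obtain t k where k: "t > 0" "k \<in> ?K" "d - x = of_real t * (k * z)" using P1'[OF d] by blast
        have "c k = d" using nbr_unique_dir[OF _ d _ k(3) _ k(1), of "c k" "s k"] cs[OF k(2)] by simp
        then show "d \<in> c ` ?K" using k(2) by blast
      qed
    qed
  qed
  then have "card (nbr x) = card ?K" using bij_betw_same_card by metis
  also have "card ?K = 4" by (simp add: complex_eq_iff)
  finally show ?thesis .
qed

lemma degree_sum: "(\<Sum>u\<in>V. card {e\<in>E. u \<in> e}) = 2 * card E"
proof -
  have "(\<Sum>u\<in>V. card {e\<in>E. u \<in> e}) = (\<Sum>u\<in>V. \<Sum>e\<in>E. if u \<in> e then 1 else 0)"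
    using finE by (simp add: sum.If_cases Int_def)
  also have "\<dots> = (\<Sum>e\<in>E. \<Sum>u\<in>V. if u \<in> e then 1 else 0)" by (rule sum.swap)
  also have "\<dots> = (\<Sum>e\<in>E. 2)"
  proof (rule sum.cong[OF refl])
    fix e assume e: "e \<in> E"
    have "{u\<in>V. u \<in> e} = e" using E_V[OF e] by auto
    then show "(\<Sum>u\<in>V. if u \<in> e then 1 else 0) = (2::nat)" using finV card_edge[OF e] by (simp add: sum.If_cases Int_def)
  qed
  finally show ?thesis by simp
qed

lemma A_Sigma: "A = Sigma N nbr" using A_N by (auto simp: nbr_def)

lemma sum_nbr_V: "(\<Sum>w\<in>p ` V. card (nbr w)) = 2 * card E"
  using degree_sum card_nbr_V by (simp add: sum.reindex[OF p_inj])

lemma N_parts: "finite (p ` V \<union> b ` E)" "(p ` V \<union> b ` E) \<inter> X = {}"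
  using finV finE X_disj(1,2) by (simp_all add: Int_Un_distrib Int_commute)

lemma card_N: "card N = card V + card E + card X"
proof -
  have "card N = card (p ` V \<union> b ` E) + card X"
    unfolding N_def by (rule card_Un_disjoint[OF N_parts(1) finX N_parts(2)])
  also have "card (p ` V \<union> b ` E) = card (p ` V) + card (b ` E)"
    by (rule card_Un_disjoint[OF finite_imageI[OF finV] finite_imageI[OF finE] X_disj(3)])
  finally have "card N = card (p ` V) + card (b ` E) + card X" .
  then show ?thesis by (simp add: card_image[OF p_inj] card_image[OF b_inj])
qed

text \<open>Sum of degrees: the vertices contribute \<open>2 * card E\<close>, every bend 2 and
  every crossing 4.\<close>

lemma card_A: "card A = 4 * card E + 4 * card X"
proof -
  have "card A = card (Sigma N nbr)" by (rule arg_cong[OF A_Sigma])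
  also have "\<dots> = (\<Sum>w\<in>N. card (nbr w))" by (rule card_SigmaI) (simp_all add: finN finite_nbr)
  also have "\<dots> = (\<Sum>w\<in>p ` V. card (nbr w)) + (\<Sum>w\<in>b ` E. card (nbr w)) + (\<Sum>w\<in>X. card (nbr w))"
  proof -
    have "sum (\<lambda>w. card (nbr w)) N = sum (\<lambda>w. card (nbr w)) (p ` V \<union> b ` E) + sum (\<lambda>w. card (nbr w)) X"
      unfolding N_def by (rule sum.union_disjoint[OF N_parts(1) finX N_parts(2)])
    moreover have "sum (\<lambda>w. card (nbr w)) (p ` V \<union> b ` E) = sum (\<lambda>w. card (nbr w)) (p ` V) + sum (\<lambda>w. card (nbr w)) (b ` E)"
      by (rule sum.union_disjoint[OF finite_imageI[OF finV] finite_imageI[OF finE] X_disj(3)])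
    ultimately show ?thesis by simp
  qed
  also have "(\<Sum>w\<in>b ` E. card (nbr w)) = 2 * card E"
    by (simp add: sum.reindex[OF b_inj] card_nbr_b)
  also have "(\<Sum>w\<in>X. card (nbr w)) = 4 * card X" by (simp add: card_nbr_X)
  finally show ?thesis using sum_nbr_V by simp
qed

text \<open>The bends cancel, since each of them adds one node and one further piece of its
  edge.\<close>

theorem euler_drawing:
  assumes "E \<noteq> {}"
  shows "card E + card X + npc S + 1 \<le> card (lf ` A) + card V"
proof -
  have "card E \<noteq> 0" using assms finE by simp
  then have "card A \<noteq> 0" using card_A by simp
  then have "A \<noteq> {}" by auto
  from euler_faces(2)[OF this] show ?thesis using card_A card_N by simp
qed

lemma nbr_nonempty:
  assumes "w \<in> N" "\<And>u. u \<in> V \<Longrightarrow> \<exists>e\<in>E. u \<in> e"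
  shows "nbr w \<noteq> {}"
proof -
  have "0 < card (nbr w)"
  proof -
    consider u where "u \<in> V" "w = p u" | e where "e \<in> E" "w = b e" | "w \<in> X" using assms(1) by (auto simp: N_def)
    then show ?thesis
    proof cases
      case 1
      obtain e where "e \<in> E" "u \<in> e" using assms(2)[OF 1(1)] by blast
      then have "{e\<in>E. u \<in> e} \<noteq> {}" by blast
      then show ?thesis using card_nbr_V[OF 1(1)] finE 1 by (simp add: card_gt_0_iff)
    next
      case 2 then show ?thesis using card_nbr_b by simp
    next
      case 3 then show ?thesis using card_nbr_X by simp
    qed
  qed
  then show ?thesis by auto
qed

end

section \<open>Sides of faces\<close>

definition pp :: "complex \<Rightarrow> complex \<Rightarrow> bool" where
  "pp x y \<longleftrightarrow> (\<exists>s>0. x = of_real s * y)"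

lemma pp_refl [simp]: "pp x x" unfolding pp_def by (intro exI[of _ 1]) simp

lemma pp_sym: "pp x y \<Longrightarrow> pp y x"
  unfolding pp_def by (erule exE, rule_tac x="inverse s" in exI) simp

lemma pp_trans: "pp x y \<Longrightarrow> pp y z \<Longrightarrow> pp x z"
proof -
  assume "pp x y" "pp y z"
  then obtain s t where "s > 0" "t > 0" "x = of_real s * y" "y = of_real t * z" unfolding pp_def by auto
  then show "pp x z" unfolding pp_def by (intro exI[of _ "s * t"]) simp
qed

lemma pp_mult: "pp x y \<Longrightarrow> pp (k * x) (k * y)"
  unfolding pp_def by (auto simp: mult.left_commute)

lemma pp_minus: "pp x y \<Longrightarrow> pp (- x) (- y)"
  unfolding pp_def by auto

lemma pp_scale: "0 < s \<Longrightarrow> pp (of_real s * x) x"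
  unfolding pp_def by auto

lemma pp_not_minus: "pp x y \<Longrightarrow> pp (- x) y \<Longrightarrow> y = 0"
proof -
  assume "pp x y" "pp (- x) y"
  then obtain s t where st: "s > 0" "t > 0" "x = of_real s * y" "- x = of_real t * y" unfolding pp_def by auto
  have "of_real (s + t) * y = x + - x" by (simp only: st(3,4)[symmetric] of_real_add distrib_right)
  then show "y = 0" using st(1,2) by (simp del: of_real_add)
qed

lemma pp_zero: "pp x y \<Longrightarrow> x = 0 \<longleftrightarrow> y = 0"
  unfolding pp_def by auto

context drawing begin

definition W :: "complex set" where "W = p ` V \<union> X"

lemma W_N: "w \<in> W \<Longrightarrow> w \<in> N" by (auto simp: W_def N_def)

lemma b_notin_W: "e \<in> E \<Longrightarrow> b e \<notin> W" using X_disj(2,3) by (auto simp: W_def)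

lemma N_W: "w \<in> N \<Longrightarrow> w \<notin> W \<Longrightarrow> \<exists>e\<in>E. w = b e" by (auto simp: W_def N_def)

text \<open>A bend has exactly two neighbours, one on each half of its edge, and two bends are never
  adjacent. So every boundary walk passes through a bend to the other half.\<close>

lemma bend_step:
  assumes A: "(a,w) \<in> A" and w: "w \<notin> W"
  shows "\<exists>e u v c. e \<in> E \<and> w = b e \<and> u \<in> e \<and> v \<in> e \<and> u \<noteq> v \<and> nx (a,w) = (w,c) \<and> (w,c) \<in> A \<and> c \<noteq> a \<and> c \<in> W \<and> a \<in> W \<and>
    own (a,w) = (e,u) \<and> own (w,c) = (e,v) \<and> a \<in> hs e u \<and> c \<in> hs e v \<and> nx (c,w) = (w,a)"
proof -
  obtain e where e: "e \<in> E" "w = b e" using N_W[OF A_N2[OF A] w] by auto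
  have wa: "(b e, a) \<in> A" using A_sym[OF A] e by simp
  obtain u where u: "own (b e,a) = (e,u)" "u \<in> e" "a \<in> hs e u" using b_nbr_own[OF e(1) wa] by auto
  obtain v where v: "v \<noteq> u" "e = {u,v}" using E_other[OF e(1) u(2)] by auto
  then have ve: "v \<in> e" by auto
  obtain c where c: "(b e,c) \<in> A" "own (b e,c) = (e,v)" "c \<in> hs e v" using b_nbr_ex[OF e(1) ve] by auto
  have ca: "c \<noteq> a" using c(2) u(1) v(1) by auto
  have W: "z \<in> W" if zA: "(b e, z) \<in> A" for z
  proof (rule ccontr)
    assume "z \<notin> W"
    then obtain f where f: "f \<in> E" "z = b f" using N_W[OF A_N2[OF zA]] by auto
    obtain s where "z \<in> hs e s" "s \<in> e" using b_nbr_own[OF e(1) zA] by auto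
    then have "f = e" using b_in_hs[OF f(1) e(1)] f(2) by simp
    then show False using A_ne[OF zA] f by simp
  qed
  have two: "z = a \<or> z = c" if zA: "(b e, z) \<in> A" for z
  proof -
    obtain s where s: "own (b e,z) = (e,s)" "s \<in> e" using b_nbr_own[OF e(1) zA] by auto
    then have "s = u \<or> s = v" using v by auto
    then show ?thesis using b_nbr_unique[OF e(1) zA wa] b_nbr_unique[OF e(1) zA c(1)] s(1) u(1) c(2) by auto
  qed
  have n1: "nx (a,w) = (w,c)"
  proof -
    have "(w, snd (nx (a,w))) \<in> A" using nx_A[OF A] fst_nx[of "(a,w)"] by (metis prod.collapse snd_conv)
    moreover have "snd (nx (a,w)) \<noteq> a" using nx_other[OF A _ ca] c(1) e by simp
    ultimately have "snd (nx (a,w)) = c" using two e by auto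
    then show ?thesis by (metis fst_nx prod.collapse snd_conv)
  qed
  have cw: "(c,w) \<in> A" using A_sym[OF c(1)] e by simp
  have n2: "nx (c,w) = (w,a)"
  proof -
    have "(w, snd (nx (c,w))) \<in> A" using nx_A[OF cw] fst_nx[of "(c,w)"] by (metis prod.collapse snd_conv)
    moreover have "snd (nx (c,w)) \<noteq> c" using nx_other[OF cw _ ca[symmetric]] wa e by simp
    ultimately have "snd (nx (c,w)) = a" using two e by auto
    then show ?thesis by (metis fst_nx prod.collapse snd_conv)
  qed
  have "own (a,w) = (e,u)" using own_sym[OF wa] u(1) e by simp
  then show ?thesis using e u v(1) ve c ca n1 n2 W[OF wa] W[OF c(1)] by auto
qed

text \<open>Sides of faces run between vertices and crossings, possibly through a bend. A side is represented by its first
  dart \<open>d\<close>: \<open>ml d\<close> is its last dart, \<open>mh d\<close> its head, \<open>mn d\<close> the next side of the face on the left, \<open>rv d\<close> the reversed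
  side, \<open>od d\<close> and \<open>idr d\<close> its directions at the tail and at the head, and \<open>turn d\<close> is positive iff it bends to the left.\<close>

definition ml :: "complex \<times> complex \<Rightarrow> complex \<times> complex" where
  "ml d = (if snd d \<in> W then d else nx d)"

definition mh :: "complex \<times> complex \<Rightarrow> complex" where "mh d = snd (ml d)"

definition mn :: "complex \<times> complex \<Rightarrow> complex \<times> complex" where "mn d = nx (ml d)"

definition ed :: "complex \<times> complex \<Rightarrow> 'a set" where "ed d = fst (own d)"

definition od :: "complex \<times> complex \<Rightarrow> complex" where "od d = snd d - fst d"

definition idr :: "complex \<times> complex \<Rightarrow> complex" where "idr d = snd (ml d) - fst (ml d)"

definition rv :: "complex \<times> complex \<Rightarrow> complex \<times> complex" where "rv d = prod.swap (ml d)"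

definition turn :: "complex \<times> complex \<Rightarrow> real" where "turn d = Im (cnj (od d) * idr d)"

definition M :: "(complex \<times> complex) set" where "M = {d\<in>A. fst d \<in> W}"

lemma M_A: "d \<in> M \<Longrightarrow> d \<in> A" by (simp add: M_def)

lemma M_cases:
  assumes "d \<in> M"
  obtains (straight) a c where "d = (a,c)" "(a,c) \<in> A" "a \<in> W" "c \<in> W" "ml d = d" "mh d = c" "idr d = od d" "rv d = (c,a)"
  | (bend) a c e u v where "d = (a,b e)" "(a,b e) \<in> A" "a \<in> W" "c \<in> W" "e \<in> E" "u \<in> e" "v \<in> e" "u \<noteq> v"
     "nx d = (b e,c)" "(b e,c) \<in> A" "c \<noteq> a" "own d = (e,u)" "own (b e,c) = (e,v)" "a \<in> hs e u" "c \<in> hs e v"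
     "nx (c,b e) = (b e,a)" "ml d = (b e,c)" "mh d = c" "idr d = c - b e" "od d = b e - a" "rv d = (c,b e)"
proof -
  obtain a w where aw: "d = (a,w)" by (cases d)
  have A: "(a,w) \<in> A" "a \<in> W" using assms aw by (auto simp: M_def)
  show thesis
  proof (cases "w \<in> W")
    case True
    show thesis by (rule straight[OF aw A True]) (use True aw in \<open>simp_all add: ml_def mh_def idr_def od_def rv_def\<close>)
  next
    case False
    obtain e u v c where e: "e \<in> E" "w = b e" "u \<in> e" "v \<in> e" "u \<noteq> v" "nx (a,w) = (w,c)" "(w,c) \<in> A" "c \<noteq> a" "c \<in> W"
      "own (a,w) = (e,u)" "own (w,c) = (e,v)" "a \<in> hs e u" "c \<in> hs e v" "nx (c,w) = (w,a)"
      using bend_step[OF A(1) False] by blast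
    show thesis
      by (rule bend[of a e c u v]) (use e A aw False in \<open>simp_all add: ml_def mh_def idr_def od_def rv_def\<close>)
  qed
qed

lemma ml_A: "d \<in> M \<Longrightarrow> ml d \<in> A" by (auto elim!: M_cases)

lemma mh_W: "d \<in> M \<Longrightarrow> mh d \<in> W" by (auto elim!: M_cases)

lemma lf_ml: "d \<in> M \<Longrightarrow> lf (ml d) = lf d" using lf_nx M_A by (simp add: ml_def)

lemma mn_M: "d \<in> M \<Longrightarrow> mn d \<in> M"
  using nx_A[OF ml_A] mh_W by (simp add: M_def mn_def mh_def)

lemma fst_mn [simp]: "fst (mn d) = mh d" by (simp add: mn_def mh_def)

lemma lf_mn: "d \<in> M \<Longrightarrow> lf (mn d) = lf d" using lf_nx[OF ml_A] lf_ml by (simp add: mn_def)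

lemma mn_inj: "d \<in> M \<Longrightarrow> d' \<in> M \<Longrightarrow> mn d = mn d' \<Longrightarrow> d = d'"
proof -
  assume d: "d \<in> M" "d' \<in> M" and e: "mn d = mn d'"
  have m: "ml d = ml d'" using nx_inj[OF ml_A[OF d(1)] ml_A[OF d(2)]] e by (simp add: mn_def)
  show "d = d'"
  proof (cases "snd d \<in> W \<longleftrightarrow> snd d' \<in> W")
    case True
    then show ?thesis using m nx_inj[OF M_A[OF d(1)] M_A[OF d(2)]] by (auto simp: ml_def split: if_splits)
  next
    case False
    then show ?thesis using m d fst_nx[of d] fst_nx[of d'] by (auto simp: ml_def M_def split: if_splits)
  qed
qed

lemma own_ml: "d \<in> M \<Longrightarrow> fst (own (ml d)) = ed d"
  by (auto elim!: M_cases simp: ed_def)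

lemma ed_E: "d \<in> M \<Longrightarrow> ed d \<in> E"
proof -
  assume d: "d \<in> M"
  obtain a c where ac: "d = (a,c)" by (cases d)
  show ?thesis using own_cases[of a c] M_A[OF d] ac by (metis ed_def fst_conv)
qed

lemma mh_ne: "d \<in> M \<Longrightarrow> mh d \<noteq> fst d"
  by (erule M_cases) (auto dest: A_ne)

lemma od_nz: "d \<in> M \<Longrightarrow> od d \<noteq> 0"
  by (cases d) (auto simp: od_def M_def dest: A_ne)

lemma idr_nz: "d \<in> M \<Longrightarrow> idr d \<noteq> 0"
  using ml_A[of d] A_ne[of "fst (ml d)" "snd (ml d)"] by (auto simp: idr_def)

lemma rv_M: "d \<in> M \<Longrightarrow> rv d \<in> M"
  by (erule M_cases) (auto simp: M_def intro: A_sym)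

lemma rv_props:
  assumes "d \<in> M"
  shows "fst (rv d) = mh d" "mh (rv d) = fst d" "od (rv d) = - idr d" "idr (rv d) = - od d" "ed (rv d) = ed d"
    "rv (rv d) = d" "turn (rv d) = - turn d"
proof -
  have "fst (rv d) = mh d \<and> mh (rv d) = fst d \<and> od (rv d) = - idr d \<and> idr (rv d) = - od d \<and> ed (rv d) = ed d \<and> rv (rv d) = d"
    using assms
  proof (cases rule: M_cases)
    case (straight a c)
    have m: "ml (c,a) = (c,a)" using straight(3) by (simp add: ml_def)
    show ?thesis unfolding straight(8) straight(6) straight(7)
      unfolding straight(1) by (simp add: mh_def od_def idr_def rv_def m ed_def own_sym[OF straight(2)])
  next
    case (bend a c e u v)
    have m: "ml (c,b e) = (b e,a)" using bend(16) b_notin_W[OF bend(5)] by (simp add: ml_def)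
    have o: "own (c,b e) = (e,v)" using own_sym[OF bend(10)] bend(13) by simp
    show ?thesis unfolding bend(21) bend(18) bend(19) bend(20)
      unfolding mh_def od_def idr_def rv_def m ed_def o using bend(1,12) by simp
  qed
  then show o: "fst (rv d) = mh d" "mh (rv d) = fst d" "od (rv d) = - idr d" and i: "idr (rv d) = - od d" and "ed (rv d) = ed d"
    and "rv (rv d) = d" by auto
  show "turn (rv d) = - turn d" unfolding turn_def o i by simp
qed

lemma mh_eq: "d \<in> M \<Longrightarrow> snd d \<notin> W \<Longrightarrow> mh d = fst d + od d + idr d"
  by (simp add: mh_def ml_def od_def idr_def)

text \<open>With \<open>turn d = 0\<close> the two pieces are parallel; if they pointed in opposite
  directions, the bend would have two neighbours on one ray.\<close>

lemma unbent:
  assumes d: "d \<in> M" and t: "turn d = 0"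
  shows "pp (idr d) (od d)" "pp (mh d - fst d) (od d)"
proof -
  have "pp (idr d) (od d) \<and> pp (mh d - fst d) (od d)"
    using d
  proof (cases rule: M_cases)
    case (straight a c)
    then show ?thesis by (simp add: od_def)
  next
    case (bend a c e u v)
    have nz: "od d \<noteq> 0" "idr d \<noteq> 0" using od_nz[OF d] idr_nz[OF d] .
    define k where "k = Re (cnj (od d) * idr d) / (cmod (od d))\<^sup>2"
    have "cnj (od d) * idr d = of_real (k * (cmod (od d))\<^sup>2)"
      using t nz by (simp add: k_def complex_eq_iff turn_def)
    then have "cnj (od d) * idr d = cnj (od d) * (of_real k * od d)"
      by (simp add: complex_norm_square mult_ac del: of_real_power)
    then have ik: "idr d = of_real k * od d" using nz by simp
    have "0 < k"
    proof (rule ccontr)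
      assume "\<not> 0 < k"
      then have "0 < - k" using ik nz by (metis mult_eq_0_iff neg_0_less_iff_less linorder_neqE_linordered_idom of_real_eq_0_iff)
      moreover have "c - b e = of_real (- k) * (a - b e)"
        using ik unfolding bend(19) bend(20) by (simp add: algebra_simps)
      ultimately show False using nbr_unique[OF A_sym[OF bend(2)] bend(10)] bend(11) by blast
    qed
    moreover have "mh d - fst d = of_real (1 + k) * od d" using mh_eq[OF d] b_notin_W bend ik by (simp add: algebra_simps)
    ultimately show ?thesis using ik unfolding pp_def by (metis add_pos_pos zero_less_one)
  qed
  then show "pp (idr d) (od d)" "pp (mh d - fst d) (od d)" by auto
qed

definition on :: "'a set \<Rightarrow> complex set" where "on e = (\<Union>u\<in>e. hs e u)"

text \<open>A quarter turn exchanges the two axes of the cross, so the next dart leaves on the other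
  edge.\<close>

lemma cross_step:
  assumes A: "(a,x) \<in> A" and x: "x \<in> X"
  shows "\<exists>c. nx (a,x) = (x,c) \<and> pp (c - x) (\<i> * (x - a)) \<and> fst (own (x,c)) \<noteq> fst (own (a,x)) \<and>
    (\<forall>g\<in>E. x \<in> on g \<longleftrightarrow> g = fst (own (a,x)) \<or> g = fst (own (x,c)))"
proof -
  obtain e u f v z where ef: "e \<in> E" "u \<in> e" "f \<in> E" "v \<in> f" "e \<noteq> f" "x \<in> hs e u" "x \<in> hs f v" and z: "z \<noteq> 0"
    and P1: "\<And>c. (x,c) \<in> A \<Longrightarrow> (\<exists>s>0. \<exists>k\<in>{1,-1}. c - x = of_real s * (k * z) \<and> own (x,c) = (e,u)) \<or>
        (\<exists>s>0. \<exists>k\<in>{\<i>,-\<i>}. c - x = of_real s * (k * z) \<and> own (x,c) = (f,v))"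
    and P2: "\<And>k. k \<in> {1,-1,\<i>,-\<i>} \<Longrightarrow> \<exists>c s. (x,c) \<in> A \<and> 0 < s \<and> c - x = of_real s * (k * z)"
    by (rule X_nbrs[OF x]) blast
  let ?K = "{1,-1,\<i>,-\<i>}"
  have xa: "(x,a) \<in> A" using A_sym[OF A] .
  obtain sa ka where ka: "0 < sa" "ka \<in> ?K" "a - x = of_real sa * (ka * z)" using P1[OF xa] by blast
  have xa': "x - a = of_real sa * (- ka * z)" using ka(3) by (simp add: algebra_simps)
  have "\<i> * - ka \<in> ?K" using ka(2) by auto
  then obtain c sc where c: "(x,c) \<in> A" "0 < sc" "c - x = of_real sc * ((\<i> * - ka) * z)" using P2 by blast
  have cx: "c - x = of_real (sc / sa) * (\<i> * (x - a))" unfolding c(3) xa' using ka(1) by simp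
  have n: "nx (a,x) = (x,c)"
  proof (rule nx_cross[OF A c(1) cx])
    show "0 < sc / sa" using c(2) ka(1) by simp
    fix c' assume "c' \<in> nbr x"
    then have "(x,c') \<in> A" by (simp add: nbr_def)
    then obtain s k where k: "0 < s" "k \<in> ?K" "c' - x = of_real s * (k * z)" using P1 by blast
    \<comment> \<open>The directions are units of modulus 1, so this is \<open>- k\<close> divided
      by \<open>ka\<close>.\<close>
    define m where "m = - k * cnj ka"
    have mk: "m * - ka = k" using ka(2) by (elim insertE emptyE; simp add: m_def mult.assoc)
    have "m \<in> {1,-1,\<i>,-\<i>}" using k(2) ka(2) by (elim insertE emptyE; simp add: m_def)
    moreover have "c' - x = of_real (s / sa) * (m * (x - a))"
      unfolding k(3) xa' by (subst mk[symmetric]) (use ka(1) in simp)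
    moreover have "0 < s / sa" using k(1) ka(1) by simp
    ultimately show "\<exists>s>0. \<exists>u\<in>{1,-1,\<i>,-\<i>}. c' - x = of_real s * (u * (x - a))" by blast
  qed
  have oa: "own (a,x) = own (x,a)" using own_sym[OF xa] .
  have dirs: "own (x,c') = (if k \<in> {1,-1} then (e,u) else (f,v))"
    if c': "(x,c') \<in> A" "c' - x = of_real s * (k * z)" "0 < s" "k \<in> ?K" for c' s k
  proof -
    obtain s' k' where k': "0 < s'" "k' \<in> ?K" "c' - x = of_real s' * (k' * z)"
      "own (x,c') = (if k' \<in> {1,-1} then (e,u) else (f,v))"
    proof -
      from P1[OF c'(1)] show ?thesis
      proof
        assume "\<exists>s>0. \<exists>k\<in>{1,-1}. c' - x = of_real s * (k * z) \<and> own (x,c') = (e,u)"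
        then obtain s k where "0 < s" "k \<in> {1,-1}" "c' - x = of_real s * (k * z)" "own (x,c') = (e,u)" by blast
        then show ?thesis using that[of s k] by auto
      next
        assume "\<exists>s>0. \<exists>k\<in>{\<i>,-\<i>}. c' - x = of_real s * (k * z) \<and> own (x,c') = (f,v)"
        then obtain s k where k: "0 < s" "k \<in> {\<i>,-\<i>}" "c' - x = of_real s * (k * z)" "own (x,c') = (f,v)" by blast
        then have "k \<notin> {1,-1}" by (auto simp: complex_eq_iff)
        then show ?thesis using that[of s k] k by auto
      qed
    qed
    have "k = k'" by (rule unit_dirs_inj[OF c'(4) k'(2) trans[OF c'(2)[symmetric] k'(3)] c'(3) k'(1) z])
    then show ?thesis using k'(4) by simp
  qed
  have o1: "own (x,a) = (if ka \<in> {1,-1} then (e,u) else (f,v))" by (rule dirs[OF xa ka(3,1,2)])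
  have o2: "own (x,c) = (if \<i> * - ka \<in> {1,-1} then (e,u) else (f,v))"
    by (rule dirs[OF c(1,3,2)]) (use ka(2) in auto)
  have flip: "\<i> * - ka \<in> {1,-1} \<longleftrightarrow> ka \<notin> {1,-1}" using ka(2) by (auto simp: complex_eq_iff)
  have both: "{fst (own (a,x)), fst (own (x,c))} = {e,f}" unfolding oa o1 o2 flip by auto
  have ne: "fst (own (x,c)) \<noteq> fst (own (a,x))" unfolding oa o1 o2 flip using ef(5) by auto
  have "x \<in> on g \<longleftrightarrow> g = e \<or> g = f" if g: "g \<in> E" for g
  proof
    assume "x \<in> on g"
    then obtain w where w: "w \<in> g" "x \<in> hs g w" by (auto simp: on_def)
    obtain e' u' f' v' where ef': "e' \<in> E" "f' \<in> E"
      and un: "\<And>g w. g \<in> E \<Longrightarrow> w \<in> g \<Longrightarrow> x \<in> hs g w \<Longrightarrow> g = e' \<and> w = u' \<or> g = f' \<and> w = v'"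
      by (rule X_edges[OF x]) blast
    show "g = e \<or> g = f" using un[OF g w] un[OF ef(1,2,6)] un[OF ef(3,4,7)] ef(5) by auto
  next
    assume "g = e \<or> g = f"
    then show "x \<in> on g" using ef by (auto simp: on_def)
  qed
  then have "\<forall>g\<in>E. x \<in> on g \<longleftrightarrow> g = fst (own (a,x)) \<or> g = fst (own (x,c))" using both by (metis doubleton_eq_iff)
  moreover have "pp (c - x) (\<i> * (x - a))" unfolding cx by (rule pp_scale) (use c ka in simp)
  ultimately show ?thesis using n ne by blast
qed

lemma mn_cross:
  assumes d: "d \<in> M" and x: "mh d \<in> X"
  shows "pp (od (mn d)) (\<i> * idr d)" "ed (mn d) \<noteq> ed d"
    "g \<in> E \<Longrightarrow> mh d \<in> on g \<longleftrightarrow> g = ed d \<or> g = ed (mn d)"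
proof -
  obtain a where ml: "ml d = (a, mh d)" by (metis mh_def prod.collapse)
  have A: "(a, mh d) \<in> A" using ml_A[OF d] ml by simp
  obtain c where c: "nx (a, mh d) = (mh d, c)" "pp (c - mh d) (\<i> * (mh d - a))" "fst (own (mh d,c)) \<noteq> fst (own (a,mh d))"
    "\<forall>g\<in>E. mh d \<in> on g \<longleftrightarrow> g = fst (own (a,mh d)) \<or> g = fst (own (mh d,c))" using cross_step[OF A x] by blast
  have m: "mn d = (mh d, c)" using c(1) ml by (simp add: mn_def)
  have i: "idr d = mh d - a" by (simp add: idr_def ml)
  have e: "ed d = fst (own (a,mh d))" using own_ml[OF d] ml by simp
  show "pp (od (mn d)) (\<i> * idr d)" using c(2) m i by (simp add: od_def)
  show "ed (mn d) \<noteq> ed d" using c(3) m e by (simp add: ed_def)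
  show "g \<in> E \<Longrightarrow> mh d \<in> on g \<longleftrightarrow> g = ed d \<or> g = ed (mn d)" using c(4) m e by (simp add: ed_def)
qed

text \<open>\<open>kf f\<close> counts the sides and \<open>vf f\<close> the vertices (not crossings) on the boundary of \<open>f\<close>, with multiplicity.\<close>

definition mdF :: "complex set \<Rightarrow> (complex \<times> complex) set" where
  "mdF f = {d\<in>M. lf d = f}"

definition kf :: "complex set \<Rightarrow> nat" where "kf f = card (mdF f)"

definition vf :: "complex set \<Rightarrow> nat" where "vf f = card {d\<in>mdF f. fst d \<in> p ` V}"

lemma finM: "finite M" using finA by (simp add: M_def)

lemma fin_mdF: "finite (mdF f)" using finM by (simp add: mdF_def)

lemma mn_mdF: "d \<in> mdF f \<Longrightarrow> mn d \<in> mdF f" by (simp add: mdF_def mn_M lf_mn)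

lemma mdF_M: "d \<in> mdF f \<Longrightarrow> d \<in> M" by (simp add: mdF_def)

lemma mn_ne: "d \<in> M \<Longrightarrow> mn d \<noteq> d" using mh_ne fst_mn by metis

lemma kf_ge2:
  assumes "f \<in> lf ` A" shows "2 \<le> kf f"
proof -
  obtain d where d: "d \<in> A" "lf d = f" using assms by auto
  have "\<exists>d'. d' \<in> mdF f"
  proof (cases "fst d \<in> W")
    case True then show ?thesis using d unfolding mdF_def M_def by blast
  next
    case False
    obtain a w where aw: "d = (a,w)" by (cases d)
    obtain e where e: "e \<in> E" "a = b e" using N_W False A_N[of a w] d aw by auto
    have "w \<in> W" using bend_step[OF A_sym, of a w] d aw False by auto
    then have "nx d \<in> mdF f" using nx_A[OF d(1)] lf_nx[OF d(1)] d(2) aw by (simp add: mdF_def M_def)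
    then show ?thesis by blast
  qed
  then obtain d' where d': "d' \<in> mdF f" by blast
  then have "{d', mn d'} \<subseteq> mdF f" using mn_mdF by simp
  moreover have "card {d', mn d'} = 2" using mn_ne[OF mdF_M[OF d']] by (metis card_2_iff)
  ultimately show ?thesis unfolding kf_def using card_mono[OF fin_mdF] by metis
qed

lemma kf2:
  assumes k: "kf f = 2" and d: "d \<in> mdF f"
  shows "mdF f = {d, mn d}" "mn (mn d) = d"
proof -
  have n: "mn d \<noteq> d" using mn_ne mdF_M[OF d] by simp
  have "card {d, mn d} = 2" using n by (metis card_2_iff)
  then show s: "mdF f = {d, mn d}"
    using card_subset_eq[OF fin_mdF, of "{d, mn d}" f] k d mn_mdF[OF d] by (simp add: kf_def)
  have "mn (mn d) \<in> {d, mn d}" using s mn_mdF[OF mn_mdF[OF d]] by simp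
  then show "mn (mn d) = d" using mn_ne mdF_M[OF mn_mdF[OF d]] by auto
qed

text \<open>The boundary could consist of several closed walks, but each of them has at least two
  sides; three sides therefore form a single cycle.\<close>

lemma kf3:
  assumes k: "kf f = 3" and d: "d \<in> mdF f"
  shows "mdF f = {d, mn d, mn (mn d)}" "mn (mn (mn d)) = d" "mn (mn d) \<noteq> d"
proof -
  note m = mdF_M
  have d2: "mn d \<in> mdF f" "mn (mn d) \<in> mdF f" "mn (mn (mn d)) \<in> mdF f" using d mn_mdF by simp_all
  have n1: "mn d \<noteq> d" "mn (mn d) \<noteq> mn d" using mn_ne m d d2 by simp_all
  show n3: "mn (mn d) \<noteq> d"
  proof
    assume e: "mn (mn d) = d"
    have "card {d, mn d} \<le> 2" by (metis card_2_iff n1(1) order_refl)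
    then have "\<not> mdF f \<subseteq> {d, mn d}" using k card_mono[of "{d, mn d}" "mdF f"] by (auto simp: kf_def)
    then obtain d3 where d3: "d3 \<in> mdF f" "d3 \<noteq> d" "d3 \<noteq> mn d" by auto
    have m3: "mn d3 \<in> mdF f" "mn d3 \<noteq> d3" using d3 mn_mdF mn_ne m by simp_all
    have "mn d3 \<noteq> d" "mn d3 \<noteq> mn d" using mn_inj[of d3 "mn d"] mn_inj[of d3 d] e d3 d d2 m by auto
    then have "card {d, mn d, d3, mn d3} = 4" using n1 d3 m3 by auto
    moreover have "{d, mn d, d3, mn d3} \<subseteq> mdF f" using d d2 d3 m3 by simp
    ultimately show False using card_mono[OF fin_mdF, of "{d, mn d, d3, mn d3}" f] k by (simp add: kf_def)
  qed
  have "card {d, mn d, mn (mn d)} = 3" using n1 n3 by auto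
  then show s: "mdF f = {d, mn d, mn (mn d)}"
    using card_subset_eq[OF fin_mdF, of "{d, mn d, mn (mn d)}" f] k d d2 by (simp add: kf_def)
  have "mn (mn (mn d)) \<in> {d, mn d, mn (mn d)}" using s d2 by simp
  moreover have "mn (mn (mn d)) \<noteq> mn (mn d)" using mn_ne m d2 by simp
  moreover have "mn (mn (mn d)) \<noteq> mn d" using mn_inj[of "mn (mn d)" d] n3 d d2 m by auto
  ultimately show "mn (mn (mn d)) = d" by auto
qed

lemma sum_mdF: "(\<Sum>f\<in>lf ` A. card {d\<in>mdF f. Q d}) = card {d\<in>M. Q d}"
proof -
  have "{d\<in>M. Q d} = (\<Union>f\<in>lf ` A. {d\<in>mdF f. Q d})" by (auto simp: mdF_def M_def)
  moreover have "card (\<Union>f\<in>lf ` A. {d\<in>mdF f. Q d}) = (\<Sum>f\<in>lf ` A. card {d\<in>mdF f. Q d})"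
  proof (rule card_UN_disjoint)
    show "finite (lf ` A)" "\<forall>f\<in>lf ` A. finite {d\<in>mdF f. Q d}" using finA fin_mdF by auto
  qed (auto simp: mdF_def)
  ultimately show ?thesis by simp
qed

text \<open>As many sides start at a vertex as it has edges, and four start at every
  crossing.\<close>

lemma card_M: "card M = 2 * card E + 4 * card X"
proof -
  have "M = Sigma W nbr" using W_N A_N by (auto simp: M_def nbr_def)
  then have "card M = (\<Sum>w\<in>W. card (nbr w))"
    using card_SigmaI[of W nbr] finite_nbr finV finX by (simp add: W_def)
  also have "\<dots> = (\<Sum>w\<in>p ` V. card (nbr w)) + (\<Sum>w\<in>X. card (nbr w))"
    unfolding W_def by (rule sum.union_disjoint[OF finite_imageI[OF finV] finX]) (use X_disj(1) in auto)
  also have "(\<Sum>w\<in>X. card (nbr w)) = 4 * card X" by (simp add: card_nbr_X)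
  finally show ?thesis using sum_nbr_V by simp
qed

lemma sum_kf: "(\<Sum>f\<in>lf ` A. kf f) = 2 * card E + 4 * card X"
  using sum_mdF[of "\<lambda>_. True"] card_M by (simp add: kf_def)

end

section \<open>Claiming bends by small faces\<close>

context drawing begin

lemma dart_vertex_own:
  assumes A: "(p u, c) \<in> A" and u: "u \<in> V"
  shows "\<exists>e s. own (p u, c) = (e,u) \<and> e \<in> E \<and> u \<in> e \<and> c \<in> hs e u \<and> 0 < s \<and> c - p u = of_real s * (b e - p u)"
proof -
  obtain e v where e: "e \<in> E" "v \<in> e" "p u \<in> hs e v" "c \<in> hs e v" "own (p u,c) = (e,v)" by (rule own_cases[OF A])
  have v: "v = u" using p_in_hs[OF e(1,2) u e(3)] by simp
  obtain q s where "q \<in> {p v, b e}" "q \<noteq> p u" "s > 0" "c - p u = of_real s * (q - p u)"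
    using nbr_ray[OF A e(1-4)] by blast
  then show ?thesis using e v by auto
qed

lemma vertex_dart_unique:
  assumes d: "d \<in> M" "d' \<in> M" "fst d = p u" "fst d' = p u" "u \<in> V" "ed d = ed d'"
  shows "d = d'"
proof -
  obtain c where c: "d = (p u, c)" "(p u,c) \<in> A" using d M_A by (metis prod.collapse)
  obtain c' where c': "d' = (p u, c')" "(p u,c') \<in> A" using d M_A by (metis prod.collapse)
  obtain e s where e: "own (p u, c) = (e,u)" "0 < s" "c - p u = of_real s * (b e - p u)"
    using dart_vertex_own[OF c(2) d(5)] by blast
  obtain e' s' where e': "own (p u, c') = (e',u)" "0 < s'" "c' - p u = of_real s' * (b e' - p u)"
    using dart_vertex_own[OF c'(2) d(5)] by blast
  have "e = e'" using e e' d(6) c c' by (simp add: ed_def)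
  then show ?thesis using nbr_unique_dir[OF c(2) c'(2) e(3) _ e(2) e'(2)] e'(3) c c' by simp
qed

lemma vertex_ed: "d \<in> M \<Longrightarrow> fst d = p u \<Longrightarrow> u \<in> V \<Longrightarrow> u \<in> ed d"
  using dart_vertex_own[of u "snd d"] M_A[of d] by (cases d) (auto simp: ed_def)

lemma vertex_ed_mh: "d \<in> M \<Longrightarrow> mh d = p u \<Longrightarrow> u \<in> V \<Longrightarrow> u \<in> ed d"
  using vertex_ed[OF rv_M, of d u] rv_props[of d] by simp

lemma fst_on: "d \<in> M \<Longrightarrow> fst d \<in> on (ed d)"
proof -
  assume d: "d \<in> M"
  obtain a c where ac: "d = (a,c)" by (cases d)
  have A: "(a,c) \<in> A" using M_A[OF d] ac by simp
  show ?thesis by (rule own_cases[OF A]) (auto simp: on_def ed_def ac)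
qed

lemma mh_on: "d \<in> M \<Longrightarrow> mh d \<in> on (ed d)"
  using fst_on[OF rv_M, of d] rv_props[of d] by simp

text \<open>Only one side and its reverse run through the bend of an edge. This is what turns claims
  of bends into claims of edges.\<close>

lemma bend_dart_unique:
  assumes d: "d \<in> M" "d' \<in> M" and n: "snd d \<notin> W" "snd d' \<notin> W" and e: "ed d = ed d'"
  shows "d' = d \<or> d' = rv d"
proof -
  have 1: "snd d = b (ed d)" using d(1) n(1) by (cases rule: M_cases) (auto simp: ed_def)
  have 2: "snd d' = b (ed d')" using d(2) n(2) by (cases rule: M_cases) (auto simp: ed_def)
  have eq: "snd d' = snd d" using 1 2 e by simp
  from d(1) show ?thesis
  proof (cases rule: M_cases)
    case (straight a c) then show ?thesis using n by simp
  next
    case (bend a c f u v)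
    have s': "snd d' = b f" using eq bend by simp
    then have A': "(b f, fst d') \<in> A" using M_A[OF d(2)] A_sym by (metis prod.collapse)
    obtain w where w: "own (b f, fst d') = (f,w)" "w \<in> f" using b_nbr_own[OF bend(5) A'] by auto
    have "f = {u,v}" using E_other[OF bend(5,6)] bend(7,8) by auto
    then have "w = u \<or> w = v" using w by auto
    then show ?thesis
    proof
      assume "w = u"
      then have "fst d' = a" using b_nbr_unique[OF bend(5) A' A_sym[OF bend(2)]] w own_sym[OF bend(2)] bend by simp
      then show ?thesis using bend(1) s' by (metis prod.collapse)
    next
      assume "w = v"
      then have "fst d' = c" using b_nbr_unique[OF bend(5) A' bend(10)] w bend by simp
      then show ?thesis using bend(21) s' by (metis prod.collapse)
    qed
  qed
qed

lemma turn_bend: "d \<in> M \<Longrightarrow> turn d \<noteq> 0 \<Longrightarrow> snd d \<notin> W"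
  by (erule M_cases) (auto simp: turn_def b_notin_W)

text \<open>The direction at the point \<open>x\<close> of the edge \<open>g\<close> that leads along \<open>g\<close> to its end \<open>u\<close>.\<close>

definition tow :: "'a set \<Rightarrow> 'a \<Rightarrow> complex \<Rightarrow> complex" where
  "tow g u x = (if x \<in> hs g u then p u - x else b g - x)"

lemma X_ne: "x \<in> X \<Longrightarrow> u \<in> V \<Longrightarrow> x \<noteq> p u" "x \<in> X \<Longrightarrow> e \<in> E \<Longrightarrow> x \<noteq> b e"
  using X_disj by auto

lemma tow_nz: "x \<in> X \<Longrightarrow> u \<in> V \<Longrightarrow> g \<in> E \<Longrightarrow> tow g u x \<noteq> 0"
  using X_ne by (auto simp: tow_def)

lemma tow_end:
  assumes d: "d \<in> M" and u: "mh d = p u" "u \<in> V" and x: "fst d \<in> X"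
  shows "pp (od d) (tow (ed d) u (fst d))"
  using d
proof (cases rule: M_cases)
  case (straight a c)
  obtain e w where e: "e \<in> E" "w \<in> e" "a \<in> hs e w" "c \<in> hs e w" "own (a,c) = (e,w)" by (rule own_cases[OF straight(2)])
  have "w = u" using p_in_hs[OF e(1,2) u(2)] e(4) straight(6) u(1) by simp
  then show ?thesis using e straight u(1) by (simp add: tow_def od_def ed_def)
next
  case (bend a c e v w)
  have "w = u" using p_in_hs[OF bend(5,7) u(2)] bend(15,18) u(1) by simp
  moreover have "a \<noteq> b e" using X_ne(2)[OF x bend(5)] bend(1) by simp
  ultimately have "a \<notin> hs e u" using hs_other[OF bend(5,6), of u a] bend(7,8,14) by auto
  then show ?thesis using bend(1,12,20) by (simp add: tow_def ed_def)
qed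

lemma hs_param_X:
  assumes "x \<in> hs e w" "e \<in> E" "w \<in> e" "x \<in> X"
  shows "\<exists>r. 0 < r \<and> r < 1 \<and> x = p w + of_real r * (b e - p w)"
proof -
  obtain r where r: "0 \<le> r" "r \<le> 1" "x = p w + of_real r * (b e - p w)" using assms(1) unfolding hs_def closed_segment_param by blast
  have "r \<noteq> 0" "r \<noteq> 1" using r X_ne(1)[OF assms(4) E_V[OF assms(2,3)]] X_ne(2)[OF assms(4,2)] by auto
  then show ?thesis using r by (intro exI[of _ r]) auto
qed

lemma pp_of_real: "0 < s * t \<Longrightarrow> pp (of_real s * z) (of_real t * z)"
proof -
  assume st: "0 < s * t"
  then have "t \<noteq> 0" "0 < s / t" by (auto simp: zero_less_mult_iff zero_less_divide_iff)
  then show ?thesis unfolding pp_def by (intro exI[of _ "s / t"]) simp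
qed

text \<open>Any side between two crossings of an edge at \<open>u\<close> leads towards
  \<open>u\<close> in one of its two orientations.\<close>

lemma tow_pass:
  assumes d: "d \<in> M" and u: "u \<in> ed d" and x: "fst d \<in> X" "mh d \<in> X"
  shows "pp (od d) (tow (ed d) u (fst d)) \<or> pp (- idr d) (tow (ed d) u (mh d))"
  using d
proof (cases rule: M_cases)
  case (straight a c)
  obtain e w where e: "e \<in> E" "w \<in> e" "a \<in> hs e w" "c \<in> hs e w" "own (a,c) = (e,w)" by (rule own_cases[OF straight(2)])
  define Q where "Q = b e - p w"
  have xac: "a \<in> X" "c \<in> X" using x straight by auto
  obtain r where r: "0 < r" "r < 1" "a = p w + of_real r * Q" using hs_param_X[OF e(3,1,2) xac(1)] Q_def by auto
  obtain t where t: "0 < t" "t < 1" "c = p w + of_real t * Q" using hs_param_X[OF e(4,1,2) xac(2)] Q_def by auto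
  have rt: "r \<noteq> t" using r t A_ne[OF straight(2)] by auto
  have od: "od d = of_real (t - r) * Q" "- idr d = of_real (r - t) * Q"
    using straight(1,7) r(3) t(3) by (simp_all add: od_def algebra_simps)
  have ede: "ed d = e" using e straight by (simp add: ed_def)
  have fd: "fst d = a" "mh d = c" using straight by simp_all
  show ?thesis
  proof (cases "u = w")
    case True
    have tw: "tow e u a = of_real (- r) * Q" "tow e u c = of_real (- t) * Q" using True e r(3) t(3) by (simp_all add: tow_def)
    have "0 < (t - r) * (- r) \<or> 0 < (r - t) * (- t)" 
    proof (cases "t < r")
      case True
      then have "0 < (t - r) * (- r)" using r(1) by (intro mult_neg_neg) auto
      then show ?thesis by blast
    next
      case False
      then have "0 < (r - t) * (- t)" using rt t(1) by (intro mult_neg_neg) auto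
      then show ?thesis by blast
    qed
    then show ?thesis unfolding od ede fd tw using pp_of_real[of "t - r" "- r" Q] pp_of_real[of "r - t" "- t" Q] by blast
  next
    case False
    have ue: "u \<in> e" using u ede by simp
    have "a \<notin> hs e u" "c \<notin> hs e u" using hs_other[OF e(1) ue e(2)] e(3,4) False X_ne(2) xac e(1) by blast+
    then have "tow e u a = b e - a" "tow e u c = b e - c" by (simp_all add: tow_def)
    moreover have "b e - a = of_real (1 - r) * Q" "b e - c = of_real (1 - t) * Q"
      unfolding r(3) t(3) Q_def by (simp_all add: algebra_simps)
    ultimately have tw: "tow e u a = of_real (1 - r) * Q" "tow e u c = of_real (1 - t) * Q" by simp_all
    have "0 < (t - r) * (1 - r) \<or> 0 < (r - t) * (1 - t)" using rt r(2) t(2) by (cases "t < r") auto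
    then show ?thesis unfolding od ede fd tw using pp_of_real[of "t - r" "1 - r" Q] pp_of_real[of "r - t" "1 - t" Q] by blast
  qed
next
  case (bend a c e v w)
  have xac: "a \<in> X" "c \<in> X" using x bend by auto
  have ede: "ed d = e" using bend by (simp add: ed_def)
  have "e = {v,w}" using E_other[OF bend(5,6)] bend(7,8) by auto
  then have "u = v \<or> u = w" using u ede by auto
  then show ?thesis
  proof
    assume uv: "u = v"
    have "c \<notin> hs e u" using hs_other[OF bend(5,6,7), of c] uv bend(8,15) X_ne(2)[OF xac(2) bend(5)] by auto
    then have "tow e u c = - idr d" using bend(19) by (simp add: tow_def)
    then show ?thesis using ede bend by simp
  next
    assume uw: "u = w"
    have "a \<notin> hs e u" using hs_other[OF bend(5,7,6), of a] uw bend(8,14) X_ne(2)[OF xac(1) bend(5)] by auto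
    then have "tow e u a = od d" using bend(20) by (simp add: tow_def)
    then show ?thesis using ede bend by simp
  qed
qed

text \<open>The exceptional sides: the edge that crosses at the head ends at \<open>u\<close> as
  well. For these, convexity of the bend does not decide which of the two adjacent faces should have
  it.\<close>

definition radial :: "complex \<times> complex \<Rightarrow> 'a \<Rightarrow> bool" where
  "radial d u \<longleftrightarrow> d \<in> M \<and> u \<in> V \<and> fst d = p u \<and> mh d \<in> X \<and> u \<in> ed (mn d)"

text \<open>A bent side from a vertex \<open>u\<close> to a crossing with another edge at \<open>u\<close> is claimed by the face that lies on the
  part of this other edge towards \<open>u\<close>, any other side by the face in which its bend is convex.\<close>

definition cl0 :: "complex \<times> complex \<Rightarrow> bool" where
  "cl0 d \<longleftrightarrow> turn d \<noteq> 0 \<and>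
    (if \<exists>u. radial d u then \<exists>u. radial d u \<and> pp (\<i> * idr d) (tow (ed (mn d)) u (mh d))
     else if \<exists>u. radial (rv d) u then \<exists>u. radial (rv d) u \<and> pp (\<i> * od d) (tow (ed (mn (rv d))) u (fst d))
     else 0 < turn d)"

lemma radial_unique: "radial d u \<Longrightarrow> radial d v \<Longrightarrow> u = v"
  using p_inj by (auto simp: radial_def inj_on_def)

lemma radial_rv: "radial d u \<Longrightarrow> \<not> radial (rv d) v"
  using X_ne(1)[of "mh d" v] rv_props(1)[of d] by (auto simp: radial_def)

text \<open>Reversing a side negates the quantity that decides: the direction at the crossing for an
  exceptional side, the turn for any other side.\<close>

lemma cl0_excl:
  assumes d: "d \<in> M" shows "\<not> (cl0 d \<and> cl0 (rv d))"
proof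
  assume c: "cl0 d \<and> cl0 (rv d)"
  note r = rv_props[OF d]
  have main: False if h: "d \<in> M" "radial d u" "cl0 d" "cl0 (rv d)" for d u
  proof -
    note r = rv_props[OF h(1)]
    have 1: "pp (\<i> * idr d) (tow (ed (mn d)) u (mh d))" using h(2,3) radial_unique unfolding cl0_def by (metis (full_types))
    have "\<not> (\<exists>v. radial (rv d) v)" using radial_rv[OF h(2)] by blast
    then have 2: "pp (\<i> * od (rv d)) (tow (ed (mn d)) u (mh d))"
      using h(2,4) radial_unique r unfolding cl0_def by (metis (full_types))
    then have 3: "pp (- (\<i> * idr d)) (tow (ed (mn d)) u (mh d))" using r(3) by simp
    have "tow (ed (mn d)) u (mh d) \<noteq> 0"
      using h(2) tow_nz ed_E[OF mn_M[OF h(1)]] by (auto simp: radial_def)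
    then show False using pp_not_minus[OF 1 3] by simp
  qed
  show False
  proof (cases "\<exists>u. radial d u")
    case True then show False using main[OF d] c by blast
  next
    case F: False
    show False
    proof (cases "\<exists>u. radial (rv d) u")
      case True then show False using main[OF rv_M[OF d]] c r(6) by auto
    next
      case False
      have "0 < turn d" using c F False unfolding cl0_def by auto
      moreover have "0 < turn (rv d)" using c F False r(6) unfolding cl0_def by auto
      ultimately show False using r(7) by simp
    qed
  qed
qed

text \<open>Faces that have to claim \<open>4 - kf f\<close> bends to balance Euler's formula.\<close>

definition needy :: "complex set \<Rightarrow> bool" where
  "needy f \<longleftrightarrow> f \<in> lf ` A \<and> kf f \<le> 3 \<and> vf f \<le> 1"

text \<open>The subtraction is truncated at 0, so a face with at least four sides is always
  satisfied.\<close>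

definition sat :: "(complex \<times> complex \<Rightarrow> bool) \<Rightarrow> complex set \<Rightarrow> bool" where
  "sat c f \<longleftrightarrow> 4 - kf f \<le> card {d\<in>mdF f. c d}"

lemma sat1:
  assumes "kf f = 3" "d \<in> mdF f" "c d" shows "sat c f"
proof -
  have "{d} \<subseteq> {d\<in>mdF f. c d}" using assms by simp
  then have "card {d} \<le> card {d\<in>mdF f. c d}" by (rule card_mono[rotated]) (simp add: fin_mdF)
  then show ?thesis using assms(1) by (simp add: sat_def)
qed

lemma sat2:
  assumes "kf f = 2" "\<And>d. d \<in> mdF f \<Longrightarrow> c d" shows "sat c f"
proof -
  have "{d\<in>mdF f. c d} = mdF f" using assms by auto
  then show ?thesis using assms(1) by (simp add: sat_def kf_def)
qed

lemma vf_two: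
  assumes "vf f \<le> 1" "d \<in> mdF f" "d' \<in> mdF f" "fst d \<in> p ` V" "fst d' \<in> p ` V" shows "d = d'"
proof (rule ccontr)
  assume "d \<noteq> d'"
  then have "card {d,d'} = 2" by simp
  moreover have "card {d,d'} \<le> vf f" unfolding vf_def by (rule card_mono) (use assms fin_mdF in auto)
  ultimately show False using assms(1) by simp
qed

section \<open>Right angles force convex bends in bounded faces\<close>

lemma fst_cases: "d \<in> M \<Longrightarrow> fst d \<in> p ` V \<or> fst d \<in> X" by (auto simp: M_def W_def)

lemma mh_cases: "d \<in> M \<Longrightarrow> mh d \<in> p ` V \<or> mh d \<in> X" using mh_W by (auto simp: W_def)

text \<open>Vectors from \<open>x\<close> into the triangle are nonnegative combinations of its two
  sides at \<open>x\<close>. If these sides had a positive inner product, so would any two such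
  nonzero vectors.\<close>

lemma right_angle_hull:
  fixes x q r a c :: complex
  assumes "a \<in> convex hull {x,q,r}" "c \<in> convex hull {x,q,r}" "a \<noteq> x" "c \<noteq> x" "(a - x) \<bullet> (c - x) = 0"
  shows "(q - x) \<bullet> (r - x) \<le> 0" "q \<noteq> x"
proof -
  have par: "\<exists>\<beta> \<gamma>. 0 \<le> \<beta> \<and> 0 \<le> \<gamma> \<and> z - x = \<beta> *\<^sub>R (q - x) + \<gamma> *\<^sub>R (r - x)" if z: "z \<in> convex hull {x,q,r}" for z
  proof -
    obtain u v w where u: "0 \<le> u" "0 \<le> v" "0 \<le> w" "u + v + w = 1" "z = u *\<^sub>R x + v *\<^sub>R q + w *\<^sub>R r"
      using z unfolding convex_hull_3 by auto
    have u1: "u = 1 - v - w" using u(4) by simp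
    have "z - x = v *\<^sub>R (q - x) + w *\<^sub>R (r - x)" unfolding u(5) u1 by (simp add: algebra_simps)
    then show ?thesis using u by blast
  qed
  obtain \<beta> \<gamma> where 1: "0 \<le> \<beta>" "0 \<le> \<gamma>" "a - x = \<beta> *\<^sub>R (q - x) + \<gamma> *\<^sub>R (r - x)" using par[OF assms(1)] by blast
  obtain \<beta>' \<gamma>' where 2: "0 \<le> \<beta>'" "0 \<le> \<gamma>'" "c - x = \<beta>' *\<^sub>R (q - x) + \<gamma>' *\<^sub>R (r - x)" using par[OF assms(2)] by blast
  define Q R where "Q = q - x" and "R = r - x"
  have n: "\<beta> *\<^sub>R Q + \<gamma> *\<^sub>R R \<noteq> 0" "\<beta>' *\<^sub>R Q + \<gamma>' *\<^sub>R R \<noteq> 0" using assms(3,4) 1 2 by (auto simp: Q_def R_def)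
  have e: "\<beta> * \<beta>' * (Q \<bullet> Q) + \<gamma> * \<gamma>' * (R \<bullet> R) + (\<beta> * \<gamma>' + \<gamma> * \<beta>') * (Q \<bullet> R) = 0"
    using assms(5) unfolding 1(3) 2(3) Q_def[symmetric] R_def[symmetric]
    by (simp add: inner_add_left inner_add_right inner_commute[of R Q] algebra_simps)
  have nn: "0 \<le> \<beta> * \<beta>' * (Q \<bullet> Q)" "0 \<le> \<gamma> * \<gamma>' * (R \<bullet> R)" "0 \<le> \<beta> * \<gamma>'" "0 \<le> \<gamma> * \<beta>'" using 1 2 by auto
  have le: "Q \<bullet> R \<le> 0"
  proof (rule ccontr)
    assume "\<not> Q \<bullet> R \<le> 0"
    then have pos: "0 < Q \<bullet> R" by simp
    then have QR: "Q \<noteq> 0" "R \<noteq> 0" by auto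
    have "0 \<le> (\<beta> * \<gamma>' + \<gamma> * \<beta>') * (Q \<bullet> R)" using nn pos by simp
    then have z: "\<beta> * \<beta>' * (Q \<bullet> Q) = 0" "\<gamma> * \<gamma>' * (R \<bullet> R) = 0" "(\<beta> * \<gamma>' + \<gamma> * \<beta>') * (Q \<bullet> R) = 0" using e nn by linarith+
    then have "\<beta> * \<gamma>' + \<gamma> * \<beta>' = 0" using pos by simp
    then have "\<beta> * \<gamma>' = 0" "\<gamma> * \<beta>' = 0" using nn by linarith+
    moreover have "\<beta> * \<beta>' = 0" "\<gamma> * \<gamma>' = 0" using z QR by auto
    ultimately have "(\<beta> = 0 \<and> \<gamma> = 0) \<or> (\<beta>' = 0 \<and> \<gamma>' = 0)" by auto
    then show False using n by auto
  qed
  then show "(q - x) \<bullet> (r - x) \<le> 0" by (simp add: Q_def R_def)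
  show "q \<noteq> x"
  proof
    assume "q = x"
    then have "Q = 0" by (simp add: Q_def)
    then have "\<gamma> * \<gamma>' * (R \<bullet> R) = 0" "\<gamma> *\<^sub>R R \<noteq> 0" "\<gamma>' *\<^sub>R R \<noteq> 0" using e n by auto
    then show False by auto
  qed
qed

text \<open>Angles of at least a right angle at both \<open>x\<close> and \<open>y\<close> give two
  nonpositive inner products, whose sum is the squared distance of \<open>x\<close> and
  \<open>y\<close>.\<close>

lemma two_right_angles:
  fixes x y r :: complex
  assumes x: "a \<in> convex hull {x,y,r}" "c \<in> convex hull {x,y,r}" "a \<noteq> x" "c \<noteq> x" "(a - x) \<bullet> (c - x) = 0"
    and y: "a' \<in> convex hull {x,y,r}" "c' \<in> convex hull {x,y,r}" "a' \<noteq> y" "c' \<noteq> y" "(a' - y) \<bullet> (c' - y) = 0"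
  shows False
proof -
  have e: "{x,y,r} = {y,x,r}" by auto
  have 1: "(y - x) \<bullet> (r - x) \<le> 0" "y \<noteq> x" using right_angle_hull[OF x] by auto
  have 2: "(x - y) \<bullet> (r - y) \<le> 0" using right_angle_hull(1)[of a' y x r c'] y e by simp
  have "(y - x) \<bullet> (y - x) = (y - x) \<bullet> (r - x) + (x - y) \<bullet> (r - y)" by (simp add: inner_diff_left inner_diff_right algebra_simps)
  then have "(y - x) \<bullet> (y - x) \<le> 0" using 1 2 by simp
  moreover have "0 < (y - x) \<bullet> (y - x)" unfolding inner_gt_zero_iff using 1(2) by simp
  ultimately show False by linarith
qed

lemma inner_i: "z \<bullet> (\<i> * z) = 0" by (simp add: inner_complex_def)

lemma P_finite: "finite (P f)"
proof -
  have "P f \<subseteq> fst ` A" unfolding P_def by blast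
  then show ?thesis using finA finite_subset by blast
qed

lemma pred_dart:
  assumes "d \<in> A" "fst d \<notin> W"
  shows "\<exists>a. (a, fst d) \<in> M \<and> nx (a, fst d) = d \<and> snd d \<noteq> a \<and> turn (a, fst d) = Im (cnj (fst d - a) * (snd d - fst d))"
proof -
  obtain w c where wc: "d = (w,c)" by (cases d)
  have A: "(c,w) \<in> A" "w \<notin> W" using A_sym[of w c] assms wc by auto
  obtain a where a: "nx (c,w) = (w,a)" "(w,a) \<in> A" "a \<noteq> c" "a \<in> W" "nx (a,w) = (w,c)"
    using bend_step[OF A] by blast
  have m: "(a,w) \<in> M" using A_sym[OF a(2)] a(4) by (simp add: M_def)
  have "turn (a,w) = Im (cnj (w - a) * (c - w))" using A(2) a(5) by (simp add: turn_def od_def idr_def ml_def)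
  then show ?thesis using m a wc by auto
qed

text \<open>At an extreme node the boundary of a bounded face turns left, so an extreme bend is a
  convex one.\<close>

lemma face_points_hull:
  assumes iso: "\<And>w. w \<in> N \<Longrightarrow> nbr w \<noteq> {}" and b: "bounded f"
  shows "P f \<subseteq> convex hull (fst ` mdF f \<union> snd ` {d\<in>mdF f. 0 < turn d})"
proof -
  let ?R = "fst ` mdF f \<union> snd ` {d\<in>mdF f. 0 < turn d}"
  have "{w. w extreme_point_of (convex hull (P f))} \<subseteq> ?R"
  proof
    fix w assume "w \<in> {w. w extreme_point_of (convex hull (P f))}"
    then have ext: "w extreme_point_of (convex hull (P f))" by simp
    then have "w \<in> P f" using extreme_point_of_convex_hull by blast
    then obtain d where d: "d \<in> A" "lf d = f" "fst d = w" by (auto simp: P_def)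
    show "w \<in> ?R"
    proof (cases "w \<in> W")
      case True
      then have "d \<in> mdF f" using d by (simp add: mdF_def M_def)
      then show ?thesis using d(3) by blast
    next
      case False
      then obtain a where a: "(a,w) \<in> M" "nx (a,w) = d" "snd d \<noteq> a" "turn (a,w) = Im (cnj (w - a) * (snd d - w))"
        using pred_dart[OF d(1)] d(3) by blast
      have lfa: "lf (a,w) = f" using lf_nx[OF M_A[OF a(1)]] a(2) d(2) by simp
      have nx: "nx (a,w) = (w, snd d)" using a(2) d(3) by (metis prod.collapse)
      have "0 < Im (cnj (w - a) * (snd d - w))"
        using extreme_left_turn[OF iso M_A[OF a(1)] nx a(3)] b ext lfa by simp
      then have "(a,w) \<in> {d\<in>mdF f. 0 < turn d}" using a lfa by (simp add: mdF_def)
      then show ?thesis by force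
    qed
  qed
  then have "convex hull {w. w extreme_point_of (convex hull (P f))} \<subseteq> convex hull ?R" by (rule hull_mono)
  moreover have "convex hull (P f) = convex hull {w. w extreme_point_of (convex hull (P f))}"
    by (rule Krein_Milman_polytope[OF P_finite])
  ultimately show ?thesis using hull_subset[of "P f" convex] by auto
qed

lemma corner:
  assumes d: "d \<in> mdF f" and x: "mh d \<in> X"
  shows "fst (ml d) \<in> P f" "snd (mn d) \<in> P f" "fst (ml d) \<noteq> mh d" "snd (mn d) \<noteq> mh d"
    "(fst (ml d) - mh d) \<bullet> (snd (mn d) - mh d) = 0"
proof -
  have dM: "d \<in> M" using mdF_M[OF d] .
  show "fst (ml d) \<in> P f" using P_fst[OF ml_A[OF dM]] lf_ml[OF dM] d by (simp add: mdF_def)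
  show "snd (mn d) \<in> P f" using P_snd[OF M_A[OF mn_M[OF dM]]] lf_mn[OF dM] d by (simp add: mdF_def)
  show "fst (ml d) \<noteq> mh d" using idr_nz[OF dM] by (auto simp: idr_def mh_def)
  have o: "od (mn d) = snd (mn d) - mh d" by (simp add: od_def)
  then show "snd (mn d) \<noteq> mh d" using od_nz[OF mn_M[OF dM]] by auto
  obtain s where s: "od (mn d) = of_real s * (\<i> * idr d)" using mn_cross(1)[OF dM x] by (auto simp: pp_def)
  have i: "fst (ml d) - mh d = - idr d" by (simp add: idr_def mh_def)
  have "of_real s * (\<i> * idr d) = s *\<^sub>R (\<i> * idr d)" by (simp add: scaleR_conv_of_real)
  then show "(fst (ml d) - mh d) \<bullet> (snd (mn d) - mh d) = 0" unfolding o[symmetric] i s by (simp add: inner_i)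
qed

text \<open>Without a convex bend the whole boundary lies in the triangle of the three corners, and
  at least two of these are crossings with right angles.\<close>

lemma bounded_k3:
  assumes iso: "\<And>w. w \<in> N \<Longrightarrow> nbr w \<noteq> {}" and b: "bounded f" and k: "kf f = 3" and v: "vf f \<le> 1"
  shows "\<exists>d\<in>mdF f. 0 < turn d"
proof (rule ccontr)
  assume "\<not> ?thesis"
  then have no: "{d\<in>mdF f. 0 < turn d} = {}" by auto
  have "mdF f \<noteq> {}" using k by (auto simp: kf_def)
  then obtain d0 where d0: "d0 \<in> mdF f" by auto
  have "\<exists>d\<in>mdF f. mh d \<in> X \<and> mh (mn d) \<in> X"
  proof -
    have m: "mn d0 \<in> mdF f" "mn (mn d0) \<in> mdF f" using d0 mn_mdF by auto
    have c: "mh d0 \<in> p ` V \<or> mh d0 \<in> X" "mh (mn d0) \<in> p ` V \<or> mh (mn d0) \<in> X" "mh (mn (mn d0)) \<in> p ` V \<or> mh (mn (mn d0)) \<in> X"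
      using mh_cases mdF_M d0 m by blast+
    have n: "mn d0 \<noteq> d0" "mn (mn d0) \<noteq> mn d0" "mn (mn d0) \<noteq> d0" "mn (mn (mn d0)) = d0"
      using mn_ne mdF_M d0 m kf3[OF k d0] by auto
    have f: "fst (mn d0) = mh d0" "fst (mn (mn d0)) = mh (mn d0)" "fst d0 = mh (mn (mn d0))"
      using fst_mn[of d0] fst_mn[of "mn d0"] fst_mn[of "mn (mn d0)"] n(4) by simp_all
    have "\<not> (mh d0 \<in> p ` V \<and> mh (mn d0) \<in> p ` V)" "\<not> (mh d0 \<in> p ` V \<and> mh (mn (mn d0)) \<in> p ` V)"
      "\<not> (mh (mn d0) \<in> p ` V \<and> mh (mn (mn d0)) \<in> p ` V)"
      using vf_two[OF v] d0 m n f by metis+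
    then show ?thesis using c d0 m n(4) by metis
  qed
  then obtain d where d: "d \<in> mdF f" "mh d \<in> X" "mh (mn d) \<in> X" by blast
  have "fst ` mdF f = {mh d, mh (mn d), fst d}" using kf3(1)[OF k d(1)] fst_mn[of d] fst_mn[of "mn d"] by auto
  then have sub: "P f \<subseteq> convex hull {mh d, mh (mn d), fst d}" using face_points_hull[OF iso b] no by simp
  note c1 = corner[OF d(1,2)] and c2 = corner[OF mn_mdF[OF d(1)] d(3)]
  show False
    by (rule two_right_angles[of "fst (ml d)" "mh d" "mh (mn d)" "fst d" "snd (mn d)" "fst (ml (mn d))" "snd (mn (mn d))"])
      (use c1 c2 sub in auto)
qed

text \<open>If \<open>d\<close> had no convex bend, the boundary would lie in the triangle of the
  two crossings and the bend of the other side, again with two right angles.\<close>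

lemma bounded_k2:
  assumes iso: "\<And>w. w \<in> N \<Longrightarrow> nbr w \<noteq> {}" and b: "bounded f" and k: "kf f = 2" and d: "d \<in> mdF f" and x: "fst d \<in> X" "mh d \<in> X"
  shows "0 < turn d"
proof (rule ccontr)
  assume no: "\<not> 0 < turn d"
  have m: "mdF f = {d, mn d}" "mn (mn d) = d" using kf2[OF k d] by auto
  have h: "mh (mn d) = fst d" using fst_mn[of "mn d"] m(2) by simp
  have "fst ` mdF f \<union> snd ` {d\<in>mdF f. 0 < turn d} \<subseteq> {mh d, mh (mn d), snd (mn d)}" using m(1) no h by auto
  then have "P f \<subseteq> convex hull {mh d, mh (mn d), snd (mn d)}"
    using face_points_hull[OF iso b] hull_mono by (metis (no_types, lifting) order_trans)
  moreover note c1 = corner[OF d x(2)] and c2 = corner[OF mn_mdF[OF d]]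
  ultimately show False
    using two_right_angles[of "fst (ml d)" "mh d" "mh (mn d)" "snd (mn d)" "snd (mn d)" "fst (ml (mn d))" "snd (mn (mn d))"]
      c1 c2 h x by auto
qed

end

text \<open>The condition \<open>star\<close> is what is extracted from having the fewest crossings:
  exceptional sides are bent, so there is a bend to be claimed.\<close>

locale star_drawing = drawing +
  assumes cover: "u \<in> V \<Longrightarrow> \<exists>e\<in>E. u \<in> e"
    and star: "d \<in> M \<Longrightarrow> u \<in> V \<Longrightarrow> fst d = p u \<Longrightarrow> mh d \<in> X \<Longrightarrow> u \<in> ed (mn d) \<Longrightarrow> turn d \<noteq> 0"
begin

lemma iso: "w \<in> N \<Longrightarrow> nbr w \<noteq> {}" by (rule nbr_nonempty[OF _ cover])

lemma k3_setup:
  assumes k: "kf f = 3" and v: "vf f \<le> 1" and ex: "\<exists>d\<in>mdF f. fst d \<in> p ` V"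
  obtains u d where "u \<in> V" "d \<in> mdF f" "fst d = p u" "mh d \<in> X" "mh (mn d) \<in> X" "mh (mn (mn d)) = p u"
    "mn (mn (mn d)) = d" "mn d \<in> mdF f" "mn (mn d) \<in> mdF f" "mdF f = {d, mn d, mn (mn d)}"
proof -
  obtain d where d: "d \<in> mdF f" "fst d \<in> p ` V" using ex by auto
  then obtain u where u: "u \<in> V" "fst d = p u" by auto
  note t = kf3[OF k d(1)]
  have m: "mn d \<in> mdF f" "mn (mn d) \<in> mdF f" using d mn_mdF by auto
  have n: "mn d \<noteq> d" using mn_ne mdF_M d by auto
  have "fst (mn d) \<notin> p ` V" using vf_two[OF v m(1) d(1)] d(2) n by auto
  then have 1: "mh d \<in> X" using mh_cases[OF mdF_M[OF d(1)]] by simp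
  have "fst (mn (mn d)) \<notin> p ` V" using vf_two[OF v m(2) d(1)] d(2) t(3) by auto
  then have 2: "mh (mn d) \<in> X" using mh_cases[OF mdF_M[OF m(1)]] by simp
  have 3: "mh (mn (mn d)) = p u" using fst_mn[of "mn (mn d)"] t(2) u(2) by simp
  show thesis by (rule that[OF u(1) d(1) u(2) 1 2 3 t(2) m t(1)])
qed

text \<open>Reversing the next side and turning left at the same crossing leads onto the
  continuation of the first edge.\<close>

lemma other_end:
  assumes d: "d \<in> M" and x: "mh d \<in> X"
  shows "ed (mn (rv (mn d))) = ed d"
proof -
  have m: "mn d \<in> M" using mn_M[OF d] .
  have r: "rv (mn d) \<in> M" "mh (rv (mn d)) = mh d" "ed (rv (mn d)) = ed (mn d)" using rv_M[OF m] rv_props[OF m] by auto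
  have "mh d \<in> on (ed d)" using mh_on[OF d] .
  then have "ed d = ed (rv (mn d)) \<or> ed d = ed (mn (rv (mn d)))"
    using mn_cross(3)[OF r(1) _ ed_E[OF d]] r(2) x by simp
  then show ?thesis using mn_cross(2)[OF d x] r(3) by auto
qed

lemma od_idr_next:
  assumes d: "d \<in> M" and x: "mh d \<in> X"
  shows "pp (od (mn d)) (\<i> * idr d)" "pp (\<i> * od (mn d)) (- idr d)"
proof -
  show 1: "pp (od (mn d)) (\<i> * idr d)" using mn_cross(1)[OF d x] .
  have "pp (\<i> * od (mn d)) (\<i> * (\<i> * idr d))" by (rule pp_mult[OF 1])
  then show "pp (\<i> * od (mn d)) (- idr d)" by (simp add: mult.assoc[symmetric])
qed

text \<open>The opposite side lies on an edge at \<open>u\<close>, which makes both sides at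
  \<open>u\<close> exceptional. It leads towards \<open>u\<close> from one of its two ends, and the
  face claims the side at \<open>u\<close> that meets it at this end.\<close>

lemma sat_radial:
  assumes k: "kf f = 3" and u: "u \<in> V" and d: "d \<in> mdF f" "fst d = p u" "mh d \<in> X" "mh (mn d) \<in> X" "mh (mn (mn d)) = p u"
    and g: "u \<in> ed (mn d)"
  shows "sat cl0 f"
proof -
  have m: "mn d \<in> mdF f" "mn (mn d) \<in> mdF f" using d mn_mdF by auto
  have M: "d \<in> M" "mn d \<in> M" "mn (mn d) \<in> M" using d m mdF_M by auto
  define d3 where "d3 = mn (mn d)"
  have r: "rv d3 \<in> M" "fst (rv d3) = p u" "mh (rv d3) = mh (mn d)" "turn (rv d3) = - turn d3"
    using rv_M[OF M(3)] rv_props[OF M(3)] d(5) by (simp_all add: d3_def)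
  have o: "ed (mn (rv d3)) = ed (mn d)" unfolding d3_def by (rule other_end[OF M(2) d(4)])
  have R1: "radial d u" using M u d g by (simp add: radial_def)
  have R3: "radial (rv d3) u" using r u d(4) o g by (simp add: radial_def)
  have t1: "turn d \<noteq> 0" by (rule star[OF M(1) u d(2,3) g])
  have t3: "turn d3 \<noteq> 0" using star[OF r(1) u r(2)] r(3,4) d(4) o g by simp
  have "pp (od (mn d)) (tow (ed (mn d)) u (fst (mn d))) \<or> pp (- idr (mn d)) (tow (ed (mn d)) u (mh (mn d)))"
    by (rule tow_pass[OF M(2) g]) (use d in simp_all)
  then show ?thesis
  proof
    assume "pp (od (mn d)) (tow (ed (mn d)) u (fst (mn d)))"
    then have "pp (\<i> * idr d) (tow (ed (mn d)) u (mh d))"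
      using pp_trans[OF pp_sym[OF od_idr_next(1)[OF M(1) d(3)]]] by simp
    then have "cl0 d" using t1 R1 unfolding cl0_def by auto
    then show ?thesis using sat1[OF k d(1)] by simp
  next
    assume "pp (- idr (mn d)) (tow (ed (mn d)) u (mh (mn d)))"
    then have a: "pp (\<i> * od d3) (tow (ed (mn (rv d3))) u (fst d3))"
      using pp_trans[OF od_idr_next(2)[OF M(2) d(4)]] o by (simp add: d3_def)
    have "\<not> (\<exists>v. radial d3 v)" using radial_rv[OF R3] rv_props(6)[OF M(3)] by (auto simp: d3_def)
    then have "cl0 d3" using t3 R3 a unfolding cl0_def by auto
    then show ?thesis using sat1[OF k m(2)] by (simp add: d3_def)
  qed
qed

text \<open>Both sides belong to edges at \<open>u\<close> that cross each other, and both are the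
  parts of these edges towards \<open>u\<close>. Hence the rule for exceptional sides gives both
  bends to the face between them.\<close>

lemma sat_digon1:
  assumes k: "kf f = 2" and d: "d \<in> mdF f" "fst d \<in> p ` V" and v: "vf f \<le> 1"
  shows "sat cl0 f"
proof -
  obtain u where u: "u \<in> V" "fst d = p u" using d by auto
  note t = kf2[OF k d(1)]
  have m: "mn d \<in> mdF f" using d mn_mdF by auto
  have M: "d \<in> M" "mn d \<in> M" using d m mdF_M by auto
  have n: "mn d \<noteq> d" using mn_ne M by auto
  have "fst (mn d) \<notin> p ` V" using vf_two[OF v m d(1)] d(2) n by auto
  then have x: "mh d \<in> X" using mh_cases[OF M(1)] by simp
  have e: "mh (mn d) = p u" using fst_mn[of "mn d"] t(2) u(2) by simp
  have g: "u \<in> ed (mn d)" using vertex_ed_mh[OF M(2) e u(1)] .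
  have g': "u \<in> ed d" using vertex_ed[OF M(1) u(2,1)] .
  define d2 where "d2 = mn d"
  have r: "rv d2 \<in> M" "fst (rv d2) = p u" "mh (rv d2) = mh d" "turn (rv d2) = - turn d2"
    using rv_M[OF M(2)] rv_props[OF M(2)] e by (simp_all add: d2_def)
  have o: "ed (mn (rv d2)) = ed d" unfolding d2_def by (rule other_end[OF M(1) x])
  have R1: "radial d u" using M u x g by (simp add: radial_def)
  have R2: "radial (rv d2) u" using r u x o g' by (simp add: radial_def)
  have t1: "turn d \<noteq> 0" by (rule star[OF M(1) u x g])
  have t2: "turn d2 \<noteq> 0" using star[OF r(1) u(1) r(2)] r(3,4) x o g' by simp
  have tw1: "pp (od (mn d)) (tow (ed (mn d)) u (mh d))"
    using tow_end[OF M(2) e u(1)] x by simp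
  have c1: "cl0 d" using t1 R1 pp_trans[OF pp_sym[OF od_idr_next(1)[OF M(1) x]] tw1] unfolding cl0_def by auto
  have rd: "rv d \<in> M" "mh (rv d) = p u" "fst (rv d) = mh d" "od (rv d) = - idr d" "ed (rv d) = ed d"
    using rv_M[OF M(1)] rv_props[OF M(1)] u by auto
  have tw2: "pp (- idr d) (tow (ed d) u (mh d))" using tow_end[OF rd(1,2) u(1)] x rd by simp
  have "\<not> (\<exists>v. radial d2 v)" using radial_rv[OF R2] rv_props(6)[OF M(2)] by (auto simp: d2_def)
  moreover have "pp (\<i> * od d2) (tow (ed (mn (rv d2))) u (fst d2))"
    using pp_trans[OF od_idr_next(2)[OF M(1) x] tw2] o by (simp add: d2_def)
  ultimately have c2: "cl0 d2" using t2 R2 unfolding cl0_def by auto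
  show ?thesis by (rule sat2[OF k]) (use t(1) c1 c2 in \<open>auto simp: d2_def\<close>)
qed

lemma cl0_default: "d \<in> M \<Longrightarrow> (\<And>u. \<not> radial d u) \<Longrightarrow> (\<And>u. \<not> radial (rv d) u) \<Longrightarrow> cl0 d \<longleftrightarrow> 0 < turn d"
  unfolding cl0_def by auto

lemma not_radial_X: "d \<in> M \<Longrightarrow> fst d \<in> X \<Longrightarrow> \<not> radial d u"
  using X_ne(1)[of "fst d" u] by (auto simp: radial_def)

lemma cl0_X: "d \<in> M \<Longrightarrow> fst d \<in> X \<Longrightarrow> mh d \<in> X \<Longrightarrow> cl0 d \<longleftrightarrow> 0 < turn d"
  by (rule cl0_default) (use not_radial_X rv_M rv_props in auto)

text \<open>If the side entering the vertex were exceptional in reverse, the opposite side would lie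
  on an edge at this vertex, and then the side leaving the vertex would be exceptional too.\<close>

lemma plain_k3:
  assumes k: "kf f = 3" and v: "vf f \<le> 1" and nr: "\<not> (\<exists>u d. u \<in> V \<and> d \<in> mdF f \<and> fst d = p u \<and> mh d \<in> X \<and> u \<in> ed (mn d))"
    and d: "d \<in> mdF f"
  shows "cl0 d \<longleftrightarrow> 0 < turn d"
proof (rule cl0_default[OF mdF_M[OF d]])
  have dM: "d \<in> M" using mdF_M[OF d] .
  show "\<not> radial d u" for u using nr d unfolding radial_def by blast
  show "\<not> radial (rv d) u" for u
  proof
    assume R: "radial (rv d) u"
    then have h: "u \<in> V" "mh d = p u" "fst d \<in> X" "u \<in> ed (mn (rv d))"
      using rv_props[OF dM] by (auto simp: radial_def)
    define c where "c = mn (mn d)"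
    have mc: "mn c = d" using kf3(2)[OF k d] by (simp add: c_def)
    have cm: "c \<in> mdF f" "mn d \<in> mdF f" using d mn_mdF by (auto simp: c_def)
    have cM: "c \<in> M" using mdF_M[OF cm(1)] .
    have hc: "mh c = fst d" using fst_mn[of c] mc by simp
    have "ed (mn (rv d)) = ed c" using other_end[OF cM] mc hc h(3) by simp
    then have uc: "u \<in> ed c" using h(4) by simp
    have fm: "fst (mn d) = p u" using h(2) by simp
    have x: "mh (mn d) \<in> X"
    proof -
      have "fst c \<notin> p ` V" using vf_two[OF v cm(1,2)] fm h(1) mn_ne[OF mdF_M[OF cm(2)]] by (auto simp: c_def)
      then show ?thesis using mh_cases[OF mdF_M[OF cm(2)]] by (simp add: c_def)
    qed
    show False using nr h(1) cm(2) fm x uc unfolding c_def by blast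
  qed
qed

lemma sat_k3:
  assumes k: "kf f = 3" and v: "vf f \<le> 1" and c: "bounded f \<or> (\<exists>d\<in>mdF f. 0 < turn d) \<or> 
     (\<exists>u d. u \<in> V \<and> d \<in> mdF f \<and> fst d = p u \<and> mh d \<in> X \<and> u \<in> ed (mn d))"
  shows "sat cl0 f"
proof (cases "\<exists>u d. u \<in> V \<and> d \<in> mdF f \<and> fst d = p u \<and> mh d \<in> X \<and> u \<in> ed (mn d)")
  case True
  then obtain u d where d: "u \<in> V" "d \<in> mdF f" "fst d = p u" "mh d \<in> X" "u \<in> ed (mn d)" by blast
  obtain u' d' where d': "u' \<in> V" "d' \<in> mdF f" "fst d' = p u'" "mh d' \<in> X" "mh (mn d') \<in> X" "mh (mn (mn d')) = p u'"
    by (rule k3_setup[OF k v]) (use d in blast)+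
  have "d' = d" using vf_two[OF v d'(2) d(2)] d d' by auto
  moreover have "u' = u" using calculation d d' p_inj by (auto simp: inj_on_def)
  ultimately show ?thesis using sat_radial[OF k d(1-4)] d' d by simp
next
  case False
  then have "\<exists>d\<in>mdF f. 0 < turn d" using c bounded_k3[OF iso _ k v] by blast
  then obtain d where d: "d \<in> mdF f" "0 < turn d" by auto
  then have "cl0 d" using plain_k3[OF k v False d(1)] by simp
  then show ?thesis using sat1[OF k d(1)] by simp
qed

lemma sat_k2:
  assumes k: "kf f = 2" and v: "vf f \<le> 1" and c: "bounded f \<or> (\<exists>d\<in>mdF f. fst d \<in> p ` V)"
  shows "sat cl0 f"
proof (cases "\<exists>d\<in>mdF f. fst d \<in> p ` V")
  case True
  then show ?thesis using sat_digon1[OF k _ _ v] by blast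
next
  case False
  then have b: "bounded f" using c by simp
  show ?thesis
  proof (rule sat2[OF k])
    fix d assume d: "d \<in> mdF f"
    have x: "fst d \<in> X" "mh d \<in> X"
      using fst_cases[OF mdF_M[OF d]] fst_cases[OF mdF_M[OF mn_mdF[OF d]]] False d mn_mdF[OF d] by auto
    show "cl0 d" using bounded_k2[OF iso b k d x] cl0_X[OF mdF_M[OF d] x] by simp
  qed
qed

text \<open>For the unbounded face, these points contain all extreme points of the drawing: a straight bend is never extreme.\<close>

definition hullQ :: "complex set \<Rightarrow> complex set" where
  "hullQ f = (fst ` mdF f \<inter> p ` V) \<union> snd ` {d\<in>mdF f. turn d \<noteq> 0}"

section \<open>Extreme points on the unbounded face\<close>

lemma halfplane_hull:
  fixes v :: complex assumes "x \<in> convex hull Q" "\<And>q. q \<in> Q \<Longrightarrow> 0 < (q - y) \<bullet> v" shows "0 < (x - y) \<bullet> v"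
proof -
  have "convex {z. y \<bullet> v < z \<bullet> v}" using convex_halfspace_gt[of "y \<bullet> v" v] by (simp add: inner_commute)
  moreover have "Q \<subseteq> {z. y \<bullet> v < z \<bullet> v}" using assms(2) by (auto simp: inner_diff_left)
  ultimately have "convex hull Q \<subseteq> {z. y \<bullet> v < z \<bullet> v}" by (rule hull_minimal[rotated])
  then show ?thesis using assms(1) by (auto simp: inner_diff_left)
qed

lemma halfplane_hull_le:
  fixes v :: complex assumes "x \<in> convex hull Q" "\<And>q. q \<in> Q \<Longrightarrow> 0 \<le> (q - y) \<bullet> v" shows "0 \<le> (x - y) \<bullet> v"
proof -
  have "convex {z. y \<bullet> v \<le> z \<bullet> v}" using convex_halfspace_ge[of "y \<bullet> v" v] by (simp add: inner_commute)
  moreover have "Q \<subseteq> {z. y \<bullet> v \<le> z \<bullet> v}" using assms(2) by (auto simp: inner_diff_left)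
  ultimately have "convex hull Q \<subseteq> {z. y \<bullet> v \<le> z \<bullet> v}" by (rule hull_minimal[rotated])
  then show ?thesis using assms(1) by (auto simp: inner_diff_left)
qed

text \<open>The four directions of a cross cannot all stay in a closed half plane.\<close>

lemma X_inner:
  assumes x: "x \<in> X" and v: "v \<noteq> 0" shows "\<exists>n\<in>N. (n - x) \<bullet> v < 0"
proof -
  obtain z where z: "z \<noteq> 0"
    and P2: "\<And>k. k \<in> {1,-1,\<i>,-\<i>} \<Longrightarrow> \<exists>c s. (x,c) \<in> A \<and> 0 < s \<and> c - x = of_real s * (k * z)"
    by (rule X_nbrs[OF x]) blast
  have "\<exists>k\<in>{1,-1,\<i>,-\<i>}. (k * z) \<bullet> v < 0"
  proof (rule ccontr)
    assume "\<not> ?thesis"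
    then have "0 \<le> z \<bullet> v" "0 \<le> (- z) \<bullet> v" "0 \<le> (\<i> * z) \<bullet> v" "0 \<le> (- (\<i> * z)) \<bullet> v" by auto
    then have e: "z \<bullet> v = 0" "(\<i> * z) \<bullet> v = 0" by auto
    obtain t where "v = of_real t * (\<i> * z)" using inner_zero_perp[OF z e(1)] by blast
    then have t: "v = t *\<^sub>R (\<i> * z)" by (simp add: scaleR_conv_of_real)
    then have "t * ((\<i> * z) \<bullet> (\<i> * z)) = 0" using e(2) by simp
    then have "t = 0" using z by simp
    then show False using t v by simp
  qed
  then obtain k where k: "k \<in> {1,-1,\<i>,-\<i>}" "(k * z) \<bullet> v < 0" by blast
  obtain c s where c: "(x,c) \<in> A" "0 < s" "c - x = of_real s * (k * z)" using P2[OF k(1)] by blast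
  have "c - x = s *\<^sub>R (k * z)" using c(3) by (simp add: scaleR_conv_of_real)
  then have "(c - x) \<bullet> v = s * ((k * z) \<bullet> v)" by simp
  then have "(c - x) \<bullet> v < 0" using k(2) c(2) by (simp add: mult_pos_neg)
  then show ?thesis using A_N2[OF c(1)] by blast
qed

text \<open>Otherwise the hull, and with it all nodes, would lie in the complementary closed half
  plane, against \<open>X_inner\<close>. Used with suitable directions \<open>v\<close>, this
  locates the few points that span the drawing.\<close>

lemma X_hull:
  assumes h: "N \<subseteq> convex hull Q" and x: "x \<in> X" and v: "v \<noteq> 0" shows "\<exists>q\<in>Q. (q - x) \<bullet> v < 0"
proof (rule ccontr)
  assume "\<not> ?thesis"
  then have "\<And>q. q \<in> Q \<Longrightarrow> 0 \<le> (q - x) \<bullet> v" by force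
  then have "0 \<le> (n - x) \<bullet> v" if "n \<in> N" for n using halfplane_hull_le[of n Q] h that by auto
  then show False using X_inner[OF x v] by force
qed

text \<open>The line through the crossing parallel to the one through \<open>q\<close> and
  \<open>r\<close> has both points in one closed half plane, so the open half plane on its other
  side contains neither.\<close>

lemma no_two:
  assumes h: "N \<subseteq> convex hull Q" and x: "x \<in> X" shows "\<not> Q \<subseteq> {q, r}"
proof
  assume Q: "Q \<subseteq> {q,r}"
  have "\<exists>v. v \<noteq> 0 \<and> 0 \<le> (q - x) \<bullet> v \<and> 0 \<le> (r - x) \<bullet> v"
  proof (cases "q = r")
    case True
    show ?thesis
    proof (cases "q = x")
      case True then show ?thesis using \<open>q = r\<close> by (intro exI[of _ 1]) simp
    next
      case False then show ?thesis using \<open>q = r\<close> by (intro exI[of _ "q - x"]) simp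
    qed
  next
    case False
    define z where "z = \<i> * (q - r)"
    have z: "z \<noteq> 0" "(q - r) \<bullet> z = 0" using False inner_i[of "q - r"] by (auto simp: z_def)
    then have e: "(q - x) \<bullet> z = (r - x) \<bullet> z" by (simp add: inner_diff_left)
    show ?thesis
    proof (cases "0 \<le> (q - x) \<bullet> z")
      case True then show ?thesis using z e by auto
    next
      case False then show ?thesis using z e by (intro exI[of _ "- z"]) auto
    qed
  qed
  then obtain v where v: "v \<noteq> 0" "0 \<le> (q - x) \<bullet> v" "0 \<le> (r - x) \<bullet> v" by blast
  obtain q' where q': "q' \<in> Q" "(q' - x) \<bullet> v < 0" using X_hull[OF h x v(1)] by auto
  then show False using Q v by auto
qed

text \<open>Extreme nodes of the drawing occur on the unbounded face, and a crossing is never among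
  them because it lies between opposite neighbours.\<close>

lemma outer_Q:
  assumes f: "f \<in> components (- S)" "\<not> bounded f"
  shows "N \<subseteq> convex hull (hullQ f)"
proof -
  have "{w \<in> P f. w extreme_point_of (convex hull N)} \<subseteq> hullQ f"
  proof
    fix w assume "w \<in> {w \<in> P f. w extreme_point_of (convex hull N)}"
    then have w: "w \<in> P f" "w extreme_point_of (convex hull N)" by auto
    have nos: False if "a \<in> N" "c \<in> N" "w \<in> open_segment a c" for a c
      using w(2) hull_inc[OF that(1), of convex] hull_inc[OF that(2), of convex] that(3) unfolding extreme_point_of_def by blast
    obtain d where d: "d \<in> A" "lf d = f" "fst d = w" using w(1) by (auto simp: P_def)
    have wN: "w \<in> N" using A_N[of w "snd d"] d by (metis prod.collapse)
    show "w \<in> hullQ f"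
    proof (cases "w \<in> W")
      case True
      have "w \<notin> X"
      proof
        assume "w \<in> X"
        then obtain z where z: "z \<noteq> 0"
          and P2: "\<And>k. k \<in> {1,-1,\<i>,-\<i>} \<Longrightarrow> \<exists>c s. (w,c) \<in> A \<and> 0 < s \<and> c - w = of_real s * (k * z)"
          by (rule X_nbrs) blast
        obtain c s where c: "(w,c) \<in> A" "0 < s" "c - w = of_real s * (1 * z)" using P2[of 1] by auto
        obtain c' s' where c': "(w,c') \<in> A" "0 < s'" "c' - w = of_real s' * (-1 * z)" using P2[of "-1"] by auto
        have "c = w + of_real s * z" "c' = w + of_real (- s') * z" using c(3) c'(3) by (simp_all add: algebra_simps)
        moreover have "w = w + of_real 0 * z" by simp
        ultimately have "w \<in> open_segment c' c" using open_segment_param[OF z, of "- s'" s w w] c(2) c'(2) by fastforce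
        then show False using nos A_N2[OF c(1)] A_N2[OF c'(1)] by blast
      qed
      then have "w \<in> p ` V" using True by (simp add: W_def)
      moreover have "fst d \<in> fst ` mdF f" by (rule imageI) (use d True in \<open>simp add: mdF_def M_def\<close>)
      ultimately show ?thesis using d(3) unfolding hullQ_def by simp
    next
      case False
      then obtain a where a: "(a,w) \<in> M" "nx (a,w) = d" "snd d \<noteq> a" using pred_dart[OF d(1)] d(3) by blast
      have lfa: "lf (a,w) = f" using lf_nx[OF M_A[OF a(1)]] a(2) d(2) by simp
      have "turn (a,w) \<noteq> 0"
      proof
        assume t: "turn (a,w) = 0"
        have ml: "ml (a,w) = d" using False a(2) by (simp add: ml_def)
        have "pp (snd d - w) (w - a)" using unbent(1)[OF a(1) t] d(3) by (simp add: idr_def od_def ml)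
        then obtain s where s: "0 < s" "snd d - w = of_real s * (w - a)" by (auto simp: pp_def)
        have ne: "w - a \<noteq> 0" using od_nz[OF a(1)] by (simp add: od_def)
        have "snd d = w + of_real s * (w - a)" "a = w + of_real (-1) * (w - a)" using s(2) by (simp_all add: algebra_simps)
        moreover have "w = w + of_real 0 * (w - a)" by simp
        ultimately have "w \<in> open_segment a (snd d)" using open_segment_param[OF ne, of "-1" s w w] s(1) by fastforce
        moreover have "a \<in> N" "snd d \<in> N" using A_N[OF M_A[OF a(1)]] A_N2[of w "snd d"] d by (auto simp: prod_eq_iff)
        ultimately show False using nos by blast
      qed
      then have "(a,w) \<in> {d\<in>mdF f. turn d \<noteq> 0}" using a(1) lfa by (simp add: mdF_def)
      then have "snd (a,w) \<in> snd ` {d\<in>mdF f. turn d \<noteq> 0}" by (rule imageI)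
      then show ?thesis by (simp add: hullQ_def)
    qed
  qed
  then show ?thesis using outer_hull[OF iso f] hull_mono by blast
qed

end

section \<open>The unbounded face\<close>

lemma ppR: "pp x y \<longleftrightarrow> (\<exists>s>0. x = s *\<^sub>R y)"
  by (simp add: pp_def scaleR_conv_of_real)

lemma inner_rot: "(\<i> * z) \<bullet> z = 0" "z \<bullet> (\<i> * z) = 0" "(\<i> * z) \<bullet> (\<i> * y) = z \<bullet> y" "y \<bullet> (\<i> * z) = - ((\<i> * y) \<bullet> z)"
  by (simp_all add: inner_complex_def)

lemma pp_perp: "pp x (\<i> * y) \<Longrightarrow> x \<bullet> y = 0" "pp x (\<i> * y) \<Longrightarrow> y \<bullet> x = 0"
  by (auto simp: ppR inner_rot)

context star_drawing begin

lemma snd_bent: "d \<in> M \<Longrightarrow> turn d \<noteq> 0 \<Longrightarrow> snd d = mh d - idr d"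
  using mh_eq[of d] turn_bend[of d] by (simp add: od_def)

lemma turn_unique:
  assumes "d \<in> M" "d' \<in> M" "turn d \<noteq> 0" "turn d' \<noteq> 0" "ed d = ed d'" shows "d' = d \<or> d' = rv d"
  using bend_dart_unique[of d d'] turn_bend assms by blast

lemma rv_ne: "d \<in> M \<Longrightarrow> rv d \<noteq> d"
  using rv_props(1)[of d] mh_ne[of d] by auto

text \<open>By Thales, \<open>x\<close> and \<open>y\<close> lie on the circle with diameter from
  \<open>q\<close> to \<open>w\<close>. Points beyond \<open>x\<close> or \<open>y\<close> as seen
  from \<open>q\<close> are strictly on the side of \<open>w\<close> of the tangent at
  \<open>q\<close>, and so is \<open>w\<close>; hence \<open>q\<close> is not in their hull.\<close>

lemma rect_hull:
  fixes w :: complex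
  assumes h: "N \<subseteq> convex hull Q" and q: "q \<in> N" and p: "(w - x) \<bullet> (q - x) = 0" "(w - y) \<bullet> (y - q) = 0" "q \<noteq> x" "q \<noteq> y"
    and Q: "\<And>z. z \<in> Q \<Longrightarrow> z = w \<or> (\<exists>s>0. z = x - s *\<^sub>R (q - x)) \<or> (\<exists>s>0. z = y + s *\<^sub>R (y - q))"
  shows False
proof -
  have "0 < (z - q) \<bullet> (w - q)" if z: "z \<in> Q" for z
    using Q[OF z]
  proof (elim disjE exE conjE)
    assume "z = w"
    have "(w - q) \<bullet> (q - x) = (w - x) \<bullet> (q - x) - (q - x) \<bullet> (q - x)" by (simp add: inner_diff_left)
    then have "w \<noteq> q" using p by auto
    then show ?thesis using \<open>z = w\<close> by simp
  next
    fix s :: real assume s: "0 < s" "z = x - s *\<^sub>R (q - x)"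
    have e: "z - q = - ((1 + s) *\<^sub>R (q - x))" using s by (simp add: algebra_simps)
    have "(q - x) \<bullet> (w - q) = (w - x) \<bullet> (q - x) - (q - x) \<bullet> (q - x)" by (simp add: inner_diff_left inner_diff_right inner_commute)
    then have "(z - q) \<bullet> (w - q) = (1 + s) * ((q - x) \<bullet> (q - x))" using p(1) by (simp add: e)
    then show ?thesis using p(3) s by simp
  next
    fix s :: real assume s: "0 < s" "z = y + s *\<^sub>R (y - q)"
    have e: "z - q = (1 + s) *\<^sub>R (y - q)" using s by (simp add: algebra_simps)
    have "(y - q) \<bullet> (w - q) = (w - y) \<bullet> (y - q) + (y - q) \<bullet> (y - q)" by (simp add: inner_diff_left inner_diff_right inner_commute)
    then have "(z - q) \<bullet> (w - q) = (1 + s) * ((y - q) \<bullet> (y - q))" using p(2) by (simp add: e)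
    then show ?thesis using p(4) s by simp
  qed
  then have "0 < (q - q) \<bullet> (w - q)" using halfplane_hull[of q Q q "w - q"] h q by blast
  then show False by simp
qed

text \<open>The parameter \<open>j\<close> is \<open>\<i>\<close> or its conjugate, which covers a configuration and its mirror image.\<close>

lemma one_straight_hull:
  fixes j :: complex
  assumes h: "N \<subseteq> convex hull Q" and q: "q \<in> X" and j: "j = \<i> \<or> j = - \<i>" and Q: "Q \<subseteq> {a, w, w'}" and y: "y \<noteq> 0"
    and e: "a = x - l *\<^sub>R z" "w = x + al *\<^sub>R (j * z)" "q = x + z + y" "w = q + ka *\<^sub>R (j * y) - ga *\<^sub>R y" "w' = q + mu *\<^sub>R (j * y)"
    and pos: "0 < l" "0 < al" "0 < ka" "0 < ga" "0 < mu"
  shows False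
proof -
  have J: "(j * s) \<bullet> s = 0" "s \<bullet> (j * s) = 0" "(j * s) \<bullet> (j * t) = s \<bullet> t" for s t
    using j by (auto simp: inner_complex_def)
  have jy: "j * y \<noteq> 0" using j y by auto
  have yy: "0 < y \<bullet> y" using y by simp
  have 1: "a - q = - (1 + l) *\<^sub>R z - y" using e(1,3) by (simp add: algebra_simps)
  have 2: "w - q = ka *\<^sub>R (j * y) - ga *\<^sub>R y" using e(4) by (simp add: algebra_simps)
  have 3: "w' - q = mu *\<^sub>R (j * y)" using e(5) by simp
  have "(w - q) \<bullet> (- y) = ga * (y \<bullet> y)" "(w' - q) \<bullet> (- y) = 0" "(a - q) \<bullet> (- y) = (1 + l) * (z \<bullet> y) + y \<bullet> y"
    unfolding 1 2 3 by (simp_all add: inner_diff_left J algebra_simps)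
  moreover obtain r where "r \<in> Q" "(r - q) \<bullet> (- y) < 0" using X_hull[OF h q, of "- y"] y by auto
  moreover have "0 < ga * (y \<bullet> y)" using pos yy by simp
  ultimately have "(1 + l) * (z \<bullet> y) + y \<bullet> y < 0" using Q by fastforce
  then have "(1 + l) * (z \<bullet> y) < 0" using yy by linarith
  \<comment> \<open>Neither \<open>w\<close> nor \<open>w'\<close> lies in the open half plane given
    by \<open>- y\<close>, so \<open>a\<close> must, and this fixes the sign. The direction
    \<open>j * y\<close> is used in the same way below.\<close>
  then have A: "z \<bullet> y < 0" using pos(1) by (simp add: mult_less_0_iff)
  have "(w - q) \<bullet> (j * y) = ka * (y \<bullet> y)" "(w' - q) \<bullet> (j * y) = mu * (y \<bullet> y)" "(a - q) \<bullet> (j * y) = - ((1 + l) * (z \<bullet> (j * y)))"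
    unfolding 1 2 3 by (simp_all add: inner_diff_left J algebra_simps)
  moreover obtain r where "r \<in> Q" "(r - q) \<bullet> (j * y) < 0" using X_hull[OF h q jy] by auto
  moreover have "0 < ka * (y \<bullet> y)" "0 < mu * (y \<bullet> y)" using pos yy by simp_all
  ultimately have "- ((1 + l) * (z \<bullet> (j * y))) < 0" using Q by fastforce
  then have B: "0 < z \<bullet> (j * y)" using pos(1) by (simp add: zero_less_mult_iff)
  \<comment> \<open>The descriptions of \<open>w\<close> from \<open>x\<close> and from
    \<open>q\<close> are compared along \<open>j * y\<close>; their signs are incompatible.\<close>
  have "al *\<^sub>R (j * z) - z = y + ka *\<^sub>R (j * y) - ga *\<^sub>R y" using e by (simp add: algebra_simps)
  then have "(al *\<^sub>R (j * z) - z) \<bullet> (j * y) = (y + ka *\<^sub>R (j * y) - ga *\<^sub>R y) \<bullet> (j * y)" by simp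
  then have "al * (z \<bullet> y) - z \<bullet> (j * y) = ka * (y \<bullet> y)" by (simp add: inner_diff_left inner_add_left J)
  moreover have "al * (z \<bullet> y) < 0" using A pos(2) by (simp add: mult_pos_neg)
  moreover have "0 < ka * (y \<bullet> y)" using pos yy by simp
  ultimately show False using B by linarith
qed

lemma sat_mono:
  assumes "sat c f" "\<And>d. d \<in> mdF f \<Longrightarrow> c d \<Longrightarrow> c' d" shows "sat c' f"
proof -
  have "card {d\<in>mdF f. c d} \<le> card {d\<in>mdF f. c' d}" by (rule card_mono) (use assms(2) fin_mdF in auto)
  then show ?thesis using assms(1) by (simp add: sat_def)
qed

text \<open>All that the charging needs from a system of claims. It is stated for an arbitrary
  \<open>c\<close> because \<open>cl0\<close> may have to be modified for the sake of the unbounded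
  face.\<close>

definition admissible :: "(complex \<times> complex \<Rightarrow> bool) \<Rightarrow> bool" where
  "admissible c \<longleftrightarrow> (\<forall>d\<in>M. \<not> (c d \<and> c (rv d))) \<and> (\<forall>d\<in>M. c d \<longrightarrow> turn d \<noteq> 0) \<and> (\<forall>f. needy f \<longrightarrow> sat c f)"

text \<open>If the face on the other side of \<open>d\<close> has no need, \<open>f\<close> may take
  the bend of \<open>d\<close> whichever way it turns.\<close>

lemma override:
  assumes d: "d \<in> mdF f" and t: "turn d \<noteq> 0" and k: "kf f = 3" and n: "\<not> needy (lf (rv d))"
    and o: "\<And>f'. needy f' \<Longrightarrow> f' \<noteq> f \<Longrightarrow> sat cl0 f'"
  shows "\<exists>c. admissible c"
proof -
  define c where "c d' \<longleftrightarrow> d' = d \<or> (d' \<noteq> rv d \<and> cl0 d')" for d'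
  have dM: "d \<in> M" using mdF_M[OF d] .
  have rr: "rv (rv d') = d'" if "d' \<in> M" for d' using rv_props(6)[OF that] .
  have "\<not> (c d' \<and> c (rv d'))" if d': "d' \<in> M" for d'
    using cl0_excl[OF d'] rr[OF d'] rr[OF dM] rv_ne[OF dM] unfolding c_def by auto
  moreover have "turn d' \<noteq> 0" if "c d'" for d' using that t by (auto simp: c_def cl0_def)
  moreover have "sat c f'" if f': "needy f'" for f'
  proof (cases "f' = f")
    case True then show ?thesis using sat1[OF k d, of c] by (simp add: c_def)
  next
    case False
    show ?thesis
    proof (rule sat_mono[OF o[OF f' False]])
      fix d' assume d': "d' \<in> mdF f'" "cl0 d'"
      then have "d' \<noteq> rv d" using n f' by (auto simp: mdF_def)
      then show "c d'" using d' by (simp add: c_def)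
    qed
  qed
  ultimately show ?thesis unfolding admissible_def by blast
qed

end

text \<open>The situation that remains when \<open>cl0\<close> fails: a triangular unbounded face
  whose middle side \<open>d2\<close> joins two crossings. The third corner, the tail of
  \<open>d1\<close>, is a vertex or a crossing.\<close>

locale outer_triangle = star_drawing +
  fixes f d1 d2 d3
  assumes f: "f \<in> components (- S)" "\<not> bounded f" and k: "kf f = 3"
    and d1: "d1 \<in> mdF f" and d2: "mn d1 = d2" and d3: "mn d2 = d3"
    and x1: "mh d1 \<in> X" and x2: "mh d2 \<in> X" and ne: "ed d1 \<noteq> ed d3"
    and others: "needy f' \<Longrightarrow> f' \<noteq> f \<Longrightarrow> sat cl0 f'"
begin

lemma tri: "mdF f = {d1,d2,d3}" "mn d3 = d1" "d2 \<in> mdF f" "d3 \<in> mdF f" "d1 \<in> M" "d2 \<in> M" "d3 \<in> M"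
  "fst d2 = mh d1" "fst d3 = mh d2" "fst d1 = mh d3"
proof -
  note t = kf3[OF k d1]
  show 1: "mdF f = {d1,d2,d3}" "mn d3 = d1" using t d2 d3 by auto
  show 2: "d2 \<in> mdF f" "d3 \<in> mdF f" using 1 by auto
  show "d1 \<in> M" "d2 \<in> M" "d3 \<in> M" using mdF_M d1 2 by auto
  show "fst d2 = mh d1" "fst d3 = mh d2" "fst d1 = mh d3" using fst_mn d2 d3 1 by metis+
qed

lemma dirs: "pp (od d2) (\<i> * idr d1)" "pp (od d3) (\<i> * idr d2)"
  using mn_cross(1)[OF tri(5) x1] mn_cross(1)[OF tri(6) x2] d2 d3 by auto

lemma hullN: "N \<subseteq> convex hull (hullQ f)" by (rule outer_Q[OF f])

lemma hullQ_cases: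
  assumes "z \<in> hullQ f"
  obtains (vertex) "z = fst d1" "fst d1 \<in> p ` V" | (1) "z = snd d1" "turn d1 \<noteq> 0" | (2) "z = snd d2" "turn d2 \<noteq> 0" | (3) "z = snd d3" "turn d3 \<noteq> 0"
proof -
  have "mh d1 \<notin> p ` V" "mh d2 \<notin> p ` V" using X_disj x1 x2 by auto
  moreover have "z \<in> {fst d1, mh d1, mh d2} \<and> z \<in> p ` V \<or> (\<exists>d\<in>{d1,d2,d3}. z = snd d \<and> turn d \<noteq> 0)"
    using assms tri(8,9) unfolding hullQ_def tri(1) by force
  ultimately show thesis using that by blast
qed

text \<open>The face beyond \<open>d2\<close> is no digon, since its second side would lie on
  \<open>ed d1\<close> and on \<open>ed d3\<close>. In the triangle, the other two sides continue
  these edges across the crossings. Each edge has only one bend, so the continuation of a bent side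
  is straight.\<close>

lemma across:
  assumes n: "needy (lf (rv d2))"
  obtains m2 m3 where "m2 \<in> M" "m3 \<in> M" "fst m2 = mh d1" "mn m2 = m3" "mn m3 = rv d2" "mh m3 = mh d2" "fst m3 = mh m2"
    "ed m2 = ed d1" "ed m3 = ed d3" "pp (od m2) (idr d1)" "pp (idr m3) (od d3)"
    "turn d1 \<noteq> 0 \<Longrightarrow> turn m2 = 0" "turn d3 \<noteq> 0 \<Longrightarrow> turn m3 = 0"
proof -
  define r where "r = rv d2"
  define m2 where "m2 = mn r"
  have r: "r \<in> M" "fst r = mh d2" "mh r = mh d1" "od r = - idr d2" "idr r = - od d2" "ed r = ed d2"
    using rv_M[OF tri(6)] rv_props[OF tri(6)] tri(8) by (simp_all add: r_def)
  have rm: "r \<in> mdF (lf r)" using r by (simp add: mdF_def)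
  have m2: "m2 \<in> M" "fst m2 = mh d1" using mn_M[OF r(1)] r(3) by (simp_all add: m2_def)
  have e2: "ed m2 = ed d1" using other_end[OF tri(5) x1] by (simp add: d2 m2_def r_def)
  have ne2: "ed d3 \<noteq> ed d2" using mn_cross(2)[OF tri(6) x2] d3 by simp
  have on3: "mh d2 \<in> on (ed d3)" using fst_on[OF tri(7)] tri(9) by simp
  have E3: "ed d3 \<in> E" using ed_E[OF tri(7)] .
  have last: "ed m = ed d3" if m: "m \<in> M" "mn m = r" for m
  proof -
    have h: "mh m = mh d2" using fst_mn[of m] m(2) r(2) by simp
    have "ed d3 = ed m \<or> ed d3 = ed r" using mn_cross(3)[OF m(1) _ E3] h x2 on3 m(2) by simp
    then show ?thesis using r(6) ne2 by auto
  qed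
  have k3: "kf (lf r) = 3"
  proof (rule ccontr)
    assume "kf (lf r) \<noteq> 3"
    then have "kf (lf r) = 2" using n kf_ge2[of "lf r"] unfolding needy_def r_def[symmetric] by force
    then have "mn m2 = r" using kf2(2)[OF _ rm] by (simp add: m2_def)
    then show False using last[OF m2(1)] e2 ne by simp
  qed
  define m3 where "m3 = mn m2"
  have m3: "m3 \<in> M" "mn m3 = r" "fst m3 = mh m2" using mn_M[OF m2(1)] kf3(2)[OF k3 rm] by (simp_all add: m3_def m2_def)
  have h3: "mh m3 = mh d2" using fst_mn[of m3] m3(2) r(2) by simp
  have e3: "ed m3 = ed d3" using last[OF m3(1,2)] .
  have p2: "pp (od m2) (idr d1)"
  proof -
    have "pp (od m2) (\<i> * idr r)" using mn_cross(1)[OF r(1)] r(3) x1 by (simp add: m2_def)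
    then have a: "pp (od m2) (- (\<i> * od d2))" using r(5) by simp
    have "pp (\<i> * od d2) (\<i> * (\<i> * idr d1))" by (rule pp_mult[OF dirs(1)])
    then have "pp (- (\<i> * od d2)) (idr d1)" using pp_minus by (fastforce simp: mult.assoc[symmetric])
    then show ?thesis using pp_trans[OF a] by simp
  qed
  have p3: "pp (idr m3) (od d3)"
  proof -
    have "pp (od r) (\<i> * idr m3)" using mn_cross(1)[OF m3(1)] h3 x2 m3(2) by simp
    then have a: "pp (\<i> * idr m3) (- idr d2)" using r(4) pp_sym by simp
    have "pp (\<i> * (\<i> * idr m3)) (\<i> * - idr d2)" by (rule pp_mult[OF a])
    then have "pp (idr m3) (\<i> * idr d2)" using pp_minus by (fastforce simp: mult.assoc[symmetric])
    then show ?thesis using pp_trans pp_sym[OF dirs(2)] by blast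
  qed
  have s2: "turn m2 = 0" if t: "turn d1 \<noteq> 0"
  proof (rule ccontr)
    assume "turn m2 \<noteq> 0"
    then have "m2 = d1 \<or> m2 = rv d1" using turn_unique[OF tri(5) m2(1) t] e2 by simp
    then show False
    proof
      assume "m2 = d1" then show False using m2(2) mh_ne[OF tri(5)] by simp
    next
      assume "m2 = rv d1"
      then have "pp (- idr d1) (idr d1)" using p2 rv_props(3)[OF tri(5)] by simp
      then show False using pp_not_minus[of "idr d1" "idr d1"] idr_nz[OF tri(5)] by simp
    qed
  qed
  have s3: "turn m3 = 0" if t: "turn d3 \<noteq> 0"
  proof (rule ccontr)
    assume "turn m3 \<noteq> 0"
    then have "m3 = d3 \<or> m3 = rv d3" using turn_unique[OF tri(7) m3(1) t] e3 by simp
    then show False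
    proof
      assume "m3 = d3" then show False using h3 mh_ne[OF tri(7)] tri(9) by simp
    next
      assume "m3 = rv d3"
      then have "pp (- od d3) (od d3)" using p3 rv_props(4)[OF tri(7)] by simp
      then show False using pp_not_minus[of "od d3" "od d3"] od_nz[OF tri(7)] by simp
    qed
  qed
  show thesis by (rule that[OF m2(1) m3(1) m2(2) m3_def[symmetric] m3(2)[unfolded r_def] h3 m3(3) e2 e3 p2 p3 s2 s3])
qed

text \<open>The point of \<open>d1\<close> that may span the hull, its tail or its bend, lies behind
  the crossing on the line from \<open>q\<close>.\<close>

lemma back1:
  assumes "pp (q - mh d1) (idr d1)"
  shows "turn d1 = 0 \<Longrightarrow> \<exists>s>0. fst d1 = mh d1 - s *\<^sub>R (q - mh d1)" "turn d1 \<noteq> 0 \<Longrightarrow> \<exists>s>0. snd d1 = mh d1 - s *\<^sub>R (q - mh d1)"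
proof -
  { assume t: "turn d1 = 0"
    have "pp (mh d1 - fst d1) (q - mh d1)"
      using unbent[OF tri(5) t] assms pp_trans pp_sym by blast
    then obtain s where "0 < s" "mh d1 - fst d1 = s *\<^sub>R (q - mh d1)" by (auto simp: ppR)
    then show "\<exists>s>0. fst d1 = mh d1 - s *\<^sub>R (q - mh d1)" by (intro exI[of _ s]) (simp add: algebra_simps) }
  { assume t: "turn d1 \<noteq> 0"
    obtain s where "0 < s" "idr d1 = s *\<^sub>R (q - mh d1)" using pp_sym[OF assms] by (auto simp: ppR)
    then show "\<exists>s>0. snd d1 = mh d1 - s *\<^sub>R (q - mh d1)" using snd_bent[OF tri(5) t] by (intro exI[of _ s]) simp }
qed

lemma fwd3:
  assumes "pp (mh d2 - q) (od d3)"
  shows "turn d3 = 0 \<Longrightarrow> \<exists>s>0. fst d1 = mh d2 + s *\<^sub>R (mh d2 - q)" "turn d3 \<noteq> 0 \<Longrightarrow> \<exists>s>0. snd d3 = mh d2 + s *\<^sub>R (mh d2 - q)"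
proof -
  { assume t: "turn d3 = 0"
    have "pp (mh d3 - fst d3) (mh d2 - q)"
      using unbent[OF tri(7) t] assms pp_trans pp_sym by blast
    then obtain s where "0 < s" "mh d3 - fst d3 = s *\<^sub>R (mh d2 - q)" by (auto simp: ppR)
    then show "\<exists>s>0. fst d1 = mh d2 + s *\<^sub>R (mh d2 - q)" using tri(9,10) by (intro exI[of _ s]) (simp add: algebra_simps) }
  { assume t: "turn d3 \<noteq> 0"
    obtain s where "0 < s" "od d3 = s *\<^sub>R (mh d2 - q)" using pp_sym[OF assms] by (auto simp: ppR)
    then show "\<exists>s>0. snd d3 = mh d2 + s *\<^sub>R (mh d2 - q)" using tri(9) by (intro exI[of _ s]) (simp add: od_def algebra_simps) }
qed

text \<open>The point \<open>q\<close>, the two crossings and the bend of \<open>d2\<close> form the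
  figure of \<open>rect_hull\<close>. All other hull points lie beyond the crossings as seen from
  \<open>q\<close>; a vertex does so as soon as one of its two sides is straight.\<close>

lemma straight_contra:
  assumes q: "q \<in> N" and s: "pp (q - mh d1) (idr d1)" "pp (mh d2 - q) (od d3)" and t: "turn d2 \<noteq> 0"
    and v: "fst d1 \<in> p ` V \<Longrightarrow> turn d1 = 0 \<or> turn d3 = 0"
  shows False
proof (rule rect_hull[OF hullN q])
  have "od d2 = snd d2 - mh d1" using tri(8) by (simp add: od_def)
  then show "(snd d2 - mh d1) \<bullet> (q - mh d1) = 0"
    using pp_perp(1)[OF dirs(1)] s(1) by (auto simp: ppR)
  have "snd d2 - mh d2 = - idr d2" using snd_bent[OF tri(6) t] by simp
  then show "(snd d2 - mh d2) \<bullet> (mh d2 - q) = 0"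
    using pp_perp(2)[OF dirs(2)] s(2) by (auto simp: ppR)
  show "q \<noteq> mh d1" using pp_zero[OF s(1)] idr_nz[OF tri(5)] by auto
  show "q \<noteq> mh d2" using pp_zero[OF s(2)] od_nz[OF tri(7)] by auto
  fix z assume "z \<in> hullQ f"
  then show "z = snd d2 \<or> (\<exists>s>0. z = mh d1 - s *\<^sub>R (q - mh d1)) \<or> (\<exists>s>0. z = mh d2 + s *\<^sub>R (mh d2 - q))"
  proof (cases rule: hullQ_cases)
    case vertex then show ?thesis using v back1(1)[OF s(1)] fwd3(1)[OF s(2)] by blast
  next
    case 1 then show ?thesis using back1(2)[OF s(1)] by blast
  next
    case 2 then show ?thesis by blast
  next
    case 3 then show ?thesis using fwd3(2)[OF s(2)] by blast
  qed
qed

text \<open>Only the bends can span the hull, and two do not suffice; so all three sides are bent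
  and their continuations are straight. Then the face beyond \<open>d2\<close> is not needy, and the
  unbounded face may take the bend of \<open>d2\<close>.\<close>

lemma outer_crossings:
  assumes "fst d1 \<in> X"
  shows "\<exists>c. admissible c"
proof -
  have nV: "fst d1 \<notin> p ` V" using X_disj assms by auto
  have t1: "turn d1 \<noteq> 0"
  proof
    assume t0: "turn d1 = 0"
    have "z \<in> {snd d2, snd d3}" if "z \<in> hullQ f" for z using that by (cases rule: hullQ_cases) (use nV t0 in auto)
    then have "hullQ f \<subseteq> {snd d2, snd d3}" by blast
    then show False using no_two[OF hullN x1] by blast
  qed
  have t2: "turn d2 \<noteq> 0"
  proof
    assume t0: "turn d2 = 0"
    have "z \<in> {snd d1, snd d3}" if "z \<in> hullQ f" for z using that by (cases rule: hullQ_cases) (use nV t0 in auto)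
    then have "hullQ f \<subseteq> {snd d1, snd d3}" by blast
    then show False using no_two[OF hullN x1] by blast
  qed
  have t3: "turn d3 \<noteq> 0"
  proof
    assume t0: "turn d3 = 0"
    have "z \<in> {snd d1, snd d2}" if "z \<in> hullQ f" for z using that by (cases rule: hullQ_cases) (use nV t0 in auto)
    then have "hullQ f \<subseteq> {snd d1, snd d2}" by blast
    then show False using no_two[OF hullN x1] by blast
  qed
  have "\<not> needy (lf (rv d2))"
  proof
    assume "needy (lf (rv d2))"
    then show False
    proof (rule across)
      fix m2 m3 assume m: "m2 \<in> M" "m3 \<in> M" "fst m2 = mh d1" "mh m3 = mh d2" "fst m3 = mh m2"
        "pp (od m2) (idr d1)" "pp (idr m3) (od d3)"
        and s: "turn d1 \<noteq> 0 \<Longrightarrow> turn m2 = 0" "turn d3 \<noteq> 0 \<Longrightarrow> turn m3 = 0"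
      have "pp (mh m2 - mh d1) (idr d1)" using pp_trans[OF unbent(2)[OF m(1) s(1)[OF t1]] m(6)] m(3) by simp
      moreover have "pp (mh d2 - mh m2) (od d3)"
        using pp_trans[OF pp_trans[OF unbent(2)[OF m(2) s(2)[OF t3]] pp_sym[OF unbent(1)[OF m(2) s(2)[OF t3]]]] m(7)] m(4,5) by simp
      moreover have "mh m2 \<in> N" using mh_W[OF m(1)] W_N by simp
      ultimately show False using straight_contra t2 nV by blast
    qed
  qed
  then show ?thesis using override[OF tri(3) t2 k] others by blast
qed

end

section \<open>A triangular unbounded face with a vertex\<close>

context outer_triangle begin

text \<open>If \<open>d2\<close> were straight, the bends of \<open>d1\<close> and \<open>d3\<close>
  would lie on the perpendiculars at its two ends. Both of the disjoint half planes beyond these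
  ends would then have to contain the only remaining hull point, the vertex.\<close>

lemma middle_bent:
  assumes "fst d1 \<in> p ` V" shows "turn d2 \<noteq> 0"
proof
  assume t: "turn d2 = 0"
  define v where "v = mh d2 - mh d1"
  have o: "pp v (od d2)" using unbent(2)[OF tri(6) t] tri(8) by (simp add: v_def)
  note ov = o pp_trans[OF o pp_sym[OF unbent(1)[OF tri(6) t]]]
  have v0: "v \<noteq> 0" using pp_zero[OF ov(1)] od_nz[OF tri(6)] by simp
  have p1: "v \<bullet> idr d1 = 0" using ov(1) pp_perp(1)[OF dirs(1)] by (auto simp: ppR)
  have p3: "od d3 \<bullet> v = 0" using ov(2) pp_perp(1)[OF dirs(2)] by (auto simp: ppR)
  have w1: "(snd d1 - mh d1) \<bullet> v = 0" if "turn d1 \<noteq> 0"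
    using p1 snd_bent[OF tri(5) that] by (simp add: inner_commute)
  have w3: "(snd d3 - mh d2) \<bullet> v = 0" using p3 tri(9) by (simp add: od_def)
  have vv: "0 < v \<bullet> v" using v0 by simp
  have sh: "(z - mh d1) \<bullet> v = (z - mh d2) \<bullet> v + v \<bullet> v" for z by (simp add: v_def inner_diff_left)
  obtain q where q: "q \<in> hullQ f" "(q - mh d1) \<bullet> v < 0" using X_hull[OF hullN x1 v0] by blast
  from q(1) have A: "(fst d1 - mh d1) \<bullet> v < 0"
  proof (cases rule: hullQ_cases)
    case vertex then show ?thesis using q(2) by simp
  next
    case 1 then show ?thesis using q(2) w1 by simp
  next
    case 2 then show ?thesis using t by simp
  next
    case 3 then have "0 < (q - mh d1) \<bullet> v" using sh[of q] w3 vv by simp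
    then show ?thesis using q(2) by linarith
  qed
  obtain r where r: "r \<in> hullQ f" "(r - mh d2) \<bullet> (- v) < 0" using X_hull[OF hullN x2, of "- v"] v0 by auto
  from r(1) have B: "0 < (fst d1 - mh d2) \<bullet> v"
  proof (cases rule: hullQ_cases)
    case vertex then show ?thesis using r(2) by simp
  next
    case 1 then have "(r - mh d2) \<bullet> v = - (v \<bullet> v)" using sh[of "snd d1"] w1 by simp
    then show ?thesis using r(2) vv by simp
  next
    case 2 then show ?thesis using t by simp
  next
    case 3 then show ?thesis using r(2) w3 by simp
  qed
  show False using A B sh[of "fst d1"] vv by linarith
qed

text \<open>The last case: the middle edge is claimed from the other side, and all three sides are bent.
  The unbounded face claims its first side; every face that loses its claim by this is again a triangle at
  the vertex \<open>u\<close> whose opposite side lies on the middle edge, and it claims its own first side instead.\<close>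

definition fan :: "'a \<Rightarrow> (complex \<times> complex) set" where
  "fan u = {d\<in>M. fst d = p u \<and> mh d \<in> X \<and> (\<exists>s\<ge>0. mh d = mh d1 - s *\<^sub>R od d2) \<and> ed (mn d) = ed d2 \<and> pp (idr d) (idr d1)}"

text \<open>The head lies on the line of \<open>od d2\<close> through \<open>mh d1\<close>, and
  \<open>u\<close> lies ahead of this line in the direction \<open>idr d1\<close>. A straight side
  from \<open>u\<close> would reach the line against the direction in which it has to
  arrive.\<close>

lemma fan_bent:
  assumes d: "d \<in> fan u" and u: "fst d1 = p u" and i: "0 < (fst d1 - mh d1) \<bullet> idr d1"
  shows "turn d \<noteq> 0"
proof
  assume t: "turn d = 0"
  obtain s where s: "mh d = mh d1 - s *\<^sub>R od d2" and dM: "d \<in> M" and fd: "fst d = fst d1" and pd: "pp (idr d) (idr d1)"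
    using d u by (auto simp: fan_def)
  have "pp (mh d - fst d) (idr d1)" using pp_trans[OF pp_trans[OF unbent(2)[OF dM t] pp_sym[OF unbent(1)[OF dM t]]] pd] .
  then obtain r where r: "0 < r" "mh d - fst d1 = r *\<^sub>R idr d1" using fd by (auto simp: ppR)
  have "(mh d - fst d1) \<bullet> idr d1 = - ((fst d1 - mh d1) \<bullet> idr d1) - s * (od d2 \<bullet> idr d1)"
    by (simp add: s inner_diff_left)
  also have "\<dots> < 0" using i pp_perp(1)[OF dirs(1)] by simp
  finally have "r * (idr d1 \<bullet> idr d1) < 0" using r(2) by simp
  then show False using r(1) by (metis inner_ge_zero mult_nonneg_nonneg less_imp_le not_less)
qed

text \<open>The edge of \<open>d2\<close> has its only bend on \<open>d2\<close>, so the opposite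
  side \<open>e\<close> of the triangle is straight and prolongs the line of \<open>od d2\<close>
  backwards. The next side at \<open>u\<close> then meets this line at a right angle, further
  back.\<close>

lemma fan_step:
  assumes u: "u \<in> V" "fst d1 = p u" "u \<notin> ed d2" and t: "turn d2 \<noteq> 0"
    and f': "needy f'" "f' \<noteq> f" and d: "d \<in> mdF f'" "rv d \<in> fan u"
  shows "kf f' = 3 \<and> mn d \<in> mdF f' \<and> mn d \<in> fan u"
proof -
  have dM: "d \<in> M" using mdF_M[OF d(1)] .
  obtain s where s: "0 \<le> s" "mh (rv d) = mh d1 - s *\<^sub>R od d2" and R: "fst (rv d) = p u" "mh (rv d) \<in> X" "ed (mn (rv d)) = ed d2"
    "pp (idr (rv d)) (idr d1)" using d(2) by (auto simp: fan_def)
  note r = rv_props[OF dM]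
  have hd: "mh d = p u" and fX: "fst d \<in> X" and fs: "fst d = mh d1 - s *\<^sub>R od d2" using R r s by auto
  have od: "pp (od d) (- idr d1)" using R(4) r(4) pp_minus[of "idr (rv d)"] by simp
  have uV: "p u \<in> p ` V" using u by simp
  have v1: "vf f' \<le> 1" using f'(1) by (simp add: needy_def)
  define e where "e = (if kf f' = 2 then mn d else mn (mn d))"
  have k23: "kf f' = 2 \<or> kf f' = 3" using f'(1) kf_ge2 unfolding needy_def by force
  have em: "e \<in> mdF f'" using d(1) mn_mdF by (simp add: e_def)
  have eM: "e \<in> M" using mdF_M[OF em] .
  have me: "mn e = d" using k23 kf2(2)[OF _ d(1)] kf3(2)[OF _ d(1)] by (auto simp: e_def)
  have he: "mh e = fst d" using fst_mn[of e] me by simp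
  have hX: "mh e \<in> X" using he fX by simp
  have ee: "ed e = ed d2" using other_end[OF eM hX] me R(3) by simp
  \<comment> \<open>In a digon the other side would start at \<open>u\<close> and lie on the edge of
    \<open>d2\<close>, which does not end at \<open>u\<close>.\<close>
  have "kf f' \<noteq> 2"
  proof
    assume "kf f' = 2"
    then have "fst e = p u" using hd by (simp add: e_def)
    then show False using vertex_ed[OF eM _ u(1)] ee u(3) by simp
  qed
  then have k3: "kf f' = 3" using k23 by simp
  have e: "e = mn (mn d)" using k3 by (simp add: e_def)
  have md: "mn d \<in> mdF f'" "mn d \<in> M" "fst (mn d) = p u" using mn_mdF[OF d(1)] mn_M[OF dM] hd by auto
  have "fst e \<notin> p ` V"
  proof
    assume "fst e \<in> p ` V"
    then have "e = mn d" using vf_two[OF v1 em md(1)] md(3) uV by simp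
    then show False using e mn_ne[OF md(2)] by simp
  qed
  then have eX: "fst e \<in> X" using fst_cases[OF eM] by simp
  then have hmX: "mh (mn d) \<in> X" using e by simp
  have ip: "pp (idr e) (od d2)"
  proof -
    have "pp (od d) (\<i> * idr e)" using mn_cross(1)[OF eM hX] me by simp
    then have "pp (\<i> * idr e) (- idr d1)" using pp_trans[OF pp_sym od] by blast
    then have "pp (\<i> * (\<i> * idr e)) (\<i> * - idr d1)" by (rule pp_mult)
    then have "pp (idr e) (\<i> * idr d1)" using pp_minus by (fastforce simp: mult.assoc[symmetric])
    then show ?thesis by (rule pp_trans[OF _ pp_sym[OF dirs(1)]])
  qed
  have et: "turn e = 0"
  proof (rule ccontr)
    assume "turn e \<noteq> 0"
    then have "e = d2 \<or> e = rv d2" using turn_unique[OF tri(6) eM t] ee by simp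
    then show False
    proof
      assume "e = d2" then show False using em tri(3) f'(2) by (simp add: mdF_def)
    next
      assume "e = rv d2"
      then have "pp (- od d2) (od d2)" using ip rv_props(4)[OF tri(6)] by simp
      then show False using pp_not_minus[of "od d2" "od d2"] od_nz[OF tri(6)] by simp
    qed
  qed
  have "pp (mh e - fst e) (od d2)" using pp_trans[OF pp_trans[OF unbent(2)[OF eM et] pp_sym[OF unbent(1)[OF eM et]]] ip] .
  then obtain s' where s': "0 < s'" "mh e - fst e = s' *\<^sub>R od d2" by (auto simp: ppR)
  have "fst e = mh e - s' *\<^sub>R od d2" using s'(2) by (simp add: algebra_simps)
  then have "fst e = mh d1 - (s + s') *\<^sub>R od d2" using he fs by (simp add: algebra_simps)
  then have pos: "\<exists>s\<ge>0. mh (mn d) = mh d1 - s *\<^sub>R od d2" using s(1) s'(1) e by (intro exI[of _ "s + s'"]) simp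
  have "pp (od e) (\<i> * idr (mn d))" using mn_cross(1)[OF md(2) hmX] e by simp
  then have "pp (\<i> * idr (mn d)) (\<i> * idr d1)"
    by (rule pp_trans[OF pp_trans[OF pp_sym pp_trans[OF pp_sym[OF unbent(1)[OF eM et]] ip]] dirs(1)])
  then have "pp (\<i> * (\<i> * idr (mn d))) (\<i> * (\<i> * idr d1))" by (rule pp_mult)
  then have "pp (idr (mn d)) (idr d1)" using pp_minus by (fastforce simp: mult.assoc[symmetric])
  then have "mn d \<in> fan u" using md hmX pos e ee unfolding fan_def by simp
  then show ?thesis using k3 md(1) by simp
qed

lemma fan_admissible:
  assumes u: "u \<in> V" "fst d1 = p u" "u \<notin> ed d2" and t: "turn d2 \<noteq> 0" and i: "0 < (fst d1 - mh d1) \<bullet> idr d1"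
  shows "\<exists>c. admissible c"
proof -
  define c where "c d \<longleftrightarrow> d \<in> fan u \<or> (rv d \<notin> fan u \<and> cl0 d)" for d
  have rr: "rv (rv d) = d" if "d \<in> M" for d using rv_props(6)[OF that] .
  have "\<not> (c d \<and> c (rv d))" if d: "d \<in> M" for d
  proof -
    have "\<not> (d \<in> fan u \<and> rv d \<in> fan u)"
      using rv_props(1)[OF d] mh_ne[OF d] by (auto simp: fan_def)
    then show ?thesis using cl0_excl[OF d] rr[OF d] unfolding c_def by auto
  qed
  moreover have "turn d \<noteq> 0" if "c d" for d using that fan_bent[OF _ u(2) i, of d] unfolding c_def cl0_def by blast
  moreover have "sat c f'" if f': "needy f'" for f'
  proof (cases "f' = f")
    case True
    have "d1 \<in> fan u" using tri(5) u x1 d2 by (auto simp: fan_def intro: exI[of _ 0])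
    then show ?thesis using True sat1[OF k d1, of c] by (simp add: c_def)
  next
    case False
    show ?thesis
    proof (cases "\<exists>d\<in>mdF f'. rv d \<in> fan u")
      case True
      then obtain d where d: "d \<in> mdF f'" "rv d \<in> fan u" by blast
      then show ?thesis using fan_step[OF u t f' False d] sat1[of f' "mn d" c] by (simp add: c_def)
    next
      case no: False
      show ?thesis by (rule sat_mono[OF others[OF f' False]]) (use no in \<open>auto simp: c_def\<close>)
    qed
  qed
  ultimately show ?thesis unfolding admissible_def by blast
qed

text \<open>If the face beyond \<open>d2\<close> is needy, its far corner \<open>q\<close> is a
  crossing, and the cases depend on which of \<open>d1\<close>, \<open>d3\<close> and their
  continuations are bent. The hull condition excludes all but one: three bent sides with straight
  continuations, where it places \<open>u\<close> ahead of \<open>mh d1\<close> as required for the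
  fan.\<close>

lemma outer_vertex:
  assumes u: "u \<in> V" "fst d1 = p u" "u \<notin> ed d2"
  shows "\<exists>c. admissible c"
proof (cases "needy (lf (rv d2))")
  case False
  have "fst d1 \<in> p ` V" using u by simp
  then show ?thesis using override[OF tri(3) middle_bent k False] others by blast
next
  case True
  have uV: "fst d1 \<in> p ` V" using u by simp
  have t2: "turn d2 \<noteq> 0" by (rule middle_bent[OF uV])
  obtain m2 m3 where m: "m2 \<in> M" "m3 \<in> M" and f2: "fst m2 = mh d1" and n2: "mn m2 = m3" and h3: "mh m3 = mh d2" and f3: "fst m3 = mh m2"
    and e: "ed m2 = ed d1" "ed m3 = ed d3" and p2: "pp (od m2) (idr d1)" and p3: "pp (idr m3) (od d3)"
    and s2: "turn d1 \<noteq> 0 \<Longrightarrow> turn m2 = 0" and s3: "turn d3 \<noteq> 0 \<Longrightarrow> turn m3 = 0" by (rule across[OF True]) blast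
  \<comment> \<open>A vertex at the far corner would be a common end of \<open>ed d1\<close> and
    \<open>ed d3\<close>. If it is \<open>u\<close>, then \<open>m2\<close> runs back along
    \<open>d1\<close>; if not, the two edges have the same ends.\<close>
  have qX: "mh m2 \<in> X"
  proof (rule ccontr)
    assume "mh m2 \<notin> X"
    then obtain v where v: "v \<in> V" "mh m2 = p v" using mh_cases[OF m(1)] by auto
    have a: "v \<in> ed d1" "v \<in> ed d3" using vertex_ed_mh[OF m(1) v(2,1)] vertex_ed[OF m(2) _ v(1)] f3 v(2) e by auto
    have b: "u \<in> ed d1" "u \<in> ed d3" using vertex_ed[OF tri(5) u(2,1)] vertex_ed_mh[OF tri(7) _ u(1)] u(2) tri(10) by auto
    show False
    proof (cases "v = u")
      case True
      have "rv m2 = d1"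
        by (rule vertex_dart_unique[of _ _ u]) (use rv_M[OF m(1)] rv_props[OF m(1)] tri(5) u v True e in auto)
      then have "od m2 = - idr d1" using rv_props(4)[OF m(1)] by auto
      then show False using p2 pp_not_minus[of "idr d1" "idr d1"] idr_nz[OF tri(5)] by simp
    next
      case False
      obtain r s where "ed d1 = {u,r}" "ed d3 = {u,s}" using E_other[OF ed_E[OF tri(5)] b(1)] E_other[OF ed_E[OF tri(7)] b(2)] by blast
      then show False using ne a False by auto
    qed
  qed
  define q where "q = mh m2"
  have qN: "q \<in> N" using qX W_N by (simp add: q_def W_def)
  have st2: "pp (q - mh d1) (idr d1)" if "turn m2 = 0"
    using pp_trans[OF unbent(2)[OF m(1) that] p2] f2 by (simp add: q_def)
  have st3: "pp (mh d2 - q) (od d3)" if "turn m3 = 0"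
    using pp_trans[OF pp_trans[OF unbent(2)[OF m(2) that] pp_sym[OF unbent(1)[OF m(2) that]]] p3] f3 h3 by (simp add: q_def)
  have qd: "pp (od m3) (\<i> * idr m2)" using mn_cross(1)[OF m(1) qX] n2 by simp
  show ?thesis
  proof (cases "turn m2 = 0 \<and> turn m3 = 0")
    case st: True
    show ?thesis
    proof (cases "turn d1 = 0 \<or> turn d3 = 0")
      case True
      then show ?thesis using straight_contra[OF qN st2 st3 t2] st by blast
    next
      case False
      define v where "v = - (q - mh d1)"
      have S2: "pp (q - mh d1) (idr d1)" and S3: "pp (mh d2 - q) (od d3)" using st st2 st3 by auto
      have v0: "v \<noteq> 0" using pp_zero[OF S2] idr_nz[OF tri(5)] by (auto simp: v_def)
      have vv: "0 < v \<bullet> v" using v0 by simp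
      obtain l where l: "0 < l" "snd d1 = mh d1 - l *\<^sub>R (q - mh d1)" using back1(2)[OF S2] False by blast
      have c1: "snd d1 - q = (1 + l) *\<^sub>R v" by (simp add: l(2) v_def algebra_simps)
      then have w1: "0 < (snd d1 - q) \<bullet> v" using vv l(1) by simp
      have "(snd d2 - mh d1) \<bullet> (q - mh d1) = 0"
        using pp_perp(1)[OF dirs(1)] S2 tri(8) by (auto simp: ppR od_def)
      then have "(snd d2 - mh d1) \<bullet> v = 0" unfolding v_def by (simp only: inner_minus_right minus_zero)
      then have w2: "0 < (snd d2 - q) \<bullet> v" using vv by (simp add: v_def inner_diff_left)
      have im: "pp (idr m2) (- v)" using st pp_trans[OF unbent(1)[OF m(1)] pp_sym[OF unbent(2)[OF m(1)]]] f2 by (simp add: q_def v_def)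
      have om: "pp (mh d2 - q) (od m3)" using st unbent(2)[OF m(2)] f3 h3 by (simp add: q_def)
      have o: "(mh d2 - q) \<bullet> v = 0" using pp_perp(1)[OF qd] im om by (auto simp: ppR)
      obtain l' where l': "snd d3 = mh d2 + l' *\<^sub>R (mh d2 - q)" using fwd3(2)[OF S3] False by blast
      have "snd d3 - q = (1 + l') *\<^sub>R (mh d2 - q)" by (simp add: l' algebra_simps)
      then have w3: "(snd d3 - q) \<bullet> v = 0" using o by simp
      \<comment> \<open>None of the three bends lies in the open half plane at \<open>q\<close>
        opposite to \<open>v\<close>, so the vertex must.\<close>
      obtain r where r: "r \<in> hullQ f" "(r - q) \<bullet> v < 0" using X_hull[OF hullN qX v0] unfolding q_def by blast
      have "r \<noteq> snd d1" "r \<noteq> snd d2" "r \<noteq> snd d3" using r(2) w1 w2 w3 by auto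
      with r(1) have "r = fst d1" by (blast elim: hullQ_cases)
      then have "(fst d1 - q) \<bullet> v < 0" using r(2) by simp
      then have "(fst d1 - mh d1) \<bullet> v < 0" using vv by (simp add: v_def inner_diff_left)
      then have "0 < (fst d1 - mh d1) \<bullet> (q - mh d1)" by (simp add: v_def inner_diff_right)
      then have "0 < (fst d1 - mh d1) \<bullet> idr d1" using pp_sym[OF S2] by (auto simp: ppR)
      then show ?thesis by (rule fan_admissible[OF u t2])
    qed
  next
    case False
    show ?thesis
    proof (cases "turn m2 = 0")
      case True
      then have b3: "turn m3 \<noteq> 0" using False by simp
      then have t3: "turn d3 = 0" using s3 by blast
      show ?thesis
      proof (cases "turn d1 = 0")
        case True
        have "z \<in> {fst d1, snd d2}" if "z \<in> hullQ f" for z using that by (cases rule: hullQ_cases) (use True t3 in auto)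
        then have "hullQ f \<subseteq> {fst d1, snd d2}" by blast
        then show ?thesis using no_two[OF hullN x1] by blast
      next
        \<comment> \<open>The mirror image: \<open>z\<close> and \<open>y\<close> run backwards
          along the bent side \<open>m3\<close>, starting from \<open>mh d2\<close>, and
          \<open>j\<close> is \<open>- \<i>\<close>.\<close>
        case t1: False
        have S2: "pp (q - mh d1) (idr d1)" using st2 True by simp
        define z where "z = - idr m3"
        define y where "y = - od m3"
        have vz: "q = mh d2 + z + y" using mh_eq[OF m(2) turn_bend[OF m(2) b3]] h3 f3 by (simp add: z_def y_def q_def algebra_simps)
        have y0: "y \<noteq> 0" using od_nz[OF m(2)] by (simp add: y_def)
        obtain l where l: "0 < l" "fst d1 = mh d2 - l *\<^sub>R z"
        proof -
          have "pp (mh d3 - fst d3) (idr m3)" using pp_trans[OF unbent(2)[OF tri(7) t3] pp_sym[OF p3]] .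
          then obtain l where "0 < l" "fst d1 - mh d2 = l *\<^sub>R idr m3" using tri(9,10) by (auto simp: ppR)
          then show thesis by (intro that[of l]) (simp_all add: z_def algebra_simps)
        qed
        obtain al where al: "0 < al" "snd d2 = mh d2 + al *\<^sub>R (- \<i> * z)"
        proof -
          have "pp (idr m3) (\<i> * idr d2)" using p3 dirs(2) pp_trans by blast
          then have "pp (- \<i> * idr m3) (- \<i> * (\<i> * idr d2))" by (rule pp_mult)
          then have "pp (- \<i> * idr m3) (idr d2)" by (simp add: mult.assoc[symmetric])
          then obtain al where "0 < al" "idr d2 = al *\<^sub>R (- \<i> * idr m3)" using pp_sym unfolding ppR by blast
          then show thesis using snd_bent[OF tri(6) t2] by (intro that[of al]) (simp_all add: z_def)
        qed
        have k1: "pp (idr m2) (\<i> * y)"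
        proof -
          have "pp (- \<i> * od m3) (- \<i> * (\<i> * idr m2))" by (rule pp_mult[OF qd])
          then have "pp (\<i> * y) (idr m2)" by (simp add: mult.assoc[symmetric] y_def)
          then show ?thesis by (rule pp_sym)
        qed
        have k2: "pp (q - mh d1) (\<i> * y)"
          using pp_trans[OF pp_trans[OF unbent(2)[OF m(1) True] pp_sym[OF unbent(1)[OF m(1) True]]] k1] f2 by (simp add: q_def)
        obtain ka where ka: "0 < ka" "mh d1 = q + ka *\<^sub>R (- \<i> * y)"
        proof -
          obtain ka where "0 < ka" "q - mh d1 = ka *\<^sub>R (\<i> * y)" using k2 by (auto simp: ppR)
          then show thesis by (intro that[of ka]) (simp_all add: algebra_simps)
        qed
        obtain ga where ga: "0 < ga" "snd d2 = mh d1 - ga *\<^sub>R y"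
        proof -
          have "pp (idr d1) (\<i> * y)" using pp_trans[OF pp_sym[OF S2] k2] .
          then have "pp (\<i> * idr d1) (\<i> * (\<i> * y))" by (rule pp_mult)
          then have "pp (od d2) (- y)" using dirs(1) pp_trans by (fastforce simp: mult.assoc[symmetric])
          then obtain ga where g: "0 < ga" "od d2 = ga *\<^sub>R (- y)" unfolding ppR by blast
          then have "snd d2 - mh d1 = - (ga *\<^sub>R y)" using tri(8) by (simp add: od_def)
          then show thesis using g(1) by (intro that[of ga]) (simp_all add: algebra_simps)
        qed
        obtain mu where mu: "0 < mu" "snd d1 = q + mu *\<^sub>R (- \<i> * y)"
        proof -
          obtain s where s: "0 < s" "snd d1 = mh d1 - s *\<^sub>R (q - mh d1)" using back1(2)[OF S2 t1] by blast
          have "q - mh d1 = ka *\<^sub>R (\<i> * y)" using ka(2) by (simp add: algebra_simps)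
          then have "snd d1 = q + (ka + s * ka) *\<^sub>R (- \<i> * y)" using s(2) ka(2) by (simp add: algebra_simps)
          then show thesis using s(1) ka(1) by (intro that[of "ka + s * ka"]) (simp_all add: add_pos_pos)
        qed
        have "z \<in> {fst d1, snd d2, snd d1}" if "z \<in> hullQ f" for z using that by (cases rule: hullQ_cases) (use t3 in auto)
        then have Q: "hullQ f \<subseteq> {fst d1, snd d2, snd d1}" by blast
        have "snd d2 = q + ka *\<^sub>R (- \<i> * y) - ga *\<^sub>R y" using ga(2) ka(2) by simp
        then have False
          using one_straight_hull[OF hullN _ _ Q y0 l(2) al(2) vz _ mu(2) l(1) al(1) ka(1) ga(1) mu(1)] qX by (simp add: q_def)
        then show ?thesis ..
      qed
    next
      case b2: False
      then have t1: "turn d1 = 0" using s2 by blast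
      show ?thesis
      proof (cases "turn d3 = 0")
        case True
        have "z \<in> {fst d1, snd d2}" if "z \<in> hullQ f" for z using that by (cases rule: hullQ_cases) (use True t1 in auto)
        then have "hullQ f \<subseteq> {fst d1, snd d2}" by blast
        then show ?thesis using no_two[OF hullN x1] by blast
      next
        \<comment> \<open>Here \<open>z\<close> and \<open>y\<close> are the two pieces of the bent
          side \<open>m2\<close>, starting from \<open>mh d1\<close>, and \<open>j\<close> is
          \<open>\<i>\<close>.\<close>
        case t3: False
        have s3: "turn m3 = 0" using s3[OF t3] .
        have S3: "pp (mh d2 - q) (od d3)" using st3[OF s3] .
        define z where "z = od m2"
        define y where "y = idr m2"
        have vz: "q = mh d1 + z + y" using mh_eq[OF m(1) turn_bend[OF m(1) b2]] f2 by (simp add: z_def y_def q_def algebra_simps)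
        have y0: "y \<noteq> 0" using idr_nz[OF m(1)] by (simp add: y_def)
        obtain l where l: "0 < l" "fst d1 = mh d1 - l *\<^sub>R z"
        proof -
          have "pp (mh d1 - fst d1) z" using pp_trans[OF pp_trans[OF unbent(2)[OF tri(5) t1] pp_sym[OF unbent(1)[OF tri(5) t1]]] pp_sym[OF p2]] unfolding z_def .
          then obtain l where "0 < l" "mh d1 - fst d1 = l *\<^sub>R z" by (auto simp: ppR)
          then show thesis by (intro that[of l]) (simp_all add: algebra_simps)
        qed
        obtain al where al: "0 < al" "snd d2 = mh d1 + al *\<^sub>R (\<i> * z)"
        proof -
          have "pp (\<i> * idr d1) (\<i> * z)" by (rule pp_mult) (use pp_sym[OF p2] in \<open>simp add: z_def\<close>)
          then have "pp (od d2) (\<i> * z)" using dirs(1) pp_trans by blast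
          then obtain al where "0 < al" "od d2 = al *\<^sub>R (\<i> * z)" by (auto simp: ppR)
          then show thesis using tri(8) by (intro that[of al]) (simp_all add: od_def algebra_simps)
        qed
        have k2: "pp (mh d2 - q) (\<i> * y)"
          using pp_trans[OF unbent(2)[OF m(2) s3]] qd f3 h3 by (simp add: y_def q_def)
        obtain ka where ka: "0 < ka" "mh d2 = q + ka *\<^sub>R (\<i> * y)"
        proof -
          obtain ka where "0 < ka" "mh d2 - q = ka *\<^sub>R (\<i> * y)" using k2 by (auto simp: ppR)
          then show thesis by (intro that[of ka]) (simp_all add: algebra_simps)
        qed
        obtain ga where ga: "0 < ga" "snd d2 = mh d2 - ga *\<^sub>R y"
        proof -
          have "pp (od d3) (\<i> * y)" using pp_trans[OF pp_sym[OF S3] k2] .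
          then have "pp (\<i> * idr d2) (\<i> * y)" using pp_trans[OF pp_sym[OF dirs(2)]] by blast
          then have "pp (- \<i> * (\<i> * idr d2)) (- \<i> * (\<i> * y))" by (rule pp_mult)
          then have "pp (idr d2) y" by (simp add: mult.assoc[symmetric])
          then obtain ga where "0 < ga" "idr d2 = ga *\<^sub>R y" by (auto simp: ppR)
          then show thesis using snd_bent[OF tri(6) t2] by (intro that[of ga]) simp_all
        qed
        obtain mu where mu: "0 < mu" "snd d3 = q + mu *\<^sub>R (\<i> * y)"
        proof -
          obtain s where s: "0 < s" "snd d3 = mh d2 + s *\<^sub>R (mh d2 - q)" using fwd3(2)[OF S3 t3] by blast
          have "mh d2 - q = ka *\<^sub>R (\<i> * y)" using ka(2) by simp
          then have "snd d3 = q + (ka + s * ka) *\<^sub>R (\<i> * y)" using s(2) ka(2) by (simp add: algebra_simps)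
          then show thesis using s(1) ka(1) by (intro that[of "ka + s * ka"]) (simp_all add: add_pos_pos)
        qed
        have "z \<in> {fst d1, snd d2, snd d3}" if "z \<in> hullQ f" for z using that by (cases rule: hullQ_cases) (use t1 in auto)
        then have Q: "hullQ f \<subseteq> {fst d1, snd d2, snd d3}" by blast
        have "snd d2 = q + ka *\<^sub>R (\<i> * y) - ga *\<^sub>R y" using ga(2) ka(2) by simp
        then have False
          using one_straight_hull[OF hullN _ _ Q y0 l(2) al(2) vz _ mu(2) l(1) al(1) ka(1) ga(1) mu(1)] qX by (simp add: q_def)
        then show ?thesis ..
      qed
    qed
  qed
qed

end

section \<open>Existence of admissible claims\<close>

context star_drawing begin

text \<open>\<open>cl0\<close> satisfies all bounded needy faces, so only the unbounded one can
  fail. A failing digon would have no vertex, and its two bends cannot span the drawing; what is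
  left is the situation of \<open>outer_triangle\<close>.\<close>

lemma claims: "\<exists>c. admissible c"
proof (cases "\<forall>f. needy f \<longrightarrow> sat cl0 f")
  case True
  moreover have "cl0 d \<Longrightarrow> turn d \<noteq> 0" for d by (simp add: cl0_def)
  ultimately show ?thesis using cl0_excl unfolding admissible_def by blast
next
  case False
  then obtain f where f: "needy f" "\<not> sat cl0 f" by blast
  have fA: "f \<in> lf ` A" and v: "vf f \<le> 1" and k: "kf f = 2 \<or> kf f = 3"
    using f(1) kf_ge2[of f] by (auto simp: needy_def)
  have "A \<noteq> {}" using fA by auto
  then have comps: "components (- S) = lf ` A" by (rule comps_eq)
  have fc: "f \<in> components (- S)" using fA comps by simp
  have ub: "\<not> bounded f" using sat_k2[OF _ v] sat_k3[OF _ v] k f(2) by auto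
  have others: "sat cl0 f'" if f': "needy f'" "f' \<noteq> f" for f'
  proof (rule ccontr)
    assume n: "\<not> sat cl0 f'"
    have f'A: "f' \<in> lf ` A" and v': "vf f' \<le> 1" and k': "kf f' = 2 \<or> kf f' = 3"
      using f'(1) kf_ge2[of f'] by (auto simp: needy_def)
    have "\<not> bounded f'" using sat_k2[OF _ v'] sat_k3[OF _ v'] k' n by auto
    moreover have "bounded S" using compact_S compact_imp_bounded by blast
    ultimately show False
      using cobounded_unique_unbounded_components[of "- S" f f'] fc f'A comps ub f'(2) by simp
  qed
  have np: "\<not> (\<exists>d\<in>mdF f. fst d \<in> p ` V)" if "kf f = 2" using sat_k2[OF that v] f(2) by blast
  have X2: "fst d \<in> X" if "kf f = 2" "d \<in> mdF f" for d
    using fst_cases[OF mdF_M[OF that(2)]] np[OF that(1)] that(2) by blast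
  obtain d0 where d0: "d0 \<in> mdF f" using kf_ge2[OF fA] unfolding kf_def by (metis card.empty ex_in_conv not_numeral_le_zero)
  have k3: "kf f = 3"
  proof (rule ccontr)
    assume "kf f \<noteq> 3"
    then have k2: "kf f = 2" using k by simp
    have "hullQ f \<subseteq> {snd d0, snd (mn d0)}" using np[OF k2] unfolding hullQ_def kf2(1)[OF k2 d0] by auto
    then show False using no_two[OF outer_Q[OF fc ub] X2[OF k2 d0]] by blast
  qed
  \<comment> \<open>Otherwise the first side is the reverse of the last one, and the middle side
    starts and ends at the same crossing.\<close>
  have tri: "ed d \<noteq> ed (mn (mn d))" if d: "d \<in> mdF f" and x: "mh d \<in> X" "mh (mn d) \<in> X"
    and h: "fst d \<in> p ` V \<or> turn d \<noteq> 0 \<and> turn (mn (mn d)) \<noteq> 0" for d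
  proof
    assume e: "ed d = ed (mn (mn d))"
    note t = kf3[OF k3 d]
    define d3 where "d3 = mn (mn d)"
    have M: "d \<in> M" "mn d \<in> M" "d3 \<in> M" using mdF_M[OF d] mdF_M[OF mn_mdF[OF d]] mdF_M[OF mn_mdF[OF mn_mdF[OF d]]] by (simp_all add: d3_def)
    have h3: "mh d3 = fst d" using fst_mn[of d3] t(2) by (simp add: d3_def)
    have "rv d3 = d"
      using h
    proof
      assume "fst d \<in> p ` V"
      then obtain u where "u \<in> V" "fst d = p u" by auto
      then show ?thesis using vertex_dart_unique[of "rv d3" d u] rv_M[OF M(3)] rv_props[OF M(3)] M(1) h3 e by (simp add: d3_def)
    next
      assume "turn d \<noteq> 0 \<and> turn (mn (mn d)) \<noteq> 0"
      then show ?thesis using turn_unique[OF M(3,1)] e t(3) by (auto simp: d3_def)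
    qed
    then have "mh d = fst d3" using rv_props(2)[OF M(3)] by simp
    then show False using mh_ne[OF M(2)] by (simp add: d3_def)
  qed
  show ?thesis
  proof (cases "\<exists>d\<in>mdF f. fst d \<in> p ` V")
    case True
    obtain u d where d: "u \<in> V" "d \<in> mdF f" "fst d = p u" "mh d \<in> X" "mh (mn d) \<in> X"
      by (rule k3_setup[OF k3 v True]) blast
    have "u \<notin> ed (mn d)" using sat_k3[OF k3 v] f(2) d by blast
    moreover have "outer_triangle V E p b f d (mn d) (mn (mn d))"
    proof unfold_locales
      show "ed d \<noteq> ed (mn (mn d))" using tri[OF d(2,4,5)] True d(1,3) by auto
    qed (fact fc ub k3 d refl others)+
    ultimately show ?thesis using outer_triangle.outer_vertex[of V E p b f d "mn d" "mn (mn d)" u] d(1,3) by blast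
  next
    case False
    have X3: "fst d \<in> X" if "d \<in> mdF f" for d using fst_cases[OF mdF_M[OF that]] False that by blast
    have X4: "mh d \<in> X" if "d \<in> mdF f" for d using X3[OF mn_mdF[OF that]] by simp
    note t = kf3[OF k3 d0]
    have m: "mn d0 \<in> mdF f" "mn (mn d0) \<in> mdF f" using d0 mn_mdF by auto
    have two: "\<not> hullQ f \<subseteq> {a,c}" for a c using no_two[OF outer_Q[OF fc ub] X3[OF d0]] .
    have "turn d \<noteq> 0" if d: "d \<in> mdF f" for d
    proof
      assume z: "turn d = 0"
      have "hullQ f \<subseteq> {snd (mn d), snd (mn (mn d))}" using False z unfolding hullQ_def kf3(1)[OF k3 d] by auto
      then show False using two by blast
    qed
    then have ne: "ed d0 \<noteq> ed (mn (mn d0))" using tri[OF d0 X4[OF d0] X4[OF m(1)]] d0 m by blast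
    have "outer_triangle V E p b f d0 (mn d0) (mn (mn d0))"
      by unfold_locales (fact fc ub k3 d0 refl others X4[OF d0] X4[OF m(1)] ne)+
    then show ?thesis by (rule outer_triangle.outer_crossings[OF _ X3[OF d0]])
  qed
qed

end

section \<open>Subdrawings closed under crossing\<close>

context plane_graph begin

text \<open>Points of the edge pushed slightly to the left lie in the face.\<close>

lemma segment_closure:
  assumes d: "d \<in> A" shows "closed_segment (fst d) (snd d) \<subseteq> closure (lf d)"
proof -
  obtain a c where ac: "d = (a,c)" by (cases d)
  have ne: "a \<noteq> c" using A_ne d ac by auto
  have "s \<in> closure (lf d)" if s: "s \<in> open_segment a c" for s
    unfolding closure_approachable
  proof (intro allI impI)
    fix e :: real assume e: "0 < e"
    obtain r where r: "0 < r" "\<And>y. dist y s < r \<Longrightarrow> 0 < Im ((y - a) / (c - a)) \<Longrightarrow> y \<in> lf (a,c)"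
      using half_disc[of a c s] d s unfolding ac by blast
    define t where "t = min e r / (2 * cmod (c - a))"
    have t: "0 < t" "t * cmod (c - a) < min e r" using e r(1) ne by (simp_all add: t_def min_def)
    define y where "y = s + of_real t * (\<i> * (c - a))"
    have dy: "dist y s < min e r" using t by (simp add: y_def dist_norm norm_mult)
    obtain u where u: "s = a + of_real u * (c - a)"
      using s unfolding in_segment by (auto simp: scaleR_conv_of_real algebra_simps)
    have "(y - a) / (c - a) = of_real u + of_real t * \<i>" using ne by (simp add: y_def u field_simps)
    then have "0 < Im ((y - a) / (c - a))" using t(1) by simp
    then have "y \<in> lf d" using r(2) dy by (simp add: ac)
    then show "\<exists>y\<in>lf d. dist y s < e" using dy by auto
  qed
  then have "closure (open_segment a c) \<subseteq> closure (lf d)" by (intro closure_minimal) auto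
  then show ?thesis using ne by (simp add: ac)
qed

lemma fst_frontier: "d \<in> A \<Longrightarrow> fst d \<in> frontier (lf d)"
  using segment_closure[of d] comp_disj[OF lf_props(1), of d] comp_open[OF lf_props(1), of d] N_S A_N[of "fst d" "snd d"]
  by (auto simp: frontier_def interior_open)

end

context drawing begin

lemma S_sub: "S \<subseteq> p ` V \<union> (\<Union>e\<in>E. on e)"
proof -
  have X: "x \<in> (\<Union>e\<in>E. on e)" if "x \<in> X" for x using that by (auto simp: X_def on_def)
  have N: "z \<in> p ` V \<union> (\<Union>e\<in>E. on e)" if "z \<in> N" for z
  proof -
    consider "z \<in> p ` V" | e where "e \<in> E" "z = b e" | "z \<in> X" using \<open>z \<in> N\<close> by (auto simp: N_def)
    then show ?thesis
    proof cases
      case 2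
      then obtain u where "u \<in> e" using E_pair[of e] by blast
      then have "z \<in> on e" using 2 by (auto simp: on_def)
      then show ?thesis using 2 by blast
    qed (use X in auto)
  qed
  show ?thesis
  proof
    fix z assume "z \<in> S"
    then show "z \<in> p ` V \<union> (\<Union>e\<in>E. on e)"
    proof (cases rule: S_cases)
      case 1 then show ?thesis using N by blast
    next
      case (2 a c)
      then obtain e u where "e \<in> E" "u \<in> e" "a \<in> hs e u" "c \<in> hs e u" using A_D by blast
      then have "z \<in> hs e u" "e \<in> E" "u \<in> e" using open_seg_hs 2 by blast+
      then show ?thesis by (auto simp: on_def)
    qed
  qed
qed

lemma on_meet: "e \<in> E \<Longrightarrow> f \<in> E \<Longrightarrow> e \<noteq> f \<Longrightarrow> z \<in> on e \<Longrightarrow> z \<in> on f \<Longrightarrow> z \<notin> p ` V \<Longrightarrow> z \<in> X"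
  unfolding X_def on_def by blast

lemma p_on: "e \<in> E \<Longrightarrow> w \<in> V \<Longrightarrow> p w \<in> on e \<longleftrightarrow> w \<in> e"
  using p_in_hs p_hs unfolding on_def by blast

lemma closed_on: "e \<in> E \<Longrightarrow> closed (on e)"
  unfolding on_def hs_def by (intro closed_UN finite_edge) auto

lemma connected_on_compl:
  assumes e: "e \<in> E" shows "connected (- on e)"
proof -
  obtain u v where uv: "u \<noteq> v" "e = {u,v}" using E_pair[OF e] by blast
  let ?g = "linepath (p u) (b e) +++ linepath (b e) (p v)"
  have "arc ?g"
  proof (rule arc_join)
    have "u \<in> e" "v \<in> e" using uv by auto
    note h = pu_ne_b[OF e this(1)] pu_ne_b[OF e this(2)] bend_seg[OF e this uv(1)]
    show "arc (linepath (p u) (b e))" "arc (linepath (b e) (p v))" using h(1,2) by (auto intro: arc_linepath)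
    show "path_image (linepath (p u) (b e)) \<inter> path_image (linepath (b e) (p v)) \<subseteq> {pathstart (linepath (b e) (p v))}"
      using h(3) by simp
  qed simp
  then have "connected (- path_image ?g)" by (rule connected_arc_complement) simp
  moreover have "path_image ?g = on e"
    by (subst path_image_join) (auto simp: on_def hs_def uv closed_segment_commute)
  ultimately show ?thesis by simp
qed

lemma whole_half:
  assumes X: "X = {}" and e: "e \<in> E" "u \<in> e" shows "(p u, b e) \<in> A"
proof (rule A_I[OF e p_hs b_hs pu_ne_b[OF e]])
  show "p u \<in> N" "b e \<in> N" using p_V_N[OF E_V[OF e]] b_N[OF e(1)] by auto
  show "open_segment (p u) (b e) \<inter> N = {}"
  proof -
    have "z = p u \<or> z = b e" if z: "z \<in> N" "z \<in> hs e u" for z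
      using z p_in_hs[OF e, of "_"] b_in_hs[OF _ e] X by (auto simp: N_def)
    then show ?thesis using open_seg_hs[OF p_hs b_hs] unfolding open_segment_def by blast
  qed
qed

lemma on_S: "X = {} \<Longrightarrow> e \<in> E \<Longrightarrow> on e \<subseteq> S"
  using seg_S[OF whole_half] by (auto simp: on_def hs_def)

text \<open>The frontier of \<open>f\<close> is contained in the non-separating set \<open>K\<close>, so \<open>f\<close> is its complement.\<close>

lemma face_arc_component:
  assumes X: "X = {}" and U: "U \<subset> V" "\<And>e. e \<in> E \<Longrightarrow> e \<subseteq> U \<or> e \<inter> U = {}"
    and K: "K = p ` U \<union> (\<Union>e\<in>{e\<in>E. e \<subseteq> U}. on e)" "connected (- K)"
    and f: "f \<in> components (- S)" and a: "a \<in> frontier f" "a \<in> K" and good: "\<And>x. x \<in> frontier f \<Longrightarrow> path_component S a x"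
  shows False
proof -
  \<comment> \<open>The rest of the drawing. Without crossings \<open>K\<close> and \<open>R\<close>
    are disjoint closed sets, so a component that meets \<open>K\<close> stays in it.\<close>
  define R where "R = p ` (V - U) \<union> (\<Union>e\<in>{e\<in>E. e \<inter> U = {}}. on e)"
  have fin: "finite U" using U finV finite_subset by blast
  have cK: "closed K" unfolding K(1)
    by (intro closed_Un closed_UN closed_on) (use fin finE closed_on in \<open>auto intro: finite_imp_closed\<close>)
  have cR: "closed R" unfolding R_def
    by (intro closed_Un closed_UN closed_on) (use finV finE closed_on in \<open>auto intro: finite_imp_closed\<close>)
  have SKR: "S \<subseteq> K \<union> R"
  proof
    fix z assume "z \<in> S"
    then have "z \<in> p ` V \<union> (\<Union>e\<in>E. on e)" using S_sub by blast
    then show "z \<in> K \<union> R"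
    proof
      assume "z \<in> p ` V" then show ?thesis by (auto simp: K R_def)
    next
      assume "z \<in> (\<Union>e\<in>E. on e)" then show ?thesis using U(2) unfolding K R_def by blast
    qed
  qed
  have dis: "K \<inter> R = {}"
  proof (rule ccontr)
    assume "K \<inter> R \<noteq> {}"
    then obtain z where z: "z \<in> K" "z \<in> R" by blast
    consider (v) u where "u \<in> U" "z = p u" | (e) e where "e \<in> E" "e \<subseteq> U" "z \<in> on e" "z \<notin> p ` V"
      using z(1) U(1) p_on E_V unfolding K by blast
    then show False
    proof cases
      case v
      then have uV: "u \<in> V" using U by blast
      have "z \<notin> p ` (V - U)" using v uV p_inj unfolding inj_on_def by auto
      then obtain g where "g \<in> E" "g \<inter> U = {}" "p u \<in> on g" using z(2) v unfolding R_def by blast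
      then show False using p_on[of g u] uV v by auto
    next
      case e
      then obtain g where g: "g \<in> E" "g \<inter> U = {}" "z \<in> on g" using z(2) unfolding R_def by blast
      have "e \<noteq> {}" using E_pair[OF e(1)] by auto
      then have "e \<noteq> g" using g(2) e(2) by auto
      then have "z \<in> X" using on_meet[OF e(1) g(1) _ e(3) g(3) e(4)] by simp
      then show False using X by simp
    qed
  qed
  let ?T = "path_component_set S a"
  have "connected ?T" by (rule path_connected_imp_connected[OF path_connected_path_component])
  have TS: "?T \<subseteq> K \<union> R" using path_component_subset[of S a] SKR by blast
  have aT: "a \<in> ?T" using good[OF a(1)] by simp
  have TK: "?T \<subseteq> K"
  proof (rule ccontr)
    assume "\<not> ?T \<subseteq> K"
    then have "R \<inter> ?T \<noteq> {}" using TS by blast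
    moreover have "K \<inter> ?T \<noteq> {}" using aT a(2) by blast
    ultimately show False
      using connected_closedD[OF \<open>connected ?T\<close> _ TS cK cR] dis by blast
  qed
  have fr: "frontier f \<subseteq> K" using good TK by blast
  have KS: "K \<subseteq> S" unfolding K using on_S[OF X] p_V_N N_S U(1) by blast
  have "f = - K"
    by (rule open_frontier_complement[OF comp_open[OF f] in_components_nonempty[OF f] fr _ K(2)]) (use comp_disj[OF f] KS in blast)
  then have "S \<subseteq> K" using comp_disj[OF f] by blast
  moreover obtain w where w: "w \<in> V" "w \<notin> U" using U by blast
  ultimately have "p w \<in> K" using p_V_N N_S by blast
  moreover have "p w \<in> R" using w by (auto simp: R_def)
  ultimately show False using dis by blast
qed

end

text \<open>Closure under crossing means that a kept edge keeps all its crossings. Nodes and darts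
  on kept edges are thus unchanged, and only faces may grow.\<close>

locale subdrawing = drawing +
  fixes E'
  assumes sub: "E' \<subseteq> E"
    and closed_sub: "e \<in> E' \<Longrightarrow> g \<in> E \<Longrightarrow> x \<in> X \<Longrightarrow> x \<in> on e \<Longrightarrow> x \<in> on g \<Longrightarrow> g \<in> E'"

sublocale subdrawing \<subseteq> sub: drawing V E' p b
proof
  show "finite V" "inj_on p V" by (fact finV p_inj)+
  fix e f u v w x
  show "\<exists>u v. u \<in> V \<and> v \<in> V \<and> u \<noteq> v \<and> e = {u,v}" if "e \<in> E'" using E_pair that sub by blast
  show "closed_segment (p u) (b e) \<inter> closed_segment (b e) (p v) = {b e}" if "e \<in> E'" "u \<in> e" "v \<in> e" "u \<noteq> v"
    using bend_seg that sub by blast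
  show "p w \<notin> closed_segment (p u) (b e)" if "e \<in> E'" "w \<in> V - e" "u \<in> e" using far that sub by blast
  show "(p u - b e) \<bullet> (p v - b f) = 0" if "e \<in> E'" "f \<in> E'" "e \<noteq> f" "u \<in> e" "v \<in> f" "x \<in> closed_segment (p u) (b e)"
    "x \<in> closed_segment (p v) (b f)" "x \<notin> p ` V" using perp[OF _ _ that(3-8)] that sub by blast
  show "b e \<notin> p ` V" if "e \<in> E'" using bend_V that sub by blast
  show "b e \<notin> closed_segment (p v) (b f)" if "e \<in> E'" "f \<in> E'" "e \<noteq> f" "v \<in> f" using bend_free that sub by blast
qed

context subdrawing begin

lemma EE: "e \<in> E' \<Longrightarrow> e \<in> E" using sub by blast

lemma X_sub: "sub.X = {x\<in>X. \<exists>e\<in>E'. x \<in> on e}"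
proof
  show "sub.X \<subseteq> {x\<in>X. \<exists>e\<in>E'. x \<in> on e}" unfolding sub.X_def X_def on_def using EE by blast
  show "{x\<in>X. \<exists>e\<in>E'. x \<in> on e} \<subseteq> sub.X"
  proof
    fix x assume "x \<in> {x\<in>X. \<exists>e\<in>E'. x \<in> on e}"
    then obtain e where x: "x \<in> X" "e \<in> E'" "x \<in> on e" by blast
    then obtain g h where gh: "x \<notin> p ` V" "g \<in> E" "h \<in> E" "g \<noteq> h" "x \<in> on g" "x \<in> on h" unfolding X_def on_def by blast
    then have "g \<in> E'" "h \<in> E'" using closed_sub x by blast+
    then show "x \<in> sub.X" using gh unfolding sub.X_def on_def by blast
  qed
qed

lemma N_sub: "sub.N \<subseteq> N" unfolding sub.N_def N_def X_sub using EE by auto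

lemma N_hs: "e \<in> E' \<Longrightarrow> u \<in> e \<Longrightarrow> z \<in> N \<Longrightarrow> z \<in> hs e u \<Longrightarrow> z \<in> sub.N"
  using b_in_hs[OF _ EE, of _ e u] unfolding sub.N_def N_def X_sub on_def by auto

lemma A_sub: "sub.A = {d\<in>A. fst (own d) \<in> E'}" and own_sub: "d \<in> sub.A \<Longrightarrow> sub.own d = own d"
proof -
  have 1: "(a,c) \<in> A \<and> fst (own (a,c)) \<in> E' \<and> sub.own (a,c) = own (a,c)" if ac: "(a,c) \<in> sub.A" for a c
  proof -
    obtain e u where e: "e \<in> E'" "u \<in> e" "a \<in> hs e u" "c \<in> hs e u" using sub.A_D[OF ac] by blast
    have "open_segment a c \<inter> N = {}" using sub.A_D[OF ac] N_hs[OF e(1,2)] open_seg_hs[OF e(3,4)] by blast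
    then have A: "(a,c) \<in> A" using A_I[OF EE[OF e(1)] e(2-4)] sub.A_D[OF ac] N_sub by blast
    then show ?thesis using ownI[OF A EE[OF e(1)] e(2-4)] sub.ownI[OF ac e] e(1) by simp
  qed
  have 2: "(a,c) \<in> sub.A" if ac: "(a,c) \<in> A" "fst (own (a,c)) \<in> E'" for a c
  proof -
    obtain e u where e: "e \<in> E" "u \<in> e" "a \<in> hs e u" "c \<in> hs e u" "own (a,c) = (e,u)" by (rule own_cases[OF ac(1)])
    then have e': "e \<in> E'" using ac(2) by simp
    show ?thesis
      by (rule sub.A_I[OF e' e(2-4)]) (use A_D[OF ac(1)] N_hs[OF e' e(2)] e N_sub in blast)+
  qed
  show "sub.A = {d\<in>A. fst (own d) \<in> E'}" using 1 2 by auto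
  show "d \<in> sub.A \<Longrightarrow> sub.own d = own d" using 1 by (cases d) auto
qed

lemma S_mono: "sub.S \<subseteq> S"
  unfolding sub.S_def S_def using N_sub A_sub by blast

lemma W_sub: "(a,c) \<in> sub.A \<Longrightarrow> a \<in> sub.W \<longleftrightarrow> a \<in> W" "(a,c) \<in> sub.A \<Longrightarrow> c \<in> sub.W \<longleftrightarrow> c \<in> W"
  using sub.A_D[of a c] unfolding sub.W_def W_def X_sub on_def by blast+

lemma M_sub: "sub.M = {d\<in>M. ed d \<in> E'}"
  unfolding sub.M_def M_def ed_def using W_sub(1) A_sub by auto

lemma ed_sub: "d \<in> sub.M \<Longrightarrow> sub.ed d = ed d"
  using own_sub[OF sub.M_A] by (simp add: sub.ed_def ed_def)

lemma ml_sub: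
  assumes d: "d \<in> sub.M" shows "sub.ml d = ml d"
proof -
  have dM: "d \<in> M" and dA: "d \<in> sub.A" using d M_sub sub.M_A by auto
  have W: "snd d \<in> sub.W \<longleftrightarrow> snd d \<in> W" using W_sub(2)[of "fst d" "snd d"] dA by simp
  show ?thesis
  proof (cases "snd d \<in> W")
    case True then show ?thesis using W by (simp add: sub.ml_def ml_def)
  next
    case False
    from dM show ?thesis
    proof (cases rule: M_cases)
      case (straight a c) then show ?thesis using False by simp
    next
      case (bend a c e u v)
      note B = bend
      from d show ?thesis
      proof (cases rule: sub.M_cases)
        case (straight a' c') then show ?thesis using False W by simp
      next
        case (bend a' c' e' u' v')
        have ee: "e' = e" "u' = u"
          using own_sub[OF dA] B(12) bend(12) by simp_all
        obtain x where "e = {u,x}" using E_other[OF B(5,6)] by blast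
        then have "v' = v" using ee bend(7,8) B(7,8) by simp
        moreover have c'A: "(b e, c') \<in> sub.A" using bend(10) ee by simp
        moreover have "own (b e, c') = sub.own (b e, c')" using own_sub[OF c'A] by simp
        ultimately have "own (b e, c') = own (b e, c)" using bend(13) B(13) ee by simp
        then have "c' = c" using b_nbr_unique[OF B(5) _ B(10)] c'A A_sub by blast
        then show ?thesis using B(17) bend(17) ee by simp
      qed
    qed
  qed
qed

lemma mh_sub: "d \<in> sub.M \<Longrightarrow> sub.mh d = mh d" by (simp add: sub.mh_def mh_def ml_sub)

lemma turn_sub: "d \<in> sub.M \<Longrightarrow> sub.turn d = turn d"
  by (simp add: sub.turn_def turn_def sub.od_def od_def sub.idr_def idr_def ml_sub)

text \<open>The two faces share a thin triangle at the dart, and the smaller drawing leaves more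
  room.\<close>

lemma lf_sub:
  assumes "d \<in> sub.A" shows "lf d \<subseteq> sub.lf d"
proof -
  have d: "d \<in> A" using assms A_sub by blast
  obtain h where h: "0 < h" "thin (fst d) (snd d) h \<subseteq> lf d" using lf_props(2)[OF d] by blast
  obtain h' where h': "0 < h'" "thin (fst d) (snd d) h' \<subseteq> sub.lf d" using sub.lf_props(2)[OF assms] by blast
  have "thin (fst d) (snd d) (min h h') \<noteq> {}" by (rule thin_nonempty) (use h h' in auto)
  then obtain z where z: "z \<in> thin (fst d) (snd d) (min h h')" by blast
  have "z \<in> thin (fst d) (snd d) h" "z \<in> thin (fst d) (snd d) h'"
    using z thin_mono[of "min h h'" h "fst d" "snd d"] thin_mono[of "min h h'" h' "fst d" "snd d"] h(1) h'(1) by auto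
  then have z: "z \<in> lf d" "z \<in> sub.lf d" using h h' by auto
  obtain x where x: "sub.lf d = connected_component_set (- sub.S) x" using sub.lf_props(1)[OF assms] by (auto simp: components_def)
  then have C: "sub.lf d = connected_component_set (- sub.S) z" using connected_component_eq[of z "- sub.S" x] z(2) by simp
  show ?thesis unfolding C
  proof (rule connected_component_maximal[OF z(1)])
    show "connected (lf d)" by (rule in_components_connected[OF lf_props(1)[OF d]])
    show "lf d \<subseteq> - sub.S" using comp_disj[OF lf_props(1)[OF d]] S_mono by blast
  qed
qed

text \<open>A side on a deleted edge would have its midpoint in the closure of \<open>f\<close> and
  off the smaller drawing, hence inside \<open>f\<close>, although it belongs to the larger
  drawing.\<close>

lemma mdF_sub:
  assumes f: "f \<in> components (- S)" "f \<in> components (- sub.S)"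
  shows "mdF f = sub.mdF f"
proof
  show "sub.mdF f \<subseteq> mdF f"
  proof
    fix d assume "d \<in> sub.mdF f"
    then have d: "d \<in> sub.M" "sub.lf d = f" by (auto simp: sub.mdF_def)
    have dM: "d \<in> M" using d M_sub by blast
    have "lf d \<in> components (- S)" using lf_props(1)[OF M_A[OF dM]] .
    moreover have "lf d \<subseteq> f" using lf_sub[OF sub.M_A[OF d(1)]] d(2) by simp
    ultimately have "lf d = f" using comp_eqI f(1) in_components_nonempty by blast
    then show "d \<in> mdF f" using dM by (simp add: mdF_def)
  qed
  show "mdF f \<subseteq> sub.mdF f"
  proof
    fix d assume "d \<in> mdF f"
    then have d: "d \<in> M" "lf d = f" by (auto simp: mdF_def)
    obtain a c where ac: "d = (a,c)" by (cases d)
    have acA: "(a,c) \<in> A" using M_A[OF d(1)] ac by simp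
    obtain e u where e: "e \<in> E" "u \<in> e" "a \<in> hs e u" "c \<in> hs e u" "own (a,c) = (e,u)" by (rule own_cases[OF acA])
    have "e \<in> E'"
    proof (rule ccontr)
      assume n: "e \<notin> E'"
      define z where "z = midpoint a c"
      have zo: "z \<in> open_segment a c" using A_D[OF acA] by (simp add: z_def)
      have zN: "z \<notin> N" using zo A_D[OF acA] by blast
      have zh: "z \<in> hs e u" using open_seg_hs[OF e(3,4) zo] .
      have "z \<notin> sub.S"
      proof
        assume "z \<in> sub.S"
        then have "z \<in> p ` V \<union> (\<Union>e\<in>E'. on e)" using sub.S_sub by blast
        moreover have "z \<notin> p ` V" using zN by (auto simp: N_def)
        ultimately obtain g w where g: "g \<in> E'" "w \<in> g" "z \<in> hs g w" unfolding on_def by blast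
        then show False using hs_N[OF e(1,2) EE[OF g(1)] g(2) zh g(3) zN] n by blast
      qed
      then have zc: "z \<in> connected_component_set (- sub.S) z" and cc: "connected_component_set (- sub.S) z \<in> components (- sub.S)"
        by (auto simp: components_def connected_component_refl_eq)
      have "z \<in> closure f" using segment_closure[OF acA] d(2) ac zo open_closed_segment by fastforce
      then have "connected_component_set (- sub.S) z \<inter> f \<noteq> {}"
        using open_Int_closure_eq_empty[OF sub.comp_open[OF cc]] zc by blast
      then have "z \<in> f" using sub.comp_eqI[OF cc f(2)] zc by blast
      moreover have "z \<in> S" using seg_S[OF acA] zo open_closed_segment by blast
      ultimately show False using comp_disj[OF f(1)] by blast
    qed
    then have dM: "d \<in> sub.M" using d(1) ac e(5) by (simp add: M_sub ed_def)
    have "f \<subseteq> sub.lf d" using lf_sub[OF sub.M_A[OF dM]] d(2) by simp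
    then have "sub.lf d = f" using sub.comp_eqI[OF sub.lf_props(1)[OF sub.M_A[OF dM]] f(2)] in_components_nonempty[OF f(2)] by blast
    then show "d \<in> sub.mdF f" using dM by (simp add: sub.mdF_def)
  qed
qed

end

text \<open>A side that is exceptional in the subdrawing is exceptional in the drawing, since the
  crossing at its head has the same two edges.\<close>

lemma (in star_drawing) star_sub:
  assumes s: "subdrawing V E p b E'" and c: "\<And>u. u \<in> V \<Longrightarrow> \<exists>e\<in>E'. u \<in> e"
  shows "star_drawing V E' p b"
proof -
  interpret s: subdrawing V E p b E' by (rule s)
  show ?thesis
  proof
    show "u \<in> V \<Longrightarrow> \<exists>e\<in>E'. u \<in> e" for u by (rule c)
    fix d u assume d: "d \<in> s.sub.M" and u: "u \<in> V" "fst d = p u" and x: "s.sub.mh d \<in> s.sub.X" and g: "u \<in> s.sub.ed (s.sub.mn d)"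
    have dM: "d \<in> M" using d s.M_sub by blast
    have mM: "s.sub.mn d \<in> s.sub.M" by (rule s.sub.mn_M[OF d])
    let ?g = "s.sub.ed (s.sub.mn d)"
    have xX: "mh d \<in> X" using x s.X_sub s.mh_sub[OF d] by simp
    have gE: "?g \<in> E" using s.sub.ed_E[OF mM] s.EE by blast
    have "mh d \<in> on ?g" using s.sub.fst_on[OF mM] s.mh_sub[OF d] by simp
    moreover have "?g \<noteq> ed d" using s.sub.mn_cross(2)[OF d x] s.ed_sub[OF d] by simp
    ultimately have "u \<in> ed (mn d)" using mn_cross(3)[OF dM xX gE] g by simp
    then show "s.sub.turn d \<noteq> 0" using star[OF dM u xX] s.turn_sub[OF d] by simp
  qed
qed

section \<open>Counting edges\<close>

context drawing begin

definition uncrossed :: "'a set set" where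
  "uncrossed = {e\<in>E. X \<inter> on e = {}}"

text \<open>A side without a bend node stays in one half edge, which contains only one vertex. So
  the side consists of two whole half edges without nodes inside.\<close>

lemma vertex_to_vertex:
  assumes d: "d \<in> M" and v: "fst d \<in> p ` V" "mh d \<in> p ` V"
  shows "ed d \<in> uncrossed"
proof -
  obtain u1 v1 where uv: "u1 \<in> V" "fst d = p u1" "v1 \<in> V" "mh d = p v1" using v by auto
  from d show ?thesis
  proof (cases rule: M_cases)
    case (straight a c)
    obtain e w where e: "e \<in> E" "w \<in> e" "a \<in> hs e w" "c \<in> hs e w" "own (a,c) = (e,w)" by (rule own_cases[OF straight(2)])
    have "u1 = w" "v1 = w" using p_in_hs[OF e(1,2)] uv e(3,4) straight(1,6) by simp_all
    then have "a = c" using uv straight(1,6) by simp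
    then show ?thesis using A_ne[OF straight(2)] by simp
  next
    case (bend a c e u v)
    have "a = p u" using p_in_hs[OF bend(5,6) uv(1)] bend(1,14) uv(2) by simp
    moreover have "c = p v" using p_in_hs[OF bend(5,7) uv(3)] bend(15,18) uv(4) by simp
    ultimately have o: "open_segment (p u) (b e) \<inter> N = {}" "open_segment (b e) (p v) \<inter> N = {}"
      using A_open bend(2,10) by blast+
    have euv: "e = {u,v}" using E_other[OF bend(5,6)] bend(7,8) by auto
    have "x \<notin> on e" if x: "x \<in> X" for x
    proof
      assume "x \<in> on e"
      then have "x \<in> hs e u \<or> x \<in> hs e v" using euv by (auto simp: on_def)
      moreover have "x \<noteq> p u" "x \<noteq> p v" "x \<noteq> b e" using X_ne[OF x] E_V[OF bend(5)] bend(5-7) by auto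
      ultimately have "x \<in> open_segment (p u) (b e) \<or> x \<in> open_segment (b e) (p v)"
        unfolding open_segment_def hs_def by (auto simp: closed_segment_commute)
      then show False using o X_N[OF x] by blast
    qed
    then show ?thesis using bend(1,5,12) by (auto simp: uncrossed_def ed_def)
  qed
qed

text \<open>With \<open>v\<close> vertices among \<open>k\<close> corners, \<open>v\<close> sides
  start and \<open>v\<close> sides end at a vertex, so at least \<open>2 * v - k\<close> sides do
  both.\<close>

lemma vertex_pairs:
  assumes v: "2 \<le> vf f" shows "4 \<le> kf f + card {d\<in>mdF f. ed d \<in> uncrossed}"
proof -
  let ?T = "{d\<in>mdF f. fst d \<in> p ` V}" and ?T' = "{d\<in>mdF f. mh d \<in> p ` V}"
  have fin: "finite ?T" "finite ?T'" using fin_mdF by auto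
  have inj: "inj_on mn (mdF f)" unfolding inj_on_def using mn_inj mdF_M by blast
  have "mn ` mdF f \<subseteq> mdF f" using mn_mdF by blast
  then have im: "mn ` mdF f = mdF f" using inj fin_mdF by (simp add: endo_inj_surj)
  have "mn ` ?T' = ?T"
  proof
    show "mn ` ?T' \<subseteq> ?T" using mn_mdF by auto
    show "?T \<subseteq> mn ` ?T'"
    proof
      fix d assume d: "d \<in> ?T"
      then obtain d' where "d' \<in> mdF f" "d = mn d'" using im by blast
      then show "d \<in> mn ` ?T'" using d by auto
    qed
  qed
  then have "card ?T' = vf f" using card_image[OF inj_on_subset[OF inj], of ?T'] by (simp add: vf_def)
  moreover have "card ?T + card ?T' = card (?T \<union> ?T') + card (?T \<inter> ?T')" by (rule card_Un_Int[OF fin])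
  moreover have "card (?T \<union> ?T') \<le> kf f" unfolding kf_def by (rule card_mono[OF fin_mdF]) auto
  moreover have "card (?T \<inter> ?T') \<le> card {d\<in>mdF f. ed d \<in> uncrossed}"
    by (rule card_mono) (use fin_mdF vertex_to_vertex mdF_M in auto)
  ultimately show ?thesis using v unfolding vf_def by linarith
qed

end

context star_drawing begin

text \<open>Claims belong to bent sides; an edge has only two of these, mutually reverse, and at
  most one of them is claimed. A needy face has at most one vertex, so each of its sides ends in a
  crossing and the claimed edge is crossed.\<close>

lemma claims_bound:
  assumes c: "admissible c"
  shows "card {d\<in>M. c d \<and> needy (lf d)} \<le> card (E - uncrossed)"
proof (rule card_inj_on_le)
  show "inj_on ed {d\<in>M. c d \<and> needy (lf d)}"
  proof (rule inj_onI)
    fix d d' assume d: "d \<in> {d\<in>M. c d \<and> needy (lf d)}" "d' \<in> {d\<in>M. c d \<and> needy (lf d)}" and e: "ed d = ed d'"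
    then have "d' = d \<or> d' = rv d" using turn_unique[of d d'] c unfolding admissible_def by blast
    then show "d = d'" using d c unfolding admissible_def by blast
  qed
  show "ed ` {d\<in>M. c d \<and> needy (lf d)} \<subseteq> E - uncrossed"
  proof
    fix e assume "e \<in> ed ` {d\<in>M. c d \<and> needy (lf d)}"
    then obtain d where d: "d \<in> M" "needy (lf d)" "e = ed d" by blast
    have m: "d \<in> mdF (lf d)" "mn d \<in> mdF (lf d)" using d(1) mn_mdF by (auto simp: mdF_def)
    have "\<not> (fst d \<in> p ` V \<and> fst (mn d) \<in> p ` V)"
      using vf_two[OF _ m] d(2) mn_ne[OF d(1)] unfolding needy_def by metis
    then have "fst d \<in> X \<or> mh d \<in> X" using fst_cases[OF d(1)] mh_cases[OF d(1)] by auto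
    then have "X \<inter> on e \<noteq> {}" using fst_on[OF d(1)] mh_on[OF d(1)] d(3) by blast
    then show "e \<in> E - uncrossed" using ed_E[OF d(1)] d(3) by (simp add: uncrossed_def)
  qed
  show "finite (E - uncrossed)" using finE by simp
qed

text \<open>Euler's inequality bounds the sum of \<open>4 - kf f\<close> from below by
  \<open>2 * card E + 8 - 4 * card V\<close>. From above, every face is paid by its claims or its
  uncrossed sides; for the faces in \<open>Sm\<close> the exact surplus is kept.\<close>

lemma charge:
  assumes E: "E \<noteq> {}" and Sm: "Sm \<subseteq> lf ` A"
  shows "2 * int (card E) + 8 \<le> 4 * int (card V) + int (card (E - uncrossed)) + int (card {d\<in>M. ed d \<in> uncrossed})
    + (\<Sum>f\<in>Sm. 4 - int (kf f) - int (card {d\<in>mdF f. ed d \<in> uncrossed}))"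
proof -
  obtain c where c: "admissible c" using claims by blast
  let ?F = "lf ` A"
  let ?z = "\<lambda>f. card {d\<in>mdF f. ed d \<in> uncrossed}" and ?t = "\<lambda>f. card {d\<in>mdF f. c d \<and> needy (lf d)}"
  have finF: "finite ?F" using finA by simp
  have ne: "A \<noteq> {}"
  proof -
    obtain e u where e: "e \<in> E" "u \<in> e" using E E_pair by blast
    then have "nbr (p u) \<noteq> {}" using iso p_V_N E_V by blast
    then show ?thesis by (auto simp: nbr_def)
  qed
  have "4 - int (kf f) \<le> int (?t f) + (int (?z f) + (if f \<in> Sm then 4 - int (kf f) - int (?z f) else 0))" if f: "f \<in> ?F" for f
  proof (cases "f \<in> Sm")
    case False
    consider "4 \<le> kf f" | "needy f" | "2 \<le> vf f" using f unfolding needy_def by linarith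
    then show ?thesis
    proof cases
      case 2
      then have "{d\<in>mdF f. c d} = {d\<in>mdF f. c d \<and> needy (lf d)}" by (auto simp: mdF_def)
      moreover have "sat c f" using c 2 by (simp add: admissible_def)
      ultimately have "4 - kf f \<le> ?t f" by (simp add: sat_def)
      then show ?thesis using False by simp
    next
      case 3 then show ?thesis using vertex_pairs[OF 3] False by simp
    qed (use False in simp)
  qed simp
  then have "(\<Sum>f\<in>?F. 4 - int (kf f)) \<le> (\<Sum>f\<in>?F. int (?t f) + (int (?z f) + (if f \<in> Sm then 4 - int (kf f) - int (?z f) else 0)))"
    by (rule sum_mono)
  also have "\<dots> = int (\<Sum>f\<in>?F. ?t f) + (int (\<Sum>f\<in>?F. ?z f) + (\<Sum>f\<in>?F. if f \<in> Sm then 4 - int (kf f) - int (?z f) else 0))"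
    by (simp add: sum.distrib)
  also have "(\<Sum>f\<in>?F. if f \<in> Sm then 4 - int (kf f) - int (?z f) else 0) = (\<Sum>f\<in>Sm. 4 - int (kf f) - int (?z f))"
    using Sm finF by (simp add: sum.If_cases Int_absorb1)
  also have "(\<Sum>f\<in>?F. ?t f) = card {d\<in>M. c d \<and> needy (lf d)}" by (rule sum_mdF)
  also have "(\<Sum>f\<in>?F. ?z f) = card {d\<in>M. ed d \<in> uncrossed}" by (rule sum_mdF)
  finally have 1: "(\<Sum>f\<in>?F. 4 - int (kf f)) \<le> int (card {d\<in>M. c d \<and> needy (lf d)}) + (int (card {d\<in>M. ed d \<in> uncrossed})
    + (\<Sum>f\<in>Sm. 4 - int (kf f) - int (?z f)))" .
  have "(\<Sum>f\<in>?F. 4 - int (kf f)) = 4 * int (card ?F) - int (\<Sum>f\<in>?F. kf f)" by (simp add: sum_subtractf)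
  then have 2: "(\<Sum>f\<in>?F. 4 - int (kf f)) = 4 * int (card ?F) - (2 * int (card E) + 4 * int (card X))" using sum_kf by simp
  have 3: "1 \<le> npc S" using bad_faces_bound[OF ne, of "{}"] by simp
  show ?thesis using 1 2 3 euler_drawing[OF E] claims_bound[OF c] by linarith
qed

end

context drawing begin

text \<open>Turning back is the last choice of \<open>nx\<close>, so a second edge at
  \<open>u\<close> would have been taken instead.\<close>

lemma turn_back:
  assumes X: "X = {}" and d: "d \<in> M" "mn (rv d) = d" and u: "fst d = p u" and g: "g \<in> E" "u \<in> g"
  shows "g = ed d"
proof (rule ccontr)
  assume ne: "g \<noteq> ed d"
  have r: "rv d \<in> M" using rv_M[OF d(1)] .
  have sw: "ml (rv d) = prod.swap d" using rv_props(6)[OF d(1)] unfolding rv_def[of "rv d"] by (cases "ml (rv d)") auto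
  have A1: "(snd d, p u) \<in> A" using ml_A[OF r] sw u by (metis prod.collapse swap_simp)
  have nx: "nx (snd d, p u) = d" using d(2) sw u unfolding mn_def by (metis prod.collapse swap_simp)
  have A2: "(p u, b g) \<in> A" using whole_half[OF X g] .
  have "own (p u, b g) = (g,u)" by (rule ownI[OF A2 g p_hs b_hs])
  then have "(p u, b g) \<noteq> d" using ne by (auto simp: ed_def)
  then have "b g \<noteq> snd d" using u by (metis prod.collapse)
  then have "snd (nx (snd d, p u)) \<noteq> snd d" using nx_other[OF A1 A2] by simp
  then show False using nx by simp
qed

end

lemma half_segment:
  fixes P Q :: complex
  assumes z: "z \<in> closed_segment P Q" "z \<noteq> P" and y: "y \<in> closed_segment z Q" shows "y \<noteq> P"
proof
  assume "y = P"
  then have "dist z Q = dist z P + dist P Q" using y by (simp add: between_mem_segment[symmetric] between)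
  moreover have "dist P Q = dist P z + dist z Q" using z(1) by (simp add: between_mem_segment[symmetric] between)
  ultimately have "dist P z = 0" by (simp add: dist_commute)
  then show False using z(2) by simp
qed

lemma (in drawing) uncrossed_sub: "subdrawing V E p b uncrossed"
  by unfold_locales (auto simp: uncrossed_def)

section \<open>Faces of the uncrossed part\<close>

locale full_drawing = star_drawing +
  assumes n3: "3 \<le> card V"

sublocale full_drawing \<subseteq> z: subdrawing V E p b uncrossed by (rule uncrossed_sub)

context full_drawing begin

lemma X0: "z.sub.X = {}" unfolding z.X_sub by (auto simp: uncrossed_def)

definition good :: "complex set \<Rightarrow> bool" where
  "good f \<longleftrightarrow> (\<forall>a\<in>frontier f. \<forall>c\<in>frontier f. path_component z.sub.S a c)"

definition small :: "complex set set" where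
  "small = {f\<in>z.sub.lf ` z.sub.A. good f \<and> z.sub.kf f \<le> 5}"

text \<open>The face of the uncrossed part of the drawing in which a crossed edge runs.\<close>

definition reg :: "'a set \<Rightarrow> complex set" where
  "reg e = connected_component_set (- z.sub.S) (b e)"

text \<open>These edges are deleted before charging. A small face contains at most \<open>2 kf - 5\<close> crossed edges, and once it
  is empty it is a face of the remaining drawing whose contribution compensates for them.\<close>

definition inside :: "'a set set" where
  "inside = {e\<in>E - uncrossed. reg e \<in> small}"

lemma small_comp: "f \<in> small \<Longrightarrow> f \<in> components (- z.sub.S)"
  using z.sub.lf_props(1) by (auto simp: small_def)

text \<open>A common point off the vertices would be a crossing on an uncrossed edge.\<close>

lemma crossed_out:
  assumes e: "e \<in> E - uncrossed" and x: "x \<in> on e" "x \<notin> p ` e" shows "x \<notin> z.sub.S"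
proof
  assume "x \<in> z.sub.S"
  then have "x \<in> p ` V \<union> (\<Union>e\<in>uncrossed. on e)" using z.sub.S_sub by blast
  moreover have nV: "x \<notin> p ` V" using p_on[of e] e x by blast
  ultimately obtain f where f: "f \<in> uncrossed" "x \<in> on f" by blast
  then have "x \<in> X" using on_meet[of e f x] e x(1) nV z.EE by blast
  then show False using f by (auto simp: uncrossed_def)
qed

lemma reg_comp:
  assumes e: "e \<in> E - uncrossed" shows "reg e \<in> components (- z.sub.S)" "b e \<in> reg e"
proof -
  have "b e \<in> on e" using E_pair[of e] e by (auto simp: on_def)
  moreover have "b e \<notin> p ` e" using bend_V[of e] e E_V by blast
  ultimately have "b e \<notin> z.sub.S" using crossed_out[OF e] by blast
  then show "reg e \<in> components (- z.sub.S)" "b e \<in> reg e"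
    by (auto simp: reg_def components_def connected_component_refl_eq)
qed

text \<open>From each such point one can walk along its half edge to the bend without meeting an
  end.\<close>

lemma on_reg:
  assumes e: "e \<in> E - uncrossed" and x: "x \<in> on e" "x \<notin> p ` e" shows "x \<in> reg e"
proof -
  obtain u where u: "u \<in> e" "x \<in> hs e u" using x by (auto simp: on_def)
  have eE: "e \<in> E" using e by simp
  have "y \<notin> z.sub.S" if y: "y \<in> closed_segment x (b e)" for y
  proof (rule crossed_out[OF e])
    have yh: "y \<in> hs e u"
      using y u(2) unfolding hs_def by (metis closed_segment_subset convex_closed_segment ends_in_segment(2) subsetD)
    then show "y \<in> on e" using u(1) by (auto simp: on_def)
    have "y \<noteq> p u" by (rule half_segment[OF _ _ y]) (use u x(2) in \<open>auto simp: hs_def\<close>)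
    then show "y \<notin> p ` e" using p_in_hs[OF eE u(1)] yh E_V[OF eE] by blast
  qed
  then have "connected_component (- z.sub.S) (b e) x"
    by (intro connected_componentI[of "closed_segment x (b e)"]) auto
  then show ?thesis by (simp add: reg_def)
qed

lemma end_frontier:
  assumes e: "e \<in> E - uncrossed" and u: "u \<in> e" shows "p u \<in> frontier (reg e)"
proof -
  have eE: "e \<in> E" using e by simp
  have "open_segment (p u) (b e) \<subseteq> reg e"
  proof
    fix x assume x: "x \<in> open_segment (p u) (b e)"
    then have h: "x \<in> hs e u" "x \<noteq> p u" by (auto simp: open_segment_def hs_def)
    then have "x \<notin> p ` e" using p_in_hs[OF eE u] E_V[OF eE] by blast
    moreover have "x \<in> on e" using h u by (auto simp: on_def)
    ultimately show "x \<in> reg e" using on_reg[OF e] by blast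
  qed
  then have "closure (open_segment (p u) (b e)) \<subseteq> closure (reg e)" by (rule closure_mono)
  then have "p u \<in> closure (reg e)" using pu_ne_b[OF eE u] by auto
  moreover have "p u \<in> z.sub.S" using z.sub.N_S z.sub.p_V_N E_V[OF eE u] by blast
  ultimately show ?thesis
    using z.sub.comp_disj[OF reg_comp(1)[OF e]] z.sub.comp_open[OF reg_comp(1)[OF e]] by (auto simp: frontier_def interior_open)
qed

text \<open>A vertex without uncrossed edges is a component of its own. If it lies on the frontier
  of a good face, it is the whole frontier; the face is then the rest of the plane and leaves no
  place for other vertices.\<close>

lemma good_nbr:
  assumes f: "f \<in> components (- z.sub.S)" "good f" and u: "u \<in> V" "p u \<in> frontier f"
  shows "\<exists>e\<in>uncrossed. u \<in> e"
proof (rule ccontr)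
  assume n: "\<not> ?thesis"
  have "\<not> e \<subseteq> {u}" if "e \<in> uncrossed" for e
    using card_mono[of "{u}" e] card_edge[OF z.EE[OF that]] by auto
  then have none: "{e\<in>uncrossed. e \<subseteq> {u}} = {}" by blast
  show False
  proof (rule z.sub.face_arc_component[OF X0, of "{u}" "{p u}" f "p u"])
    have "{u} \<noteq> V" using n3 by auto
    then show "{u} \<subset> V" using u by blast
    show "e \<subseteq> {u} \<or> e \<inter> {u} = {}" if "e \<in> uncrossed" for e using n that by blast
    show "{p u} = p ` {u} \<union> (\<Union>e\<in>{e\<in>uncrossed. e \<subseteq> {u}}. on e)" unfolding none by simp
    show "connected (- {p u})" by (rule connected_punctured_universe) simp
    show "path_component z.sub.S (p u) x" if "x \<in> frontier f" for x using f(2) u(2) that by (simp add: good_def)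
  qed (use f u in auto)
qed

text \<open>The same argument for an isolated edge: an arc does not separate the plane, and with at
  least three vertices it is not the whole drawing.\<close>

lemma good_edge:
  assumes f: "f \<in> components (- z.sub.S)" "good f" and e: "e \<in> uncrossed" "u \<in> e" "p u \<in> frontier f"
  shows "\<exists>g\<in>uncrossed. g \<noteq> e \<and> g \<inter> e \<noteq> {}"
proof (rule ccontr)
  assume n: "\<not> ?thesis"
  have eE: "e \<in> E" using e z.EE by blast
  have "g = e" if "g \<in> uncrossed" "g \<subseteq> e" for g
    using card_subset_eq[OF finite_edge[OF eE] that(2)] card_edge[OF eE] card_edge[OF z.EE[OF that(1)]] by simp
  then have only: "{g\<in>uncrossed. g \<subseteq> e} = {e}" using e(1) by blast
  show False
  proof (rule z.sub.face_arc_component[OF X0, of e "on e" f "p u"])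
    have "e \<noteq> V" using n3 card_edge[OF eE] by auto
    then show "e \<subset> V" using E_V[OF eE] by blast
    show "g \<subseteq> e \<or> g \<inter> e = {}" if "g \<in> uncrossed" for g using n that by blast
    have "p ` e \<subseteq> on e" by (auto simp: on_def)
    then show "on e = p ` e \<union> (\<Union>g\<in>{g\<in>uncrossed. g \<subseteq> e}. on g)" unfolding only by auto
    show "connected (- on e)" by (rule connected_on_compl[OF eE])
    show "path_component z.sub.S (p u) x" if "x \<in> frontier f" for x using f(2) e(3) that by (simp add: good_def)
    show "p u \<in> on e" using e(2) p_hs unfolding on_def by blast
  qed (use f e in auto)
qed

lemma M0_vertex:
  assumes "d \<in> z.sub.M" obtains u v where "u \<in> V" "v \<in> V" "fst d = p u" "z.sub.mh d = p v" "u \<noteq> v" "z.sub.ed d = {u,v}" "z.sub.ed d \<in> uncrossed"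
proof -
  obtain u where u: "u \<in> V" "fst d = p u" using z.sub.fst_cases[OF assms] X0 by auto
  obtain v where v: "v \<in> V" "z.sub.mh d = p v" using z.sub.mh_cases[OF assms] X0 by auto
  have ne: "u \<noteq> v" using z.sub.mh_ne[OF assms] u v by auto
  have "u \<in> z.sub.ed d" "v \<in> z.sub.ed d" using z.sub.vertex_ed[OF assms u(2,1)] z.sub.vertex_ed_mh[OF assms v(2,1)] by auto
  moreover obtain x where x: "z.sub.ed d = {u,x}" using z.sub.E_other[OF z.sub.ed_E[OF assms] calculation(1)] by blast
  ultimately have "z.sub.ed d = {u,v}" using ne by auto
  then show thesis using that[OF u(1) v(1) u(2) v(2) ne] z.sub.ed_E[OF assms] by blast
qed

lemma mdF_frontier:
  assumes "d \<in> z.sub.mdF f" shows "f \<in> components (- z.sub.S)" "fst d \<in> frontier f"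
  using z.sub.lf_props(1)[OF z.sub.M_A] z.sub.fst_frontier[OF z.sub.M_A] assms unfolding z.sub.mdF_def by blast+

text \<open>A walk back and forth along one edge turns back at both ends, so both have degree one
  and the edge is isolated.\<close>

lemma no_digon:
  assumes g: "good f" and d: "d \<in> z.sub.mdF f" and r: "z.sub.mn d = z.sub.rv d" "z.sub.mn (z.sub.rv d) = d"
  shows False
proof -
  have dM: "d \<in> z.sub.M" using z.sub.mdF_M[OF d] .
  obtain u v where uv: "fst d = p u" "z.sub.mh d = p v" "z.sub.ed d = {u,v}" "z.sub.ed d \<in> uncrossed" by (rule M0_vertex[OF dM])
  have "p u \<in> frontier f" using mdF_frontier(2)[OF d] uv by simp
  then obtain h where h: "h \<in> uncrossed" "h \<noteq> z.sub.ed d" "h \<inter> z.sub.ed d \<noteq> {}"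
    using good_edge[OF mdF_frontier(1)[OF d] g uv(4), of u] uv(3) by auto
  have rM: "z.sub.rv d \<in> z.sub.M" using z.sub.rv_M[OF dM] .
  note rp = z.sub.rv_props[OF dM]
  from h(3) uv(3) consider "u \<in> h" | "v \<in> h" by auto
  then show False
  proof cases
    case 1 then show False using z.sub.turn_back[OF X0 dM r(2) uv(1) h(1)] h(2) by simp
  next
    case 2
    have "z.sub.mn (z.sub.rv (z.sub.rv d)) = z.sub.rv d" by (simp only: rp(6) r(1))
    moreover have "fst (z.sub.rv d) = p v" using rp(1) uv(2) by simp
    ultimately have "h = z.sub.ed (z.sub.rv d)" using z.sub.turn_back[OF X0 rM _ _ h(1) 2] by blast
    then show False using rp(5) h(2) by simp
  qed
qed

lemma twins:
  assumes d: "d \<in> z.sub.M" "d' \<in> z.sub.M" "z.sub.ed d = z.sub.ed d'" "d \<noteq> d'"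
  shows "d' = z.sub.rv d" "d = z.sub.rv d'"
proof -
  have *: "d' = z.sub.rv d" if d: "d \<in> z.sub.M" "d' \<in> z.sub.M" "z.sub.ed d = z.sub.ed d'" "d \<noteq> d'" for d d'
  proof -
    obtain u v where uv: "u \<in> V" "v \<in> V" "fst d = p u" "z.sub.mh d = p v" "z.sub.ed d = {u,v}" by (rule M0_vertex[OF d(1)])
    obtain u' v' where uv': "u' \<in> V" "fst d' = p u'" "z.sub.ed d' = {u',v'}" by (rule M0_vertex[OF d(2)])
    have "u' \<noteq> u" using z.sub.vertex_dart_unique[OF d(1,2) uv(3) _ uv(1) d(3)] uv'(2) d(4) by auto
    then have u': "u' = v" using uv(5) uv'(3) d(3) by auto
    note rp = z.sub.rv_props[OF d(1)]
    show ?thesis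
    proof (rule z.sub.vertex_dart_unique[OF d(2) z.sub.rv_M[OF d(1)], of v])
      show "fst d' = p v" using uv'(2) u' by simp
      show "fst (z.sub.rv d) = p v" using rp(1) uv(4) by simp
      show "z.sub.ed d' = z.sub.ed (z.sub.rv d)" using rp(5) d(3) by simp
    qed (rule uv)
  qed
  show "d' = z.sub.rv d" "d = z.sub.rv d'" using *[of d d'] *[of d' d] d by auto
qed

text \<open>The sides of a digon join the same two vertices and lie on one edge, because the graph
  is simple; this is the walk excluded by \<open>no_digon\<close>.\<close>

lemma good_k3:
  assumes f: "f \<in> z.sub.lf ` z.sub.A" "good f" shows "3 \<le> z.sub.kf f"
proof (rule ccontr)
  assume "\<not> ?thesis"
  then have k: "z.sub.kf f = 2" using z.sub.kf_ge2[OF f(1)] by simp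
  have "z.sub.mdF f \<noteq> {}" using k unfolding z.sub.kf_def by auto
  then obtain d where d: "d \<in> z.sub.mdF f" by blast
  note t = z.sub.kf2[OF k d]
  have M: "d \<in> z.sub.M" "z.sub.mn d \<in> z.sub.M" using z.sub.mdF_M[OF d] z.sub.mdF_M[OF z.sub.mn_mdF[OF d]] by auto
  obtain u v where uv: "u \<in> V" "v \<in> V" "fst d = p u" "z.sub.mh d = p v" "u \<noteq> v" "z.sub.ed d = {u,v}" by (rule M0_vertex[OF M(1)])
  have "z.sub.mh (z.sub.mn d) = p u" using z.sub.fst_mn[of "z.sub.mn d"] t(2) uv(3) by simp
  then have a: "u \<in> z.sub.ed (z.sub.mn d)" using z.sub.vertex_ed_mh[OF M(2) _ uv(1)] by simp
  have c: "v \<in> z.sub.ed (z.sub.mn d)" using z.sub.vertex_ed[OF M(2) _ uv(2)] uv(4) by simp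
  obtain x where x: "z.sub.ed (z.sub.mn d) = {u,x}" using z.sub.E_other[OF z.sub.ed_E[OF M(2)] a] by blast
  then have "x = v" using c uv(5) by simp
  then have "z.sub.ed d = z.sub.ed (z.sub.mn d)" using x uv(6) by simp
  then have "z.sub.mn d = z.sub.rv d" using twins(1)[OF M] z.sub.mn_ne[OF M(1)] by simp
  then show False using no_digon[OF f(2) d] t(2) by simp
qed

text \<open>Edges inside \<open>f\<close> and edges along \<open>f\<close> are different pairs of
  boundary vertices. If the \<open>k\<close> corners are distinct vertices, there are
  \<open>k\<close> edges along \<open>f\<close>, and the \<open>k * (k - 3) / 2\<close> remaining
  pairs are at most \<open>2 * k - 5\<close> precisely for \<open>2 \<le> k \<le> 5\<close>.\<close>

lemma few_inside:
  assumes f: "f \<in> small"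
  shows "int (card {e\<in>E - uncrossed. reg e = f}) \<le> 2 * int (z.sub.kf f) - 5"
proof -
  have fA: "f \<in> z.sub.lf ` z.sub.A" and gf: "good f" and k5: "z.sub.kf f \<le> 5" and fc: "f \<in> components (- z.sub.S)"
    using f small_comp by (auto simp: small_def)
  have k3: "3 \<le> z.sub.kf f" by (rule good_k3[OF fA gf])
  define T where "T = {u\<in>V. \<exists>d\<in>z.sub.mdF f. fst d = p u}"
  define G where "G = z.sub.ed ` z.sub.mdF f"
  let ?D = "{e\<in>E - uncrossed. reg e = f}"
  have finT: "finite T" using finV by (simp add: T_def)
  have pT: "p ` T = fst ` z.sub.mdF f"
  proof
    show "fst ` z.sub.mdF f \<subseteq> p ` T"
    proof
      fix x assume "x \<in> fst ` z.sub.mdF f"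
      then obtain d where d: "d \<in> z.sub.mdF f" "x = fst d" by blast
      obtain u where "u \<in> V" "fst d = p u" by (rule M0_vertex[OF z.sub.mdF_M[OF d(1)]])
      then show "x \<in> p ` T" using d by (auto simp: T_def)
    qed
    show "p ` T \<subseteq> fst ` z.sub.mdF f"
    proof
      fix x assume "x \<in> p ` T"
      then obtain u d where "d \<in> z.sub.mdF f" "fst d = p u" "x = p u" unfolding T_def by blast
      then show "x \<in> fst ` z.sub.mdF f" using imageI[of d "z.sub.mdF f" fst] by simp
    qed
  qed
  have injT: "inj_on p T" by (rule inj_on_subset[OF p_inj]) (auto simp: T_def)
  then have cT: "card T = card (fst ` z.sub.mdF f)" using card_image[OF injT] pT by simp
  have Tk: "card T \<le> z.sub.kf f" unfolding cT z.sub.kf_def by (rule card_image_le[OF z.sub.fin_mdF])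
  have DT: "e \<subseteq> T" if e: "e \<in> ?D" for e
  proof
    fix u assume u: "u \<in> e"
    have eE: "e \<in> E - uncrossed" "reg e = f" using e by auto
    have uV: "u \<in> V" using E_V eE(1) u by blast
    have fr: "p u \<in> frontier f" using end_frontier[OF eE(1) u] eE(2) by simp
    obtain g where g: "g \<in> uncrossed" "u \<in> g" using good_nbr[OF fc gf uV fr] by blast
    have pN: "p u \<in> z.sub.N" using z.sub.p_V_N[OF uV] .
    have "(p u, b g) \<in> z.sub.A" using z.sub.whole_half[OF X0 g] .
    then have "z.sub.nbr (p u) \<noteq> {}" by (auto simp: z.sub.nbr_def)
    then obtain c where c: "(p u, c) \<in> z.sub.A" "z.sub.lf (p u, c) = f" using z.sub.frontier_node[OF fc fr pN] by blast
    have "(p u, c) \<in> z.sub.mdF f" using c uV by (simp add: z.sub.mdF_def z.sub.M_def z.sub.W_def)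
    moreover have "fst (p u, c) = p u" by simp
    ultimately show "u \<in> T" using uV unfolding T_def by blast
  qed
  have GT: "e \<subseteq> T \<and> card e = 2 \<and> e \<in> uncrossed" if e: "e \<in> G" for e
  proof -
    obtain d where d: "d \<in> z.sub.mdF f" "e = z.sub.ed d" using e by (auto simp: G_def)
    obtain u v where uv: "u \<in> V" "v \<in> V" "fst d = p u" "z.sub.mh d = p v" "u \<noteq> v" "z.sub.ed d = {u,v}" "z.sub.ed d \<in> uncrossed"
      by (rule M0_vertex[OF z.sub.mdF_M[OF d(1)]])
    have "fst (z.sub.mn d) = p v" using z.sub.fst_mn[of d] uv(4) by simp
    then have "v \<in> T" using uv(2) z.sub.mn_mdF[OF d(1)] unfolding T_def by blast
    moreover have "u \<in> T" using uv(1,3) d(1) unfolding T_def by blast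
    moreover have "e = {u,v}" using uv(6) d(2) by simp
    ultimately show ?thesis using uv(5,7) d(2) by simp
  qed
  have finG: "finite G" using z.sub.fin_mdF by (simp add: G_def)
  have finD: "finite ?D" using finE by simp
  have "card ?D + card G = card (?D \<union> G)" 
  proof (rule card_Un_disjoint[symmetric, OF finD finG])
    show "?D \<inter> G = {}" using GT by blast
  qed
  also have "\<dots> \<le> card {B. B \<subseteq> T \<and> card B = 2}"
  proof (rule card_mono)
    show "finite {B. B \<subseteq> T \<and> card B = 2}" by (rule finite_subset[of _ "Pow T"]) (use finT in auto)
    show "?D \<union> G \<subseteq> {B. B \<subseteq> T \<and> card B = 2}"
    proof
      fix e assume "e \<in> ?D \<union> G"
      then show "e \<in> {B. B \<subseteq> T \<and> card B = 2}"
      proof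
        assume e: "e \<in> ?D" then show ?thesis using DT[OF e] card_edge[of e] by simp
      next
        assume e: "e \<in> G" then show ?thesis using GT[OF e] by simp
      qed
    qed
  qed
  also have "\<dots> = card T choose 2" using n_subsets[OF finT] .
  finally have C: "card ?D + card G \<le> card T choose 2" .
  have two: "2 * (n choose 2) = n * (n - 1)" for n :: nat
  proof -
    have "even (n * (n - 1))" by (cases n) auto
    then show ?thesis by (simp add: choose_two)
  qed
  note T2 = two[of "card T"]
  have k: "z.sub.kf f = 3 \<or> z.sub.kf f = 4 \<or> z.sub.kf f = 5" using k3 k5 by linarith
  show ?thesis
  proof (cases "card T = z.sub.kf f")
    case True
    then have inj: "inj_on fst (z.sub.mdF f)" using cT z.sub.fin_mdF by (simp add: z.sub.kf_def eq_card_imp_inj_on)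
    \<comment> \<open>Two sides on one edge are mutually reverse; as all corners are distinct, they
      would follow each other in a walk excluded by \<open>no_digon\<close>.\<close>
    have "inj_on z.sub.ed (z.sub.mdF f)"
    proof (rule inj_onI, rule ccontr)
      fix d d' assume d: "d \<in> z.sub.mdF f" "d' \<in> z.sub.mdF f" "z.sub.ed d = z.sub.ed d'" "d \<noteq> d'"
      have M: "d \<in> z.sub.M" "d' \<in> z.sub.M" using z.sub.mdF_M[OF d(1)] z.sub.mdF_M[OF d(2)] .
      note t = twins[OF M d(3,4)]
      have 1: "fst d' = z.sub.mh d" by (subst t(1)) (rule z.sub.rv_props(1)[OF M(1)])
      have 2: "fst d = z.sub.mh d'" by (subst t(2)) (rule z.sub.rv_props(1)[OF M(2)])
      have "z.sub.mn d = d'" by (rule inj_onD[OF inj _ z.sub.mn_mdF[OF d(1)] d(2)]) (simp only: z.sub.fst_mn 1)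
      moreover have "z.sub.mn d' = d" by (rule inj_onD[OF inj _ z.sub.mn_mdF[OF d(2)] d(1)]) (simp only: z.sub.fst_mn 2)
      ultimately show False using no_digon[OF gf d(1)] unfolding t(1) by blast
    qed
    then have "card G = z.sub.kf f" by (simp add: G_def card_image z.sub.kf_def)
    moreover have "z.sub.kf f * (z.sub.kf f - 1) + 10 \<le> 6 * z.sub.kf f" using k by (elim disjE) simp_all
    ultimately show ?thesis using C T2 True by simp
  next
    case False
    \<comment> \<open>With fewer vertices than sides it suffices to count the pairs among
      \<open>k - 1\<close> vertices and subtract one edge along \<open>f\<close>.\<close>
    have "z.sub.mdF f \<noteq> {}" using k3 unfolding z.sub.kf_def by auto
    then have "0 < card G" using finG by (simp add: G_def card_gt_0_iff)
    moreover have "card T * (card T - 1) \<le> (z.sub.kf f - 1) * (z.sub.kf f - 2)"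
      by (rule mult_le_mono) (use False Tk in linarith)+
    moreover have "(z.sub.kf f - 1) * (z.sub.kf f - 2) + 8 \<le> 4 * z.sub.kf f" using k by (elim disjE) simp_all
    ultimately show ?thesis using C T2 by linarith
  qed
qed

text \<open>A face that is not good meets two components of the uncrossed drawing; by Janiszewski's theorem there are fewer
  such faces than components.\<close>

lemma uncrossed_count:
  assumes E0: "uncrossed \<noteq> {}"
  shows "4 * card uncrossed + 12 \<le> 6 * card V + 3 * card small"
proof -
  let ?F = "z.sub.lf ` z.sub.A"
  let ?B = "{f\<in>?F. \<not> good f}"
  obtain e u where e: "e \<in> uncrossed" "u \<in> e" using E0 E_pair z.EE by blast
  have ne: "z.sub.A \<noteq> {}" using z.sub.whole_half[OF X0 e] by blast
  have comps: "components (- z.sub.S) = ?F" by (rule z.sub.comps_eq[OF ne])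
  have finF: "finite ?F" using z.sub.finA by simp
  have B: "card ?B + 1 \<le> npc z.sub.S"
    by (rule z.sub.bad_faces_bound[OF ne]) (use comps in \<open>auto simp: good_def\<close>)
  have eu: "card uncrossed + npc z.sub.S + 1 \<le> card ?F + card V" using z.sub.euler_drawing[OF E0] X0 by simp
  have sumk: "(\<Sum>f\<in>?F. z.sub.kf f) = 2 * card uncrossed" using z.sub.sum_kf X0 by simp
  \<comment> \<open>Good faces have at least three sides and all others at least two, so 3 and 4
    cover what they can lack to six.\<close>
  have "6 \<le> z.sub.kf f + ((if f \<in> small then 3 else 0) + (if f \<in> ?B then 4 else 0))" if f: "f \<in> ?F" for f
    using z.sub.kf_ge2[OF f] good_k3[OF f] f by (auto simp: small_def)
  then have "(\<Sum>f\<in>?F. 6) \<le> (\<Sum>f\<in>?F. z.sub.kf f + ((if f \<in> small then 3 else 0) + (if f \<in> ?B then 4 else 0)))"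
    by (rule sum_mono)
  also have "\<dots> = 2 * card uncrossed + ((\<Sum>f\<in>?F. if f \<in> small then 3 else 0) + (\<Sum>f\<in>?F. if f \<in> ?B then 4 else 0))"
    using sumk by (simp only: sum.distrib)
  also have "(\<Sum>f\<in>?F. if f \<in> small then 3 else 0) = 3 * card small"
  proof -
    have "?F \<inter> {f. f \<in> small} = small" by (auto simp: small_def)
    then show ?thesis using finF by (simp add: sum.If_cases)
  qed
  also have "(\<Sum>f\<in>?F. if f \<in> ?B then 4 else 0) = 4 * card ?B"
  proof -
    have "?F \<inter> {f. f \<in> ?B} = ?B" by auto
    then show ?thesis using finF by (simp add: sum.If_cases del: mem_Collect_eq)
  qed
  finally have "6 * card ?F \<le> 2 * card uncrossed + (3 * card small + 4 * card ?B)" by simp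
  then show ?thesis using B eu by linarith
qed

end

section \<open>The drawing without the edges inside small faces\<close>

context full_drawing begin

text \<open>Edges that cross run in the same face of the uncrossed part, so they are deleted or kept
  together.\<close>

lemma kept_sub: "subdrawing V E p b (E - inside)"
proof unfold_locales
  show "E - inside \<subseteq> E" by blast
  fix e g x assume e: "e \<in> E - inside" and g: "g \<in> E" and x: "x \<in> X" "x \<in> on e" "x \<in> on g"
  show "g \<in> E - inside"
  proof (rule ccontr)
    assume "g \<notin> E - inside"
    then have gi: "g \<in> E - uncrossed" "reg g \<in> small" using g by (auto simp: inside_def)
    have eu: "e \<in> E - uncrossed" using e x by (auto simp: uncrossed_def)
    have nV: "x \<notin> p ` V" using x(1) X_disj by blast
    have "x \<notin> p ` e" "x \<notin> p ` g" using nV E_V e g by blast+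
    then have "x \<in> reg e" "x \<in> reg g" using on_reg[OF eu x(2)] on_reg[OF gi(1) x(3)] by blast+
    then have "reg e = reg g" using z.sub.comp_eqI[OF reg_comp(1)[OF eu] reg_comp(1)[OF gi(1)]] by blast
    then show False using gi(2) e eu by (auto simp: inside_def)
  qed
qed

lemma uncrossed_kept: "uncrossed \<subseteq> E - inside"
  using z.EE by (auto simp: inside_def)

text \<open>An end of a deleted edge lies on the frontier of a good face and so has an uncrossed
  edge, which is kept.\<close>

lemma kept_cover:
  assumes u: "u \<in> V" shows "\<exists>e\<in>E - inside. u \<in> e"
proof (rule ccontr)
  assume n: "\<not> ?thesis"
  obtain e where e: "e \<in> E" "u \<in> e" using cover[OF u] by blast
  then have "e \<in> inside" using n by blast
  then have ei: "e \<in> E - uncrossed" "reg e \<in> small" by (auto simp: inside_def)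
  have "good (reg e)" using ei(2) by (simp add: small_def)
  then obtain g where "g \<in> uncrossed" "u \<in> g" using good_nbr[OF reg_comp(1)[OF ei(1)] _ u end_frontier[OF ei(1) e(2)]] by blast
  then show False using n uncrossed_kept by blast
qed

end

sublocale full_drawing \<subseteq> y: subdrawing V E p b "E - inside" by (rule kept_sub)

context full_drawing begin

lemma kept_uncrossed: "y.sub.uncrossed = uncrossed"
proof
  show "y.sub.uncrossed \<subseteq> uncrossed"
  proof
    fix e assume "e \<in> y.sub.uncrossed"
    then have e: "e \<in> E - inside" "y.sub.X \<inter> on e = {}" by (auto simp: y.sub.uncrossed_def)
    then have "X \<inter> on e = {}" unfolding y.X_sub by blast
    then show "e \<in> uncrossed" using e by (simp add: uncrossed_def)
  qed
  show "uncrossed \<subseteq> y.sub.uncrossed"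
  proof
    fix e assume e: "e \<in> uncrossed"
    then have "y.sub.X \<inter> on e = {}" unfolding y.X_sub by (auto simp: uncrossed_def)
    then show "e \<in> y.sub.uncrossed" using e uncrossed_kept unfolding y.sub.uncrossed_def by blast
  qed
qed

lemma w_sub: "subdrawing V (E - inside) p b uncrossed"
  using y.sub.uncrossed_sub by (simp add: kept_uncrossed)

text \<open>No remaining edge runs inside a small face, so it stays connected and undivided; it
  cannot grow because the uncrossed edges are all kept.\<close>

lemma small_kept:
  assumes f: "f \<in> small" shows "f \<in> components (- y.sub.S)"
proof -
  interpret w: subdrawing V "E - inside" p b uncrossed by (rule w_sub)
  have fc: "f \<in> components (- z.sub.S)" using small_comp[OF f] .
  have out: "x \<notin> f" if x: "x \<in> y.sub.S" for x
  proof
    assume xf: "x \<in> f"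
    then have xS: "x \<notin> z.sub.S" using z.sub.comp_disj[OF fc] by blast
    have "x \<in> p ` V \<union> (\<Union>e\<in>E - inside. on e)" using y.sub.S_sub x by blast
    moreover have "x \<notin> p ` V" using xS z.sub.N_S z.sub.p_V_N by blast
    ultimately obtain e where e: "e \<in> E" "e \<notin> inside" "x \<in> on e" by blast
    have "e \<notin> uncrossed" using z.sub.on_S[OF X0, of e] e(3) xS by blast
    then have eu: "e \<in> E - uncrossed" using e by blast
    have "x \<notin> p ` e" using \<open>x \<notin> p ` V\<close> E_V[OF e(1)] by blast
    then have "x \<in> reg e" using on_reg[OF eu e(3)] by blast
    then have "reg e = f" using z.sub.comp_eqI[OF reg_comp(1)[OF eu] fc] xf by blast
    then show False using e(2) eu f by (simp add: inside_def)
  qed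
  obtain x where x: "x \<in> f" using in_components_nonempty[OF fc] by blast
  obtain x' where x': "f = connected_component_set (- z.sub.S) x'" using fc by (auto simp: components_def)
  then have C: "f = connected_component_set (- z.sub.S) x" using connected_component_eq[of x "- z.sub.S" x'] x by simp
  have "f = connected_component_set (- y.sub.S) x"
  proof
    show "f \<subseteq> connected_component_set (- y.sub.S) x"
      by (rule connected_component_maximal[OF x in_components_connected[OF fc]]) (use out in blast)
    show "connected_component_set (- y.sub.S) x \<subseteq> f"
      unfolding C by (rule connected_component_mono) (use w.S_mono in blast)
  qed
  moreover have "x \<in> - y.sub.S" using out x by blast
  ultimately show ?thesis unfolding components_def by blast
qed

theorem edge_bound: "2 * card E + 22 \<le> 11 * card V"
proof -
  interpret w: subdrawing V "E - inside" p b uncrossed by (rule w_sub)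
  have st: "star_drawing V (E - inside) p b"
    by (rule star_sub[OF kept_sub]) (rule kept_cover)
  interpret ys: star_drawing V "E - inside" p b by (rule st)
  have Vne: "V \<noteq> {}" using n3 by auto
  then have Ene: "E - inside \<noteq> {}" using kept_cover by blast
  have smA: "small \<subseteq> y.sub.lf ` y.sub.A"
  proof
    fix f assume f: "f \<in> small"
    obtain u e where e: "e \<in> E - inside" "u \<in> e" "u \<in> V" using Vne kept_cover by blast
    then have "y.sub.nbr (p u) \<noteq> {}" using ys.iso[OF y.sub.p_V_N] by blast
    then have "y.sub.A \<noteq> {}" by (auto simp: y.sub.nbr_def)
    then show "f \<in> y.sub.lf ` y.sub.A" using y.sub.comps_eq small_kept[OF f] by blast
  qed
  have same: "y.sub.mdF f = z.sub.mdF f" if "f \<in> small" for f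
    using w.mdF_sub[OF small_kept[OF that] small_comp[OF that]] .
  let ?k = "\<lambda>f. int (z.sub.kf f)"
  \<comment> \<open>All sides of a small face are uncrossed, so both counts equal the number of
    sides.\<close>
  have face_term: "4 - int (y.sub.kf f) - int (card {d\<in>y.sub.mdF f. y.sub.ed d \<in> y.sub.uncrossed}) = 4 - 2 * ?k f" if f: "f \<in> small" for f
  proof -
    have "y.sub.ed d \<in> uncrossed" if "d \<in> z.sub.mdF f" for d
    proof -
      have "d \<in> z.sub.M" using z.sub.mdF_M[OF that] .
      then show ?thesis using w.M_sub by blast
    qed
    then have "{d\<in>y.sub.mdF f. y.sub.ed d \<in> y.sub.uncrossed} = z.sub.mdF f" unfolding same[OF f] kept_uncrossed by blast
    then show ?thesis by (simp add: y.sub.kf_def z.sub.kf_def same[OF f])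
  qed
  have M0: "card {d\<in>y.sub.M. y.sub.ed d \<in> y.sub.uncrossed} = 2 * card uncrossed"
  proof -
    have eq: "{d\<in>y.sub.M. y.sub.ed d \<in> y.sub.uncrossed} = z.sub.M" unfolding kept_uncrossed w.M_sub ..
    show ?thesis unfolding eq using z.sub.card_M X0 by simp
  qed
  have ch: "2 * int (card (E - inside)) + 8 \<le> 4 * int (card V) + int (card (E - inside - uncrossed)) + 2 * int (card uncrossed)
    + (\<Sum>f\<in>small. 4 - 2 * ?k f)"
  proof -
    have sm: "(\<Sum>f\<in>small. 4 - int (y.sub.kf f) - int (card {d\<in>y.sub.mdF f. y.sub.ed d \<in> y.sub.uncrossed})) = (\<Sum>f\<in>small. 4 - 2 * ?k f)"
      by (rule sum.cong[OF refl face_term])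
    show ?thesis using ys.charge[OF Ene smA] unfolding sm M0 unfolding kept_uncrossed by simp
  qed
  have fs: "finite small" using finite_subset[OF smA] y.sub.finA by simp
  have ins: "inside = (\<Union>f\<in>small. {e\<in>E - uncrossed. reg e = f})" by (auto simp: inside_def)
  have "card inside \<le> (\<Sum>f\<in>small. card {e\<in>E - uncrossed. reg e = f})"
    by (subst ins) (rule card_UN_le[OF fs])
  then have "int (card inside) \<le> int (\<Sum>f\<in>small. card {e\<in>E - uncrossed. reg e = f})" by (rule of_nat_mono)
  also have "\<dots> = (\<Sum>f\<in>small. int (card {e\<in>E - uncrossed. reg e = f}))" by (rule of_nat_sum)
  also have "\<dots> \<le> (\<Sum>f\<in>small. 2 * ?k f - 5)" by (rule sum_mono) (rule few_inside)
  \<comment> \<open>For each small face the at most \<open>2 * k - 5\<close> deleted edges and its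
    charging term \<open>4 - 2 * k\<close> add up to at most \<open>-1\<close>.\<close>
  finally have "int (card inside) + (\<Sum>f\<in>small. 4 - 2 * ?k f) \<le> (\<Sum>f\<in>small. 2 * ?k f - 5) + (\<Sum>f\<in>small. 4 - 2 * ?k f)" by simp
  also have "\<dots> = (\<Sum>f\<in>small. (2 * ?k f - 5) + (4 - 2 * ?k f))" by (rule sum.distrib[symmetric])
  also have "\<dots> = - int (card small)" by simp
  finally have del: "int (card inside) + (\<Sum>f\<in>small. 4 - 2 * ?k f) \<le> - int (card small)" .
  have fin: "finite (E - inside - uncrossed)" "finite uncrossed" "finite inside" "finite (E - inside)"
    using finE z.sub.finE by (auto simp: inside_def)
  have c1: "card (E - inside) = card (E - inside - uncrossed) + card uncrossed"
    using card_Diff_subset[OF fin(2) uncrossed_kept] card_mono[OF fin(4) uncrossed_kept] by linarith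
  have iE: "inside \<subseteq> E" by (auto simp: inside_def)
  have c2: "card E = card (E - inside) + card inside"
    using card_Diff_subset[OF fin(3) iE] card_mono[OF finE iE] by linarith
  define \<sigma> where "\<sigma> = (\<Sum>f\<in>small. 4 - 2 * ?k f)"
  note bounds = ch[folded \<sigma>_def] del[folded \<sigma>_def] c1 c2
  show ?thesis
  proof (cases "uncrossed = {}")
    \<comment> \<open>Without uncrossed edges there are no small faces, and the charging bound is
      enough for three or more vertices.\<close>
    case True
    have "z.sub.A = {}"
    proof (rule ccontr)
      assume "z.sub.A \<noteq> {}"
      then obtain a c where "(a,c) \<in> z.sub.A" by auto
      then show False using z.sub.A_D[of a c] True by blast
    qed
    then have "card small = 0" by (simp add: small_def)
    moreover have "card uncrossed = 0" using True by simp
    ultimately show ?thesis using bounds n3 by linarith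
  next
    case False
    show ?thesis using bounds uncrossed_count[OF False] by linarith
  qed
qed

end

section \<open>Minimising the number of crossings\<close>

text \<open>The segment is compact and so has positive distance from \<open>C\<close>; tilting its
  direction by \<open>s\<close> times \<open>z\<close> moves its points by at most
  \<open>s * cmod z\<close>.\<close>

lemma near_segment_avoid:
  fixes P h z :: complex
  assumes C: "closed C" and d: "\<And>t. 0 \<le> t \<Longrightarrow> t \<le> 1 \<Longrightarrow> P + of_real t * h \<notin> C"
  shows "\<exists>\<delta>>0. \<forall>s. 0 < s \<longrightarrow> s < \<delta> \<longrightarrow> (\<forall>t. 0 \<le> t \<longrightarrow> t \<le> 1 \<longrightarrow> P + of_real t * (h + of_real s * z) \<notin> C)"
proof -
  let ?L = "closed_segment P (P + h)"
  have "x \<notin> C" if x: "x \<in> ?L" for x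
  proof -
    obtain t where "0 \<le> t" "t \<le> 1" "x = P + of_real t * (P + h - P)" using x unfolding closed_segment_param by blast
    then show ?thesis using d[of t] by simp
  qed
  then have dis: "?L \<inter> C = {}" by blast
  obtain \<epsilon> where e: "0 < \<epsilon>" "\<And>x y. x \<in> ?L \<Longrightarrow> y \<in> C \<Longrightarrow> \<epsilon> \<le> dist x y"
    using separate_compact_closed[OF compact_segment C dis] by blast
  define \<delta> where "\<delta> = \<epsilon> / (cmod z + 1)"
  have dp: "0 < \<delta>" using e(1) by (simp add: \<delta>_def add_nonneg_pos)
  have "P + of_real t * (h + of_real s * z) \<notin> C" if s: "0 < s" "s < \<delta>" and t: "0 \<le> t" "t \<le> 1" for s t
  proof
    assume c: "P + of_real t * (h + of_real s * z) \<in> C"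
    have "P + of_real t * h \<in> ?L" using t unfolding closed_segment_param by (intro exI[of _ t]) simp
    then have "\<epsilon> \<le> dist (P + of_real t * h) (P + of_real t * (h + of_real s * z))" using e(2) c by blast
    also have "\<dots> = t * (s * cmod z)"
    proof -
      have "P + of_real t * h - (P + of_real t * (h + of_real s * z)) = - (of_real t * (of_real s * z))" by (simp add: ring_distribs)
      then show ?thesis using s t by (simp only: dist_norm norm_minus_cancel norm_mult norm_of_real abs_of_nonneg less_imp_le)
    qed
    also have "\<dots> \<le> 1 * (s * cmod z)" by (rule mult_right_mono) (use t s in auto)
    also have "\<dots> \<le> s * (cmod z + 1)" using s by (simp add: algebra_simps)
    also have "\<dots> < \<delta> * (cmod z + 1)" by (rule mult_strict_right_mono[OF s(2)]) (simp add: add_nonneg_pos)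
    also have "\<dots> = \<epsilon>"
    proof -
      have "cmod z + 1 \<noteq> 0" using norm_ge_zero[of z] by linarith
      then show ?thesis by (simp add: \<delta>_def)
    qed
    finally show False by simp
  qed
  then show ?thesis by (intro exI[of _ \<delta>] conjI dp allI impI)
qed

text \<open>The expression is affine in \<open>s\<close>. It would vanish identically only if
  \<open>w\<close> were parallel to both of the perpendicular vectors \<open>h\<close> and
  \<open>z\<close>.\<close>

lemma line_avoid:
  fixes w h z :: complex
  assumes "w \<noteq> 0" "h \<noteq> 0" "z \<noteq> 0" "h \<bullet> z = 0"
  shows "finite {s. Im (cnj w * (h + of_real s * z)) = 0}"
proof -
  let ?a = "Im (cnj w * h)" and ?c = "Im (cnj w * z)"
  have lin: "Im (cnj w * (h + of_real s * z)) = ?a + s * ?c" for s by (simp add: algebra_simps)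
  have ne: "?a \<noteq> 0 \<or> ?c \<noteq> 0"
  proof (rule ccontr)
    assume n: "\<not> ?thesis"
    obtain t where t: "z = of_real t * (\<i> * h)" using inner_zero_perp[OF assms(2,4)] by blast
    then have t0: "t \<noteq> 0" using assms(3) by auto
    have "?c = t * Re (cnj w * h)" by (simp add: t algebra_simps)
    then have "Re (cnj w * h) = 0" "Im (cnj w * h) = 0" using n t0 by auto
    then have "cnj w * h = 0" by (simp add: complex_eq_iff)
    then show False using assms by simp
  qed
  have "{s. Im (cnj w * (h + of_real s * z)) = 0} \<subseteq> {- ?a / ?c}"
  proof
    fix s assume "s \<in> {s. Im (cnj w * (h + of_real s * z)) = 0}"
    then have "Im (cnj w * (h + of_real s * z)) = 0" by blast
    then have e: "?a + s * ?c = 0" using lin[of s] by linarith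
    then have c: "?c \<noteq> 0" using ne by auto
    have "s * ?c = - ?a" using e by linarith
    then have "s = - ?a / ?c" by (rule nonzero_eq_divide_eq[OF c, THEN iffD2])
    then show "s \<in> {- ?a / ?c}" by blast
  qed
  then show ?thesis using finite_subset by blast
qed

section \<open>Rerouting an edge along a straight piece\<close>

context drawing begin

text \<open>The piece is a single dart, or two darts joined by a straight bend; in both cases the
  half edges that touch it lie on the line from \<open>u\<close> to the crossing.\<close>

lemma straight_piece:
  assumes d: "d \<in> M" and u: "u \<in> V" "fst d = p u" and yX: "mh d \<in> X" and t: "turn d = 0"
  defines "\<eta> \<equiv> mh d - p u"
  shows "0 \<le> r \<Longrightarrow> r \<le> 1 \<Longrightarrow> z = p u + of_real r * \<eta> \<Longrightarrow> z \<in> on (ed d) \<and> (z \<in> X \<longrightarrow> z = mh d) \<and> (z \<in> p ` V \<longrightarrow> z = p u)"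
    and "x \<in> ed d \<Longrightarrow> hs (ed d) x \<inter> closed_segment (p u) (mh d) \<noteq> {} \<Longrightarrow> z \<in> hs (ed d) x \<Longrightarrow> \<exists>s. z = p u + of_real s * \<eta>"
    and "\<exists>x\<in>ed d. \<exists>k. mh d \<in> hs (ed d) x \<and> k \<noteq> 0 \<and> b (ed d) - p x = of_real k * \<eta>"
proof -
  let ?y = "mh d" and ?h = "ed d"
  have hE: "?h \<in> E" using ed_E[OF d] .
  have yV: "?y \<notin> p ` V" using X_disj yX by blast
  have seg: "z \<in> closed_segment (p u) ?y" if "0 \<le> r" "r \<le> 1" "z = p u + of_real r * \<eta>" for z r
    using that by (auto simp: closed_segment_param \<eta>_def)
  have line: "\<exists>s. z = p u + of_real s * \<eta>" if k: "k \<noteq> 0" "b ?h - p x = of_real k * \<eta>" "b ?h = p u + of_real l * \<eta>" and z: "z \<in> hs ?h x" for z x k l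
  proof -
    obtain r where r: "z = p x + of_real r * (b ?h - p x)" using z unfolding hs_def closed_segment_param by blast
    have "p x = p u + of_real l * \<eta> - of_real k * \<eta>" using k(2,3) by (simp add: algebra_simps)
    then have "z = p u + of_real (l - k + r * k) * \<eta>" using r k(2) by (simp add: algebra_simps)
    then show ?thesis by blast
  qed
  have "(\<forall>z\<in>closed_segment (p u) ?y. z \<in> on ?h \<and> (z \<in> X \<longrightarrow> z = ?y) \<and> (z \<in> p ` V \<longrightarrow> z = p u)) \<and>
    (\<forall>x\<in>?h. hs ?h x \<inter> closed_segment (p u) ?y \<noteq> {} \<longrightarrow> (\<forall>z\<in>hs ?h x. \<exists>s. z = p u + of_real s * \<eta>)) \<and>
    (\<exists>x\<in>?h. \<exists>k. ?y \<in> hs ?h x \<and> k \<noteq> 0 \<and> b ?h - p x = of_real k * \<eta>)"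
    using d
  proof (cases rule: M_cases)
    case (straight a c)
    obtain e w where e: "e \<in> E" "w \<in> e" "a \<in> hs e w" "c \<in> hs e w" "own (a,c) = (e,w)" by (rule own_cases[OF straight(2)])
    have eh: "e = ?h" using e(5) straight(1) by (simp add: ed_def)
    have w: "w = u" using p_in_hs[OF e(1,2) u(1)] e(3) straight(1) u(2) by simp
    have au: "a = p u" "c = ?y" using straight(1,6) u(2) by simp_all
    have yh: "?y \<in> hs ?h u" and uh: "u \<in> ?h" using e w eh au by simp_all
    have O: "open_segment (p u) ?y \<inter> N = {}" using A_open[OF straight(2)] au by simp
    have sub: "closed_segment (p u) ?y \<subseteq> hs ?h u"
      using yh p_hs[of u ?h] unfolding hs_def by (simp add: closed_segment_subset)
    have ends: "z = p u \<or> z = ?y" if "z \<in> closed_segment (p u) ?y" "z \<in> N" for z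
      using that O by (auto simp: open_segment_def)
    obtain r where r: "0 < r" "r < 1" "?y = p u + of_real r * (b ?h - p u)" using hs_param_X[OF yh hE uh yX] by blast
    have k: "b ?h - p u = of_real (1 / r) * \<eta>" using r by (simp add: \<eta>_def)
    have k': "b ?h = p u + of_real (1 / r) * \<eta>" using k by (simp add: algebra_simps)
    have 1: "\<forall>z\<in>closed_segment (p u) ?y. z \<in> on ?h \<and> (z \<in> X \<longrightarrow> z = ?y) \<and> (z \<in> p ` V \<longrightarrow> z = p u)"
    proof (intro ballI conjI impI)
      fix z assume z: "z \<in> closed_segment (p u) ?y"
      show "z \<in> on ?h" using sub z uh by (auto simp: on_def)
      show "z = ?y" if "z \<in> X" using ends[OF z X_N[OF that]] X_ne(1)[OF that u(1)] by auto
      show "z = p u" if "z \<in> p ` V" using ends[OF z] that yV p_V_N by blast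
    qed
    have 2: "\<exists>s. z = p u + of_real s * \<eta>" if x: "x \<in> ?h" "hs ?h x \<inter> closed_segment (p u) ?y \<noteq> {}" "z \<in> hs ?h x" for x z
    proof (cases "x = u")
      case True
      have "1 / r \<noteq> 0" using r(1) by simp
      then show ?thesis using line[OF _ k k'] x(3) True by blast
    next
      case False
      obtain z' where z': "z' \<in> hs ?h x" "z' \<in> closed_segment (p u) ?y" using x(2) by blast
      have "z' = b ?h" using hs_other[OF hE x(1) uh z'(1)] sub z'(2) False by blast
      then have "b ?h = p u \<or> b ?h = ?y" using ends[OF z'(2)] b_N[OF hE] by simp
      then show ?thesis using pu_ne_b[OF hE uh] X_ne(2)[OF yX hE] by auto
    qed
    have 3: "\<exists>x\<in>?h. \<exists>k. ?y \<in> hs ?h x \<and> k \<noteq> 0 \<and> b ?h - p x = of_real k * \<eta>"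
      by (rule bexI[OF _ uh], rule exI[of _ "1 / r"]) (use yh k r(1) in simp)
    show ?thesis by (intro conjI ballI impI 3 bspec[OF 1] 2)
  next
    case (bend a c e w v)
    have w: "w = u" using p_in_hs[OF bend(5,6) u(1)] bend(1,14) u(2) by simp
    have au: "a = p u" "c = ?y" using bend(1,18) u(2) by simp_all
    have eh: "e = ?h" using bend(1,12) by (simp add: ed_def)
    have uh: "u \<in> ?h" and vh: "v \<in> ?h" and uv: "u \<noteq> v" using bend(6-8) w eh by auto
    have yv: "?y \<in> hs ?h v" using bend(15) au eh by simp
    have O: "open_segment (p u) (b ?h) \<inter> N = {}" "open_segment (b ?h) ?y \<inter> N = {}"
      using A_open[OF M_A[OF d, unfolded bend(1)]] A_open[OF bend(10)] au eh by simp_all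
    have i: "idr d = ?y - b ?h" "od d = b ?h - p u" using bend(19,20) au eh by simp_all
    note ub = unbent[OF d t]
    obtain l where l: "0 < l" "od d = of_real l * \<eta>" using pp_sym[OF ub(2)] u(2) by (auto simp: pp_def \<eta>_def)
    obtain m where m: "0 < m" "idr d = of_real m * \<eta>" using pp_trans[OF ub(1) pp_sym[OF ub(2)]] u(2) by (auto simp: pp_def \<eta>_def)
    have bh: "b ?h = p u + of_real l * \<eta>" using l(2) i(2) by (simp add: algebra_simps)
    have "\<eta> = od d + idr d" using i by (simp add: \<eta>_def)
    then have "of_real 1 * \<eta> = of_real (l + m) * \<eta>" using l(2) m(2) by (simp add: algebra_simps)
    moreover have "\<eta> \<noteq> 0" using mh_ne[OF d] u(2) by (simp add: \<eta>_def)
    ultimately have lm: "l + m = 1" by (metis mult_cancel_right of_real_eq_iff)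
    obtain r where r: "0 < r" "r < 1" "?y = p v + of_real r * (b ?h - p v)" using hs_param_X[OF yv hE vh yX] by blast
    have "of_real m * \<eta> = of_real (r - 1) * (b ?h - p v)" using m(2) i(1) r(3) by (simp add: algebra_simps)
    then have k: "b ?h - p v = of_real (m / (r - 1)) * \<eta>" using r(2) by (simp add: field_simps)
    have k0: "m / (r - 1) \<noteq> 0" using m(1) r(2) by simp
    have ku: "b ?h - p u = of_real l * \<eta>" using l(2) i(2) by simp
    have two: "?h = {u,v}" using E_other[OF hE uh] vh uv by auto
    have bm: "b ?h \<in> closed_segment (p u) ?y"
      using seg[of l] l(1) m(1) lm bh by simp
    have split: "closed_segment (p u) ?y = closed_segment (p u) (b ?h) \<union> closed_segment (b ?h) ?y"
      using Un_closed_segment[OF bm] by simp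
    have sub: "closed_segment (p u) (b ?h) \<subseteq> hs ?h u" "closed_segment (b ?h) ?y \<subseteq> hs ?h v"
      using yv b_hs[of ?h v] unfolding hs_def by (simp_all add: closed_segment_subset)
    have ends: "z = p u \<or> z = b ?h \<or> z = ?y" if "z \<in> closed_segment (p u) ?y" "z \<in> N" for z
      using that O unfolding split by (auto simp: open_segment_def)
    have 1: "\<forall>z\<in>closed_segment (p u) ?y. z \<in> on ?h \<and> (z \<in> X \<longrightarrow> z = ?y) \<and> (z \<in> p ` V \<longrightarrow> z = p u)"
    proof (intro ballI conjI impI)
      fix z assume z: "z \<in> closed_segment (p u) ?y"
      show "z \<in> on ?h" using sub z uh vh unfolding split by (auto simp: on_def)
      show "z = ?y" if "z \<in> X" using ends[OF z X_N[OF that]] X_ne(1)[OF that u(1)] X_ne(2)[OF that hE] by auto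
      show "z = p u" if "z \<in> p ` V" using ends[OF z] that yV p_V_N bend_V[OF hE] by blast
    qed
    have 2: "\<exists>s. z = p u + of_real s * \<eta>" if x: "x \<in> ?h" "z \<in> hs ?h x" for x z
    proof (cases "x = u")
      case True
      have "l \<noteq> 0" using l(1) by simp
      then show ?thesis using line[OF _ ku bh] x(2) True by blast
    next
      case False
      then have "x = v" using x(1) two by blast
      then show ?thesis using line[OF k0 k bh] x(2) by blast
    qed
    have 3: "\<exists>x\<in>?h. \<exists>k. ?y \<in> hs ?h x \<and> k \<noteq> 0 \<and> b ?h - p x = of_real k * \<eta>"
      using vh yv k k0 by blast
    show ?thesis by (intro conjI ballI impI 3 bspec[OF 1] 2)
  qed
  note C = this
  show "0 \<le> r \<Longrightarrow> r \<le> 1 \<Longrightarrow> z = p u + of_real r * \<eta> \<Longrightarrow> z \<in> on ?h \<and> (z \<in> X \<longrightarrow> z = ?y) \<and> (z \<in> p ` V \<longrightarrow> z = p u)"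
    using bspec[OF conjunct1[OF C] seg] by simp
  show "x \<in> ?h \<Longrightarrow> hs ?h x \<inter> closed_segment (p u) ?y \<noteq> {} \<Longrightarrow> z \<in> hs ?h x \<Longrightarrow> \<exists>s. z = p u + of_real s * \<eta>"
    using conjunct1[OF conjunct2[OF C]] by simp
  show "\<exists>x\<in>?h. \<exists>k. ?y \<in> hs ?h x \<and> k \<noteq> 0 \<and> b ?h - p x = of_real k * \<eta>"
    by (rule conjunct2[OF conjunct2[OF C]])
qed

text \<open>If an edge \<open>g\<close> at \<open>u\<close> is crossed by the straight initial piece of another edge at \<open>u\<close>, then \<open>g\<close> can
  follow that piece closely from \<open>u\<close> and turn into its own second half just behind the crossing.\<close>

lemma reroute:
  assumes d: "d \<in> M" and u: "u \<in> V" "fst d = p u" and yX: "mh d \<in> X" and ug: "u \<in> ed (mn d)" and t: "turn d = 0"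
  shows "\<exists>b'. drawing V E p b' \<and> card (drawing.X V E p b') < card X"
proof -
  define y where "y = mh d"
  define g where "g = ed (mn d)"
  define h where "h = ed d"
  define \<eta> where "\<eta> = y - p u"
  have only: "f = g \<or> f = h" if "f \<in> E" "y \<in> on f" for f
    using mn_cross(3)[OF d yX that(1)] that(2) by (auto simp: g_def h_def y_def)
  have gh: "g \<noteq> h" using mn_cross(2)[OF d yX] by (simp add: g_def h_def)
  have yX': "y \<in> X" using yX by (simp add: y_def)
  have yV: "y \<notin> p ` V" using X_disj yX' by blast
  have gE: "g \<in> E" and hE: "h \<in> E" using ed_E[OF mn_M[OF d]] ed_E[OF d] by (simp_all add: g_def h_def)
  have ugg: "u \<in> g" using ug by (simp add: g_def)
  have yg: "y \<in> on g" using fst_on[OF mn_M[OF d]] by (simp add: g_def y_def)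
  have \<eta>0: "\<eta> \<noteq> 0" using mh_ne[OF d] u by (simp add: \<eta>_def y_def)
  obtain v where v: "v \<noteq> u" "g = {u,v}" using E_other[OF gE ugg] by blast
  have vV: "v \<in> V" and vg: "v \<in> g" using E_V[OF gE] v by auto
  note sp = straight_piece[OF d u yX t, folded y_def, folded \<eta>_def h_def]
  obtain x0 k0 where x0: "x0 \<in> h" "y \<in> hs h x0" "k0 \<noteq> 0" "b h - p x0 = of_real k0 * \<eta>" using sp(3) by blast
  have pr: "(p w - b g) \<bullet> \<eta> = 0" if "w \<in> g" "y \<in> hs g w" for w
  proof -
    have "(p w - b g) \<bullet> (p x0 - b h) = 0"
      by (rule perp[OF gE hE gh that(1) x0(1)]) (use that(2) x0(2) yV in \<open>auto simp: hs_def\<close>)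
    moreover have "p x0 - b h = - (k0 *\<^sub>R \<eta>)" using x0(4) by (simp add: scaleR_conv_of_real algebra_simps)
    ultimately show ?thesis using x0(3) by simp
  qed
  \<comment> \<open>On the half at \<open>u\<close>, the crossing would be reached from
    \<open>u\<close> along \<open>g\<close>, so \<open>g\<close> would be parallel to
    \<open>\<eta>\<close> there and not perpendicular.\<close>
  have yv: "y \<in> hs g v"
  proof (rule ccontr)
    assume "y \<notin> hs g v"
    then have yu: "y \<in> hs g u" using yg v by (auto simp: on_def)
    obtain r where r: "0 < r" "y = p u + of_real r * (b g - p u)" using hs_param_X[OF yu gE ugg yX'] by blast
    have "\<eta> = - (r *\<^sub>R (p u - b g))" using r(2) by (simp add: \<eta>_def scaleR_conv_of_real algebra_simps)
    then have "r * ((p u - b g) \<bullet> (p u - b g)) = 0" using pr[OF ugg yu] by simp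
    then show False using r(1) pu_ne_b[OF gE ugg] by simp
  qed
  obtain rr where rr: "0 < rr" "rr < 1" "y = p v + of_real rr * (b g - p v)" using hs_param_X[OF yv gE vg yX'] by blast
  define z where "z = p v - y"
  have zR: "z = rr *\<^sub>R (p v - b g)" using rr(3) by (simp add: z_def scaleR_conv_of_real algebra_simps)
  have z0: "z \<noteq> 0" using zR rr(1) pu_ne_b[OF gE vg] by simp
  have perpz: "\<eta> \<bullet> z = 0" using pr[OF vg yv] zR by (simp add: inner_commute)
  let ?L = "closed_segment (p u) y"
  \<comment> \<open>Half edges that miss the straight piece also miss all nearby pieces. The others
    lie on lines through \<open>p u\<close>, and for these it suffices to avoid the direction of the
    line.\<close>
  have rem: "hs f x \<inter> ?L = {} \<or> (\<exists>w. w \<noteq> 0 \<and> (\<forall>q\<in>hs f x. \<exists>s. q = p u + of_real s * w))" if f: "f \<in> E" "f \<noteq> g" "x \<in> f" for f x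
  proof (cases "f = h")
    case True
    then show ?thesis using sp(2)[of x] f(3) \<eta>0 by blast
  next
    case False
    show ?thesis
    proof (cases "hs f x \<inter> ?L = {}")
      case ne: False
      then obtain q where q: "q \<in> hs f x" "q \<in> ?L" by blast
      obtain r where r: "0 \<le> r" "r \<le> 1" "q = p u + of_real r * \<eta>" using q(2) by (auto simp: closed_segment_param \<eta>_def)
      note qq = sp(1)[OF r]
      have qf: "q \<in> on f" using q(1) f(3) by (auto simp: on_def)
      have "q \<in> p ` V"
      proof (rule ccontr)
        assume "q \<notin> p ` V"
        then have "q \<in> X" using on_meet[OF f(1) hE False qf] qq by blast
        then have "q = y" using qq by blast
        then show False using only[OF f(1)] qf f(2) False by blast
      qed
      then have "q = p u" using qq by blast
      then have xu: "x = u" using p_in_hs[OF f(1,3) u(1)] q(1) by simp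
      have "b f - p u \<noteq> 0" using pu_ne_b[OF f(1,3)] xu by auto
      moreover have "\<exists>s. q = p u + of_real s * (b f - p u)" if "q \<in> hs f x" for q
        using that unfolding xu hs_def closed_segment_param by blast
      ultimately show ?thesis by blast
    qed blast
  qed
  define K where "K = Sigma (E - {g}) (\<lambda>f. f)"
  have finK: "finite K" unfolding K_def using finE finite_edge by (intro finite_SigmaI) auto
  define K1 where "K1 = {c\<in>K. hs (fst c) (snd c) \<inter> ?L = {}}"
  define C where "C = p ` (V - {u}) \<union> (\<Union>c\<in>K1. hs (fst c) (snd c))"
  have finK1: "finite K1" using finK by (simp add: K1_def)
  have cC: "closed C" unfolding C_def hs_def
    by (intro closed_Un closed_UN finK1) (use finV in \<open>auto intro: finite_imp_closed\<close>)
  have "p u + of_real r * \<eta> \<notin> C" if r: "0 \<le> r" "r \<le> 1" for r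
  proof
    assume a: "p u + of_real r * \<eta> \<in> C"
    have L: "p u + of_real r * \<eta> \<in> ?L" using r by (auto simp: closed_segment_param \<eta>_def)
    have "p u + of_real r * \<eta> \<in> p ` (V - {u})" using a L by (auto simp: C_def K1_def)
    then obtain w where w: "w \<in> V" "w \<noteq> u" "p u + of_real r * \<eta> = p w" by blast
    then have "p w = p u" using sp(1)[OF r refl] by simp
    then show False using p_inj w(1,2) u(1) by (auto simp: inj_on_def)
  qed
  from near_segment_avoid[OF cC this, of z] obtain \<delta>0 where \<delta>0: "0 < \<delta>0"
    "\<And>s t. 0 < s \<Longrightarrow> s < \<delta>0 \<Longrightarrow> 0 \<le> t \<Longrightarrow> t \<le> 1 \<Longrightarrow> p u + of_real t * (\<eta> + of_real s * z) \<notin> C" by blast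
  have "\<forall>c\<in>K - K1. \<exists>w. w \<noteq> 0 \<and> (\<forall>q\<in>hs (fst c) (snd c). \<exists>s. q = p u + of_real s * w)"
  proof
    fix c assume "c \<in> K - K1"
    then have "fst c \<in> E" "fst c \<noteq> g" "snd c \<in> fst c" "hs (fst c) (snd c) \<inter> ?L \<noteq> {}" by (auto simp: K_def K1_def)
    then show "\<exists>w. w \<noteq> 0 \<and> (\<forall>q\<in>hs (fst c) (snd c). \<exists>s. q = p u + of_real s * w)" using rem by blast
  qed
  from bchoice[OF this] obtain W where W: "\<And>c. c \<in> K - K1 \<Longrightarrow> W c \<noteq> 0"
    "\<And>c q. c \<in> K - K1 \<Longrightarrow> q \<in> hs (fst c) (snd c) \<Longrightarrow> \<exists>s. q = p u + of_real s * W c" by blast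
  define Bad where "Bad = (\<Union>c\<in>K - K1. {s. Im (cnj (W c) * (\<eta> + of_real s * z)) = 0})"
  have "finite Bad" unfolding Bad_def using finK line_avoid[OF W(1) \<eta>0 z0 perpz] by blast
  moreover have "infinite {0 <..< min \<delta>0 1}" using \<delta>0(1) by (simp add: infinite_Ioo)
  ultimately have "{0 <..< min \<delta>0 1} - Bad \<noteq> {}" by (metis finite.emptyI finite_Diff2)
  then obtain \<delta> where del: "\<delta> \<in> {0 <..< min \<delta>0 1}" "\<delta> \<notin> Bad" by blast
  then have dl: "0 < \<delta>" "\<delta> < \<delta>0" "\<delta> < 1" "\<delta> \<notin> Bad" by simp_all
  \<comment> \<open>This is the point \<open>y + \<delta> * z\<close> on the second half of
    \<open>g\<close>, just behind the crossing. The part of that half beyond it keeps its position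
    and direction.\<close>
  define b' where "b' = p u + (\<eta> + of_real \<delta> * z)"
  have b'z: "b' = p v - of_real (1 - \<delta>) * z" by (simp add: b'_def \<eta>_def z_def algebra_simps)
  have new: "\<exists>s. 0 \<le> s \<and> s \<le> 1 \<and> q = p u + of_real s * (\<eta> + of_real \<delta> * z)" if "q \<in> closed_segment (p u) b'" for q
    using that by (simp add: closed_segment_param b'_def)
  \<comment> \<open>Half edges in \<open>K1\<close> are avoided because \<open>\<delta>\<close> is
    small, the others because it is not in \<open>Bad\<close>.\<close>
  have meet: "q = p u" if q: "q \<in> closed_segment (p u) b'" and f: "f \<in> E" "f \<noteq> g" "x \<in> f" "q \<in> hs f x" for q f x
  proof -
    obtain s where s: "0 \<le> s" "s \<le> 1" "q = p u + of_real s * (\<eta> + of_real \<delta> * z)" using new[OF q] by blast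
    have K: "(f,x) \<in> K" using f by (simp add: K_def)
    have "q \<notin> C" using \<delta>0(2)[OF dl(1,2) s(1,2)] s(3) by simp
    then have K2: "(f,x) \<in> K - K1" using K f(4) by (auto simp: C_def)
    obtain r where r: "q = p u + of_real r * W (f,x)" using W(2)[OF K2] f(4) by auto
    let ?w = "W (f,x)"
    have e: "of_real s * (\<eta> + of_real \<delta> * z) = of_real r * ?w" using s(3) r by simp
    have im: "Im (c * (of_real s * x)) = s * Im (c * x)" for c x :: complex by (simp add: algebra_simps)
    have "s * Im (cnj ?w * (\<eta> + of_real \<delta> * z)) = Im (cnj ?w * (of_real s * (\<eta> + of_real \<delta> * z)))"
      by (rule im[symmetric])
    also have "\<dots> = 0" unfolding e by simp
    finally have "s * Im (cnj ?w * (\<eta> + of_real \<delta> * z)) = 0" .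
    moreover have "Im (cnj ?w * (\<eta> + of_real \<delta> * z)) \<noteq> 0" using dl(4) K2 unfolding Bad_def by blast
    ultimately have "s = 0" by simp
    then show ?thesis using s(3) by simp
  qed
  have vert: "w = u" if "w \<in> V" "p w \<in> closed_segment (p u) b'" for w
  proof (rule ccontr)
    assume "w \<noteq> u"
    then have "p w \<in> C" using that(1) by (simp add: C_def)
    then show False using new[OF that(2)] \<delta>0(2)[OF dl(1,2)] by metis
  qed
  have b'g: "b' \<in> hs g v"
  proof -
    have "b' = p v + of_real ((1 - \<delta>) * rr) * (b g - p v)" unfolding b'z zR by (simp add: scaleR_conv_of_real algebra_simps)
    moreover have "0 \<le> (1 - \<delta>) * rr" "(1 - \<delta>) * rr \<le> 1" using dl rr by (auto intro: mult_le_one)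
    ultimately show ?thesis unfolding hs_def closed_segment_param by blast
  qed
  have old: "closed_segment (p v) b' \<subseteq> hs g v"
    using b'g p_hs[of v g] unfolding hs_def by (simp add: closed_segment_subset)
  have b'v: "b' \<noteq> p v" using b'z z0 dl by simp
  have b'V: "b' \<notin> p ` V" using p_in_hs[OF gE vg] b'g b'v by blast
  have b'u: "b' \<noteq> p u" using b'V u by blast
  define B where "B = b(g := b')"
  have Bg: "B g = b'" and Bo: "f \<noteq> g \<Longrightarrow> B f = b f" for f by (simp_all add: B_def)
  have apart: "closed_segment (p u) b' \<inter> closed_segment b' (p v) = {b'}"
  proof
    show "closed_segment (p u) b' \<inter> closed_segment b' (p v) \<subseteq> {b'}"
    proof
      fix q assume q: "q \<in> closed_segment (p u) b' \<inter> closed_segment b' (p v)"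
      obtain s where s: "q = p u + of_real s * (\<eta> + of_real \<delta> * z)" using new q by blast
      obtain r where r: "q = b' + of_real r * (p v - b')" using q by (auto simp: closed_segment_param)
      have "p v - b' = of_real (1 - \<delta>) * z" using b'z by simp
      then have "q = p u + (\<eta> + of_real \<delta> * z) + of_real r * (of_real (1 - \<delta>) * z)" using r unfolding b'_def[symmetric] by simp
      then have "of_real s * (\<eta> + of_real \<delta> * z) = \<eta> + of_real \<delta> * z + of_real r * (of_real (1 - \<delta>) * z)"
        using s by (simp only: add.assoc add_left_cancel)
      then have "(s - 1) *\<^sub>R \<eta> = (\<delta> + r * (1 - \<delta>) - s * \<delta>) *\<^sub>R z"
        by (simp add: scaleR_conv_of_real algebra_simps)
      then have "((s - 1) *\<^sub>R \<eta>) \<bullet> \<eta> = ((\<delta> + r * (1 - \<delta>) - s * \<delta>) *\<^sub>R z) \<bullet> \<eta>" by simp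
      then have "s = 1" using \<eta>0 perpz by (simp add: inner_commute)
      then show "q \<in> {b'}" using s by (simp add: b'_def)
    qed
  qed simp
  have D: "drawing V E p B"
  proof
    show "finite V" "inj_on p V" by (fact finV p_inj)+
    fix e f w x q c
    show "\<exists>u v. u \<in> V \<and> v \<in> V \<and> u \<noteq> v \<and> e = {u,v}" if "e \<in> E" by (rule E_pair[OF that])
    show "closed_segment (p w) (B e) \<inter> closed_segment (B e) (p x) = {B e}" if h: "e \<in> E" "w \<in> e" "x \<in> e" "w \<noteq> x"
    proof (cases "e = g")
      case True
      then have "w = u \<and> x = v \<or> w = v \<and> x = u" using h v by auto
      then show ?thesis using apart True Bg by (auto simp: closed_segment_commute)
    next
      case False then show ?thesis using bend_seg[OF h] Bo by simp
    qed
    show "p w \<notin> closed_segment (p x) (B e)" if h: "e \<in> E" "w \<in> V - e" "x \<in> e"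
    proof (cases "e = g")
      case True
      then have "x = u \<or> x = v" "w \<noteq> u" "w \<noteq> v" "w \<in> V" using h v by auto
      then show ?thesis using vert[of w] old p_in_hs[OF gE vg, of w] True Bg by auto
    next
      case False then show ?thesis using far[OF h] Bo by simp
    qed
    have one: "(p w - B g) \<bullet> (p x - b f) = 0" if h: "f \<in> E" "f \<noteq> g" "w \<in> g" "x \<in> f" "q \<in> closed_segment (p w) (B g)" "q \<in> closed_segment (p x) (b f)" "q \<notin> p ` V" for f w x q
    proof (cases "w = u")
      case True
      then have "q = p u" using meet[OF _ h(1,2,4)] h(5,6) Bg by (simp add: hs_def)
      then show ?thesis using h(7) u by blast
    next
      case False
      then have w: "w = v" using h(3) v by auto
      then have "q \<in> hs g v" using old h(5) Bg by auto
      then have "(p v - b g) \<bullet> (p x - b f) = 0"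
        using perp[OF gE h(1) h(2)[symmetric] vg h(4) _ h(6,7)] by (simp add: hs_def)
      moreover have "p v - B g = ((1 - \<delta>) * rr) *\<^sub>R (p v - b g)" using b'z zR Bg by (simp add: scaleR_conv_of_real)
      ultimately show ?thesis using w by simp
    qed
    show "(p w - B e) \<bullet> (p x - B f) = 0" if h: "e \<in> E" "f \<in> E" "e \<noteq> f" "w \<in> e" "x \<in> f" "q \<in> closed_segment (p w) (B e)" "q \<in> closed_segment (p x) (B f)" "q \<notin> p ` V"
    proof (cases "e = g")
      case True
      then have "f \<noteq> g" using h(3) by blast
      then show ?thesis using one[of f w x q] h True Bo by simp
    next
      case eg: False
      show ?thesis
      proof (cases "f = g")
        case True
        then show ?thesis using one[of e x w q] h eg Bo by (simp add: inner_commute)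
      next
        case False
        then show ?thesis using perp[OF h(1-5)] h(6-8) eg Bo by simp
      qed
    qed
    show "B e \<notin> p ` V" if "e \<in> E" using b'V Bg Bo bend_V[OF that] by (cases "e = g") auto
    show "B e \<notin> closed_segment (p x) (B f)" if h: "e \<in> E" "f \<in> E" "e \<noteq> f" "x \<in> f"
    proof (cases "e = g")
      case True
      then have fg: "f \<noteq> g" using h(3) by blast
      have "b' \<notin> hs f x" using meet[of b' f x] h(2,4) fg b'u by auto
      then show ?thesis using True fg Bg Bo by (simp add: hs_def)
    next
      case eg: False
      show ?thesis
      proof (cases "f = g")
        case True
        obtain a where a: "a \<in> e" using E_pair[OF h(1)] by blast
        have "b e \<noteq> p u" using bend_V[OF h(1)] u by blast
        then have "b e \<notin> closed_segment (p u) b'" using meet[OF _ h(1) eg a b_hs] by blast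
        moreover have "b e \<notin> closed_segment (p v) b'" using old bend_free[OF h(1) gE eg vg] unfolding hs_def by blast
        moreover have "x = u \<or> x = v" using h(4) True v by auto
        ultimately show ?thesis using True eg Bg Bo by auto
      next
        case False
        then show ?thesis using bend_free[OF h] eg Bo by simp
      qed
    qed
  qed
  interpret D: drawing V E p B by (rule D)
  have hso: "D.hs f x = hs f x" if "f \<noteq> g" for f x using that Bo by (simp add: D.hs_def hs_def)
  \<comment> \<open>No crossing is new, since the new half meets other edges only in
    \<open>p u\<close>; and \<open>y\<close> disappears, since the shortened second half ends before
    it.\<close>
  have "D.X \<subseteq> X - {y}"
  proof
    fix q assume "q \<in> D.X"
    then obtain e f w x where q: "q \<notin> p ` V" "e \<in> E" "f \<in> E" "e \<noteq> f" "w \<in> e" "q \<in> D.hs e w" "x \<in> f" "q \<in> D.hs f x"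
      unfolding D.X_def by blast
    have one: "q \<in> X - {y}" if h: "f \<in> E" "f \<noteq> g" "w \<in> g" "x \<in> f" "q \<in> D.hs g w" "q \<in> hs f x" for f w x
    proof -
      have "w \<noteq> u"
      proof
        assume "w = u"
        then have "q = p u" using meet[OF _ h(1,2,4,6)] h(5) Bg by (simp add: D.hs_def)
        then show False using q(1) u by blast
      qed
      then have w: "w = v" using h(3) v by auto
      then have qs: "q \<in> closed_segment (p v) b'" using h(5) Bg by (simp add: D.hs_def)
      then have qg: "q \<in> hs g v" using old by blast
      have "q \<in> X" unfolding X_def using q(1) gE h(1,2,4,6) vg qg by blast
      moreover have "q \<noteq> y"
      proof
        assume "q = y"
        then obtain r where r: "0 \<le> r" "r \<le> 1" "y = p v + of_real r * (b' - p v)" using qs by (auto simp: closed_segment_param)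
        have "p v - y = of_real (r * (1 - \<delta>)) * z" using r(3) b'z by simp
        then have "of_real 1 * z = of_real (r * (1 - \<delta>)) * z" by (simp add: z_def)
        then have "r * (1 - \<delta>) = 1" using z0 by (metis mult_cancel_right of_real_eq_iff)
        moreover have "r * (1 - \<delta>) \<le> 1 * (1 - \<delta>)" by (rule mult_right_mono) (use r dl in auto)
        ultimately show False using dl(1) by simp
      qed
      ultimately show ?thesis by blast
    qed
    consider "e = g" "f \<noteq> g" | "f = g" "e \<noteq> g" | "e \<noteq> g" "f \<noteq> g" using q(4) by blast
    then show "q \<in> X - {y}"
    proof cases
      case 1 then show ?thesis using one[of f w x] q hso by simp
    next
      case 2 then show ?thesis using one[of e x w] q hso by simp
    next
      case 3
      then have h: "q \<in> hs e w" "q \<in> hs f x" using q hso by simp_all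
      have "q \<in> X" unfolding X_def using q(1-5,7) h by blast
      moreover have "q \<noteq> y"
      proof
        assume qy: "q = y"
        have "y \<in> on e" "y \<in> on f" using h q(5,7) qy by (auto simp: on_def)
        then have "e = h" "f = h" using only q(2,3) 3 by blast+
        then show False using q(4) by simp
      qed
      ultimately show ?thesis by blast
    qed
  qed
  then have "card D.X \<le> card (X - {y})" by (rule card_mono[rotated]) (simp add: finX)
  also have "\<dots> < card X" using card_Diff1_less[OF finX yX'] .
  finally show ?thesis using D by blast
qed

end

section \<open>From RAC graphs to drawings\<close>

text \<open>The vertices stay fixed and the bends are chosen to minimise the number of crossings. A
  violation of \<open>star\<close> could be rerouted with fewer of them.\<close>

lemma star_drawing_exists:
  assumes D: "drawing V E p b" and c: "\<And>u. u \<in> V \<Longrightarrow> \<exists>e\<in>E. u \<in> e"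
  shows "\<exists>b'. star_drawing V E p b'"
proof -
  obtain b0 where b0: "drawing V E p b0" "\<And>b'. drawing V E p b' \<Longrightarrow> card (drawing.X V E p b0) \<le> card (drawing.X V E p b')"
    using ex_has_least_nat[of "drawing V E p" b "\<lambda>b'. card (drawing.X V E p b')"] D by blast
  interpret d: drawing V E p b0 by (rule b0(1))
  have "star_drawing V E p b0"
  proof
    show "u \<in> V \<Longrightarrow> \<exists>e\<in>E. u \<in> e" for u by (rule c)
    fix d u assume h: "d \<in> d.M" "u \<in> V" "fst d = p u" "d.mh d \<in> d.X" "u \<in> d.ed (d.mn d)"
    show "d.turn d \<noteq> 0"
    proof
      assume "d.turn d = 0"
      then obtain b' where "drawing V E p b'" "card (drawing.X V E p b') < card d.X"
        using d.reroute[OF h] by blast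
      then show False using b0(2)[of b'] by simp
    qed
  qed
  then show ?thesis by blast
qed

text \<open>A bend that lies on a vertex or on another edge is a bend of a straight edge, so it can be moved along that edge.\<close>

lemma drawing_exists:
  fixes p :: "'a \<Rightarrow> complex" and b :: "'a set \<Rightarrow> complex"
  assumes finV: "finite V"
    and EP: "\<And>e. e \<in> E \<Longrightarrow> \<exists>u v. u \<in> V \<and> v \<in> V \<and> u \<noteq> v \<and> e = {u,v}"
    and inj: "inj_on p V"
    and bs: "\<And>e u v. e \<in> E \<Longrightarrow> u \<in> e \<Longrightarrow> v \<in> e \<Longrightarrow> u \<noteq> v \<Longrightarrow>
      closed_segment (p u) (b e) \<inter> closed_segment (b e) (p v) = {b e}"
    and far: "\<And>e u w. e \<in> E \<Longrightarrow> w \<in> V - e \<Longrightarrow> u \<in> e \<Longrightarrow> p w \<notin> closed_segment (p u) (b e)"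
    and perp: "\<And>e f u v x. e \<in> E \<Longrightarrow> f \<in> E \<Longrightarrow> e \<noteq> f \<Longrightarrow> u \<in> e \<Longrightarrow> v \<in> f \<Longrightarrow> x \<in> closed_segment (p u) (b e) \<Longrightarrow>
      x \<in> closed_segment (p v) (b f) \<Longrightarrow> x \<notin> p ` V \<Longrightarrow> (p u - b e) \<bullet> (p v - b f) = 0"
  shows "\<exists>b'. drawing V E p b'"
proof -
  have EV: "u \<in> V" if "e \<in> E" "u \<in> e" for e u using EP[OF that(1)] that(2) by auto
  have finE: "finite E"
  proof (rule finite_subset)
    show "E \<subseteq> Pow V" using EV by blast
  qed (use finV in simp)
  define T where "T e = (\<Union>u\<in>e. closed_segment (p u) (b e))" for e
  define ok where "ok e \<longleftrightarrow> b e \<notin> p ` V \<and> (\<forall>f\<in>E. f \<noteq> e \<longrightarrow> b e \<notin> T f)" for e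
  \<comment> \<open>A bend on a vertex sits at an end of its own edge. If it lies on another edge,
    both of its halves are perpendicular to that edge and hence collinear, and they point in
    opposite directions because they share only the bend.\<close>
  have straight: "b e \<in> closed_segment (p u) (p v)" if e: "e \<in> E" "\<not> ok e" "e = {u,v}" "u \<noteq> v" for e u v
  proof -
    have ue: "u \<in> e" "v \<in> e" using e(3) by auto
    show ?thesis
    proof (cases "b e \<in> p ` V")
      case True
      then obtain w where w: "w \<in> V" "b e = p w" by blast
      have "w \<in> e" using far[OF e(1) _ ue(1), of w] w by auto
      then show ?thesis using w e(3) by auto
    next
      case False
      then obtain f x where f: "f \<in> E" "f \<noteq> e" "x \<in> f" "b e \<in> closed_segment (p x) (b f)"
        using e(2) by (auto simp: ok_def T_def)
      define w where "w = p x - b f"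
      have w0: "w \<noteq> 0"
      proof
        assume "w = 0"
        then have "b e = p x" using f(4) by (simp add: w_def)
        then show False using False EV[OF f(1,3)] by blast
      qed
      have "(p u - b e) \<bullet> w = 0" "(p v - b e) \<bullet> w = 0"
        using perp[OF e(1) f(1) f(2)[symmetric] ue(1) f(3) _ f(4) False] perp[OF e(1) f(1) f(2)[symmetric] ue(2) f(3) _ f(4) False]
        by (simp_all add: w_def)
      then obtain s t where st: "p u - b e = of_real s * (\<i> * w)" "p v - b e = of_real t * (\<i> * w)"
        using inner_zero_perp[OF w0, of "p u - b e"] inner_zero_perp[OF w0, of "p v - b e"] by (auto simp: inner_commute)
      let ?D = "\<i> * w"
      have D0: "?D \<noteq> 0" using w0 by simp
      have pu: "p u = b e + of_real s * ?D" "p v = b e + of_real t * ?D" using st by (simp_all add: algebra_simps)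
      have "p u \<in> p ` V" "p v \<in> p ` V" using EV[OF e(1)] ue by blast+
      then have "p u \<noteq> b e" "p v \<noteq> b e" using False by metis+
      then have s0: "s \<noteq> 0" "t \<noteq> 0" using st by auto
      have same: False if "0 \<le> r" "r \<le> 1" "of_real s' * ?D = of_real r * (of_real t' * ?D)" "p u' = b e + of_real s' * ?D"
        "p v' = b e + of_real t' * ?D" "u' \<in> e" "v' \<in> e" "u' \<noteq> v'" "p u' \<noteq> b e" for r s' t' u' v'
      proof -
        have "p u' = b e + of_real r * (p v' - b e)" using that(3-5) by simp
        then have "p u' \<in> closed_segment (b e) (p v')" using that(1,2) unfolding closed_segment_param by blast
        then show False using bs[OF e(1) that(6-8)] that(9) by auto
      qed
      have opp: "s * t < 0"
      proof (rule ccontr)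
        assume "\<not> s * t < 0"
        then have pos: "0 < s * t" using s0 by (metis linorder_neqE_linordered_idom mult_eq_0_iff)
        show False
        proof (cases "\<bar>s\<bar> \<le> \<bar>t\<bar>")
          case True
          have "0 \<le> s / t" "s / t \<le> 1" using pos True s0 by (auto simp: divide_le_eq zero_le_divide_iff zero_less_mult_iff abs_if split: if_splits)
          moreover have "of_real s * ?D = of_real (s / t) * (of_real t * ?D)" using s0 by simp
          ultimately show False using same[OF _ _ _ pu ue e(4) \<open>p u \<noteq> b e\<close>] by blast
        next
          case F: False
          have "0 \<le> t / s" "t / s \<le> 1" using pos F s0 by (auto simp: divide_le_eq zero_le_divide_iff zero_less_mult_iff abs_if split: if_splits)
          moreover have "of_real t * ?D = of_real (t / s) * (of_real s * ?D)" using s0 by simp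
          ultimately show False using same[OF _ _ _ pu(2,1) ue(2,1) e(4)[symmetric] \<open>p v \<noteq> b e\<close>] by blast
        qed
      qed
      have st0: "s - t \<noteq> 0" using opp by (auto simp: mult_less_0_iff)
      have "p u + of_real (s / (s - t)) * (p v - p u) = p u + of_real (s / (s - t)) * (of_real (t - s) * ?D)"
        using pu by (simp add: algebra_simps)
      also have "\<dots> = p u + of_real (s / (s - t) * (t - s)) * ?D" by simp
      also have "s / (s - t) * (t - s) = - s" using st0 by (simp add: field_simps)
      finally have "b e = p u + of_real (s / (s - t)) * (p v - p u)" using pu by simp
      moreover have "0 \<le> s / (s - t)" "s / (s - t) \<le> 1"
        using opp by (auto simp: mult_less_0_iff divide_le_eq zero_le_divide_iff)
      ultimately show ?thesis unfolding closed_segment_param by blast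
    qed
  qed
  have dir: "\<exists>w\<in>e. \<exists>k. k \<noteq> 0 \<and> q \<in> closed_segment (p w) (b e) \<and> p w - b e = k *\<^sub>R (p v - p u)"
    if e: "e \<in> E" "\<not> ok e" "e = {u,v}" "u \<noteq> v" and q: "q \<in> closed_segment (p u) (p v)" "q \<notin> p ` V" for e u v q
  proof -
    obtain r where r: "b e = p u + of_real r * (p v - p u)" using straight[OF e] unfolding closed_segment_param by blast
    have V: "u \<in> V" "v \<in> V" "u \<in> e" "v \<in> e" using EV[OF e(1)] e(3) by auto
    have "q \<in> closed_segment (p u) (b e) \<or> q \<in> closed_segment (p v) (b e)"
      using q(1) Un_closed_segment[OF straight[OF e]] closed_segment_commute by blast
    then show ?thesis
    proof
      assume h: "q \<in> closed_segment (p u) (b e)"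
      have "p u \<noteq> b e"
      proof
        assume "p u = b e"
        then have "q = p u" using h by simp
        then show False using q(2) V(1) by blast
      qed
      moreover have k: "p u - b e = (- r) *\<^sub>R (p v - p u)" unfolding r by (simp add: scaleR_conv_of_real)
      ultimately have "- r \<noteq> 0" by auto
      then show ?thesis using V(3) h k by blast
    next
      assume h: "q \<in> closed_segment (p v) (b e)"
      have "p v \<noteq> b e"
      proof
        assume "p v = b e"
        then have "q = p v" using h by simp
        then show False using q(2) V(2) by blast
      qed
      moreover have k: "p v - b e = (1 - r) *\<^sub>R (p v - p u)" unfolding r by (simp add: scaleR_conv_of_real algebra_simps)
      ultimately have "1 - r \<noteq> 0" by auto
      then show ?thesis using V(4) h k by blast
    qed
  qed
  \<comment> \<open>By the right angles, every other half edge meets the segment in at most one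
    point off the vertices. So all but finitely many of its points can serve as the bend.\<close>
  have ex: "\<exists>c. c \<notin> p ` V \<and> (\<forall>f\<in>E. f \<noteq> e \<longrightarrow> c \<notin> T f) \<and> (\<forall>u v. e = {u,v} \<longrightarrow> u \<noteq> v \<longrightarrow> c \<in> closed_segment (p u) (p v))"
    if e: "e \<in> E" "\<not> ok e" for e
  proof -
    obtain u v where uv: "u \<in> V" "v \<in> V" "u \<noteq> v" "e = {u,v}" using EP[OF e(1)] by blast
    have ne: "p u \<noteq> p v" using inj uv by (auto simp: inj_on_def)
    define Q where "Q c = {q. q \<in> closed_segment (p u) (p v) \<and> q \<in> closed_segment (p (snd c)) (b (fst c)) \<and> q \<notin> p ` V}" for c
    define K where "K = Sigma (E - {e}) (\<lambda>f. f)"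
    have "finite f" if "f \<in> E" for f using EP[OF that] by auto
    then have finK: "finite K" unfolding K_def using finE by (intro finite_SigmaI) auto
    have "finite (Q c)" if c: "c \<in> K" for c
    proof -
      obtain f x where f: "c = (f,x)" "f \<in> E" "f \<noteq> e" "x \<in> f" using c by (auto simp: K_def)
      have "q = q'" if q: "q \<in> Q c" and q': "q' \<in> Q c" for q q'
      proof -
        have Q1: "q \<in> closed_segment (p u) (p v)" "q \<in> closed_segment (p x) (b f)" "q \<notin> p ` V" using q f by (auto simp: Q_def)
        have Q2: "q' \<in> closed_segment (p u) (p v)" "q' \<in> closed_segment (p x) (b f)" using q' f by (auto simp: Q_def)
        obtain w k where w: "w \<in> e" "k \<noteq> 0" "q \<in> closed_segment (p w) (b e)" "p w - b e = k *\<^sub>R (p v - p u)"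
          using dir[OF e uv(4,3) Q1(1,3)] by blast
        have "(p w - b e) \<bullet> (p x - b f) = 0" by (rule perp[OF e(1) f(2) f(3)[symmetric] w(1) f(4) w(3) Q1(2,3)])
        then have o: "(p v - p u) \<bullet> (p x - b f) = 0" using w(2,4) by simp
        obtain r r' where r: "q = p u + of_real r * (p v - p u)" "q' = p u + of_real r' * (p v - p u)"
          using Q1(1) Q2(1) unfolding closed_segment_param by blast
        obtain t t' where t: "q = p x + of_real t * (b f - p x)" "q' = p x + of_real t' * (b f - p x)"
          using Q1(2) Q2(2) unfolding closed_segment_param by blast
        have 1: "q - q' = (r - r') *\<^sub>R (p v - p u)" unfolding r by (simp add: scaleR_conv_of_real algebra_simps)
        have 2: "q - q' = (t' - t) *\<^sub>R (p x - b f)" unfolding t by (simp add: scaleR_conv_of_real algebra_simps)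
        have "(q - q') \<bullet> (q - q') = ((r - r') *\<^sub>R (p v - p u)) \<bullet> ((t' - t) *\<^sub>R (p x - b f))" using 1 2 by simp
        then have "(q - q') \<bullet> (q - q') = 0" using o by simp
        then show "q = q'" by simp
      qed
      then have "\<exists>q. Q c \<subseteq> {q}" by blast
      then show ?thesis using finite_subset by blast
    qed
    then have "finite (p ` V \<union> (\<Union>c\<in>K. Q c))" using finK finV by simp
    moreover have "infinite (closed_segment (p u) (p v))" using ne by simp
    ultimately have "closed_segment (p u) (p v) - (p ` V \<union> (\<Union>c\<in>K. Q c)) \<noteq> {}" by (metis finite.emptyI finite_Diff2)
    then obtain c where c: "c \<in> closed_segment (p u) (p v)" "c \<notin> p ` V" "c \<notin> (\<Union>c\<in>K. Q c)" by blast
    have "c \<notin> T f" if f: "f \<in> E" "f \<noteq> e" for f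
    proof
      assume "c \<in> T f"
      then obtain x where "x \<in> f" "c \<in> closed_segment (p x) (b f)" by (auto simp: T_def)
      then have "c \<in> Q (f,x)" "(f,x) \<in> K" using c f by (auto simp: Q_def K_def)
      then show False using c(3) by blast
    qed
    moreover have "c \<in> closed_segment (p u') (p v')" if "e = {u',v'}" "u' \<noteq> v'" for u' v'
    proof -
      have "u' = u \<and> v' = v \<or> u' = v \<and> v' = u" using that uv by (auto simp: doubleton_eq_iff)
      then show ?thesis using c(1) closed_segment_commute by auto
    qed
    ultimately show ?thesis using c(2) by blast
  qed
  then have "\<forall>e\<in>{e\<in>E. \<not> ok e}. \<exists>c. c \<notin> p ` V \<and> (\<forall>f\<in>E. f \<noteq> e \<longrightarrow> c \<notin> T f) \<and> (\<forall>u v. e = {u,v} \<longrightarrow> u \<noteq> v \<longrightarrow> c \<in> closed_segment (p u) (p v))"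
    by blast
  from bchoice[OF this] obtain c where C: "\<forall>e\<in>{e\<in>E. \<not> ok e}. c e \<notin> p ` V \<and> (\<forall>f\<in>E. f \<noteq> e \<longrightarrow> c e \<notin> T f) \<and>
    (\<forall>u v. e = {u,v} \<longrightarrow> u \<noteq> v \<longrightarrow> c e \<in> closed_segment (p u) (p v))" ..
  have c: "c e \<notin> p ` V" "f \<in> E \<Longrightarrow> f \<noteq> e \<Longrightarrow> c e \<notin> T f" "e = {u,v} \<Longrightarrow> u \<noteq> v \<Longrightarrow> c e \<in> closed_segment (p u) (p v)"
    if "e \<in> E" "\<not> ok e" for e f u v
    using bspec[OF C, of e] that by simp_all
  define B where "B e = (if ok e then b e else c e)" for e
  have other: "\<exists>v. v \<noteq> u \<and> e = {u,v}" if "e \<in> E" "u \<in> e" for e u using EP[OF that(1)] that(2) by auto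
  have sub: "closed_segment (p u) (B e) \<subseteq> T e" if e: "e \<in> E" "u \<in> e" for e u
  proof (cases "ok e")
    case True then show ?thesis using e(2) by (auto simp: B_def T_def)
  next
    case False
    obtain v where v: "v \<noteq> u" "e = {u,v}" using other[OF e] by blast
    have "closed_segment (p u) (B e) \<subseteq> closed_segment (p u) (p v)"
      using c(3)[OF e(1) False v(2) v(1)[symmetric]] False by (simp add: B_def closed_segment_subset)
    also have "\<dots> = closed_segment (p u) (b e) \<union> closed_segment (p v) (b e)"
      using Un_closed_segment[OF straight[OF e(1) False v(2) v(1)[symmetric]]] unfolding closed_segment_commute[of "b e" "p v"] by (rule sym)
    also have "\<dots> \<subseteq> T e" unfolding T_def using v(2) by blast
    finally show ?thesis .
  qed
  \<comment> \<open>Moving the bend along a straight edge changes the vectors of its halves only by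
    factors, so vanishing inner products still vanish.\<close>
  have par: "\<exists>w\<in>e. \<exists>k. x \<in> closed_segment (p w) (b e) \<and> p u - B e = k *\<^sub>R (p w - b e)"
    if e: "e \<in> E" "u \<in> e" and x: "x \<in> closed_segment (p u) (B e)" "x \<notin> p ` V" for e u x
  proof (cases "ok e")
    case True
    then show ?thesis using e(2) x(1) by (intro bexI[of _ u] exI[of _ 1]) (simp_all add: B_def)
  next
    case False
    obtain v where v: "v \<noteq> u" "e = {u,v}" using other[OF e] by blast
    have cs: "c e \<in> closed_segment (p u) (p v)" by (rule c(3)[OF e(1) False v(2) v(1)[symmetric]])
    have "closed_segment (p u) (B e) \<subseteq> closed_segment (p u) (p v)" using cs False by (simp add: B_def closed_segment_subset)
    then have xs: "x \<in> closed_segment (p u) (p v)" using x(1) by blast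
    obtain w k where w: "w \<in> e" "k \<noteq> 0" "x \<in> closed_segment (p w) (b e)" "p w - b e = k *\<^sub>R (p v - p u)"
      using dir[OF e(1) False v(2) v(1)[symmetric] xs x(2)] by blast
    obtain r where "c e = p u + of_real r * (p v - p u)" using cs unfolding closed_segment_param by blast
    then have "p u - B e = (- r) *\<^sub>R (p v - p u)" using False by (simp add: B_def scaleR_conv_of_real)
    also have "\<dots> = (- r / k) *\<^sub>R (p w - b e)" using w(2,4) by simp
    finally show ?thesis using w(1,3) by blast
  qed
  have "drawing V E p B"
  proof
    show "finite V" "inj_on p V" by (fact finV inj)+
    fix e f u v w x
    show "\<exists>u v. u \<in> V \<and> v \<in> V \<and> u \<noteq> v \<and> e = {u,v}" if "e \<in> E" by (rule EP[OF that])
    show "closed_segment (p u) (B e) \<inter> closed_segment (B e) (p v) = {B e}" if h: "e \<in> E" "u \<in> e" "v \<in> e" "u \<noteq> v"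
    proof (cases "ok e")
      case True then show ?thesis using bs[OF h] by (simp add: B_def)
    next
      case False
      have "e = {u,v}" using other[OF h(1,2)] h(3,4) by auto
      then have "c e \<in> closed_segment (p u) (p v)" by (rule c(3)[OF h(1) False _ h(4)])
      then show ?thesis using Int_closed_segment[OF disjI1] False by (simp add: B_def)
    qed
    show "p w \<notin> closed_segment (p u) (B e)" if h: "e \<in> E" "w \<in> V - e" "u \<in> e"
      using sub[OF h(1,3)] far[OF h(1,2)] by (auto simp: T_def)
    show "(p u - B e) \<bullet> (p v - B f) = 0" if h: "e \<in> E" "f \<in> E" "e \<noteq> f" "u \<in> e" "v \<in> f" "x \<in> closed_segment (p u) (B e)"
      "x \<in> closed_segment (p v) (B f)" "x \<notin> p ` V"
    proof -
      obtain u' k where 1: "u' \<in> e" "x \<in> closed_segment (p u') (b e)" "p u - B e = k *\<^sub>R (p u' - b e)" using par[OF h(1,4,6,8)] by blast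
      obtain v' l where 2: "v' \<in> f" "x \<in> closed_segment (p v') (b f)" "p v - B f = l *\<^sub>R (p v' - b f)" using par[OF h(2,5,7,8)] by blast
      show ?thesis using perp[OF h(1-3) 1(1) 2(1) 1(2) 2(2) h(8)] 1(3) 2(3) by simp
    qed
    show "B e \<notin> p ` V" if "e \<in> E" using c(1)[OF that] by (auto simp: B_def ok_def)
    show "B e \<notin> closed_segment (p v) (B f)" if h: "e \<in> E" "f \<in> E" "e \<noteq> f" "v \<in> f"
    proof -
      have "B e \<notin> T f" using c(2)[OF h(1) _ h(2) h(3)[symmetric]] h(2,3) by (auto simp: B_def ok_def)
      then show ?thesis using sub[OF h(2,4)] by blast
    qed
  qed
  then show ?thesis by blast
qed

section \<open>Transfer from the real plane to the complex numbers\<close>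

definition to_complex :: "real^2 \<Rightarrow> complex" where
  "to_complex v = Complex (v $ 1) (v $ 2)"

lemma linear_to_complex: "linear to_complex"
  by (rule linearI) (simp_all add: to_complex_def complex_eq_iff)

lemma inner_to_complex: "to_complex x \<bullet> to_complex y = x \<bullet> y"
  by (simp add: to_complex_def inner_complex_def inner_vec_def UNIV_2)

lemma inj_to_complex: "inj to_complex"
  by (auto simp: inj_on_def to_complex_def vec_eq_iff forall_2)

text \<open>The coordinate map is linear, injective and preserves inner products. A point that is no
  vertex in \<open>W\<close> is no common end of two edges, so the right angle condition of
  \<open>rac1_drawing\<close> applies to it.\<close>

lemma drawing_of_rac1:
  assumes G: "simple_graph V E" and R: "rac1_drawing V E p b" and W: "W \<subseteq> V" "\<And>e. e \<in> E \<Longrightarrow> e \<subseteq> W"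
  shows "\<exists>q c. drawing W E q c"
proof -
  let ?i = to_complex
  have seg: "closed_segment (?i x) (?i y) = ?i ` closed_segment x y" for x y
    by (rule closed_segment_linear_image[OF linear_to_complex])
  note R = R[unfolded rac1_drawing_def]
  note Rbs = conjunct1[OF conjunct2[OF R], rule_format]
  note Rfar = conjunct1[OF conjunct2[OF conjunct2[OF R]], rule_format]
  note Rperp = conjunct2[OF conjunct2[OF conjunct2[OF R]], rule_format]
  have "\<exists>c. drawing W E (?i \<circ> p) c"
  proof (rule drawing_exists[where b = "?i \<circ> b"])
    show "finite W" using G W finite_subset by (auto simp: simple_graph_def)
    show "inj_on (?i \<circ> p) W"
      by (rule comp_inj_on[OF inj_on_subset[OF conjunct1[OF R] W(1)] inj_on_subset[OF inj_to_complex]]) simp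
    fix e f u v w x
    show "\<exists>u v. u \<in> W \<and> v \<in> W \<and> u \<noteq> v \<and> e = {u,v}" if "e \<in> E"
      using G that W(2)[OF that] unfolding simple_graph_def by blast
    show "closed_segment ((?i \<circ> p) u) ((?i \<circ> b) e) \<inter> closed_segment ((?i \<circ> b) e) ((?i \<circ> p) v) = {(?i \<circ> b) e}"
      if h: "e \<in> E" "u \<in> e" "v \<in> e" "u \<noteq> v"
    proof -
      have "closed_segment (p u) (b e) \<inter> closed_segment (b e) (p v) = {b e}" by (rule Rbs[OF h])
      then have "?i ` closed_segment (p u) (b e) \<inter> ?i ` closed_segment (b e) (p v) = ?i ` {b e}"
        using image_Int[OF inj_to_complex, of "closed_segment (p u) (b e)" "closed_segment (b e) (p v)"] by simp
      then show ?thesis by (simp add: seg)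
    qed
    show "(?i \<circ> p) w \<notin> closed_segment ((?i \<circ> p) u) ((?i \<circ> b) e)" if h: "e \<in> E" "w \<in> W - e" "u \<in> e"
    proof -
      have "p w \<notin> closed_segment (p u) (b e)" by (rule Rfar[OF h(1) _ h(3)]) (use h(2) W(1) in blast)
      then show ?thesis using inj_image_mem_iff[OF inj_to_complex] by (simp add: seg)
    qed
    show "((?i \<circ> p) u - (?i \<circ> b) e) \<bullet> ((?i \<circ> p) v - (?i \<circ> b) f) = 0"
      if h: "e \<in> E" "f \<in> E" "e \<noteq> f" "u \<in> e" "v \<in> f" "x \<in> closed_segment ((?i \<circ> p) u) ((?i \<circ> b) e)"
        "x \<in> closed_segment ((?i \<circ> p) v) ((?i \<circ> b) f)" "x \<notin> (?i \<circ> p) ` W"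
    proof -
      obtain y where y: "y \<in> closed_segment (p u) (b e)" "x = ?i y" using h(6) by (auto simp: seg)
      obtain y' where y': "y' \<in> closed_segment (p v) (b f)" "x = ?i y'" using h(7) by (auto simp: seg)
      have "y' = y" using y y' inj_to_complex by (simp add: inj_eq)
      moreover have "y \<notin> p ` (e \<inter> f)" using h(8) y(2) W(2)[OF h(1)] by auto
      ultimately have "(p u - b e) \<bullet> (p v - b f) = 0" using Rperp[OF h(1-5)] y(1) y'(1) by blast
      then have "?i (p u - b e) \<bullet> ?i (p v - b f) = 0" by (simp only: inner_to_complex)
      then show ?thesis by (simp add: linear_diff[OF linear_to_complex])
    qed
  qed
  then show ?thesis by blast
qed

theorem theorem1:
  fixes V :: "'a set" and E :: "'a set set"
  assumes "simple_graph V E" and "card V \<ge> 3" and "rac1_graph V E"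
  shows "real (card E) \<le> 11 / 2 * real (card V) - 11"
proof -
  \<comment> \<open>Isolated vertices are dropped, because \<open>star_drawing\<close> asks for an
    edge at every vertex; with fewer vertices the bound is only stronger.\<close>
  define W where "W = \<Union>E"
  have finV: "finite V" and EV: "E \<subseteq> {{u, v} | u v. u \<in> V \<and> v \<in> V \<and> u \<noteq> v}"
    using assms(1) by (auto simp: simple_graph_def)
  have WV: "W \<subseteq> V" using EV by (auto simp: W_def)
  have EW: "e \<subseteq> W" if "e \<in> E" for e using that by (auto simp: W_def)
  have card_le: "card W \<le> card V" by (rule card_mono[OF finV WV])
  show ?thesis
  proof (cases "3 \<le> card W")
    case True
    obtain p b where "rac1_drawing V E p b" using assms(3) by (auto simp: rac1_graph_def)
    then obtain q c where "drawing W E q c" using drawing_of_rac1[OF assms(1) _ WV EW] by blast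
    moreover have cover: "\<exists>e\<in>E. u \<in> e" if "u \<in> W" for u using that by (auto simp: W_def)
    ultimately obtain c' where "star_drawing W E q c'" using star_drawing_exists[of W E q c] by blast
    then have "full_drawing W E q c'" using True by (simp add: full_drawing_def full_drawing_axioms_def)
    then have "2 * card E + 22 \<le> 11 * card W" by (rule full_drawing.edge_bound)
    then have "2 * card E + 22 \<le> 11 * card V" using card_le by linarith
    then show ?thesis by linarith
  next
    case False
    \<comment> \<open>At most two vertices carry edges here, so every edge consists of all of
      them.\<close>
    have "e = W" if e: "e \<in> E" for e
    proof (rule card_seteq[OF finite_subset[OF WV finV] EW[OF e]])
      obtain u v where "u \<noteq> v" "e = {u,v}" using EV e by blast
      then show "card W \<le> card e" using False by simp
    qed
    then have "E \<subseteq> {W}" by blast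
    then have "card E \<le> 1" using card_mono[of "{W}" E] by simp
    then show ?thesis using assms(2) by linarith
  qed
qed

end
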